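(* Suppose that $n-d-1\geq 1$ and $d\ge 3$. Let $\lambda_2^*=\max\{\lambda_2(T): T\in \mathcal{T}(n,d)\}$ and let $T^*\in \mathcal{T}(n,d)$ be such that $\lambda_2(T^* )=\lambda_2^*$. Then $T^*$ is obtained from a path $v_0 \ldots v_d$ by attaching $k_1$ leaves at vertex $v_i$ and $k_2$ leaves at vertex $v_j$, where $k_1=\lfloor \frac{n-d-1}{2}\rfloor$, $k_2=\lceil \frac{n-d-1}{2}\rceil$ and $i<j$ are as follows: (i) If $n-d-1$ is even, then the following holds: (a) if $d=3,4$ then $i=1$ and $j=d-1$; (b) if $d\ge 5$ is even then $i\in \{\lfloor \frac{d-2}{4}\rfloor, \lceil\frac{d-2}{4}\rceil\}$ and $j\in \{d-\lfloor \frac{d-2}{4}\rfloor, d- \lceil\frac{d-2}{4}\rceil\}$, giving three nonisomorphic $\lambda_2$-maximizers; (c) if $d\ge 5$ is odd then $i=\lfloor \frac{d-1}{4}\rfloor$ and $j=d-\lfloor \frac{d-1}{4}\rfloor$. (ii) If $n-d-1\ge 3$ is odd, then the following holds: (a) if $d=3,4$ then $i=1$ and $j=d-1$; (b) if $d\ge 5$ and $n-d-1\ge 5$ then $i=\lfloor \frac{d-3}{2}\rfloor$ and $j=d-1$; (c) if $d\ge 5$ and $n-d-1=3$ then $i=\lfloor \frac{d-3}{2}\rfloor$ and $j=d-1$ if $d\le 10$, and $i=\lfloor \frac{d-4}{2}\rfloor$ and $j=d-1$ if $d\ge 11$. (iii) If $n-d-1=1$ then $k_1=0$ and $k_2=1$.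 Hence, the position of $v_i$ is irrelevant. Moreover, $j=d-1$ if $d\le 10$; $j\in \{d-1,d-2\}$ if $d=11$; $j=d-2$ if $12\le d\le 22$; $j\in \{d-2,d-3\}$ if $d=23$; and $j=d-3$ if $d\ge 24$.
   Context: All graphs are finite and simple. For a graph $G$, $\lambda_2(G)$ is the second largest eigenvalue (counted with multiplicity) of the adjacency matrix of $G$. $\mathcal{T}(n,d)$ is the set of trees on $n$ vertices with diameter $d$. A $\lambda_2$-maximizer in $\mathcal{T}(n,d)$ is a tree $T\in\mathcal{T}(n,d)$ with $\lambda_2(H)\le\lambda_2(T)$ for every $H\in\mathcal{T}(n,d)$. Attaching $k$ leaves at a vertex $v$ means adding $k$ new vertices, each joined by an edge to $v$ only.
   Formalization: In (i)(b), "giving three nonisomorphic λ₂-maximizers" is stated only when ⌊(d-2)/4⌋ ≠ ⌈(d-2)/4⌉, i.e. 4 divides d; otherwise (e.g. d = 6, n = 9) both sets are singletons and there is just one maximizer up to isomorphism. *)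

theory Defs
  imports "Jordan_Normal_Form.Char_Poly" "Graph_Theory.Graph_Theory"
begin

text \<open>A finite simple graph is a \<open>pair_graph\<close>: a finite loop-free digraph
  without parallel arcs whose arc relation is symmetric; an edge \<open>uv\<close> is the pair of
  arcs \<open>(u,v)\<close>, \<open>(v,u)\<close>.

  The predicate \<open>tree\<close> of \<^theory>\<open>Graph_Theory.Digraph_Component\<close> is not usable for such
  graphs, since there the closed walk \<open>u, v, u\<close> along one edge counts as a cycle. The
  cycles of the undirected graph are the directed ones of length at least 3.\<close>

definition is_tree :: "'a pair_pre_digraph \<Rightarrow> bool" where
  "is_tree G \<longleftrightarrow> pair_graph G \<and> Digraph_Component.connected (with_proj G) \<and>
     \<not> (\<exists>p. pre_digraph.cycle (with_proj G) p \<and> length p \<ge> 3)"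

text \<open>With unit weights, \<open>\<mu>\<close> is the usual graph distance.\<close>

definition diameter :: "'a pair_pre_digraph \<Rightarrow> ereal" where
  "diameter G =
     (SUP u\<in>pverts G. SUP v\<in>pverts G. wf_digraph.\<mu> (with_proj G) (\<lambda>_. 1) u v)"

definition trees :: "nat \<Rightarrow> nat \<Rightarrow> 'a pair_pre_digraph set" where
  "trees n d = {G. is_tree G \<and> card (pverts G) = n \<and> diameter G = ereal (real d)}"

text \<open>The adjacency matrix is taken with respect to an arbitrary enumeration of the
  vertices; other enumerations give permutation-similar matrices, hence the same
  characteristic polynomial.\<close>

definition vertex_list :: "'a pair_pre_digraph \<Rightarrow> 'a list" where
  "vertex_list G = (SOME vs. distinct vs \<and> set vs = pverts G)"

definition adjacency_matrix :: "'a pair_pre_digraph \<Rightarrow> real mat" where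
  "adjacency_matrix G =
     (let vs = vertex_list G; n = length vs
      in mat n n (\<lambda>(a, b). if (vs ! a, vs ! b) \<in> parcs G then 1 else 0))"

text \<open>The eigenvalues of \<open>A\<close> with multiplicity, in decreasing order. For real symmetric
  \<open>A\<close> all complex roots of the characteristic polynomial are real, so the list has
  length \<open>dim_row A\<close>, and algebraic and geometric multiplicities agree.\<close>

definition eigenvalues_desc :: "real mat \<Rightarrow> real list" where
  "eigenvalues_desc A = rev (sorted_list_of_multiset (proots (char_poly A)))"

definition lambda2 :: "'a pair_pre_digraph \<Rightarrow> real" where
  "lambda2 G = eigenvalues_desc (adjacency_matrix G) ! 1"

definition lambda2_maximizer :: "nat \<Rightarrow> nat \<Rightarrow> 'a pair_pre_digraph \<Rightarrow> bool" where
  "lambda2_maximizer n d T \<longleftrightarrow>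
     T \<in> trees n d \<and> (\<forall>H \<in> (trees n d :: 'a pair_pre_digraph set). lambda2 H \<le> lambda2 T)"

definition path_graph :: "(nat \<Rightarrow> 'a) \<Rightarrow> nat \<Rightarrow> 'a pair_pre_digraph" where
  "path_graph v d = \<lparr>pverts = v ` {0..d},
     parcs = {(v a, v b) | a b. a \<le> d \<and> b \<le> d \<and> (b = a + 1 \<or> a = b + 1)}\<rparr>"

text \<open>\<open>H\<close> arises from \<open>G\<close> by attaching \<open>k\<close> leaves at the vertex \<open>x\<close>.\<close>

definition attach_leaves ::
    "'a pair_pre_digraph \<Rightarrow> 'a \<Rightarrow> nat \<Rightarrow> 'a pair_pre_digraph \<Rightarrow> bool" where
  "attach_leaves G x k H \<longleftrightarrow> x \<in> pverts G \<and>
     (\<exists>L. finite L \<and> card L = k \<and> L \<inter> pverts G = {} \<and>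
        H = \<lparr>pverts = pverts G \<union> L, parcs = parcs G \<union> {x} \<times> L \<union> L \<times> {x}\<rparr>)"

text \<open>\<open>T\<close> is obtained from a path \<open>v\<^sub>0 \<dots> v\<^sub>d\<close> by attaching \<open>k1\<close> leaves at \<open>v\<^sub>i\<close> and
  \<open>k2\<close> leaves at \<open>v\<^sub>j\<close>.\<close>

definition path_with_leaves ::
    "nat \<Rightarrow> nat \<Rightarrow> nat \<Rightarrow> nat \<Rightarrow> nat \<Rightarrow> 'a pair_pre_digraph \<Rightarrow> bool" where
  "path_with_leaves d i k1 j k2 T \<longleftrightarrow>
     (\<exists>v G. inj_on v {0..d} \<and> attach_leaves (path_graph v d) (v i) k1 G \<and>
            attach_leaves G (v j) k2 T \<and> i \<le> d \<and> j \<le> d)"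

text \<open>The positions \<open>i < j\<close> at which leaves are attached, for \<open>m = n - d - 1\<close>. Floors
  and ceilings of quotients of natural numbers are written with \<open>div\<close>, the ceiling of
  \<open>a/b\<close> being \<open>(a + b - 1) div b\<close>; no subtraction truncates when \<open>d \<ge> 3\<close> and the
  guard of its case holds. For \<open>m = 1\<close> no leaf is attached at \<open>v\<^sub>i\<close>, so \<open>i\<close> is unconstrained.\<close>

definition even_positions :: "nat \<Rightarrow> nat \<Rightarrow> nat \<Rightarrow> bool" where
  "even_positions d i j \<longleftrightarrow>
     (d \<in> {3, 4} \<longrightarrow> i = 1 \<and> j = d - 1) \<and>
     (d \<ge> 5 \<and> even d \<longrightarrow>
        i \<in> {(d - 2) div 4, (d - 2 + 3) div 4} \<and>
        j \<in> {d - (d - 2) div 4, d - (d - 2 + 3) div 4}) \<and>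
     (d \<ge> 5 \<and> odd d \<longrightarrow> i = (d - 1) div 4 \<and> j = d - (d - 1) div 4)"

definition odd_positions :: "nat \<Rightarrow> nat \<Rightarrow> nat \<Rightarrow> nat \<Rightarrow> bool" where
  "odd_positions m d i j \<longleftrightarrow>
     (d \<in> {3, 4} \<longrightarrow> i = 1 \<and> j = d - 1) \<and>
     (d \<ge> 5 \<and> m \<ge> 5 \<longrightarrow> i = (d - 3) div 2 \<and> j = d - 1) \<and>
     (d \<ge> 5 \<and> m = 3 \<longrightarrow>
        (d \<le> 10 \<longrightarrow> i = (d - 3) div 2 \<and> j = d - 1) \<and>
        (d \<ge> 11 \<longrightarrow> i = (d - 4) div 2 \<and> j = d - 1))"

definition single_positions :: "nat \<Rightarrow> nat \<Rightarrow> bool" where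
  "single_positions d j \<longleftrightarrow>
     (d \<le> 10 \<longrightarrow> j = d - 1) \<and>
     (d = 11 \<longrightarrow> j \<in> {d - 1, d - 2}) \<and>
     (12 \<le> d \<and> d \<le> 22 \<longrightarrow> j = d - 2) \<and>
     (d = 23 \<longrightarrow> j \<in> {d - 2, d - 3}) \<and>
     (d \<ge> 24 \<longrightarrow> j = d - 3)"

definition maximizer_positions :: "nat \<Rightarrow> nat \<Rightarrow> nat \<Rightarrow> nat \<Rightarrow> bool" where
  "maximizer_positions m d i j \<longleftrightarrow> i < j \<and>
     (even m \<longrightarrow> even_positions d i j) \<and>
     (odd m \<and> m \<ge> 3 \<longrightarrow> odd_positions m d i j) \<and>
     (m = 1 \<longrightarrow> single_positions d j)"

abbreviation isomorphic :: "'a pair_pre_digraph \<Rightarrow> 'a pair_pre_digraph \<Rightarrow> bool" where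
  "isomorphic G H \<equiv> digraph_iso (with_proj G) (with_proj H)"

end

theory Submission
  imports Defs "Jordan_Normal_Form.Schur_Decomposition"
begin

text \<open>Let \<open>\<lambda>\<close> be the value claimed to be the maximum. By Courant--Fischer, \<open>\<lambda>\<^sub>2(T) \<le> \<lambda>\<close> follows once the form
  \<open>\<lambda> |x|\<^sup>2 - x \<bullet> A x\<close> is nonnegative on one hyperplane. The hyperplane prescribes where \<open>x\<close> changes
  sign along a diametral path, in the interior of an edge or at a vertex, so that the path splits into two halves. By weighted
  AM--GM a branch with \<open>s < \<lambda>\<^sup>2\<close> vertices costs no more than the load \<open>s/\<lambda>\<close> at the path vertex
  carrying it; a heavier branch gets the sign change itself. On each half a positive solution \<open>S\<close> of
  \<open>S\<^sub>j\<^sub>-\<^sub>1 + S\<^sub>j\<^sub>+\<^sub>1 = \<lambda> S\<^sub>j\<close> turns the form into a sum of squares, and the half supports \<open>k\<close> leaves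
  wherever they are attached iff \<open>k P\<^sub>i S\<^sub>i \<le> \<lambda> (\<lambda> S\<^sub>0 - S\<^sub>1)\<close> for all \<open>i\<close>, with \<open>P\<close> the
  solution starting at the end. The value \<open>\<lambda>\<close> is the one for which this holds with equality
  somewhere on both halves, and the extremal positions are exactly the indices of equality. There the
  squares vanish on an explicit eigenvector that changes sign, so \<open>\<lambda>\<close> is attained.\<close>

text \<open>The obstacle is that one value \<open>l\<close> must serve every tree, while the
  prescribed node only fits loads that split as at most \<open>k\<close> on the left and at most
  \<open>k'\<close> on the right. For any other split the node is moved to a vertex of an overloaded
  half. That half gets shorter, which leaves a genuine margin, and the opposite half gets longer but
  has to carry at least one leaf fewer. Since every such move is strict, trees with a wrong split
  never reach \<open>l\<close>, and the equality case is only studied for the prescribed node.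

  The price is a list of numerical facts about \<open>l\<close>: a longer half still carries
  \<open>k - 1\<close> leaves, and the whole path still carries \<open>k - 2\<close> when the node
  sits inside a branch. They are collected in \<open>side_conditions\<close>; verifying them for
  small \<open>k\<close> and \<open>d\<close>, where \<open>l\<close> may be below 2, is most of the
  computation.

  The equation for \<open>l\<close> is solved in three ways. For an even number of leaves both
  halves are mirror images. For an odd number of at least three, the right half is explicit and a
  single equation remains on the left. For one leaf the left half is an unloaded path and the
  equation is one between sines.\<close>

section \<open>The second eigenvalue\<close>

lemma real_symmetric_eigenvalue_exists:
  fixes A :: "real mat"
  assumes A: "A \<in> carrier_mat n n" and sym: "transpose_mat A = A" and n: "n \<noteq> 0"
  shows "\<exists>e. eigenvalue A e"
proof -
  let ?C = "map_mat complex_of_real A"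
  have C: "?C \<in> carrier_mat n n" using A by simp
  from char_poly_factorized[OF C] obtain as where
    as: "char_poly ?C = (\<Prod>a\<leftarrow>as. [:- a, 1:])" "length as = n" by auto
  from as(2) n obtain z bs where "as = z # bs" by (cases as) auto
  then have "poly (char_poly ?C) z = 0" using as by simp
  then have "eigenvalue ?C z" using eigenvalue_root_char_poly[OF C] by simp
  then obtain v where "eigenvector ?C v z" unfolding eigenvalue_def by auto
  then have v: "v \<in> carrier_vec n" and v0: "v \<noteq> 0\<^sub>v n" and ev: "?C *\<^sub>v v = z \<cdot>\<^sub>v v"
    using C unfolding eigenvector_def by auto
  have a_sym: "A $$ (i,j) = A $$ (j,i)" if "i < n" "j < n" for i j
    using that A sym by (metis carrier_matD index_transpose_mat(1))
  \<comment> \<open>Both \<open>q\<close>, the inner product of \<open>A v\<close> with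
    \<open>v\<close>, and \<open>r\<close>, that of \<open>v\<close> with itself, are fixed by
    conjugation, the first because \<open>A\<close> is real and symmetric. As
    \<open>q = z * r\<close> with \<open>r\<close> nonzero, the complex root \<open>z\<close> is
    real.\<close>
  define q where "q = (\<Sum>i<n. \<Sum>j<n. complex_of_real (A $$ (i,j)) * v $ j * cnj (v $ i))"
  define r where "r = (\<Sum>i<n. v $ i * cnj (v $ i))"
  have evi: "(\<Sum>j<n. complex_of_real (A $$ (i,j)) * v $ j) = z * v $ i" if "i < n" for i
  proof -
    have "(?C *\<^sub>v v) $ i = (\<Sum>j<n. complex_of_real (A $$ (i,j)) * v $ j)"
      using that A v by (simp add: scalar_prod_def row_def atLeast0LessThan)
    then show ?thesis using ev that v by simp
  qed
  have qz: "q = z * r"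
    unfolding q_def r_def sum_distrib_left
    by (intro sum.cong refl) (simp only: sum_distrib_right[symmetric] lessThan_iff evi, simp)
  have "cnj q = (\<Sum>i<n. \<Sum>j<n. complex_of_real (A $$ (i,j)) * cnj (v $ j) * v $ i)"
    unfolding q_def by (simp add: mult_ac)
  also have "\<dots> = (\<Sum>j<n. \<Sum>i<n. complex_of_real (A $$ (i,j)) * cnj (v $ j) * v $ i)"
    by (rule sum.swap)
  also have "\<dots> = q"
    unfolding q_def by (intro sum.cong refl) (simp add: a_sym mult_ac)
  finally have cq: "cnj q = q" .
  have cr: "cnj r = r" unfolding r_def by (simp add: mult_ac)
  have r_eq: "r = complex_of_real (\<Sum>i<n. (cmod (v $ i))\<^sup>2)"
    unfolding r_def by (simp add: complex_norm_square[symmetric])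
  have "\<exists>i<n. v $ i \<noteq> 0"
  proof (rule ccontr)
    assume "\<not> ?thesis"
    then have "v = 0\<^sub>v n" using v by (intro eq_vecI) auto
    then show False using v0 by simp
  qed
  then have "(\<Sum>i<n. (cmod (v $ i))\<^sup>2) > 0"
    by (auto intro!: sum_pos2)
  then have "r \<noteq> 0" unfolding r_eq by (metis less_irrefl of_real_eq_0_iff)
  then have "cnj z = z" using cq cr qz by (metis complex_cnj_mult mult_right_cancel)
  then have z: "z = complex_of_real (Re z)" by (simp add: complex_eq_iff)
  have "poly (char_poly ?C) (complex_of_real (Re z)) = complex_of_real (poly (char_poly A) (Re z))"
    by (simp add: of_real_hom.char_poly_hom[OF A])
  then have "poly (char_poly A) (Re z) = 0"
    using \<open>poly (char_poly ?C) z = 0\<close> z by (metis of_real_eq_0_iff)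
  then show ?thesis using eigenvalue_root_char_poly[OF A] by blast
qed

text \<open>Gram-Schmidt leaves the first vector of a basis alone, so orthogonalizing a basis that
  starts with \<open>v\<close> changes \<open>v\<close> only by the final normalization.\<close>

lemma eigenvector_orthonormal_completion:
  fixes v :: "real vec"
  assumes v: "v \<in> carrier_vec n" and v0: "v \<noteq> 0\<^sub>v n"
  shows "\<exists>U \<in> carrier_mat n n. transpose_mat U * U = 1\<^sub>m n \<and> (\<exists>c. col U 0 = c \<cdot>\<^sub>v v)"
proof -
  have n: "n \<noteq> 0" using v v0 by (metis carrier_vecD eq_vecI index_zero_vec(2) not_less_zero)
  interpret cof_vec_space n "TYPE(real)" .
  define b where "b = basis_completion v"
  define ws where "ws = gram_schmidt n b"
  from basis_completion[OF v v0, folded b_def]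
  have dist_b: "distinct b" and indep: "\<not> lin_dep (set b)" and b: "set b \<subseteq> carrier_vec n"
    and hdb: "hd b = v" and len_b: "length b = n" by auto
  from hdb len_b n obtain vs where bv: "b = v # vs" by (cases b) auto
  from gram_schmidt_result[OF b dist_b indep refl, folded ws_def]
  have ws: "set ws \<subseteq> carrier_vec n" "corthogonal ws" "length ws = n"
    by (auto simp: len_b)
  have hdws: "hd ws = v" using gram_schmidt_hd[OF v, of vs, folded bv] unfolding ws_def .
  have wc: "ws ! i \<in> carrier_vec n" if "i < n" for i using ws that by auto
  define c where "c i = 1 / sqrt (ws ! i \<bullet> ws ! i)" for i
  define us where "us = map (\<lambda>i. c i \<cdot>\<^sub>v ws ! i) [0..<n]"
  define U where "U = mat_of_cols n us"
  have us: "set us \<subseteq> carrier_vec n" "length us = n" using wc unfolding us_def by auto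
  have U: "U \<in> carrier_mat n n" unfolding U_def using us by auto
  have colU: "col U i = c i \<cdot>\<^sub>v ws ! i" if "i < n" for i
    unfolding U_def using us that wc[OF that] by (subst col_mat_of_cols) (auto simp: us_def)
  have orth: "ws ! i \<bullet> ws ! j = 0 \<longleftrightarrow> i \<noteq> j" if "i < n" "j < n" for i j
    using corthogonalD[OF ws(2), of i j] that ws(3) by (simp add: conjugate_vec_def)
  have pos: "ws ! i \<bullet> ws ! i > 0" if "i < n" for i
  proof -
    have "ws ! i \<bullet> ws ! i \<ge> 0" by (simp add: scalar_prod_def sum_nonneg)
    then show ?thesis using orth[OF that that] by simp
  qed
  have "transpose_mat U * U = 1\<^sub>m n"
  proof (rule eq_matI)
    fix i j assume "i < dim_row (1\<^sub>m n :: real mat)" "j < dim_col (1\<^sub>m n :: real mat)"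
    then have ij: "i < n" "j < n" by auto
    have "(transpose_mat U * U) $$ (i,j) = col U i \<bullet> col U j" using U ij by simp
    also have "\<dots> = c i * c j * (ws ! i \<bullet> ws ! j)"
      using smult_scalar_prod_distrib[OF wc[OF ij(1)] smult_carrier_vec[THEN iffD2, OF wc[OF ij(2)]], of "c i" "c j"]
        scalar_prod_smult_distrib[OF wc[OF ij(1)] wc[OF ij(2)], of "c j"]
      by (simp add: colU[OF ij(1)] colU[OF ij(2)])
    also have "\<dots> = 1\<^sub>m n $$ (i,j)"
      using ij orth[OF ij] pos[OF ij(1)] by (cases "i = j") (simp_all add: c_def)
    finally show "(transpose_mat U * U) $$ (i,j) = 1\<^sub>m n $$ (i,j)" .
  qed (use U in auto)
  moreover have "col U 0 = c 0 \<cdot>\<^sub>v v"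
  proof -
    have "ws ! 0 = v" using hdws n ws(3) hd_conv_nth[of ws] by (metis length_0_conv)
    then show ?thesis using colU[of 0] n by (metis neq0_conv)
  qed
  ultimately show ?thesis using U by blast
qed

text \<open>Induction on the size: in an orthonormal basis that starts with an eigenvector, the
  first column is a multiple of the first unit vector. By symmetry so is the first row, and a
  smaller symmetric block remains.\<close>

lemma real_symmetric_diagonalization:
  fixes A :: "real mat"
  assumes "A \<in> carrier_mat n n" and "transpose_mat A = A"
  shows "\<exists>U \<in> carrier_mat n n. \<exists>D \<in> carrier_mat n n.
           transpose_mat U * U = 1\<^sub>m n \<and> diagonal_mat D \<and> A * U = U * D"
  using assms
proof (induction n arbitrary: A)
  case 0
  then show ?case
    by (intro bexI[of _ A] conjI) (auto simp: diagonal_mat_def intro!: eq_matI)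
next
  case (Suc n)
  note A = Suc.prems(1) and sym = Suc.prems(2)
  obtain e v where ev: "eigenvector A v e"
    using real_symmetric_eigenvalue_exists[OF A sym] unfolding eigenvalue_def by auto
  then have v: "v \<in> carrier_vec (Suc n)" and v0: "v \<noteq> 0\<^sub>v (Suc n)" and Av: "A *\<^sub>v v = e \<cdot>\<^sub>v v"
    using A unfolding eigenvector_def by auto
  from eigenvector_orthonormal_completion[OF v v0] obtain W c where W: "W \<in> carrier_mat (Suc n) (Suc n)"
    and WW: "transpose_mat W * W = 1\<^sub>m (Suc n)" and colW: "col W 0 = c \<cdot>\<^sub>v v" by auto
  let ?Wt = "transpose_mat W"
  have Wt: "?Wt \<in> carrier_mat (Suc n) (Suc n)" using W by simp
  have WWt: "W * ?Wt = 1\<^sub>m (Suc n)" using mat_mult_left_right_inverse[OF Wt W WW] .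
  define B where "B = ?Wt * A * W"
  have B: "B \<in> carrier_mat (Suc n) (Suc n)" unfolding B_def using A W by auto
  have Bsym: "transpose_mat B = B"
  proof -
    have "transpose_mat B = ?Wt * transpose_mat (?Wt * A)"
      unfolding B_def using transpose_mult[of "?Wt * A" "Suc n" "Suc n" W "Suc n"] A W Wt by simp
    also have "transpose_mat (?Wt * A) = A * W"
      using transpose_mult[of ?Wt "Suc n" "Suc n" A "Suc n"] A W Wt sym by simp
    finally show ?thesis unfolding B_def using A W Wt by simp
  qed
  have AW: "A * W = W * B"
  proof -
    have "W * B = (W * ?Wt) * (A * W)"
      unfolding B_def using A W Wt by (simp add: assoc_mult_mat[of _ "Suc n" "Suc n" _ "Suc n" _ "Suc n"])
    then show ?thesis using WWt A W by simp
  qed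
  have colB: "B $$ (i,0) = (if i = 0 then e else 0)" if i: "i < Suc n" for i
  proof -
    have "B $$ (i,0) = row ?Wt i \<bullet> col (A * W) 0"
      unfolding B_def using i A W Wt by (simp add: assoc_mult_mat[of _ "Suc n" "Suc n" _ "Suc n" _ "Suc n"])
    also have "col (A * W) 0 = A *\<^sub>v col W 0" using A W by (intro col_mult2[of _ "Suc n" "Suc n" _ "Suc n"]) auto
    also have "\<dots> = e \<cdot>\<^sub>v col W 0"
      unfolding colW using A v Av by (simp add: mult_mat_vec[OF A] smult_smult_assoc mult.commute)
    also have "row ?Wt i \<bullet> (e \<cdot>\<^sub>v col W 0) = e * (row ?Wt i \<bullet> col W 0)"
      using W i by simp
    also have "row ?Wt i \<bullet> col W 0 = (?Wt * W) $$ (i,0)" using W i by simp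
    finally show ?thesis using i unfolding WW by simp
  qed
  define B3 where "B3 = mat n n (\<lambda>(i,j). B $$ (Suc i, Suc j))"
  have B3: "B3 \<in> carrier_mat n n" unfolding B3_def by simp
  have Bs: "B $$ (i,j) = B $$ (j,i)" if "i < Suc n" "j < Suc n" for i j
    using that B Bsym by (metis carrier_matD index_transpose_mat(1))
  have B3sym: "transpose_mat B3 = B3" by (rule eq_matI) (auto simp: B3_def Bs)
  from Suc.IH[OF B3 B3sym] obtain V D where V: "V \<in> carrier_mat n n" and D: "D \<in> carrier_mat n n"
    and VV: "transpose_mat V * V = 1\<^sub>m n" and diagD: "diagonal_mat D" and BV: "B3 * V = V * D" by auto
  let ?e = "mat 1 1 (\<lambda>_. e) :: real mat" and ?O = "1\<^sub>m 1 :: real mat"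
  let ?r = "0\<^sub>m 1 n :: real mat" and ?c = "0\<^sub>m n 1 :: real mat"
  have Bblock: "B = four_block_mat ?e ?r ?c B3"
  proof (rule eq_matI)
    fix i j assume "i < dim_row (four_block_mat ?e ?r ?c B3)" "j < dim_col (four_block_mat ?e ?r ?c B3)"
    then have ij: "i < Suc n" "j < Suc n" using B3 by auto
    then show "B $$ (i,j) = four_block_mat ?e ?r ?c B3 $$ (i,j)"
      using colB[of i] colB[of j] Bs[OF ij] B3 by (auto simp: B3_def)
  qed (use B B3 in auto)
  define X where "X = four_block_mat ?O ?r ?c V"
  define E where "E = four_block_mat ?e ?r ?c D"
  have X: "X \<in> carrier_mat (Suc n) (Suc n)" and E: "E \<in> carrier_mat (Suc n) (Suc n)"
    unfolding X_def E_def using V D by auto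
  have diagE: "diagonal_mat E"
    using diagD D unfolding diagonal_mat_def E_def by (auto simp: Suc_less_eq2)
  have Xt: "transpose_mat X = four_block_mat ?O ?r ?c (transpose_mat V)"
    unfolding X_def using V by (subst transpose_four_block_mat[of _ 1 1 _ n _ n]) auto
  have XX: "transpose_mat X * X = 1\<^sub>m (Suc n)"
    unfolding Xt unfolding X_def using V VV
    by (subst mult_four_block_mat[of _ 1 1 _ n _ n _ _ 1 _ n]) (auto intro!: eq_matI)
  have BX: "B * X = four_block_mat ?e ?r ?c (B3 * V)"
    unfolding Bblock X_def using V B3
    by (subst mult_four_block_mat[of _ 1 1 _ n _ n _ _ 1 _ n]) (auto intro!: eq_matI)
  have XE: "X * E = four_block_mat ?e ?r ?c (V * D)"
    unfolding X_def E_def using V D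
    by (subst mult_four_block_mat[of _ 1 1 _ n _ n _ _ 1 _ n]) (auto intro!: eq_matI)
  let ?U = "W * X"
  have "transpose_mat ?U * ?U = transpose_mat X * (?Wt * W) * X"
    using X W Wt by (simp add: transpose_mult[OF W X] assoc_mult_mat[of _ "Suc n" "Suc n" _ "Suc n" _ "Suc n"])
  then have UU: "transpose_mat ?U * ?U = 1\<^sub>m (Suc n)" using WW XX X by simp
  have "A * ?U = W * (B * X)"
    using AW assoc_mult_mat[OF A W X] assoc_mult_mat[OF W B X] by simp
  also have "\<dots> = ?U * E" using BX XE BV assoc_mult_mat[OF W X E] by simp
  finally show ?case using UU diagE W X E by (intro bexI[of _ ?U] bexI[of _ E]) auto
qed

lemma proots_prod_list_linear: "proots (\<Prod>a\<leftarrow>as. [:- a, 1::real:]) = mset as"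
proof (induction as)
  case (Cons a as)
  have "(\<Prod>a\<leftarrow>as. [:- a, 1::real:]) \<noteq> 0"
    by (induction as) (auto simp del: mult_pCons_left)
  then show ?case using Cons
    by (simp add: proots_mult del: mult_pCons_left)
qed simp

text \<open>A diagonalization lists the eigenvalues in some order. Permuting its columns to match
  \<open>eigenvalues_desc\<close> makes column 1 belong to the entry that \<open>lambda2\<close>
  reads off.\<close>

lemma real_symmetric_sorted_eigenbasis:
  fixes A :: "real mat"
  assumes A: "A \<in> carrier_mat n n" and sym: "transpose_mat A = A"
  shows "\<exists>U \<in> carrier_mat n n. transpose_mat U * U = 1\<^sub>m n \<and> U * transpose_mat U = 1\<^sub>m n \<and>
     length (eigenvalues_desc A) = n \<and>
     (\<forall>a b. a \<le> b --> b < n --> eigenvalues_desc A ! b \<le> eigenvalues_desc A ! a) \<and>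
     (\<forall>a<n. A *\<^sub>v col U a = (eigenvalues_desc A ! a) \<cdot>\<^sub>v col U a)"
proof -
  from real_symmetric_diagonalization[OF A sym] obtain W D where W: "W \<in> carrier_mat n n"
    and D: "D \<in> carrier_mat n n" and WW: "transpose_mat W * W = 1\<^sub>m n" and dD: "diagonal_mat D"
    and AW: "A * W = W * D" by auto
  have Wt: "transpose_mat W \<in> carrier_mat n n" using W by simp
  have WW': "W * transpose_mat W = 1\<^sub>m n" using mat_mult_left_right_inverse[OF Wt W WW] .
  have "A = A * (W * transpose_mat W)" using A WW' by simp
  also have "\<dots> = W * D * transpose_mat W" using assoc_mult_mat[OF A W Wt] AW by simp
  finally have "similar_mat_wit A D W (transpose_mat W)"
    using A D W WW WW' by (intro similar_mat_witI) auto
  then have "char_poly A = char_poly D" by (intro char_poly_similar) (auto simp: similar_mat_def)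
  also have "\<dots> = (\<Prod>a\<leftarrow>diag_mat D. [:- a, 1:])"
    using dD D by (intro char_poly_upper_triangular[OF D]) (auto simp: diagonal_mat_def upper_triangular_def)
  finally have pr: "proots (char_poly A) = mset (diag_mat D)" by (simp add: proots_prod_list_linear)
  let ?es = "eigenvalues_desc A"
  have es: "?es = rev (sort (diag_mat D))"
    unfolding eigenvalues_desc_def pr by simp
  have len: "length (diag_mat D) = n" using D by (simp add: diag_mat_def)
  have les: "length ?es = n" unfolding es using len by simp
  have mono: "?es ! b \<le> ?es ! a" if "a \<le> b" "b < n" for a b
    using that len unfolding es by (auto simp: rev_nth intro!: sorted_nth_mono)
  have "mset ?es = mset (diag_mat D)" unfolding es by simp
  then obtain p where p: "p permutes {..<n}" and pl: "permute_list p (diag_mat D) = ?es"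
    using mset_eq_permutation len by metis
  have pn: "p a < n" if "a < n" for a using p that by (metis lessThan_iff permutes_in_image)
  have esp: "?es ! a = D $$ (p a, p a)" if "a < n" for a
    using that p pn[OF that] len D unfolding pl[symmetric]
    by (subst permute_list_nth) (auto simp: diag_mat_def)
  define U where "U = mat n n (\<lambda>(i,a). W $$ (i, p a))"
  have U: "U \<in> carrier_mat n n" unfolding U_def by simp
  have colU: "col U a = col W (p a)" if "a < n" for a
    using that pn[OF that] W unfolding U_def by (intro eq_vecI) auto
  have UU: "transpose_mat U * U = 1\<^sub>m n"
  proof (rule eq_matI)
    fix i j assume "i < dim_row (1\<^sub>m n :: real mat)" "j < dim_col (1\<^sub>m n :: real mat)"
    then have ij: "i < n" "j < n" by auto
    have "(transpose_mat U * U) $$ (i,j) = col W (p i) \<bullet> col W (p j)"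
      using U ij by (simp add: colU)
    also have "\<dots> = (transpose_mat W * W) $$ (p i, p j)" using W pn ij by simp
    also have "\<dots> = 1\<^sub>m n $$ (i,j)"
      unfolding WW using pn ij permutes_inj[OF p] by (auto dest: injD)
    finally show "(transpose_mat U * U) $$ (i,j) = 1\<^sub>m n $$ (i,j)" .
  qed (use U in auto)
  have Ut: "transpose_mat U \<in> carrier_mat n n" using U by simp
  have UU': "U * transpose_mat U = 1\<^sub>m n" using mat_mult_left_right_inverse[OF Ut U UU] .
  have ev: "A *\<^sub>v col U a = (?es ! a) \<cdot>\<^sub>v col U a" if a: "a < n" for a
  proof -
    have "A *\<^sub>v col W (p a) = col (A * W) (p a)"
      using A W pn[OF a] by (intro col_mult2[symmetric]) auto
    also have "\<dots> = D $$ (p a, p a) \<cdot>\<^sub>v col W (p a)"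
    proof (rule eq_vecI)
      fix i assume "i < dim_vec (D $$ (p a, p a) \<cdot>\<^sub>v col W (p a))"
      then have i: "i < n" using W by simp
      have "col (W * D) (p a) $ i = (\<Sum>k<n. W $$ (i,k) * D $$ (k, p a))"
        using W D i pn[OF a] by (simp add: scalar_prod_def atLeast0LessThan)
      also have "\<dots> = (\<Sum>k<n. if k = p a then W $$ (i, p a) * D $$ (p a, p a) else 0)"
        using dD D pn[OF a] by (intro sum.cong) (auto simp: diagonal_mat_def)
      also have "\<dots> = (D $$ (p a, p a) \<cdot>\<^sub>v col W (p a)) $ i"
        using W i pn[OF a] by (simp add: mult.commute)
      finally show "col (A * W) (p a) $ i = (D $$ (p a, p a) \<cdot>\<^sub>v col W (p a)) $ i" by (simp add: AW)
    qed (use A W in auto)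
    finally show ?thesis using a by (simp add: colU esp)
  qed
  show ?thesis using U UU UU' les mono ev by blast
qed

section \<open>Test vectors for the second eigenvalue\<close>

definition sorted_eigenbasis ::
    "'a pair_pre_digraph => (nat => 'a => real) => (nat => real) => bool" where
  "sorted_eigenbasis G e \<mu> \<longleftrightarrow> (let V = pverts G; n = card V in
     (\<forall>a<n. \<forall>v\<in>V. (\<Sum>u\<in>V. if (v,u) \<in> parcs G then e a u else 0) = \<mu> a * e a v) \<and>
     (\<forall>a<n. \<forall>b<n. (\<Sum>v\<in>V. e a v * e b v) = (if a = b then 1 else 0)) \<and>
     (\<forall>u\<in>V. \<forall>v\<in>V. (\<Sum>a<n. e a u * e a v) = (if u = v then 1 else 0)) \<and>
     (\<forall>a b. a \<le> b --> b < n --> \<mu> b \<le> \<mu> a))"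

text \<open>Here eigenvectors become functions on vertices, and the enumeration chosen in
  \<open>adjacency_matrix\<close> disappears for good. Besides orthonormality, completeness is
  recorded because the lower bound expands a vector in this basis.\<close>

lemma adjacency_sorted_eigenbasis:
  fixes G :: "'a pair_pre_digraph"
  assumes fin: "finite (pverts G)" and sym: "sym (parcs G)"
  shows "\<exists>e \<mu>. sorted_eigenbasis G e \<mu> \<and> lambda2 G = \<mu> 1"
proof -
  define V where "V = pverts G"
  define vs where "vs = vertex_list G"
  have "\<exists>vs. distinct vs \<and> set vs = pverts G" using finite_distinct_list[OF fin] by auto
  then have vs: "distinct vs" "set vs = V"
    unfolding vs_def vertex_list_def V_def by (metis (mono_tags, lifting) someI_ex)+
  define n where "n = card V"
  have len: "length vs = n" using vs distinct_card n_def by metis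
  define A where "A = adjacency_matrix G"
  have A: "A \<in> carrier_mat n n"
    unfolding A_def adjacency_matrix_def Let_def vs_def[symmetric] len by simp
  have Aij: "A $$ (i,j) = (if (vs ! i, vs ! j) \<in> parcs G then 1 else 0)" if "i < n" "j < n" for i j
    unfolding A_def adjacency_matrix_def Let_def vs_def[symmetric] len using that by simp
  have symA: "transpose_mat A = A"
    using A sym by (intro eq_matI) (auto simp: Aij dest: symD)
  from real_symmetric_sorted_eigenbasis[OF A symA] obtain U where U: "U \<in> carrier_mat n n"
    and UU: "transpose_mat U * U = 1\<^sub>m n" and UU': "U * transpose_mat U = 1\<^sub>m n"
    and mono: "\<And>a b. a \<le> b ==> b < n ==> eigenvalues_desc A ! b \<le> eigenvalues_desc A ! a"
    and ev: "\<And>a. a < n ==> A *\<^sub>v col U a = (eigenvalues_desc A ! a) \<cdot>\<^sub>v col U a" by blast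
  have bij: "bij_betw ((!) vs) {..<n} V" using bij_betw_nth[OF vs(1) refl] vs(2) len by auto
  define ix where "ix = inv_into {..<n} ((!) vs)"
  have ix1: "ix (vs ! i) = i" if "i < n" for i
    unfolding ix_def using bij that by (simp add: bij_betw_inv_into_left)
  have ix2: "vs ! ix v = v" "ix v < n" if "v \<in> V" for v
    using bij_betw_inv_into_right[OF bij that] bij_betwE[OF bij_betw_inv_into[OF bij]] that
    unfolding ix_def by auto
  have sumV: "(\<Sum>v\<in>V. f v) = (\<Sum>i<n. f (vs ! i))" for f :: "'a => real"
    using sum.reindex_bij_betw[OF bij, of f] by simp
  define e where "e a v = U $$ (ix v, a)" for a v
  have e1: "(\<Sum>u\<in>V. if (v,u) \<in> parcs G then e a u else 0) = eigenvalues_desc A ! a * e a v"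
    if a: "a < n" and v: "v \<in> V" for a v
  proof -
    have "(A *\<^sub>v col U a) $ ix v = (\<Sum>j<n. A $$ (ix v, j) * U $$ (j,a))"
      using A U a ix2[OF v] by (simp add: scalar_prod_def atLeast0LessThan)
    also have "\<dots> = (\<Sum>u\<in>V. if (v,u) \<in> parcs G then e a u else 0)"
      unfolding sumV using ix2[OF v] by (intro sum.cong) (auto simp: Aij e_def ix1)
    finally show ?thesis using ev[OF a] U ix2[OF v] a by (simp add: e_def)
  qed
  have e2: "(\<Sum>v\<in>V. e a v * e b v) = (if a = b then 1 else 0)" if "a < n" "b < n" for a b
  proof -
    have "(\<Sum>v\<in>V. e a v * e b v) = (transpose_mat U * U) $$ (a,b)"
      unfolding sumV using U that by (simp add: e_def ix1 scalar_prod_def atLeast0LessThan)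
    then show ?thesis unfolding UU using that by simp
  qed
  have e3: "(\<Sum>a<n. e a u * e a v) = (if u = v then 1 else 0)" if u: "u \<in> V" and v: "v \<in> V" for u v
  proof -
    have "(\<Sum>a<n. e a u * e a v) = (U * transpose_mat U) $$ (ix u, ix v)"
      using U ix2[OF u] ix2[OF v] by (simp add: e_def scalar_prod_def atLeast0LessThan)
    moreover have "ix u = ix v \<longleftrightarrow> u = v" using ix2(1)[OF u] ix2(1)[OF v] by metis
    ultimately show ?thesis unfolding UU' using ix2(2)[OF u] ix2(2)[OF v] by simp
  qed
  have "lambda2 G = eigenvalues_desc A ! 1" by (simp add: lambda2_def A_def)
  then show ?thesis
    using e1 e2 e3 mono
    by (intro exI[of _ e] exI[of _ "\<lambda>a. eigenvalues_desc A ! a"])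
      (simp add: sorted_eigenbasis_def Let_def V_def[symmetric] n_def[symmetric])
qed

definition adj_sum :: "'a pair_pre_digraph => ('a => real) => 'a => real" where
  "adj_sum G x v = (\<Sum>u\<in>pverts G. if (v,u) \<in> parcs G then x u else 0)"

definition adj_form :: "'a pair_pre_digraph => ('a => real) => real" where
  "adj_form G x = (\<Sum>v\<in>pverts G. x v * adj_sum G x v)"

text \<open>The upper half of Courant--Fischer: the span of the first two eigenvectors meets every hyperplane.\<close>

lemma lambda2_test_vector:
  fixes G :: "'a pair_pre_digraph" and c :: "'a => real"
  assumes fin: "finite (pverts G)" and sym: "sym (parcs G)" and card: "card (pverts G) \<ge> 2"
  shows "\<exists>x. (\<exists>v\<in>pverts G. x v \<noteq> 0) \<and> (\<Sum>v\<in>pverts G. c v * x v) = 0 \<and>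
    ((\<forall>v\<in>pverts G. adj_sum G x v = lambda2 G * x v) \<or>
     adj_form G x > lambda2 G * (\<Sum>v\<in>pverts G. (x v)\<^sup>2))"
proof -
  define V where "V = pverts G"
  obtain e \<mu> where basis: "sorted_eigenbasis G e \<mu>" and l2: "lambda2 G = \<mu> 1"
    using adjacency_sorted_eigenbasis[OF fin sym] by blast
  note B = basis[unfolded sorted_eigenbasis_def Let_def, folded V_def]
  note ev = conjunct1[OF B, rule_format]
  note on = conjunct1[OF conjunct2[OF B], rule_format]
  note mono = conjunct2[OF conjunct2[OF conjunct2[OF B]], rule_format]
  have V: "finite V" "card V \<ge> 2" using fin card by (auto simp: V_def)
  define f where "f a = (\<Sum>v\<in>V. c v * e a v)" for a
  have x_props: "(\<exists>v\<in>V. \<alpha> * e 0 v + \<beta> * e 1 v \<noteq> 0)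
      \<and> adj_form G (\<lambda>v. \<alpha> * e 0 v + \<beta> * e 1 v) = \<mu> 0 * \<alpha>\<^sup>2 + \<mu> 1 * \<beta>\<^sup>2
      \<and> (\<Sum>v\<in>V. (\<alpha> * e 0 v + \<beta> * e 1 v)\<^sup>2) = \<alpha>\<^sup>2 + \<beta>\<^sup>2
      \<and> (\<forall>v\<in>V. adj_sum G (\<lambda>v. \<alpha> * e 0 v + \<beta> * e 1 v) v = \<alpha> * \<mu> 0 * e 0 v + \<beta> * \<mu> 1 * e 1 v)
      \<and> (\<Sum>v\<in>V. c v * (\<alpha> * e 0 v + \<beta> * e 1 v)) = \<alpha> * f 0 + \<beta> * f 1"
    if ab: "\<alpha> \<noteq> 0 \<or> \<beta> \<noteq> 0" for \<alpha> \<beta>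
  proof -
    let ?x = "\<lambda>v. \<alpha> * e 0 v + \<beta> * e 1 v"
    have as: "adj_sum G ?x v = \<alpha> * \<mu> 0 * e 0 v + \<beta> * \<mu> 1 * e 1 v" if v: "v \<in> V" for v
    proof -
      have "adj_sum G ?x v = \<alpha> * (\<Sum>u\<in>V. if (v,u) \<in> parcs G then e 0 u else 0)
          + \<beta> * (\<Sum>u\<in>V. if (v,u) \<in> parcs G then e 1 u else 0)"
        unfolding adj_sum_def V_def[symmetric] sum_distrib_left sum.distrib[symmetric]
        by (intro sum.cong) auto
      then show ?thesis using ev[of 0 v] ev[of 1 v] V v by simp
    qed
    have s: "(\<Sum>v\<in>V. (p * e 0 v + q * e 1 v) * (\<alpha> * e 0 v + \<beta> * e 1 v)) = p * \<alpha> + q * \<beta>" for p q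
    proof -
      have "(\<Sum>v\<in>V. (p * e 0 v + q * e 1 v) * (\<alpha> * e 0 v + \<beta> * e 1 v)) =
         p * \<alpha> * (\<Sum>v\<in>V. e 0 v * e 0 v) + (p * \<beta> + q * \<alpha>) * (\<Sum>v\<in>V. e 0 v * e 1 v)
           + q * \<beta> * (\<Sum>v\<in>V. e 1 v * e 1 v)"
        unfolding sum_distrib_left sum.distrib[symmetric] by (intro sum.cong) (auto simp: algebra_simps)
      then show ?thesis using on[of 0 0] on[of 0 1] on[of 1 1] V by simp
    qed
    have sq: "(\<Sum>v\<in>V. (?x v)\<^sup>2) = \<alpha>\<^sup>2 + \<beta>\<^sup>2" using s[of \<alpha> \<beta>] by (simp add: power2_eq_square)
    have "adj_form G ?x = (\<Sum>v\<in>V. (\<alpha> * \<mu> 0 * e 0 v + \<beta> * \<mu> 1 * e 1 v) * ?x v)"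
      unfolding adj_form_def V_def[symmetric]
      by (intro sum.cong refl) (simp only: as mult.commute)
    also have "\<dots> = \<mu> 0 * \<alpha>\<^sup>2 + \<mu> 1 * \<beta>\<^sup>2" unfolding s by (simp add: power2_eq_square)
    finally have fm: "adj_form G ?x = \<mu> 0 * \<alpha>\<^sup>2 + \<mu> 1 * \<beta>\<^sup>2" .
    have "\<exists>v\<in>V. ?x v \<noteq> 0"
    proof (rule ccontr)
      assume "\<not> ?thesis"
      then have "(\<Sum>v\<in>V. (?x v)\<^sup>2) = 0" by (intro sum.neutral) auto
      then show False using ab sq by (simp add: sum_power2_eq_zero_iff)
    qed
    moreover have "(\<Sum>v\<in>V. c v * ?x v) = \<alpha> * f 0 + \<beta> * f 1"
      unfolding f_def sum_distrib_left sum.distrib[symmetric]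
      by (intro sum.cong) (auto simp: algebra_simps)
    ultimately show ?thesis using sq fm as by blast
  qed
  have mu: "\<mu> 1 \<le> \<mu> 0" using mono[of 0 1] V by simp
  show ?thesis
  \<comment> \<open>The functional \<open>c\<close> is annihilated by \<open>e 1\<close> itself if
    \<open>f 1 = 0\<close>, and otherwise by \<open>f 1 * e 0 - f 0 * e 1\<close>, which has a
    nonzero component along \<open>e 0\<close>.\<close>
  proof (cases "f 1 = 0")
    case True
    show ?thesis unfolding V_def[symmetric] l2 using x_props[of 0 1] True
      by (intro exI[of _ "\<lambda>v. 0 * e 0 v + 1 * e 1 v"]) auto
  next
    case False
    let ?x = "\<lambda>v. f 1 * e 0 v + (- f 0) * e 1 v"
    have x: "\<exists>v\<in>V. ?x v \<noteq> 0" "adj_form G ?x = \<mu> 0 * (f 1)\<^sup>2 + \<mu> 1 * (f 0)\<^sup>2"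
      "(\<Sum>v\<in>V. (?x v)\<^sup>2) = (f 1)\<^sup>2 + (f 0)\<^sup>2"
      "\<And>v. v \<in> V ==> adj_sum G ?x v = f 1 * \<mu> 0 * e 0 v + (- f 0) * \<mu> 1 * e 1 v"
      "(\<Sum>v\<in>V. c v * ?x v) = 0"
      using x_props[of "f 1" "- f 0"] False by (auto simp: algebra_simps)
    have "(\<forall>v\<in>V. adj_sum G ?x v = \<mu> 1 * ?x v) \<or> adj_form G ?x > \<mu> 1 * (\<Sum>v\<in>V. (?x v)\<^sup>2)"
    \<comment> \<open>If the two eigenvalues agree, the whole span is one eigenspace. Otherwise the
      nonzero coefficient of \<open>e 0\<close> raises the form strictly. Hence equality in an upper
      bound always produces a true eigenvector inside the hyperplane.\<close>
    proof (cases "\<mu> 0 = \<mu> 1")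
      case True
      then show ?thesis using x(4) by (auto simp: algebra_simps)
    next
      case F: False
      then have "\<mu> 1 * (f 1)\<^sup>2 < \<mu> 0 * (f 1)\<^sup>2" using mu False by simp
      then show ?thesis unfolding x(2,3) by (simp add: algebra_simps)
    qed
    then show ?thesis unfolding V_def[symmetric] l2 by (intro exI[of _ ?x] conjI x(1,5))
  qed
qed

text \<open>On the plane spanned by the positive and the negative part of \<open>x\<close> the form
  is at least \<open>l\<close> times the squared norm. This plane contains a nonzero vector
  orthogonal to the top eigenvector \<open>e 0\<close>, and there the form is at most
  \<open>\<mu> 1\<close> times the squared norm.\<close>

lemma lambda2_ge_sign_changing_eigenvector:
  fixes G :: "'a pair_pre_digraph" and x :: "'a => real"
  assumes fin: "finite (pverts G)" and sym: "sym (parcs G)"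
    and eig: "\<And>v. v \<in> pverts G ==> adj_sum G x v = l * x v"
    and u: "u \<in> pverts G" "x u > 0" and w: "w \<in> pverts G" "x w < 0"
  shows "lambda2 G \<ge> l"
proof (rule ccontr)
  assume "\<not> ?thesis"
  then have less: "lambda2 G < l" by simp
  define V where "V = pverts G"
  obtain e \<mu> where basis: "sorted_eigenbasis G e \<mu>" and l2: "lambda2 G = \<mu> 1"
    using adjacency_sorted_eigenbasis[OF fin sym] by blast
  note B = basis[unfolded sorted_eigenbasis_def Let_def, folded V_def]
  note ev = conjunct1[OF B, rule_format]
  note cpl = conjunct1[OF conjunct2[OF conjunct2[OF B]], rule_format]
  note mono = conjunct2[OF conjunct2[OF conjunct2[OF B]], rule_format]
  have V: "finite V" using fin by (simp add: V_def)
  have sx: "(\<Sum>v\<in>V. x v * adj_sum G y v) = (\<Sum>v\<in>V. adj_sum G x v * y v)" for x y :: "'a => real"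
  proof -
    have "(\<Sum>v\<in>V. x v * adj_sum G y v) = (\<Sum>v\<in>V. \<Sum>u\<in>V. if (v,u) \<in> parcs G then x v * y u else 0)"
      unfolding adj_sum_def V_def[symmetric] sum_distrib_left by (intro sum.cong) auto
    also have "\<dots> = (\<Sum>u\<in>V. \<Sum>v\<in>V. if (v,u) \<in> parcs G then x v * y u else 0)" by (rule sum.swap)
    also have "\<dots> = (\<Sum>v\<in>V. adj_sum G x v * y v)"
      unfolding adj_sum_def V_def[symmetric] sum_distrib_right
      using sym by (intro sum.cong) (auto dest: symD)
    finally show ?thesis .
  qed
  define xp where "xp v = max (x v) 0" for v
  define xn where "xn v = max (- x v) 0" for v
  have xpn: "x v = xp v - xn v" "xp v * xn v = 0" "xp v \<ge> 0" "xn v \<ge> 0" for v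
    by (auto simp: xp_def xn_def max_def)
  have lin: "adj_sum G (\<lambda>v. a * y v + b * z v) v = a * adj_sum G y v + b * adj_sum G z v" for a b y z v
    unfolding adj_sum_def sum_distrib_left sum.distrib[symmetric] by (intro sum.cong) (auto simp: algebra_simps)
  \<comment> \<open>\<open>E\<close> weighs the edges between the supports of the two parts. The
    form of either part is \<open>l\<close> times its squared norm plus \<open>E\<close>, so for a
    combination \<open>y\<close> the number \<open>E\<close> appears with the factor
    \<open>(\<alpha> + \<beta>)^2\<close>.\<close>
  define E where "E = (\<Sum>v\<in>V. xp v * adj_sum G xn v)"
  have E: "E \<ge> 0" unfolding E_def adj_sum_def using xpn by (intro sum_nonneg mult_nonneg_nonneg) auto
  define sp where "sp = (\<Sum>v\<in>V. xp v * xp v)"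
  define sn where "sn = (\<Sum>v\<in>V. xn v * xn v)"
  have ax: "adj_sum G xp v - adj_sum G xn v = l * (xp v - xn v)" if "v \<in> V" for v
  proof -
    have "x = (\<lambda>v. 1 * xp v + (- 1) * xn v)" by (rule ext) (simp add: xpn(1))
    then have "adj_sum G x v = 1 * adj_sum G xp v + (- 1) * adj_sum G xn v" using lin[of 1 xp "- 1" xn v] by simp
    then show ?thesis using eig[of v] that xpn(1)[of v] by (simp add: V_def)
  qed
  have ppE: "(\<Sum>v\<in>V. xp v * adj_sum G xp v) = l * sp + E"
  proof -
    have "(\<Sum>v\<in>V. xp v * adj_sum G xp v) - E = (\<Sum>v\<in>V. xp v * (adj_sum G xp v - adj_sum G xn v))"
      unfolding E_def by (simp add: sum_subtractf[symmetric] algebra_simps)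
    also have "\<dots> = (\<Sum>v\<in>V. l * (xp v * xp v))"
      using xpn(2) by (intro sum.cong) (auto simp: ax algebra_simps)
    finally show ?thesis unfolding sp_def by (simp add: sum_distrib_left)
  qed
  have nnE: "(\<Sum>v\<in>V. xn v * adj_sum G xn v) = l * sn + E"
  proof -
    have "(\<Sum>v\<in>V. xn v * adj_sum G xn v) - (\<Sum>v\<in>V. xn v * adj_sum G xp v)
        = - (\<Sum>v\<in>V. xn v * (adj_sum G xp v - adj_sum G xn v))"
      by (simp add: sum_subtractf[symmetric] sum_negf[symmetric] algebra_simps)
    also have "\<dots> = - (\<Sum>v\<in>V. - l * (xn v * xn v))"
      using xpn(2) by (intro arg_cong[of _ _ uminus] sum.cong) (auto simp: ax algebra_simps)
    also have "(\<Sum>v\<in>V. xn v * adj_sum G xp v) = E"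
      unfolding E_def using sx[of xn xp] by (simp add: mult.commute)
    finally show ?thesis unfolding sn_def by (simp add: sum_distrib_left sum_negf)
  qed
  define fp where "fp = (\<Sum>v\<in>V. e 0 v * xp v)"
  define fn where "fn = (\<Sum>v\<in>V. e 0 v * xn v)"
  obtain \<alpha> \<beta> :: real where ab: "\<alpha> \<noteq> 0 \<or> \<beta> \<noteq> 0" "\<alpha> * fp + \<beta> * fn = 0"
  proof (cases "fp = 0")
    case True then show ?thesis using that[of 1 0] by simp
  next
    case False then show ?thesis using that[of "- fn" fp] by (simp add: algebra_simps)
  qed
  define y where "y v = \<alpha> * xp v + \<beta> * xn v" for v
  have y_sq: "(\<Sum>v\<in>V. y v * y v) = \<alpha>\<^sup>2 * sp + \<beta>\<^sup>2 * sn"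
    unfolding sp_def sn_def sum_distrib_left sum.distrib[symmetric] y_def
    using xpn(2) by (intro sum.cong) (auto simp: algebra_simps power2_eq_square)
  have "(\<Sum>v\<in>V. y v * adj_sum G y v) = \<alpha>\<^sup>2 * (\<Sum>v\<in>V. xp v * adj_sum G xp v)
      + \<alpha> * \<beta> * E + \<alpha> * \<beta> * (\<Sum>v\<in>V. xn v * adj_sum G xp v) + \<beta>\<^sup>2 * (\<Sum>v\<in>V. xn v * adj_sum G xn v)"
    unfolding y_def lin E_def sum_distrib_left sum.distrib[symmetric]
    by (intro sum.cong) (auto simp: algebra_simps power2_eq_square)
  also have "(\<Sum>v\<in>V. xn v * adj_sum G xp v) = E"
    unfolding E_def using sx[of xn xp] by (simp add: mult.commute)
  finally have y_form: "(\<Sum>v\<in>V. y v * adj_sum G y v) = l * (\<alpha>\<^sup>2 * sp + \<beta>\<^sup>2 * sn) + E * (\<alpha> + \<beta>)\<^sup>2"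
    unfolding ppE nnE by (simp add: algebra_simps power2_eq_square)
  have sp0: "sp > 0" unfolding sp_def using u V
    by (intro sum_pos2[of _ u]) (auto simp: V_def xp_def)
  have sn0: "sn > 0" unfolding sn_def using w V
    by (intro sum_pos2[of _ w]) (auto simp: V_def xn_def mult_neg_neg)
  have ypos: "(\<Sum>v\<in>V. y v * y v) > 0"
    unfolding y_sq using ab(1) sp0 sn0 by (metis add_nonneg_pos add_pos_nonneg less_eq_real_def mult_pos_pos not_sum_power2_lt_zero zero_le_mult_iff zero_less_power2 zero_le_power2)
  define g where "g a = (\<Sum>v\<in>V. e a v * y v)" for a
  have g0: "g 0 = 0" unfolding g_def y_def using ab(2)
    by (simp add: fp_def fn_def sum_distrib_left sum.distrib algebra_simps)
  \<comment> \<open>Parseval: \<open>g\<close> holds the coordinates of \<open>y\<close> in the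
    eigenbasis.\<close>
  have par: "(\<Sum>a<card V. g a * h a) = (\<Sum>v\<in>V. y v * z v)"
    if h: "\<And>a. a < card V ==> h a = (\<Sum>v\<in>V. e a v * z v)" for h and z :: "'a => real"
  proof -
    have "(\<Sum>a<card V. g a * h a) = (\<Sum>a<card V. \<Sum>u\<in>V. \<Sum>v\<in>V. (e a u * e a v) * (y u * z v))"
      by (intro sum.cong) (auto simp: g_def h sum_product algebra_simps)
    also have "\<dots> = (\<Sum>u\<in>V. \<Sum>a<card V. \<Sum>v\<in>V. (e a u * e a v) * (y u * z v))" by (rule sum.swap)
    also have "\<dots> = (\<Sum>u\<in>V. \<Sum>v\<in>V. \<Sum>a<card V. (e a u * e a v) * (y u * z v))"
      by (intro sum.cong refl) (rule sum.swap)
    also have "\<dots> = (\<Sum>u\<in>V. \<Sum>v\<in>V. if u = v then y u * z v else 0)"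
      by (intro sum.cong refl) (simp add: sum_distrib_right[symmetric] cpl)
    also have "\<dots> = (\<Sum>v\<in>V. y v * z v)" using V by simp
    finally show ?thesis .
  qed
  have "(\<Sum>v\<in>V. y v * adj_sum G y v) = (\<Sum>a<card V. g a * (\<mu> a * g a))"
  proof (rule par[symmetric])
    fix a assume a: "a < card V"
    have "(\<Sum>v\<in>V. e a v * adj_sum G y v) = (\<Sum>v\<in>V. adj_sum G (e a) v * y v)" by (rule sx)
    also have "\<dots> = \<mu> a * g a"
      unfolding g_def sum_distrib_left using ev[OF a]
      by (intro sum.cong) (auto simp: adj_sum_def V_def[symmetric] mult.assoc)
    finally show "\<mu> a * g a = (\<Sum>v\<in>V. e a v * adj_sum G y v)" by simp
  qed
  also have "\<dots> \<le> (\<Sum>a<card V. \<mu> 1 * (g a * g a))"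
  proof (intro sum_mono)
    fix a assume a: "a \<in> {..<card V}"
    show "g a * (\<mu> a * g a) \<le> \<mu> 1 * (g a * g a)"
    proof (cases "a = 0")
      case False
      then have "\<mu> a \<le> \<mu> 1" using mono[of 1 a] a by simp
      then have "\<mu> a * (g a * g a) \<le> \<mu> 1 * (g a * g a)" by (intro mult_right_mono) auto
      then show ?thesis by (simp add: mult_ac)
    qed (simp add: g0)
  qed
  also have "\<dots> = \<mu> 1 * (\<Sum>v\<in>V. y v * y v)"
    unfolding sum_distrib_left[symmetric] by (subst par[of g y]) (auto simp: g_def)
  also have "\<dots> < l * (\<Sum>v\<in>V. y v * y v)" using less ypos unfolding l2 by simp
  finally show False using mult_nonneg_nonneg[OF E zero_le_power2[of "\<alpha> + \<beta>"]] unfolding y_form y_sq by linarith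
qed

section \<open>Quadratic forms on loaded paths\<close>

text \<open>\<open>chp l (n + 1)\<close> is the characteristic polynomial of the path with \<open>n\<close> vertices.\<close>

fun chp :: "real => nat => real" where
  "chp l 0 = 0"
| "chp l (Suc 0) = 1"
| "chp l (Suc (Suc n)) = l * chp l (Suc n) - chp l n"

text \<open>Continued to index -1, the recurrence gives the value \<open>l * S 0 - S 1\<close>,
  which is also the constant Wronskian of \<open>chp\<close> and \<open>S\<close>. The last conjunct
  compares \<open>k / l\<close>, the load of \<open>k\<close> leaves at \<open>i\<close>, with
  \<open>(l * S 0 - S 1) / (chp l (i + 1) * S i)\<close>, the coefficient of \<open>(X i)^2\<close>
  that survives the completion of squares. Index 0 is left out because no leaf hangs at an end of a
  diametral path.\<close>

definition half_cert :: "real => nat => (nat => real) => nat => bool" where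
  "half_cert l p S k \<longleftrightarrow> l > 0 \<and> (\<forall>j\<le>p. S j > 0) \<and> (\<forall>j<p. S (j + 2) = l * S (j + 1) - S j) \<and>
     S 1 \<le> l * S 0 \<and> (k > 0 --> S 1 < l * S 0) \<and>
     (\<forall>i. 1 \<le> i --> i \<le> p --> real k * chp l (i + 1) * S i \<le> l * (l * S 0 - S 1))"

definition half_tight :: "real => nat => (nat => real) => nat => nat => bool" where
  "half_tight l p S k i \<longleftrightarrow> 1 \<le> i \<and> i \<le> p \<and> real k * chp l (i + 1) * S i = l * (l * S 0 - S 1)"

text \<open>The last term is the share of this half in the edge that holds the node: if
  \<open>X (p + 1) = S (p + 1) / S p * X p\<close>, it is one of the two copies of
  \<open>X p * X (p + 1)\<close>. For a node at the vertex \<open>p + 1\<close> it is 0.\<close>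

definition half_form :: "real => nat => (nat => real) => (nat => real) => real" where
  "half_form l p S X = l * (\<Sum>j\<le>p. (X j)\<^sup>2) - 2 * (\<Sum>j<p. X j * X (j + 1)) - S (p + 1) / S p * (X p)\<^sup>2"

lemma chp_2 [simp]: "chp l 2 = l"
  by (simp add: numeral_2_eq_2)

lemma chp_rec: "chp l (n + 2) = l * chp l (n + 1) - chp l n"
  by simp

text \<open>The Wronskian of two solutions of one recurrence is constant. The shift in
  \<open>chp\<close> makes the left solution start with 1 and \<open>l\<close>, that is, with 0 at
  index -1.\<close>

lemma chp_wronskian:
  fixes S :: "nat => real"
  assumes "\<And>j. j < i ==> S (j + 2) = l * S (j + 1) - S j"
  shows "chp l (i + 2) * S i - chp l (i + 1) * S (i + 1) = l * S 0 - S 1"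
  using assms
proof (induction i)
  case (Suc i)
  have IH: "chp l (i + 2) * S i - chp l (i + 1) * S (i + 1) = l * S 0 - S 1"
    using Suc.IH Suc.prems by simp
  have S: "l * S (i + 1) - S (i + 2) = S i" using Suc.prems[of i] by simp
  have "chp l (Suc i + 2) * S (Suc i) - chp l (Suc i + 1) * S (Suc i + 1) =
     chp l (i + 2) * (l * S (i + 1) - S (i + 2)) - chp l (i + 1) * S (i + 1)"
    by (simp add: algebra_simps)
  then show ?case using IH unfolding S by simp
qed simp

text \<open>Sturm comparison: a nonnegative Wronskian together with a positive \<open>S\<close>
  passes the positivity of \<open>chp\<close> on to the next index.\<close>

lemma chp_pos_of_positive_solution:
  assumes rec: "\<And>j. j < p ==> S (j + 2) = l * S (j + 1) - S j"
    and pos: "\<And>j. j \<le> p ==> S j > 0" and W: "S 1 \<le> l * S 0" and "j \<le> p"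
  shows "chp l (j + 1) > 0"
  using \<open>j \<le> p\<close>
proof (induction j)
  case (Suc i)
  have "chp l (i + 2) * S i = (l * S 0 - S 1) + chp l (i + 1) * S (i + 1)"
    using chp_wronskian[of i S l] rec Suc.prems by (simp add: algebra_simps)
  moreover have "chp l (i + 1) * S (i + 1) > 0"
    using Suc pos[of "i + 1"] by simp
  ultimately have "chp l (i + 2) * S i > 0" using W by linarith
  then show ?case using pos[of i] Suc.prems by (simp add: zero_less_mult_iff)
qed simp

text \<open>Gaussian elimination starting at the end 0; the pivots are the quotients
  \<open>chp l (j + 2) / chp l (j + 1)\<close>.\<close>

lemma left_sum_of_squares:
  assumes "\<And>j. j \<le> i ==> chp l (j + 1) > 0"
  shows "l * (\<Sum>j\<le>i. (X j)\<^sup>2) - 2 * (\<Sum>j<i. X j * X (j + 1)) =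
    (\<Sum>j<i. chp l (j + 2) / chp l (j + 1) * (X j - chp l (j + 1) / chp l (j + 2) * X (j + 1))\<^sup>2)
    + chp l (i + 2) / chp l (i + 1) * (X i)\<^sup>2"
  using assms
proof (induction i)
  case (Suc i)
  define a where "a = chp l (i + 1)"
  define b where "b = chp l (i + 2)"
  have ab: "a > 0" "b > 0" using Suc.prems[of i] Suc.prems[of "Suc i"] by (auto simp: a_def b_def)
  have c: "chp l (Suc i + 2) / chp l (Suc i + 1) = l - a / b"
    using ab by (simp add: a_def b_def diff_divide_distrib)
  have sq: "b / a * (X i - a / b * X (i + 1))\<^sup>2 =
     b / a * (X i)\<^sup>2 - 2 * (X i * X (i + 1)) + a / b * (X (i + 1))\<^sup>2"
    using ab by (simp add: field_simps power2_eq_square)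
  have IH: "l * (\<Sum>j\<le>i. (X j)\<^sup>2) - 2 * (\<Sum>j<i. X j * X (j + 1)) =
    (\<Sum>j<i. chp l (j + 2) / chp l (j + 1) * (X j - chp l (j + 1) / chp l (j + 2) * X (j + 1))\<^sup>2)
    + b / a * (X i)\<^sup>2" (is "?q = ?s + _")
    using Suc.IH Suc.prems by (simp add: a_def b_def)
  have "l * (\<Sum>j\<le>Suc i. (X j)\<^sup>2) - 2 * (\<Sum>j<Suc i. X j * X (j + 1)) =
     ?q + l * (X (i + 1))\<^sup>2 - 2 * (X i * X (i + 1))" by (simp add: algebra_simps)
  also have "\<dots> = ?s + b / a * (X i - a / b * X (i + 1))\<^sup>2 + (l - a / b) * (X (i + 1))\<^sup>2"
    unfolding IH sq by (simp add: algebra_simps)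
  finally show ?case unfolding c by (simp add: a_def b_def)
qed simp

text \<open>The same elimination, coming from the node. The boundary term of
  \<open>half_form\<close> is what turns the pivots into the quotients
  \<open>S j / S (j + 1)\<close>.\<close>

lemma right_sum_of_squares:
  fixes S X :: "nat => real"
  assumes "\<And>j. i \<le> j ==> j \<le> i + n ==> S j > 0"
    and "\<And>j. i \<le> j ==> j < i + n ==> S (j + 2) = l * S (j + 1) - S j"
  shows "l * (\<Sum>j\<in>{i<..i + n}. (X j)\<^sup>2) - 2 * (\<Sum>j\<in>{i..<i + n}. X j * X (j + 1))
      - S (i + n + 1) / S (i + n) * (X (i + n))\<^sup>2 =
    (\<Sum>j\<in>{i..<i + n}. S j / S (j + 1) * (X (j + 1) - S (j + 1) / S j * X j)\<^sup>2) - S (i + 1) / S i * (X i)\<^sup>2"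
  using assms
proof (induction n)
  case (Suc n)
  define a where "a = S (i + n)"
  define b where "b = S (i + n + 1)"
  have ab: "a > 0" "b > 0" using Suc.prems(1)[of "i + n"] Suc.prems(1)[of "i + n + 1"]
    by (auto simp: a_def b_def)
  have c: "S (i + Suc n + 1) / S (i + Suc n) = l - a / b"
    using ab Suc.prems(2)[of "i + n"] by (simp add: a_def b_def diff_divide_distrib)
  let ?x = "X (i + n)" and ?y = "X (i + n + 1)"
  have sq: "a / b * (?y - b / a * ?x)\<^sup>2 = a / b * ?y\<^sup>2 - 2 * (?x * ?y) + b / a * ?x\<^sup>2"
    using ab by (simp add: field_simps power2_eq_square)
  have IH: "l * (\<Sum>j\<in>{i<..i + n}. (X j)\<^sup>2) - 2 * (\<Sum>j\<in>{i..<i + n}. X j * X (j + 1)) - b / a * ?x\<^sup>2 =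
    (\<Sum>j\<in>{i..<i + n}. S j / S (j + 1) * (X (j + 1) - S (j + 1) / S j * X j)\<^sup>2) - S (i + 1) / S i * (X i)\<^sup>2"
    using Suc.IH Suc.prems by (simp add: a_def b_def)
  have s1: "{i<..i + Suc n} = insert (i + n + 1) {i<..i + n}" by auto
  have s2: "{i..<i + Suc n} = insert (i + n) {i..<i + n}" by auto
  have "l * (\<Sum>j\<in>{i<..i + Suc n}. (X j)\<^sup>2) - 2 * (\<Sum>j\<in>{i..<i + Suc n}. X j * X (j + 1))
      - S (i + Suc n + 1) / S (i + Suc n) * (X (i + Suc n))\<^sup>2 =
    (l * (\<Sum>j\<in>{i<..i + n}. (X j)\<^sup>2) - 2 * (\<Sum>j\<in>{i..<i + n}. X j * X (j + 1)) - b / a * ?x\<^sup>2)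
      + a / b * (?y - b / a * ?x)\<^sup>2"
    unfolding c s1 s2 sq by (simp add: algebra_simps)
  then show ?case unfolding IH s2 by (simp add: a_def b_def)
qed simp

text \<open>Eliminating from both sides towards \<open>i\<close> leaves at \<open>i\<close> the
  difference of the two pivots, which is the Wronskian divided by
  \<open>chp l (i + 1) * S i\<close>. As \<open>i\<close> is free, it can be taken to be a loaded
  vertex.\<close>

lemma half_form_sum_of_squares:
  assumes P: "\<And>j. j \<le> p ==> chp l (j + 1) > 0" and S: "\<And>j. j \<le> p ==> S j > 0"
    and rec: "\<And>j. j < p ==> S (j + 2) = l * S (j + 1) - S j" and i: "i \<le> p"
  shows "half_form l p S X =
     (\<Sum>j<i. chp l (j + 2) / chp l (j + 1) * (X j - chp l (j + 1) / chp l (j + 2) * X (j + 1))\<^sup>2)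
   + (\<Sum>j\<in>{i..<p}. S j / S (j + 1) * (X (j + 1) - S (j + 1) / S j * X j)\<^sup>2)
   + (l * S 0 - S 1) / (chp l (i + 1) * S i) * (X i)\<^sup>2"
proof -
  obtain n where n: "p = i + n" using i le_Suc_ex by blast
  have s1: "(\<Sum>j\<le>p. (X j)\<^sup>2) = (\<Sum>j\<le>i. (X j)\<^sup>2) + (\<Sum>j\<in>{i<..p}. (X j)\<^sup>2)"
    using i by (subst sum.union_disjoint[symmetric]) (auto intro!: sum.cong)
  have s2: "(\<Sum>j<p. X j * X (j + 1)) = (\<Sum>j<i. X j * X (j + 1)) + (\<Sum>j\<in>{i..<p}. X j * X (j + 1))"
    using i by (subst sum.union_disjoint[symmetric]) (auto intro!: sum.cong)
  have W: "(l * S 0 - S 1) / (chp l (i + 1) * S i) = chp l (i + 2) / chp l (i + 1) - S (i + 1) / S i"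
  proof -
    have "chp l (i + 2) * S i - chp l (i + 1) * S (i + 1) = l * S 0 - S 1"
      using chp_wronskian[of i S l] rec i by simp
    then show ?thesis using P[OF i] S[OF i] by (simp only: frac_eq_eq diff_frac_eq) (simp add: field_simps)
  qed
  have r: "l * (\<Sum>j\<in>{i<..p}. (X j)\<^sup>2) - 2 * (\<Sum>j\<in>{i..<p}. X j * X (j + 1)) - S (p + 1) / S p * (X p)\<^sup>2 =
    (\<Sum>j\<in>{i..<p}. S j / S (j + 1) * (X (j + 1) - S (j + 1) / S j * X j)\<^sup>2) - S (i + 1) / S i * (X i)\<^sup>2"
    using right_sum_of_squares[of i n S l X] S rec unfolding n by simp
  have lft: "l * (\<Sum>j\<le>i. (X j)\<^sup>2) - 2 * (\<Sum>j<i. X j * X (j + 1)) =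
    (\<Sum>j<i. chp l (j + 2) / chp l (j + 1) * (X j - chp l (j + 1) / chp l (j + 2) * X (j + 1))\<^sup>2)
    + chp l (i + 2) / chp l (i + 1) * (X i)\<^sup>2"
    using P i by (intro left_sum_of_squares) simp
  show ?thesis unfolding half_form_def s1 s2 W using lft r by (simp add: algebra_simps)
qed

lemma half_certD:
  assumes "half_cert l p S k"
  shows "l > 0" "\<And>j. j \<le> p ==> S j > 0" "\<And>j. j < p ==> S (j + 2) = l * S (j + 1) - S j"
    "S 1 \<le> l * S 0" "k > 0 ==> S 1 < l * S 0"
    "\<And>i. 1 \<le> i ==> i \<le> p ==> real k * chp l (i + 1) * S i \<le> l * (l * S 0 - S 1)"
    "\<And>j. j \<le> p ==> chp l (j + 1) > 0"
  using assms chp_pos_of_positive_solution[of p S l] unfolding half_cert_def by auto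

lemma half_form_ge_square:
  assumes h: "half_cert l p S k" and i: "i \<le> p"
  shows "half_form l p S X \<ge> (l * S 0 - S 1) / (chp l (i + 1) * S i) * (X i)\<^sup>2"
    and "half_form l p S X = (l * S 0 - S 1) / (chp l (i + 1) * S i) * (X i)\<^sup>2 ==>
      (\<forall>j<i. X j = chp l (j + 1) / chp l (j + 2) * X (j + 1)) \<and>
      (\<forall>j. i \<le> j --> j < p --> X (j + 1) = S (j + 1) / S j * X j)"
proof -
  note D = half_certD[OF h]
  let ?a = "\<lambda>j. chp l (j + 2) / chp l (j + 1) * (X j - chp l (j + 1) / chp l (j + 2) * X (j + 1))\<^sup>2"
  let ?b = "\<lambda>j. S j / S (j + 1) * (X (j + 1) - S (j + 1) / S j * X j)\<^sup>2"
  have ca: "chp l (j + 2) / chp l (j + 1) > 0" if "j < i" for j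
    using that i D(7)[of j] D(7)[of "j + 1"] by simp
  have cb: "S j / S (j + 1) > 0" if "j < p" for j
    using that D(2)[of j] D(2)[of "j + 1"] by simp
  have a: "?a j \<ge> 0" if "j < i" for j using ca[OF that] by (intro mult_nonneg_nonneg) auto
  have b: "?b j \<ge> 0" if "j < p" for j using cb[OF that] by (intro mult_nonneg_nonneg) auto
  have eq: "half_form l p S X = (\<Sum>j<i. ?a j) + (\<Sum>j\<in>{i..<p}. ?b j)
     + (l * S 0 - S 1) / (chp l (i + 1) * S i) * (X i)\<^sup>2"
    using half_form_sum_of_squares[OF D(7) D(2) D(3) i] .
  have sa: "(\<Sum>j<i. ?a j) \<ge> 0" using a by (intro sum_nonneg) auto
  have sb: "(\<Sum>j\<in>{i..<p}. ?b j) \<ge> 0" using b by (intro sum_nonneg) auto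
  show "half_form l p S X \<ge> (l * S 0 - S 1) / (chp l (i + 1) * S i) * (X i)\<^sup>2"
    unfolding eq using sa sb by linarith
  assume "half_form l p S X = (l * S 0 - S 1) / (chp l (i + 1) * S i) * (X i)\<^sup>2"
  then have z: "(\<Sum>j<i. ?a j) = 0" "(\<Sum>j\<in>{i..<p}. ?b j) = 0" using eq sa sb by linarith+
  have za: "?a j = 0" if "j < i" for j
    using z(1) a that by (subst (asm) sum_nonneg_eq_0_iff) auto
  have zb: "?b j = 0" if "i \<le> j" "j < p" for j
    using z(2) b that by (subst (asm) sum_nonneg_eq_0_iff) auto
  have "X j = chp l (j + 1) / chp l (j + 2) * X (j + 1)" if "j < i" for j
    using za[OF that] ca[OF that] by (metis eq_iff_diff_eq_0 less_irrefl mult_eq_0_iff power_eq_0_iff)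
  moreover have "X (j + 1) = S (j + 1) / S j * X j" if "i \<le> j" "j < p" for j
    using zb[OF that] cb[OF that(2)] by (metis eq_iff_diff_eq_0 less_irrefl mult_eq_0_iff power_eq_0_iff)
  ultimately show "(\<forall>j<i. X j = chp l (j + 1) / chp l (j + 2) * X (j + 1)) \<and>
      (\<forall>j. i \<le> j --> j < p --> X (j + 1) = S (j + 1) / S j * X j)" by blast
qed

text \<open>The vanishing squares tie neighbouring entries by nonzero factors, so one nonzero entry
  spreads over the whole half.\<close>

lemma half_form_extremal_nonzero:
  assumes h: "half_cert l p S k" and i: "i \<le> p" and Xi: "X i \<noteq> 0"
    and l: "\<forall>j<i. X j = chp l (j + 1) / chp l (j + 2) * X (j + 1)"
    and r: "\<forall>j. i \<le> j --> j < p --> X (j + 1) = S (j + 1) / S j * X j" and "j \<le> p"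
  shows "X j \<noteq> 0"
proof -
  note D = half_certD[OF h]
  have "X (i - n) \<noteq> 0" if "n \<le> i" for n using that
  proof (induction n)
    case (Suc n)
    let ?j = "i - Suc n"
    have "?j + 1 = i - n" using Suc.prems by simp
    then have "X (?j + 1) \<noteq> 0" using Suc by simp
    moreover have "X ?j = chp l (?j + 1) / chp l (?j + 2) * X (?j + 1)" using l Suc.prems by auto
    moreover have "chp l (?j + 1) > 0" using D(7)[of ?j] i by simp
    moreover have "chp l (?j + 2) > 0" using D(7)[of "?j + 1"] i Suc.prems by simp
    ultimately show ?case by (simp del: chp.simps)
  qed (use Xi in simp)
  note left = this
  have "X (i + n) \<noteq> 0" if "i + n \<le> p" for n using that
  proof (induction n)
    case (Suc n)
    have "X (i + n + 1) = S (i + n + 1) / S (i + n) * X (i + n)" using r Suc.prems by auto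
    then show ?case using Suc D(2)[of "i + n"] D(2)[of "i + n + 1"] by simp
  qed (use Xi in simp)
  note right = this
  show ?thesis
  proof (cases "j \<le> i")
    case True then show ?thesis using left[of "i - j"] by simp
  next
    case False then show ?thesis using right[of "j - i"] \<open>j \<le> p\<close> by simp
  qed
qed

text \<open>The gap between the two sides is a weighted mean of the gaps obtained by putting the
  total load on a single vertex, so concentrated loads are the worst ones. Equality makes every
  loaded vertex extremal, and two extremal vertices contradict each other.\<close>

lemma half_form_ge_load:
  assumes h: "half_cert l p S k" and z: "w 0 = (0::nat)" and K: "(\<Sum>j\<le>p. w j) \<le> k"
  shows "(\<Sum>j\<le>p. real (w j) * (X j)\<^sup>2) / l \<le> half_form l p S X"
    and "(\<Sum>j\<le>p. real (w j) * (X j)\<^sup>2) / l = half_form l p S X ==> \<exists>j\<le>p. X j \<noteq> 0 ==>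
       (\<forall>j\<le>p. X j \<noteq> 0) \<and> (\<Sum>j\<le>p. w j) = k \<and> (k = 0 --> S 1 = l * S 0) \<and>
       (k > 0 --> (\<exists>i. half_tight l p S k i \<and> w i = k \<and> (\<forall>j\<le>p. j \<noteq> i --> w j = 0)))"
proof -
  note D = half_certD[OF h]
  let ?Q = "half_form l p S X" and ?W = "l * S 0 - S 1" and ?K = "\<Sum>j\<le>p. w j"
  let ?L = "(\<Sum>j\<le>p. real (w j) * (X j)\<^sup>2) / l"
  have "?L \<le> ?Q \<and> (?L = ?Q --> (\<exists>j\<le>p. X j \<noteq> 0) --> (\<forall>j\<le>p. X j \<noteq> 0) \<and> ?K = k \<and> (k = 0 --> S 1 = l * S 0) \<and>
       (k > 0 --> (\<exists>i. half_tight l p S k i \<and> w i = k \<and> (\<forall>j\<le>p. j \<noteq> i --> w j = 0))))"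
  proof (cases "?K = 0")
    \<comment> \<open>Without load the square at \<open>p\<close> has a nonnegative coefficient.
      Equality for a nonzero vector forces the Wronskian to vanish, hence \<open>k = 0\<close>,
      since \<open>half_cert\<close> asks for a positive one if \<open>k > 0\<close>.\<close>
    case True
    then have w0: "w j = 0" if "j \<le> p" for j using that by simp
    have L: "?L = 0" using w0 by simp
    have c: "?W / (chp l (p + 1) * S p) * (X p)\<^sup>2 \<ge> 0"
      using D(2)[of p] D(7)[of p] D(4) by (intro mult_nonneg_nonneg divide_nonneg_nonneg) auto
    have le: "?L \<le> ?Q" using half_form_ge_square(1)[OF h order.refl[of p], of X] c L by linarith
    moreover have "(\<forall>j\<le>p. X j \<noteq> 0) \<and> ?K = k \<and> (k = 0 --> S 1 = l * S 0) \<and>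
       (k > 0 --> (\<exists>i. half_tight l p S k i \<and> w i = k \<and> (\<forall>j\<le>p. j \<noteq> i --> w j = 0)))"
      if e: "?L = ?Q" and nz: "\<exists>j\<le>p. X j \<noteq> 0"
    proof -
      have t: "?Q = ?W / (chp l (p + 1) * S p) * (X p)\<^sup>2"
        using half_form_ge_square(1)[OF h order.refl[of p], of X] c e L by linarith
      note lr = half_form_ge_square(2)[OF h order.refl[of p] t]
      have Xp: "X p \<noteq> 0"
      proof
        assume Xp: "X p = 0"
        have "X (p - n) = 0" if "n \<le> p" for n using that
        proof (induction n)
          case (Suc n)
          have "p - Suc n + 1 = p - n" using Suc.prems by simp
          then show ?case using lr Suc by (metis Suc_leD Suc_leI diff_Suc_less le_zero_eq mult_zero_right not_less_eq_eq zero_less_Suc less_le_trans)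
        qed (use Xp in simp)
        then have "X j = 0" if "j \<le> p" for j using that by (metis diff_diff_cancel diff_le_self)
        then show False using nz by blast
      qed
      have all: "\<forall>j\<le>p. X j \<noteq> 0" using half_form_extremal_nonzero[where X=X and i=p, OF h order.refl[of p] Xp] lr by blast
      have "?W / (chp l (p + 1) * S p) * (X p)\<^sup>2 = 0" using t e L by linarith
      then have "?W = 0" using Xp D(2)[of p] D(7)[of p] by (simp del: chp.simps)
      then have "k = 0" using D(5) by (cases "k > 0") auto
      then show ?thesis using all True \<open>?W = 0\<close> by auto
    qed
    ultimately show ?thesis by blast
  next
    case False
    then have k: "k > 0" using K by linarith
    then have W: "?W > 0" using D(5) by simp
    have t1: "?W / (chp l (i + 1) * S i) \<ge> real k / l" if "1 \<le> i" "i \<le> p" for i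
      using D(6)[OF that] D(7)[of i] D(2)[of i] D(1) that
      by (simp add: divide_simps del: chp.simps) (simp add: algebra_simps)
    have kK: "real ?K \<le> real k" using K by (simp only: of_nat_le_iff)
    have t2: "?Q \<ge> real ?K / l * (X i)\<^sup>2" if "i \<le> p" "w i > 0" for i
    proof -
      have "i \<ge> 1" using that z by (cases i) auto
      then have "real ?K / l \<le> ?W / (chp l (i + 1) * S i)"
        using t1[of i] that divide_right_mono[OF kK, of l] D(1) by linarith
      then show ?thesis using half_form_ge_square(1)[OF h that(1), of X]
        by (meson mult_right_mono order_trans zero_le_power2)
    qed
    have Kp: "real ?K > 0" using False by (simp only: of_nat_0_less_iff neq0_conv)
    have expand: "(\<Sum>j\<le>p. real (w j) * (q - c * (X j)\<^sup>2)) =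
        real ?K * q - c * (\<Sum>j\<le>p. real (w j) * (X j)\<^sup>2)" for q c
      unfolding of_nat_sum sum_distrib_left sum_distrib_right sum_subtractf[symmetric]
      by (intro sum.cong refl) (simp add: algebra_simps)
    \<comment> \<open>The averaging identity. Each summand is nonnegative by
      \<open>half_form_ge_square\<close> at \<open>j\<close>.\<close>
    have exp: "real ?K * ?Q - real ?K * ?L = (\<Sum>j\<le>p. real (w j) * (?Q - real ?K / l * (X j)\<^sup>2))"
      unfolding expand by simp
    have nn: "real (w j) * (?Q - real ?K / l * (X j)\<^sup>2) \<ge> 0" if "j \<le> p" for j
      using t2[OF that] by (cases "w j = 0") auto
    have "real ?K * ?Q - real ?K * ?L \<ge> 0" unfolding exp using nn by (intro sum_nonneg) auto
    then have le: "?L \<le> ?Q" using Kp by (metis diff_ge_0_iff_ge mult_le_cancel_left_pos)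
    moreover have "(\<forall>j\<le>p. X j \<noteq> 0) \<and> ?K = k \<and> (k = 0 --> S 1 = l * S 0) \<and>
       (k > 0 --> (\<exists>i. half_tight l p S k i \<and> w i = k \<and> (\<forall>j\<le>p. j \<noteq> i --> w j = 0)))"
      if e: "?L = ?Q" and nz: "\<exists>j\<le>p. X j \<noteq> 0"
    proof -
      from nz obtain j where j: "j \<le> p" "X j \<noteq> 0" by blast
      have "?W / (chp l (j + 1) * S j) * (X j)\<^sup>2 > 0"
        using j W D(2)[of j] D(7)[of j] by (intro mult_pos_pos divide_pos_pos) auto
      then have Qp: "?Q > 0" using half_form_ge_square(1)[OF h j(1), of X] by linarith
      have zero: "real (w i) * (?Q - real ?K / l * (X i)\<^sup>2) = 0" if "i \<le> p" for i
      proof -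
        have "(\<Sum>j\<le>p. real (w j) * (?Q - real ?K / l * (X j)\<^sup>2)) = 0"
          unfolding exp[symmetric] e by simp
        then have "\<forall>j\<in>{..p}. real (w j) * (?Q - real ?K / l * (X j)\<^sup>2) = 0"
          by (rule sum_nonneg_eq_0_iff[THEN iffD1, rotated 2]) (use nn in auto)
        then show ?thesis using that by blast
      qed
      have sup: "X i \<noteq> 0 \<and> ?K = k \<and> half_tight l p S k i \<and>
         ?Q = ?W / (chp l (i + 1) * S i) * (X i)\<^sup>2" if i: "i \<le> p" "w i > 0" for i
      proof -
        have i1: "i \<ge> 1" using i z by (cases i) auto
        have q: "?Q = real ?K / l * (X i)\<^sup>2" using zero[OF i(1)] i(2) by simp
        then have Xi: "X i \<noteq> 0" using Qp by (intro notI) simp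
        then have x2: "(X i)\<^sup>2 > 0" by simp
        have "?W / (chp l (i + 1) * S i) * (X i)\<^sup>2 \<le> real ?K / l * (X i)\<^sup>2"
          using half_form_ge_square(1)[OF h i(1), of X] q by linarith
        then have a: "?W / (chp l (i + 1) * S i) \<le> real ?K / l"
          using x2 by (rule mult_right_le_imp_le)
        have b: "real ?K / l \<le> real k / l" using kK D(1) by (intro divide_right_mono) auto
        have c: "real ?K / l = real k / l" "?W / (chp l (i + 1) * S i) = real ?K / l"
          using a b t1[OF i1 i(1)] by linarith+
        have "real ?K = real k" using c(1) D(1) by simp
        then have Kk: "?K = k" by (simp only: of_nat_eq_iff)
        have "half_tight l p S k i"
          unfolding half_tight_def using c i1 i D(1) D(2)[OF i(1)] D(7)[OF i(1)]
          by (simp add: divide_simps del: chp.simps) (simp add: algebra_simps)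
        then show ?thesis using Xi Kk q c by auto
      qed
      obtain i where i: "i \<le> p" "w i > 0" using False by auto
      note si = sup[OF i]
      have lri: "(\<forall>j<i. X j = chp l (j + 1) / chp l (j + 2) * X (j + 1)) \<and>
        (\<forall>j. i \<le> j --> j < p --> X (j + 1) = S (j + 1) / S j * X j)" if "i \<le> p" "w i > 0" for i
        using half_form_ge_square(2)[OF h that(1), of X] sup[OF that] by blast
      have all: "\<forall>j\<le>p. X j \<noteq> 0"
        using half_form_extremal_nonzero[where X=X and i=i, OF h i(1)] si lri[OF i] by blast
      \<comment> \<open>Left of \<open>b\<close> the vector follows \<open>chp\<close>, right of
        \<open>a\<close> it follows \<open>S\<close>. On the edge from \<open>a\<close> to
        \<open>a + 1\<close> both hold, which would make the Wronskian vanish.\<close>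
      have no_two: False if ab: "a < b" "b \<le> p" "w a > 0" "w b > 0" for a b
      proof -
        have x1: "X a = chp l (a + 1) / chp l (a + 2) * X (a + 1)" using lri[of b] ab by simp
        have x2: "X (a + 1) = S (a + 1) / S a * X a" using lri[of a] ab by simp
        have pos: "chp l (a + 1) > 0" "chp l (a + 2) > 0" "S a > 0"
          using D(7)[of a] D(7)[of "a + 1"] D(2)[of a] ab by auto
        have "X a \<noteq> 0" using all ab by simp
        moreover have "X a = chp l (a + 1) / chp l (a + 2) * (S (a + 1) / S a * X a)" using x1 x2 by simp
        ultimately have "chp l (a + 1) * S (a + 1) = chp l (a + 2) * S a"
          using pos by (simp add: field_simps del: chp.simps)
        then show False using chp_wronskian[of a S l] D(3) ab W by (simp del: chp.simps)
      qed
      have others: "w j = 0" if "j \<le> p" "j \<noteq> i" for j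
        using no_two[of i j] no_two[of j i] that i by (cases "i < j") (auto intro: gr0I)
      have "?K = w i" using i(1) others by (subst sum.remove[of _ i]) auto
      then show ?thesis using all si others k by auto
    qed
    ultimately show ?thesis by blast
  qed
  then show "?L \<le> ?Q" and "?L = ?Q ==> \<exists>j\<le>p. X j \<noteq> 0 ==> (\<forall>j\<le>p. X j \<noteq> 0) \<and> ?K = k \<and> (k = 0 --> S 1 = l * S 0) \<and>
       (k > 0 --> (\<exists>i. half_tight l p S k i \<and> w i = k \<and> (\<forall>j\<le>p. j \<noteq> i --> w j = 0)))" by blast+
qed

section \<open>Gluing two halves at the node\<close>

definition path_form :: "real => nat => (nat => real) => real" where
  "path_form l d X = l * (\<Sum>j\<le>d. (X j)\<^sup>2) - 2 * (\<Sum>j<d. X j * X (j + 1))"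

text \<open>Where the two half paths meet: inside the edge between \<open>p\<close> and \<open>p + 1\<close>, or at the vertex \<open>p + 1\<close>.
  The right half is read backwards from the vertex \<open>d\<close>.\<close>

definition path_node :: "nat => nat => (nat => real) => nat => (nat => real) => bool" where
  "path_node d p S p' S' \<longleftrightarrow>
     (p + p' + 1 = d \<and> S (p + 1) < 0 \<and> S (p + 1) * S' (p' + 1) = S p * S' p') \<or>
     (p + p' + 2 = d \<and> S (p + 1) = 0 \<and> S' (p' + 1) = 0)"

lemma sum_upper_reflect:
  assumes "q \<le> (d::nat)"
  shows "(\<Sum>j\<in>{d - q..d}. f j) = (\<Sum>j\<le>q. f (d - j) :: real)"
  by (rule sum.reindex_bij_witness[of _ "\<lambda>j. d - j" "\<lambda>j. d - j"]) (use assms in auto)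

text \<open>On the hyperplane \<open>f\<close> the two halves see reciprocal ratios of the entries
  at the node edge; this is what the product condition in \<open>path_node\<close> expresses. The
  mixed term of that edge therefore falls apart into one square for each half.\<close>

lemma path_form_split:
  assumes nd: "path_node d p S p' S'" and pos: "S p > 0" "S' p' > 0"
    and f: "S (p + 1) * X p = S p * X (p + 1)"
  shows "path_form l d X = half_form l p S X + half_form l p' S' (\<lambda>j. X (d - j))"
proof -
  have r2: "(\<Sum>j\<in>{d - p'..<d}. X j * X (j + 1)) = (\<Sum>j<p'. X (d - j) * X (d - (j + 1)))" if "p' \<le> d"
    by (rule sum.reindex_bij_witness[of _ "\<lambda>j. d - j - 1" "\<lambda>j. d - j - 1"])
      (use that in \<open>auto simp: mult.commute Suc_diff_Suc\<close>)
  have r1: "(\<Sum>j\<le>p'. (X (d - j))\<^sup>2) = (\<Sum>j\<in>{d - p'..d}. (X j)\<^sup>2)" if "p' \<le> d"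
    using sum_upper_reflect[OF that, of "\<lambda>j. (X j)\<^sup>2"] by simp
  consider (edge) "p + p' + 1 = d" "S (p + 1) < 0" "S (p + 1) * S' (p' + 1) = S p * S' p'"
    | (vertex) "p + p' + 2 = d" "S (p + 1) = 0" "S' (p' + 1) = 0"
    using nd unfolding path_node_def by blast
  then show ?thesis
  proof cases
    case edge
    have dp: "d - p' = p + 1" "p' \<le> d" using edge by auto
    have "{..d} = {..p} \<union> {d - p'..d}" using edge by auto
    then have s1: "(\<Sum>j\<le>d. (X j)\<^sup>2) = (\<Sum>j\<le>p. (X j)\<^sup>2) + (\<Sum>j\<le>p'. (X (d - j))\<^sup>2)"
      unfolding r1[OF dp(2)] using edge
      by (simp only:) (rule sum.union_disjoint, auto)
    have e2: "{..<d} = insert p ({..<p} \<union> {d - p'..<d})" using edge by auto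
    have g2: "(\<Sum>j<d. g j) = g p + ((\<Sum>j<p. g j) + (\<Sum>j\<in>{d - p'..<d}. g j))" for g :: "nat => real"
      using edge unfolding e2 by (subst sum.insert, simp, simp, subst sum.union_disjoint) auto
    note s2 = g2[of "\<lambda>j. X j * X (j + 1)", unfolded r2[OF dp(2)]]
    have s0: "S (p + 1) \<noteq> 0" using edge by simp
    have x: "X (p + 1) = S (p + 1) / S p * X p" using f pos by (simp add: field_simps)
    have y: "S' (p' + 1) / S' p' = S p / S (p + 1)"
      using edge(3) s0 pos by (simp add: field_simps)
    have c: "2 * (X p * X (p + 1)) = S (p + 1) / S p * (X p)\<^sup>2 + S' (p' + 1) / S' p' * (X (p + 1))\<^sup>2"
      unfolding x y using s0 pos by (simp add: field_simps power2_eq_square)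
    show ?thesis unfolding path_form_def half_form_def s1 s2 dp(1) using c by (simp add: algebra_simps)
  next
    case vertex
    have dp: "d - p' = p + 2" "p' \<le> d" using vertex by auto
    have x: "X (p + 1) = 0" using f vertex pos by simp
    have "{..d} = insert (p + 1) ({..p} \<union> {d - p'..d})" using vertex by auto
    then have s1: "(\<Sum>j\<le>d. (X j)\<^sup>2) = (X (p + 1))\<^sup>2 + ((\<Sum>j\<le>p. (X j)\<^sup>2) + (\<Sum>j\<le>p'. (X (d - j))\<^sup>2))"
      unfolding r1[OF dp(2)] using vertex
      by (simp only:) (subst sum.insert, simp, simp, subst sum.union_disjoint, auto)
    have e2: "{..<d} = insert p (insert (p + 1) ({..<p} \<union> {d - p'..<d}))" using vertex by auto
    have g2: "(\<Sum>j<d. g j) = g p + (g (p + 1) + ((\<Sum>j<p. g j) + (\<Sum>j\<in>{d - p'..<d}. g j)))" for g :: "nat => real"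
      using vertex unfolding e2
      by (subst sum.insert, simp, simp, subst sum.insert, simp, simp, subst sum.union_disjoint) auto
    note s2 = g2[of "\<lambda>j. X j * X (j + 1)", unfolded r2[OF dp(2)]]
    show ?thesis unfolding path_form_def half_form_def s1 s2 x vertex by (simp add: algebra_simps)
  qed
qed

lemma load_split:
  fixes g :: "nat => real"
  assumes nd: "path_node d p S p' S'" and g: "S (p + 1) = 0 ==> g (p + 1) = 0"
  shows "(\<Sum>j\<le>d. g j) = (\<Sum>j\<le>p. g j) + (\<Sum>j\<le>p'. g (d - j))"
proof -
  consider (edge) "p + p' + 1 = d" | (vertex) "p + p' + 2 = d" "S (p + 1) = 0"
    using nd unfolding path_node_def by blast
  then show ?thesis
  proof cases
    case edge
    have "{..d} = {..p} \<union> {d - p'..d}" using edge by auto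
    then show ?thesis using sum_upper_reflect[of p' d g] edge
      by (simp only:) (subst sum.union_disjoint, auto)
  next
    case vertex
    have "{..d} = insert (p + 1) ({..p} \<union> {d - p'..d})" using vertex by auto
    then show ?thesis using sum_upper_reflect[of p' d g] vertex g
      by (simp only:) (subst sum.insert, simp, simp, subst sum.union_disjoint, auto)
  qed
qed

text \<open>For equality, nonvanishing must pass from one half to the other. Across a node edge the
  hyperplane does this. A node vertex decouples the halves, so the balance
  \<open>X p + X (p + 2) = 0\<close> is an extra premise; the eigenvalue equation at the node will
  supply it.\<close>

lemma path_form_ge_load:
  assumes hl: "half_cert l p S k" and hr: "half_cert l p' S' k'" and nd: "path_node d p S p' S'"
    and w0: "w 0 = (0::nat)" "w d = 0"
    and K: "(\<Sum>j\<le>p. w j) \<le> k" "(\<Sum>j\<le>p'. w (d - j)) \<le> k'"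
    and f: "S (p + 1) * X p = S p * X (p + 1)"
  shows "(\<Sum>j\<le>d. real (w j) * (X j)\<^sup>2) / l \<le> path_form l d X" (is ?le)
    and "(\<Sum>j\<le>d. real (w j) * (X j)\<^sup>2) / l = path_form l d X ==> \<exists>j\<le>d. X j \<noteq> 0 ==>
      (S (p + 1) = 0 ==> X p + X (p + 2) = 0) ==>
      (\<forall>j\<le>d. (S (p + 1) = 0 --> j \<noteq> p + 1) --> X j \<noteq> 0) \<and>
      (\<Sum>j\<le>p. w j) = k \<and> (\<Sum>j\<le>p'. w (d - j)) = k' \<and>
      (k = 0 --> S 1 = l * S 0) \<and> (k' = 0 --> S' 1 = l * S' 0) \<and>
      (k > 0 --> (\<exists>i. half_tight l p S k i \<and> w i = k \<and> (\<forall>j\<le>p. j \<noteq> i --> w j = 0))) \<and>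
      (k' > 0 --> (\<exists>i. half_tight l p' S' k' i \<and> w (d - i) = k' \<and> (\<forall>j\<le>p'. j \<noteq> i --> w (d - j) = 0)))"
proof -
  note DL = half_certD[OF hl] and DR = half_certD[OF hr]
  let ?Y = "\<lambda>j. X (d - j)" and ?u = "\<lambda>j. w (d - j)"
  have pos: "S p > 0" "S' p' > 0" using DL(2)[of p] DR(2)[of p'] by auto
  have Xn: "X (p + 1) = 0" if "S (p + 1) = 0" using f that pos by simp
  have Q: "path_form l d X = half_form l p S X + half_form l p' S' ?Y"
    by (rule path_form_split[OF nd pos f])
  have L: "(\<Sum>j\<le>d. real (w j) * (X j)\<^sup>2) / l =
     (\<Sum>j\<le>p. real (w j) * (X j)\<^sup>2) / l + (\<Sum>j\<le>p'. real (?u j) * (?Y j)\<^sup>2) / l"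
    unfolding add_divide_distrib[symmetric]
    by (subst load_split[OF nd]) (use Xn in auto)
  have u0: "?u 0 = 0" using w0 by simp
  have a: "(\<Sum>j\<le>p. real (w j) * (X j)\<^sup>2) / l \<le> half_form l p S X"
    by (rule half_form_ge_load(1)[OF hl w0(1) K(1)])
  have b: "(\<Sum>j\<le>p'. real (?u j) * (?Y j)\<^sup>2) / l \<le> half_form l p' S' ?Y"
    by (rule half_form_ge_load(1)[where w = ?u, OF hr u0 K(2)])
  show ?le unfolding L Q using a b by linarith
  assume e: "(\<Sum>j\<le>d. real (w j) * (X j)\<^sup>2) / l = path_form l d X" and nz: "\<exists>j\<le>d. X j \<noteq> 0"
    and bal: "S (p + 1) = 0 ==> X p + X (p + 2) = 0"
  have ea: "(\<Sum>j\<le>p. real (w j) * (X j)\<^sup>2) / l = half_form l p S X"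
    and eb: "(\<Sum>j\<le>p'. real (?u j) * (?Y j)\<^sup>2) / l = half_form l p' S' ?Y"
    using e a b unfolding L Q by linarith+
  have rng: "j \<le> p \<or> (\<exists>i\<le>p'. j = d - i) \<or> (S (p + 1) = 0 \<and> j = p + 1)" if "j \<le> d" for j
  proof -
    have "j \<le> p \<or> (d - p' \<le> j) \<or> (S (p + 1) = 0 \<and> j = p + 1)"
      using nd that unfolding path_node_def by auto
    moreover have "\<exists>i\<le>p'. j = d - i" if "d - p' \<le> j" using that \<open>j \<le> d\<close>
      by (intro exI[of _ "d - j"]) auto
    ultimately show ?thesis by blast
  qed
  note TL = half_form_ge_load(2)[OF hl w0(1) K(1) ea]
  note TR = half_form_ge_load(2)[where w = ?u, OF hr u0 K(2) eb]
  have some: "(\<exists>j\<le>p. X j \<noteq> 0) \<or> (\<exists>j\<le>p'. ?Y j \<noteq> 0)"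
    using nz rng Xn by blast
  have lr: "X p \<noteq> 0 \<longleftrightarrow> ?Y p' \<noteq> 0"
  proof (cases "S (p + 1) = 0")
    case True
    then have "d - p' = p + 2" using nd unfolding path_node_def by auto
    then show ?thesis using bal[OF True] by auto
  next
    case False
    then have "d - p' = p + 1" using nd unfolding path_node_def by auto
    then show ?thesis using f False pos by auto
  qed
  have both: "\<exists>j\<le>p. X j \<noteq> 0" "\<exists>j\<le>p'. ?Y j \<noteq> 0"
    using some TL TR lr by blast+
  note TL = TL[OF both(1)] and TR = TR[OF both(2)]
  have "X j \<noteq> 0" if "j \<le> d" "S (p + 1) = 0 --> j \<noteq> p + 1" for j
    using rng[OF that(1)] that(2) TL TR by blast
  then show "(\<forall>j\<le>d. (S (p + 1) = 0 --> j \<noteq> p + 1) --> X j \<noteq> 0) \<and>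
      (\<Sum>j\<le>p. w j) = k \<and> (\<Sum>j\<le>p'. w (d - j)) = k' \<and>
      (k = 0 --> S 1 = l * S 0) \<and> (k' = 0 --> S' 1 = l * S' 0) \<and>
      (k > 0 --> (\<exists>i. half_tight l p S k i \<and> w i = k \<and> (\<forall>j\<le>p. j \<noteq> i --> w j = 0))) \<and>
      (k' > 0 --> (\<exists>i. half_tight l p' S' k' i \<and> w (d - i) = k' \<and> (\<forall>j\<le>p'. j \<noteq> i --> w (d - j) = 0)))"
    using TL TR by blast
qed

section \<open>Shortening a half by moving the node\<close>

lemma solution_formula:
  fixes S :: "nat => real"
  assumes "\<And>j. j < n ==> S (j + 2) = l * S (j + 1) - S j"
  shows "S (n + 1) = S 1 * chp l (n + 1) - S 0 * chp l n"
  using assms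
proof (induction n rule: induct_nat_012)
  case (ge2 n)
  have a: "S (n + 1) = S 1 * chp l (n + 1) - S 0 * chp l n"
    by (rule ge2.IH(1)) (rule ge2.prems, simp)
  have b: "S (Suc n + 1) = S 1 * chp l (Suc n + 1) - S 0 * chp l (Suc n)"
    by (rule ge2.IH(2)) (rule ge2.prems, simp)
  have c: "S (Suc (Suc n) + 1) = l * S (Suc n + 1) - S (n + 1)"
    using ge2.prems[of "Suc n"] by simp
  show ?case unfolding c a b by (simp add: algebra_simps)
qed (simp_all add: assms numeral_2_eq_2)

text \<open>The solutions form a two-dimensional space, so \<open>S\<close>, the shifted
  \<open>chp\<close> and the solution vanishing at \<open>n\<close> are linearly dependent. The
  coefficients can be read off at \<open>i = n\<close> and at \<open>i = -1\<close>, where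
  \<open>S\<close> continues to \<open>l * S 0 - S 1\<close>.\<close>

lemma solution_interpolation:
  fixes S :: "nat => real"
  assumes rec: "\<And>j. j + 1 < n ==> S (j + 2) = l * S (j + 1) - S j" and n: "1 \<le> n" and "i \<le> n"
  shows "S i * chp l (n + 1) - chp l (n - i) * (l * S 0 - S 1) = chp l (i + 1) * S n"
  using \<open>i \<le> n\<close>
proof (induction i rule: less_induct)
  case (less i)
  obtain m where m: "n = m + 1" using n by (metis add.commute le_add_diff_inverse)
  have Sn: "S n = S 1 * chp l n - S 0 * chp l m"
    using solution_formula[of m S l] rec m by simp
  have cn: "chp l (n + 1) = l * chp l n - chp l m" using m by simp
  have "i = 0 \<or> i = 1 \<or> (\<exists>q. i = q + 2)" by presburger
  then consider "i = 0" | "i = 1" | q where "i = q + 2" by blast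
  then show ?case
  proof cases
    case 1 then show ?thesis unfolding Sn cn by (simp add: algebra_simps)
  next
    case 2
    have "n - 1 = m" using m by simp
    then show ?thesis unfolding Sn cn 2 by (simp add: algebra_simps numeral_2_eq_2)
  next
    case (3 q)
    have "n - q = (n - (q + 2)) + 2" "n - (q + 1) = (n - (q + 2)) + 1" using less.prems 3 by auto
    then have c: "chp l (n - (q + 2)) = l * chp l (n - (q + 1)) - chp l (n - q)" by (simp add: algebra_simps)
    have s: "S (q + 2) = l * S (q + 1) - S q" using rec[of q] less.prems 3 by simp
    have e1: "S q * chp l (n + 1) - chp l (n - q) * (l * S 0 - S 1) = chp l (q + 1) * S n"
      using less.prems 3 by (intro less.IH) auto
    have e2: "S (q + 1) * chp l (n + 1) - chp l (n - (q + 1)) * (l * S 0 - S 1) = chp l (q + 1 + 1) * S n"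
      using less.prems 3 by (intro less.IH) auto
    have "S i * chp l (n + 1) - chp l (n - i) * (l * S 0 - S 1) =
       l * (S (q + 1) * chp l (n + 1) - chp l (n - (q + 1)) * (l * S 0 - S 1))
         - (S q * chp l (n + 1) - chp l (n - q) * (l * S 0 - S 1))"
      unfolding 3 s c by (simp add: algebra_simps del: chp.simps)
    also have "\<dots> = chp l (i + 1) * S n" unfolding e1 e2 3 by (simp add: algebra_simps)
    finally show ?thesis .
  qed
qed

text \<open>A half on which a nonzero vector never attains the bound: the inequality excludes
  equality for \<open>k = 0\<close>, the absence of tight positions excludes it for
  \<open>k > 0\<close>.\<close>

definition half_strict :: "real => nat => (nat => real) => nat => bool" where
  "half_strict l p S k \<longleftrightarrow> half_cert l p S k \<and> S 1 \<noteq> l * S 0 \<and> (\<forall>i. \<not> half_tight l p S k i)"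

text \<open>The solution that vanishes at \<open>n\<close>, hence the one for the half consisting of
  the vertices before a node at the vertex \<open>n\<close>.\<close>

abbreviation end_sol :: "real => nat => nat => real" where
  "end_sol l n \<equiv> (\<lambda>j. chp l (n - j))"

text \<open>After multiplication with \<open>l * S 0 - S 1\<close>, interpolation turns the new load
  inequality at \<open>i\<close> into the old one with \<open>k * (chp l (i + 1))^2 * S n\<close>
  subtracted on the left. So moving the node inwards does no harm, and it leaves a margin if
  \<open>S n > 0\<close>.\<close>

lemma half_cert_shorten:
  assumes h: "half_cert l p S k" and n: "1 \<le> n" "n \<le> p + 1" and Sn: "S n \<ge> 0"
  shows "half_cert l (n - 1) (end_sol l n) k"
    and "S n > 0 ==> half_strict l (n - 1) (end_sol l n) k"
proof -
  note D = half_certD[OF h]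
  have ip: "S i * chp l (n + 1) = chp l (n - i) * (l * S 0 - S 1) + chp l (i + 1) * S n" if "i \<le> n" for i
    using solution_interpolation[of n S l i] D(3) n that by simp
  have W: "l * chp l n - chp l (n - 1) = chp l (n + 1)"
    using n by (cases n) (simp_all add: algebra_simps)
  have pos: "chp l (n - j) > 0" if "j \<le> n - 1" for j
    using D(7)[of "n - j - 1"] that n by (cases "n - j") auto
  have cn: "chp l n > 0" using pos[of 0] by simp
  have ip0: "S 0 * chp l (n + 1) = chp l n * (l * S 0 - S 1) + S n" using ip[of 0] by simp
  have W0: "chp l (n + 1) \<ge> 0"
  proof -
    have "S 0 * chp l (n + 1) \<ge> 0" unfolding ip0 using cn D(4) Sn
      by (intro add_nonneg_nonneg mult_nonneg_nonneg) auto
    then show ?thesis using D(2)[of 0] by (simp add: zero_le_mult_iff del: chp.simps)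
  qed
  have Wk: "chp l (n + 1) > 0" if "k > 0 \<or> S n > 0"
  proof -
    have "S 0 * chp l (n + 1) > 0"
    proof (cases "S n > 0")
      case True
      then show ?thesis unfolding ip0 using cn D(4) by (intro add_nonneg_pos mult_nonneg_nonneg) auto
    next
      case False
      then show ?thesis unfolding ip0 using cn D(5) that Sn by (intro add_pos_nonneg mult_pos_pos) auto
    qed
    then show ?thesis using D(2)[of 0] by (simp add: zero_less_mult_iff del: chp.simps)
  qed
  have main: "real k * chp l (i + 1) * chp l (n - i) \<le> l * chp l (n + 1)"
    and main_s: "S n > 0 ==> k > 0 ==> real k * chp l (i + 1) * chp l (n - i) < l * chp l (n + 1)"
    if i: "1 \<le> i" "i \<le> n - 1" for i
  proof -
    have Si: "S i > 0" and Pi: "chp l (i + 1) > 0" using D(2)[of i] D(7)[of i] i n by auto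
    have W': "l * S 0 - S 1 \<ge> 0" using D(4) by simp
    have a: "real k * chp l (i + 1) * chp l (n - i) * (l * S 0 - S 1) =
      real k * chp l (i + 1) * S i * chp l (n + 1) - real k * chp l (i + 1) * (chp l (i + 1) * S n)"
    proof -
      have "chp l (n - i) * (l * S 0 - S 1) = S i * chp l (n + 1) - chp l (i + 1) * S n"
        using ip[of i] i by linarith
      then show ?thesis by (simp only: mult.assoc right_diff_distrib[symmetric])
    qed
    have b: "real k * chp l (i + 1) * S i * chp l (n + 1) \<le> l * (l * S 0 - S 1) * chp l (n + 1)"
      using D(6)[of i] i n W0 by (intro mult_right_mono) auto
    have "real k * chp l (i + 1) * (chp l (i + 1) * S n) \<ge> 0" using Pi Sn by (intro mult_nonneg_nonneg) auto
    then have c: "real k * chp l (i + 1) * chp l (n - i) * (l * S 0 - S 1) \<le> l * chp l (n + 1) * (l * S 0 - S 1)"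
      using a b by (simp add: algebra_simps del: chp.simps)
    show "real k * chp l (i + 1) * chp l (n - i) \<le> l * chp l (n + 1)"
    proof (cases "k = 0")
      case True then show ?thesis using W0 D(1) by simp
    next
      case False
      then have "l * S 0 - S 1 > 0" using D(5) by simp
      then show ?thesis using c mult_right_le_imp_le by blast
    qed
    assume s: "S n > 0" "k > 0"
    have "real k * chp l (i + 1) * (chp l (i + 1) * S n) > 0" using Pi s by (intro mult_pos_pos) auto
    then have c: "real k * chp l (i + 1) * chp l (n - i) * (l * S 0 - S 1) < l * chp l (n + 1) * (l * S 0 - S 1)"
      using a b by (simp add: algebra_simps del: chp.simps)
    show "real k * chp l (i + 1) * chp l (n - i) < l * chp l (n + 1)"
      using c W' mult_right_less_imp_less by blast
  qed
  have recn: "chp l (n - (j + 2)) = l * chp l (n - (j + 1)) - chp l (n - j)" if "j < n - 1" for j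
  proof -
    have "n - j = (n - (j + 2)) + 2" "n - (j + 1) = (n - (j + 2)) + 1" using that by auto
    then show ?thesis by (simp add: algebra_simps)
  qed
  show hc: "half_cert l (n - 1) (end_sol l n) k"
    unfolding half_cert_def using D(1) pos recn W W0 Wk main by (auto simp: algebra_simps simp del: chp.simps)
  show "half_strict l (n - 1) (end_sol l n) k" if s: "S n > 0"
  proof -
    have "\<not> half_tight l (n - 1) (end_sol l n) k i" for i
    proof
      assume t: "half_tight l (n - 1) (end_sol l n) k i"
      then have i: "1 \<le> i" "i \<le> n - 1" and e: "real k * chp l (i + 1) * chp l (n - i) = l * chp l (n + 1)"
        unfolding half_tight_def using W by auto
      show False
      proof (cases "k = 0")
        case True then show ?thesis using e Wk s D(1) by (simp del: chp.simps)
      next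
        case False then show ?thesis using e main_s[OF i s] by simp
      qed
    qed
    moreover have "end_sol l n 1 \<noteq> l * end_sol l n 0" using W Wk s by auto
    ultimately show ?thesis unfolding half_strict_def using hc by blast
  qed
qed

text \<open>This is the load condition at \<open>i = 1\<close> after cutting at \<open>n\<close>.
  For \<open>n\<close> from 2 to 5 it yields the explicit lower bounds on \<open>l^2\<close> used in
  the case distinctions for small diameters.\<close>

lemma half_cert_lower_bound:
  assumes h: "half_cert l p S k" and n: "2 \<le> n" "n \<le> p + 1" and Sn: "S n \<ge> 0"
  shows "real k * chp l (n - 1) \<le> chp l (n + 1)"
proof -
  have hc: "half_cert l (n - 1) (end_sol l n) k" using half_cert_shorten(1)[OF h _ n(2) Sn] n by simp
  have l: "l > 0" using half_certD(1)[OF h] .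
  have W: "l * chp l n - chp l (n - 1) = chp l (n + 1)"
    using n by (cases n) (simp_all add: algebra_simps)
  have "l * (real k * chp l (n - 1)) \<le> l * chp l (n + 1)"
  proof -
    have "real k * chp l (1 + 1) * chp l (n - 1) \<le> l * (l * chp l (n - 0) - chp l (n - 1))"
      using half_certD(6)[OF hc, of 1] n by simp
    moreover have "chp l (1 + 1) = l" by simp
    ultimately show ?thesis using W by (simp only: mult_ac diff_zero)
  qed
  then show ?thesis using l by simp
qed

section \<open>Where the load product is largest\<close>

lemma solution_addition:
  fixes S :: "nat => real"
  assumes sol: "\<And>j. S (j + 2) = l * S (j + 1) - S j"
  shows "S (n + m + 1) = chp l (m + 1) * S (n + 1) - chp l m * S n"
proof -
  have "S (n + (m + 1)) = S (n + 1) * chp l (m + 1) - S (n + 0) * chp l m"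
    by (rule solution_formula[of m "\<lambda>j. S (n + j)"]) (use sol[of "n + j" for j] in \<open>simp add: add.assoc\<close>)
  then show ?thesis by (simp add: mult.commute add.assoc)
qed

text \<open>The increments of \<open>chp l (i + 1) * S i\<close> are values of \<open>S\<close> at
  doubled index. The conditions on \<open>S (2 * i0)\<close> and \<open>S (2 * i0 + 2)\<close> come
  from here, and so do ties: two neighbouring positions are equally good iff \<open>S\<close>
  vanishes at the corresponding even index.\<close>

lemma solution_product_step:
  fixes S :: "nat => real"
  assumes "\<And>j. S (j + 2) = l * S (j + 1) - S j"
  shows "chp l (i + 2) * S (i + 1) - chp l (i + 1) * S i = S (2 * i + 2)"
  using solution_addition[of S l i "i + 1"] assms by (simp add: mult_2)

text \<open>A conserved quantity of the recurrence. Where it is positive, the solution is strictly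
  log-concave on its positive stretch.\<close>

lemma solution_cassini:
  fixes S :: "nat => real"
  assumes sol: "\<And>j. S (j + 2) = l * S (j + 1) - S j"
  shows "(S (i + 1))\<^sup>2 - S i * S (i + 2) = (S 1)\<^sup>2 - S 0 * S 2"
proof (induction i)
  case (Suc i)
  have a: "S (i + 2) = l * S (i + 1) - S i" "S (i + 3) = l * S (i + 2) - S (i + 1)"
    using sol[of i] sol[of "i + 1"] by (simp_all add: numeral_3_eq_3)
  have "(S (i + 2))\<^sup>2 - S (i + 1) * S (i + 3) = (S (i + 1))\<^sup>2 - S i * S (i + 2)"
    unfolding a(2) unfolding a(1) by (simp add: power2_eq_square algebra_simps)
  then show ?case using Suc by (simp add: numeral_3_eq_3)
qed (simp add: numeral_2_eq_2)

text \<open>Log-concavity makes the quotients of successive values strictly decrease, so once a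
  quotient is at most 1, all later ones are below 1.\<close>

lemma log_concave_decreasing:
  fixes h :: "nat => real"
  assumes pos: "\<And>n. n \<le> N ==> h n > 0" and lc: "\<And>n. n + 2 \<le> N ==> h n * h (n + 2) < (h (n + 1))\<^sup>2"
    and start: "h 1 \<le> h 0" and n: "2 \<le> n" "n \<le> N"
  shows "h n < h 1"
proof -
  have step: "h (n + 2) < h (n + 1)" if "n + 2 \<le> N" for n using that
  proof (induction n)
    case 0
    have "h 1 * h 2 \<le> h 0 * h 2" using start pos[of 2] 0 by (intro mult_right_mono) auto
    then have "h 1 * h 2 < h 1 * h 1" using lc[of 0] 0 by (simp add: power2_eq_square numeral_2_eq_2)
    then show ?case using pos[of 1] 0 by (simp add: numeral_2_eq_2)
  next
    case (Suc n)
    have a: "h (n + 2) \<le> h (n + 1)" using Suc by simp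
    have "h (n + 2) * h (n + 3) \<le> h (n + 1) * h (n + 3)"
      using a pos[of "n + 3"] Suc.prems by (intro mult_right_mono) (auto simp: numeral_3_eq_3)
    then have "h (n + 2) * h (n + 3) < h (n + 2) * h (n + 2)"
      using lc[of "n + 1"] Suc.prems by (simp add: power2_eq_square numeral_3_eq_3)
    then show ?case using pos[of "n + 2"] Suc.prems by (simp add: numeral_3_eq_3)
  qed
  have "h (m + 2) < h 1" if "m + 2 \<le> N" for m using that
  proof (induction m)
    case 0 then show ?case using step[of 0] by simp
  next
    case (Suc m) then show ?case using step[of "Suc m"] by simp
  qed
  from this[of "n - 2"] n show ?thesis by (metis le_add_diff_inverse2)
qed

text \<open>With \<open>S\<^sub>j\<close> proportional to \<open>sin (z - j)\<theta>\<close>, the product of a left and a right solution at \<open>i\<close> is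
  maximal when \<open>i\<close> is closest to the midpoint \<open>(z - 1)/2\<close>, i.e. when \<open>2 i \<le> z \<le> 2 i + 2\<close>.\<close>

lemma product_maximal_at_midpoint:
  fixes S :: "nat => real"
  assumes sol: "\<And>j. S (j + 2) = l * S (j + 1) - S j"
    and pos: "\<And>j. j \<le> p ==> S j > 0" and neg: "S (p + 1) \<le> 0" and W: "S 1 \<le> l * S 0"
    and i0: "1 \<le> i0" "i0 \<le> p" and hi: "i0 < p ==> S (2 * i0 + 2) \<le> 0" and lo: "1 < i0 ==> S (2 * i0) \<ge> 0"
    and i: "1 \<le> i" "i \<le> p"
  shows "chp l (i + 1) * S i \<le> chp l (i0 + 1) * S i0"
    and "chp l (i + 1) * S i = chp l (i0 + 1) * S i0 \<longleftrightarrow>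
      i = i0 \<or> (i = i0 + 1 \<and> S (2 * i0 + 2) = 0) \<or> (i + 1 = i0 \<and> S (2 * i0) = 0)"
proof -
  define g where "g i = chp l (i + 1) * S i" for i
  have P: "chp l (j + 1) > 0" if "j \<le> p" for j
    using chp_pos_of_positive_solution[of p S l j] sol pos W that by blast
  have gpos: "g j > 0" if "j \<le> p" for j using P[OF that] pos[OF that] unfolding g_def by (intro mult_pos_pos)
  have step: "g (j + 1) - g j = S (2 * j + 2)" for j
    using solution_product_step[of S l j] sol unfolding g_def by (simp add: mult_ac)
  have step': "g i0 - g (i0 - 1) = S (2 * i0)"
  proof -
    obtain c where "i0 = c + 1" using i0 by (metis add.commute le_add_diff_inverse)
    then show ?thesis using step[of c] by simp
  qed
  obtain q where q: "p = q + 1" using i0 by (metis add.commute le_add_diff_inverse le_trans)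
  \<comment> \<open>The sign change at \<open>p + 1 = q + 2\<close> is what makes the Cassini
    constant positive.\<close>
  have "S q * S (q + 2) \<le> 0" using pos[of q] neg q by (intro mult_nonneg_nonpos) auto
  then have kap: "(S 1)\<^sup>2 - S 0 * S 2 > 0"
  proof -
    have "(S (q + 1))\<^sup>2 - S q * S (q + 2) = (S 1)\<^sup>2 - S 0 * S 2" by (rule solution_cassini[OF sol])
    moreover have "(S (q + 1))\<^sup>2 > 0" using pos[of "q + 1"] q by simp
    ultimately show ?thesis using \<open>S q * S (q + 2) \<le> 0\<close> by linarith
  qed
  have lcS: "S j * S (j + 2) < (S (j + 1))\<^sup>2" for j using solution_cassini[of S l j] sol kap by simp
  have lcP: "chp l (j + 1) * chp l (j + 3) < (chp l (j + 2))\<^sup>2" for j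
    using solution_cassini[of "\<lambda>n. chp l n" l "j + 1"] by (simp add: numeral_2_eq_2 numeral_3_eq_3)
  have lc: "g j * g (j + 2) < (g (j + 1))\<^sup>2" if "j + 2 \<le> p" for j
  proof -
    have "g j * g (j + 2) = (chp l (j + 1) * chp l (j + 3)) * (S j * S (j + 2))"
      unfolding g_def by (simp add: mult_ac numeral_3_eq_3)
    also have "\<dots> < (chp l (j + 2))\<^sup>2 * (S (j + 1))\<^sup>2"
      using lcP[of j] lcS[of j] pos[of j] pos[of "j + 2"] P[of j] P[of "j + 2"] that
      by (intro mult_strict_mono') (auto simp: numeral_3_eq_3 simp del: chp.simps intro!: mult_nonneg_nonneg less_imp_le)
    also have "\<dots> = (g (j + 1))\<^sup>2" unfolding g_def by (simp add: power_mult_distrib)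
    finally show ?thesis .
  qed
  \<comment> \<open>The signs of \<open>S\<close> at \<open>2 * i0\<close> and
    \<open>2 * i0 + 2\<close> settle only the two neighbours of \<open>i0\<close>. Further out the
    doubled indices may leave the range where the sign of \<open>S\<close> is known, so
    log-concavity of the product takes over.\<close>
  have right: "g (i0 + n) < g (i0 + 1)" if "2 \<le> n" "i0 + n \<le> p" for n
  proof (rule log_concave_decreasing[of "p - i0" "\<lambda>n. g (i0 + n)"])
    show "g (i0 + 1) \<le> g (i0 + 0)" using step[of i0] hi that by simp
    show "g (i0 + n) * g (i0 + (n + 2)) < (g (i0 + (n + 1)))\<^sup>2" if "n + 2 \<le> p - i0" for n
      using lc[of "i0 + n"] that i0 by (simp add: add.assoc)
  qed (use gpos that in auto)
  have left: "g (i0 - n) < g (i0 - 1)" if "2 \<le> n" "n \<le> i0 - 1" for n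
  proof (rule log_concave_decreasing[of "i0 - 1" "\<lambda>n. g (i0 - n)"])
    have "1 < i0" using that by linarith
    then show "g (i0 - 1) \<le> g (i0 - 0)" using step' lo by simp
    show "g (i0 - n) * g (i0 - (n + 2)) < (g (i0 - (n + 1)))\<^sup>2" if "n + 2 \<le> i0 - 1" for n
    proof -
      have "i0 - n = i0 - (n + 2) + 2" "i0 - (n + 1) = i0 - (n + 2) + 1" using that by auto
      then show ?thesis using lc[of "i0 - (n + 2)"] that i0 by (simp add: mult.commute)
    qed
  qed (use gpos that i0 in auto)
  have s1: "g (i0 + 1) = g i0 + S (2 * i0 + 2)" using step[of i0] by simp
  have s2: "g (i0 - 1) = g i0 - S (2 * i0)" using step' by simp
  consider "i = i0" | "i = i0 + 1" | "i + 1 = i0" | "i \<ge> i0 + 2" | "i + 2 \<le> i0" by linarith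
  then have "g i \<le> g i0 \<and> (g i = g i0 \<longleftrightarrow>
      i = i0 \<or> (i = i0 + 1 \<and> S (2 * i0 + 2) = 0) \<or> (i + 1 = i0 \<and> S (2 * i0) = 0))"
  proof cases
    case 2 then show ?thesis using s1 hi i by auto
  next
    case 3
    then have "i = i0 - 1" by simp
    then show ?thesis using s2 lo i 3 by auto
  next
    case 4
    have "g i < g (i0 + 1)" using right[of "i - i0"] 4 i by simp
    then show ?thesis using s1 hi 4 i by auto
  next
    case 5
    have "g i < g (i0 - 1)" using left[of "i0 - i"] 5 i by simp
    then show ?thesis using s2 lo 5 i by auto
  qed auto
  then show "chp l (i + 1) * S i \<le> chp l (i0 + 1) * S i0"
    and "chp l (i + 1) * S i = chp l (i0 + 1) * S i0 \<longleftrightarrow>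
      i = i0 \<or> (i = i0 + 1 \<and> S (2 * i0 + 2) = 0) \<or> (i + 1 = i0 \<and> S (2 * i0) = 0)"
    unfolding g_def by blast+
qed

text \<open>A single equation at the maximizing position implies the load conditions at all
  positions, and the tight positions are that one and those tied with it.\<close>

lemma half_cert_midpoint:
  fixes S :: "nat => real"
  assumes l: "l > 0" and sol: "\<And>j. S (j + 2) = l * S (j + 1) - S j"
    and pos: "\<And>j. j \<le> p ==> S j > 0" and neg: "S (p + 1) \<le> 0" and W: "S 1 \<le> l * S 0"
    and i0: "1 \<le> i0" "i0 \<le> p" and hi: "i0 < p ==> S (2 * i0 + 2) \<le> 0" and lo: "1 < i0 ==> S (2 * i0) \<ge> 0"
    and k: "k > 0" and tight: "real k * chp l (i0 + 1) * S i0 = l * (l * S 0 - S 1)"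
  shows "half_cert l p S k"
    and "half_tight l p S k i \<longleftrightarrow> 1 \<le> i \<and> i \<le> p \<and>
      (i = i0 \<or> (i = i0 + 1 \<and> S (2 * i0 + 2) = 0) \<or> (i + 1 = i0 \<and> S (2 * i0) = 0))"
proof -
  have M1: "chp l (i + 1) * S i \<le> chp l (i0 + 1) * S i0"
    and M2: "chp l (i + 1) * S i = chp l (i0 + 1) * S i0 \<longleftrightarrow>
      i = i0 \<or> (i = i0 + 1 \<and> S (2 * i0 + 2) = 0) \<or> (i + 1 = i0 \<and> S (2 * i0) = 0)"
    if i: "1 \<le> i" "i \<le> p" for i
    by (rule product_maximal_at_midpoint[where p = p], fact+)+
  have "chp l (i0 + 1) > 0" using chp_pos_of_positive_solution[of p S l i0] sol pos W i0 by blast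
  then have "real k * chp l (i0 + 1) * S i0 > 0" using k pos[OF i0(2)] by simp
  then have "0 < l * (l * S 0 - S 1)" unfolding tight .
  then have "S 1 < l * S 0" using zero_less_mult_pos[of l "l * S 0 - S 1"] l by simp
  moreover have "real k * chp l (i + 1) * S i \<le> l * (l * S 0 - S 1)" if "1 \<le> i" "i \<le> p" for i
    using mult_left_mono[OF M1[OF that], of "real k"] tight by (simp add: mult.assoc del: chp.simps)
  ultimately show "half_cert l p S k" unfolding half_cert_def using l sol pos W by auto
  show "half_tight l p S k i \<longleftrightarrow> 1 \<le> i \<and> i \<le> p \<and>
      (i = i0 \<or> (i = i0 + 1 \<and> S (2 * i0 + 2) = 0) \<or> (i + 1 = i0 \<and> S (2 * i0) = 0))"
  proof (cases "1 \<le> i \<and> i \<le> p")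
    case True
    have "real k * chp l (i + 1) * S i = l * (l * S 0 - S 1) \<longleftrightarrow> chp l (i + 1) * S i = chp l (i0 + 1) * S i0"
      unfolding tight[symmetric] using k by (simp add: mult.assoc del: chp.simps)
    then show ?thesis using M2[of i] True unfolding half_tight_def by blast
  qed (auto simp: half_tight_def)
qed

text \<open>For \<open>l = q + 1/q \<ge> 2\<close> the successive quotients of a left solution are at least \<open>q\<close> and those of a
  right solution at most \<open>1/q\<close>; the condition on \<open>k\<close> reads \<open>k \<le> l (q - 1/q)\<close>.\<close>

lemma half_cert_hyperbolic:
  fixes S :: "nat => real"
  assumes l: "l \<ge> 2" and rec: "\<And>j. j < p ==> S (j + 2) = l * S (j + 1) - S j"
    and Sp: "S p > 0" and neg: "S (p + 1) \<le> 0"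
    and k: "(real k)\<^sup>2 \<le> (l^2)\<^sup>2 - 4 * l^2"
  shows "half_cert l p S k" and "j \<le> p ==> S j > 0"
    and "(real k)\<^sup>2 < (l^2)\<^sup>2 - 4 * l^2 ==> i \<le> p ==> real k * chp l (i + 1) * S i < l * (l * S 0 - S 1)"
proof -
  define t where "t = sqrt (l^2 - 4)"
  define q where "q = (l + t) / 2"
  define r where "r = (l - t) / 2"
  have l2: "l^2 \<ge> 4" using power_mono[OF l, of 2] by simp
  have t2: "t\<^sup>2 = l^2 - 4" and t0: "t \<ge> 0" using l2 by (auto simp: t_def)
  have tl: "t < l" by (rule power2_less_imp_less) (use l t2 in auto)
  have "q * r = (l^2 - t\<^sup>2) / 4" by (simp add: q_def r_def power2_eq_square algebra_simps)
  then have qr: "q + r = l" "q * r = 1" "q - r = t" "q > 0" "r > 0"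
    using t2 tl t0 l by (simp_all add: q_def r_def diff_divide_distrib add_divide_distrib)
  have Pq: "chp l (i + 2) \<ge> q * chp l (i + 1) \<and> chp l (i + 1) > 0" for i
  proof (induction i)
    case 0
    then show ?case using qr by (simp add: numeral_2_eq_2)
  next
    case (Suc i)
    have pos: "chp l (i + 2) > 0" using Suc qr by (metis mult_pos_pos less_le_trans)
    have "chp l (i + 1) \<le> r * chp l (i + 2)"
      using mult_left_mono[of "q * chp l (i + 1)" "chp l (i + 2)" r] Suc qr
      by (metis less_imp_le mult.assoc mult.commute mult_1)
    moreover have "q = l - r" using qr(1) by simp
    ultimately have "chp l (i + 3) \<ge> q * chp l (i + 2)"
      by (simp add: numeral_3_eq_3 left_diff_distrib)
    then show ?case using pos by (simp add: numeral_3_eq_3 numeral_2_eq_2 del: chp.simps)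
  qed
  have S: "S (p - n) > 0 \<and> S (p - n + 1) \<le> r * S (p - n)" if "n \<le> p" for n using that
  proof (induction n)
    case 0
    have "r * S p > 0" using qr Sp by simp
    then show ?case using Sp neg by simp
  next
    case (Suc n)
    define j where "j = p - Suc n"
    have j: "p - n = j + 1" "j < p" using Suc.prems by (auto simp: j_def)
    have IH: "S (j + 1) > 0" "S (j + 2) \<le> r * S (j + 1)" using Suc j by auto
    have "S j = l * S (j + 1) - S (j + 2)" using rec[OF j(2)] by simp
    then have "S j = q * S (j + 1) + (r * S (j + 1) - S (j + 2))"
      unfolding qr(1)[symmetric] by (simp add: distrib_right)
    then have a: "S j \<ge> q * S (j + 1)" using IH by linarith
    have "S j > 0" using a IH qr(4) by (metis mult_pos_pos less_le_trans)
    moreover have "S (j + 1) \<le> r * S j"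
      using mult_left_mono[OF a, of r] qr by (metis less_imp_le mult.assoc mult.commute mult_1)
    ultimately show ?case unfolding j_def by simp
  qed
  have Spos: "S j > 0" and Sr: "S (j + 1) \<le> r * S j" if "j \<le> p" for j
    using S[of "p - j"] that by auto
  show "j \<le> p ==> S j > 0" using Spos .
  \<comment> \<open>In the Wronskian the first product is at least \<open>q\<close> times and the
    second at most \<open>r\<close> times \<open>chp l (i + 1) * S i\<close>. This bounds all
    positions at once, with \<open>q - r = t\<close>.\<close>
  have W: "l * S 0 - S 1 \<ge> t * (chp l (i + 1) * S i)" if "i \<le> p" for i
  proof -
    have "chp l (i + 2) * S i - chp l (i + 1) * S (i + 1) = l * S 0 - S 1"
      using chp_wronskian[of i S l] rec that by simp
    moreover have "chp l (i + 2) * S i \<ge> q * chp l (i + 1) * S i"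
      using Pq[of i] Spos[OF that] by (intro mult_right_mono) auto
    moreover have "chp l (i + 1) * S (i + 1) \<le> chp l (i + 1) * (r * S i)"
      using Pq[of i] Sr[OF that] by (intro mult_left_mono) auto
    ultimately show ?thesis unfolding qr(3)[symmetric] by (simp add: algebra_simps del: chp.simps)
  qed
  have lt: "(l * t)\<^sup>2 = (l^2)\<^sup>2 - 4 * l^2" unfolding power_mult_distrib t2 by (simp add: power2_eq_square algebra_simps)
  have lt0: "l * t \<ge> 0" using l t0 by simp
  have klt: "real k \<le> l * t" using k lt0 unfolding lt[symmetric] by (rule power2_le_imp_le)
  have PS: "chp l (i + 1) * S i > 0" if "i \<le> p" for i using Pq[of i] Spos[OF that] by simp
  have bd: "l * t * (chp l (i + 1) * S i) \<le> l * (l * S 0 - S 1)" if "i \<le> p" for i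
    using mult_left_mono[OF W[OF that], of l] l by (simp add: mult.assoc del: chp.simps)
  have le: "real k * chp l (i + 1) * S i \<le> l * (l * S 0 - S 1)" if "i \<le> p" for i
    using bd[OF that] mult_right_mono[OF klt, of "chp l (i + 1) * S i"] PS[OF that]
    by (simp add: mult.assoc del: chp.simps)
  have W0: "S 1 \<le> l * S 0" 
  proof -
    have "t * S 0 \<ge> 0" using t0 Spos[of 0] by simp
    then show ?thesis using W[of 0] by simp
  qed
  have Wk: "S 1 < l * S 0" if "k > 0"
  proof -
    have "t > 0" using klt that t0 l by (cases "t = 0") auto
    then have "t * S 0 > 0" using Spos[of 0] by simp
    then show ?thesis using W[of 0] by simp
  qed
  show "half_cert l p S k"
    unfolding half_cert_def using l rec Spos W0 Wk le by auto
  assume s: "(real k)\<^sup>2 < (l^2)\<^sup>2 - 4 * l^2" and i: "i \<le> p"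
  have "real k < l * t" using s lt0 unfolding lt[symmetric] by (rule power2_less_imp_less)
  then show "real k * chp l (i + 1) * S i < l * (l * S 0 - S 1)"
    using bd[OF i] mult_strict_right_mono[of "real k" "l * t" "chp l (i + 1) * S i"] PS[OF i]
    by (simp add: mult.assoc del: chp.simps)
qed

section \<open>Positivity of the path polynomials\<close>

lemma chp_pos_ge_2: "l \<ge> 2 ==> chp l (n + 1) > 0"
proof -
  assume l: "l \<ge> 2"
  have "0 < chp l (n + 1) \<and> chp l n \<le> chp l (n + 1)"
  proof (induction n)
    case (Suc n)
    have "2 * chp l (n + 1) \<le> l * chp l (n + 1)" using Suc l by (intro mult_right_mono) auto
    moreover have c: "chp l (Suc n + 1) = l * chp l (n + 1) - chp l n" by simp
    ultimately show ?case using Suc unfolding c by (simp only: Suc_eq_plus1) linarith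
  qed simp
  then show ?thesis by simp
qed

lemma chp_cos: "chp (2 * cos t) n * sin t = sin (real n * t)"
proof (induction n rule: induct_nat_012)
  case (ge2 n)
  have "sin (real (Suc (Suc n)) * t) + sin (real n * t) = 2 * cos t * sin (real (Suc n) * t)"
    using sin_add[of "real (Suc n) * t" t] sin_diff[of "real (Suc n) * t" t]
    by (simp add: algebra_simps)
  then have "sin (real (Suc (Suc n)) * t) = 2 * cos t * (chp (2 * cos t) (Suc n) * sin t) - chp (2 * cos t) n * sin t"
    using ge2.IH by simp
  then show ?case by (simp add: algebra_simps)
qed simp_all

lemma chp_cos_pos:
  assumes "0 < t" "real n * t < pi" "n \<ge> 1"
  shows "chp (2 * cos t) n > 0"
proof -
  have "t \<le> real n * t" using assms by (simp add: mult_le_cancel_right1)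
  then have "t < pi" using assms by linarith
  then have "sin t > 0" using assms by (intro sin_gt_zero) auto
  moreover have "sin (real n * t) > 0" using assms by (intro sin_gt_zero) auto
  ultimately show ?thesis using chp_cos[of t n] by (metis zero_less_mult_pos2)
qed

lemma cos_parametrization:
  assumes "0 < l" "l < 2"
  obtains t where "0 < t" "t < pi / 2" "l = 2 * cos t"
proof
  show "0 < arccos (l / 2)" using arccos_less_arccos[of "l / 2" 1] assms by simp
  show "arccos (l / 2) < pi / 2" using arccos_less_arccos[of 0 "l / 2"] assms by simp
  show "l = 2 * cos (arccos (l / 2))" using assms by simp
qed

text \<open>\<open>2 * cos (pi / n)\<close> is the largest root of the \<open>n\<close>-th
  polynomial, the spectral radius of the path with \<open>n - 1\<close> vertices; shorter paths have
  a smaller one.\<close>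

lemma chp_pos_of_ge_cos:
  assumes n: "n \<ge> 2" and l: "l \<ge> 2 * cos (pi / real n)" "l > 0"
  shows "1 \<le> j ==> j < n ==> chp l j > 0" and "chp l n \<ge> 0"
proof -
  have "(\<forall>j. 1 \<le> j --> j < n --> chp l j > 0) \<and> chp l n \<ge> 0"
  proof (cases "l \<ge> 2")
    case True
    have "chp l j > 0" if "j \<ge> 1" for j using chp_pos_ge_2[OF True, of "j - 1"] that by simp
    then show ?thesis using n by (auto intro: less_imp_le)
  next
    case False
    then have "l < 2" by simp
    then obtain t where t: "0 < t" "t < pi / 2" "l = 2 * cos t"
      using cos_parametrization[OF l(2)] by blast
    have pn: "pi / real n \<le> pi" "0 \<le> pi / real n" using n by (auto simp: field_simps)
    have tn: "t \<le> pi / real n"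
    proof (rule ccontr)
      assume "\<not> ?thesis"
      moreover have "t \<le> pi" using t pi_gt_zero by linarith
      ultimately have "cos t < cos (pi / real n)" using pn by (intro cos_monotone_0_pi) auto
      then show False using l t by simp
    qed
    then have nt: "real n * t \<le> pi" using n by (simp add: field_simps)
    have "chp l j > 0" if "1 \<le> j" "j < n" for j
    proof -
      have "real j * t < real n * t" using that t by simp
      then have "real j * t < pi" using nt by linarith
      then show ?thesis unfolding t(3) using t that by (intro chp_cos_pos) auto
    qed
    moreover have "chp l n * sin t \<ge> 0"
      unfolding t(3) chp_cos using t nt by (intro sin_ge_zero) auto
    moreover have "sin t > 0" using t pi_gt_zero by (intro sin_gt_zero) auto
    ultimately show ?thesis by (simp add: zero_le_mult_iff)
  qed
  then show "1 \<le> j ==> j < n ==> chp l j > 0" and "chp l n \<ge> 0" by auto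
qed

lemma chp_values:
  "chp l 3 = l^2 - 1" "chp l 4 = l * (l^2 - 2)" "chp l 5 = (l^2)\<^sup>2 - 3 * l^2 + 1"
  "chp l 6 = l * (l^2 - 1) * (l^2 - 3)" "chp l 7 = (l^2)^3 - 5 * (l^2)\<^sup>2 + 6 * l^2 - 1"
  by (simp_all add: numeral_eq_Suc power_Suc algebra_simps)

section \<open>Fitting the node to the loads\<close>

definition load_cert ::
    "real => nat => nat => (nat => real) => nat => nat => (nat => real) => nat => (nat => nat) => bool" where
  "load_cert l d p S k p' S' k' w \<longleftrightarrow> half_cert l p S k \<and> half_cert l p' S' k' \<and> path_node d p S p' S' \<and>
     (\<Sum>j\<le>p. w j) \<le> k \<and> (\<Sum>j\<le>p'. w (d - j)) \<le> k'"

definition strict_load_cert :: "real => nat => (nat => nat) => bool" where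
  "strict_load_cert l d w \<longleftrightarrow> (\<exists>p S k p' S' k'. load_cert l d p S k p' S' k' w \<and>
     (half_strict l p S k \<or> half_strict l p' S' k'))"

text \<open>Assigning \<open>k\<close> to the left and \<open>k'\<close> to the right fixes an
  orientation, while a load vector comes without one, so it may be reflected first. A vector that
  still does not fit may use another node, provided equality is impossible there.\<close>

definition coverable ::
    "real => nat => nat => nat => nat => (nat => real) => nat => (nat => real) => bool" where
  "coverable l d k k' p S p' S' \<longleftrightarrow> (\<forall>w. w 0 = 0 --> w d = 0 --> (\<Sum>j\<le>d. w j) = k + k' -->
     (\<exists>u\<in>{w, \<lambda>j. w (d - j)}. load_cert l d p S k p' S' k' u \<or> strict_load_cert l d u))"

lemma sum_split_reflect:
  fixes w :: "nat => nat"
  assumes "i < d"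
  shows "(\<Sum>j\<le>d. w j) = (\<Sum>j\<le>i. w j) + (\<Sum>j\<le>d - i - 1. w (d - j))"
proof -
  have "(\<Sum>j\<in>{i<..d}. w j) = (\<Sum>j\<le>d - i - 1. w (d - j))"
    by (rule sum.reindex_bij_witness[of _ "\<lambda>j. d - j" "\<lambda>j. d - j"]) (use assms in auto)
  moreover have "{..d} = {..i} \<union> {i<..d}" using assms by auto
  ultimately show ?thesis by (simp only:) (subst sum.union_disjoint, auto)
qed

lemma path_node_neg:
  assumes nd: "path_node d p S p' S'" and "S p > 0" "S' p' > 0"
  shows "S' (p' + 1) \<le> 0" "S (p + 1) \<le> 0" "p < d" "p' < d"
proof -
  have "S' (p' + 1) < 0" if "S (p + 1) < 0" "S (p + 1) * S' (p' + 1) = S p * S' p'"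
  proof -
    have "0 < S (p + 1) * S' (p' + 1)" using that assms by simp
    then show ?thesis using that(1) by (simp add: zero_less_mult_iff)
  qed
  then show "S' (p' + 1) \<le> 0" "S (p + 1) \<le> 0" "p < d" "p' < d"
    using nd unfolding path_node_def by auto
qed

lemma vertex_node: "1 \<le> w ==> w < d ==> path_node d (w - 1) (end_sol l w) (d - w - 1) (end_sol l (d - w))"
  unfolding path_node_def by auto

lemma end_sol_half_cert_shorten:
  assumes h: "half_cert l (n - 1) (end_sol l n) k" and m: "1 \<le> m" "m \<le> n"
  shows "half_cert l (m - 1) (end_sol l m) k"
proof -
  have "m = n \<or> m \<le> n - 1" using m by linarith
  then have "end_sol l n m \<ge> 0" using half_certD(2)[OF h, of m] by (auto intro: less_imp_le)
  then show ?thesis using half_cert_shorten(1)[OF h m(1)] m by simp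
qed

lemma coverableI:
  assumes hl: "half_cert l p S k" and hr: "half_cert l p' S' k'" and nd: "path_node d p S p' S'"
    and crude: "k \<ge> 1 ==> half_cert l (d - 2) (end_sol l (d - 1)) (k - 1)"
    and kk: "k \<le> k'" "k' \<le> k + 1"
  shows "coverable l d k k' p S p' S'"
proof -
  have pos: "S p > 0" "S' p' > 0" using half_certD(2)[OF hl, of p] half_certD(2)[OF hr, of p'] by auto
  note neg = path_node_neg[OF nd pos]
  have pp: "p + p' + 1 \<le> d" "d \<le> p + p' + 2" using nd unfolding path_node_def by auto
  have right_heavy: "strict_load_cert l d w"
    if w0: "w 0 = 0" "w d = 0" and tot: "(\<Sum>j\<le>d. w j) = k + k'" and heavy: "k' < (\<Sum>j\<le>p'. w (d - j))" for w
  proof -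
    define A where "A i = (\<Sum>j\<le>i. w j)" for i
    have monoA: "A i \<le> A j" if "i \<le> j" for i j unfolding A_def using that by (intro sum_mono2) auto
    have Ad: "A (d - 1) = k + k'"
    proof -
      have "(\<Sum>j\<le>d. w j) = A (d - 1) + (\<Sum>j\<le>d - (d - 1) - 1. w (d - j))"
        unfolding A_def by (rule sum_split_reflect) (use neg in simp)
      then show ?thesis using tot w0 neg by simp
    qed
    have rest: "k + k' = A i + (\<Sum>j\<le>d - i - 1. w (d - j))" if "i < d" for i
      using sum_split_reflect[OF that, of w] tot unfolding A_def by simp
    have "d - (d - p' - 1) - 1 = p'" using neg by simp
    then have ll: "A (d - p' - 1) + 1 \<le> k" using rest[of "d - p' - 1"] heavy neg by simp
    \<comment> \<open>The node moves into the right half, to the first vertex at which the loads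
      from the left add up to \<open>k\<close>. Before it at most \<open>k - 1\<close> remain, which
      the longer left half carries by \<open>crude\<close>. After it there are at most
      \<open>k'\<close>, on a half that has become shorter, hence strict.\<close>
    define v where "v = (LEAST i. k \<le> A i)"
    have v: "k \<le> A v" "v \<le> d - 1" unfolding v_def using Ad by (auto intro: LeastI[of _ "d - 1"] Least_le)
    have vr: "d - p' \<le> v" 
    proof (rule ccontr)
      assume "\<not> ?thesis"
      then have "v \<le> d - p' - 1" by simp
      then have "A v \<le> A (d - p' - 1)" by (rule monoA)
      then show False using v(1) ll by linarith
    qed
    have v1: "1 \<le> v" using vr neg by simp
    have vl: "A (v - 1) < k" using not_less_Least[of "v - 1" "\<lambda>i. k \<le> A i"] v1 unfolding v_def by auto
    have k1: "k \<ge> 1" using ll by simp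
    have vd: "v < d" using v(2) v1 by linarith
    have r: "(\<Sum>j\<le>d - v - 1. w (d - j)) \<le> k'" using rest[OF vd] v(1) by simp
    have hL: "half_cert l (v - 1) (end_sol l v) (k - 1)"
      using end_sol_half_cert_shorten[of l "d - 1" "k - 1" v] crude[OF k1] v1 v(2) by (simp add: numeral_2_eq_2)
    have n: "1 \<le> d - v" "d - v \<le> p'" using vr vd by auto
    have s: "S' (d - v) > 0" using half_certD(2)[OF hr n(2)] .
    have hR: "half_strict l (d - v - 1) (end_sol l (d - v)) k'"
      using half_cert_shorten(2)[OF hr n(1) _ _ s] n s by simp
    have "load_cert l d (v - 1) (end_sol l v) (k - 1) (d - v - 1) (end_sol l (d - v)) k' w"
      unfolding load_cert_def using hL hR[unfolded half_strict_def] vertex_node[OF v1 vd] vl r unfolding A_def by auto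
    then show ?thesis unfolding strict_load_cert_def using hR by blast
  qed
  show ?thesis unfolding coverable_def
  proof (intro allI impI)
    fix w :: "nat => nat"
    assume w0: "w 0 = 0" "w d = 0" and tot: "(\<Sum>j\<le>d. w j) = k + k'"
    define w' where "w' = (\<lambda>j. w (d - j))"
    have w0': "w' 0 = 0" "w' d = 0" using w0 by (auto simp: w'_def)
    have tot': "(\<Sum>j\<le>d. w' j) = k + k'" unfolding w'_def tot[symmetric]
      by (rule sum.reindex_bij_witness[of _ "\<lambda>j. d - j" "\<lambda>j. d - j"]) auto
    have w'': "(\<Sum>j\<le>p'. w' (d - j)) = (\<Sum>j\<le>p'. w j)" unfolding w'_def using neg by (intro sum.cong) auto
    have goal: "\<exists>u\<in>{w, w'}. load_cert l d p S k p' S' k' u \<or> strict_load_cert l d u"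
    proof (rule ccontr)
      assume no: "\<not> ?thesis"
      then have n1: "\<not> strict_load_cert l d w" "\<not> strict_load_cert l d w'"
        and n2: "\<not> load_cert l d p S k p' S' k' w" "\<not> load_cert l d p S k p' S' k' w'" by auto
      have r1: "(\<Sum>j\<le>p'. w (d - j)) \<le> k'" using right_heavy[OF w0 tot] n1(1) by (meson not_less)
      have r2: "(\<Sum>j\<le>p'. w' (d - j)) \<le> k'" using right_heavy[OF w0' tot'] n1(2) by (meson not_less)
      have l1: "k < (\<Sum>j\<le>p. w j)" using n2(1) r1 hl hr nd unfolding load_cert_def by (meson not_less)
      have l2: "k < (\<Sum>j\<le>p. w' j)" using n2(2) r2 hl hr nd unfolding load_cert_def by (meson not_less)
      define A where "A i = (\<Sum>j\<le>i. w j)" for i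
      have monoA: "A i \<le> A j" if "i \<le> j" for i j unfolding A_def using that by (intro sum_mono2) auto
      have rest: "k + k' = A i + (\<Sum>j\<le>d - i - 1. w (d - j))" if "i < d" for i
        using sum_split_reflect[OF that, of w] tot unfolding A_def by simp
      \<comment> \<open>Now both orientations overload their left half. At the first vertex where
        the loads from the left exceed \<open>k\<close>, at most \<open>k\<close> remain on either
        side, using \<open>k' \<le> k + 1\<close>. Both sides are shorter than the left half, so
        \<open>S\<close> and its mirror image serve for them.\<close>
      define v where "v = (LEAST i. k < A i)"
      have Ap: "k < A p" using l1 by (simp add: A_def)
      have v: "k < A v" "v \<le> p" unfolding v_def by (rule LeastI[of _ p], rule Ap, rule Least_le, rule Ap)
      have v1: "1 \<le> v" using v(1) w0 by (cases v) (auto simp: A_def)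
      have vl: "A (v - 1) \<le> k" using not_less_Least[of "v - 1" "\<lambda>i. k < A i"] v1 unfolding v_def by auto
      have vd: "v < d" using v(2) neg by simp
      have r: "(\<Sum>j\<le>d - v - 1. w (d - j)) \<le> k" using rest[OF vd] v(1) kk by simp
      have vr: "d - p \<le> v"
      proof (rule ccontr)
        assume "\<not> ?thesis"
        then have "A v \<le> A (d - p - 1)" using monoA by simp
        moreover have "d - (d - p - 1) - 1 = p" using neg by simp
        then have "k + k' = A (d - p - 1) + (\<Sum>j\<le>p. w' j)" using rest[of "d - p - 1"] neg unfolding w'_def by simp
        ultimately show False using v(1) l2 kk by linarith
      qed
      have sL: "S v > 0" using half_certD(2)[OF hl v(2)] .
      have hL: "half_strict l (v - 1) (end_sol l v) k"
        using half_cert_shorten(2)[OF hl v1 _ _ sL] v sL by simp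
      have n: "1 \<le> d - v" "d - v \<le> p" using vr vd by auto
      have s: "S (d - v) > 0" using half_certD(2)[OF hl n(2)] .
      have hR: "half_cert l (d - v - 1) (end_sol l (d - v)) k"
        using half_cert_shorten(1)[OF hl n(1)] n s by simp
      have "load_cert l d (v - 1) (end_sol l v) k (d - v - 1) (end_sol l (d - v)) k w"
        unfolding load_cert_def using hR hL[unfolded half_strict_def] vertex_node[OF v1 vd] vl r unfolding A_def by auto
      then show False using n1(1) hL unfolding strict_load_cert_def by blast
    qed
    show "\<exists>u\<in>{w, \<lambda>j. w (d - j)}. load_cert l d p S k p' S' k' u \<or> strict_load_cert l d u"
      using goal unfolding w'_def .
  qed
qed

section \<open>Extremal certificates\<close>

text \<open>The first condition makes a branch that cannot be pushed larger than \<open>k'\<close>.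
  The second concerns \<open>d - 1\<close> vertices, the longest possible half beside a node at an
  inner vertex. In the third the half is the whole path, with no node on it.\<close>

definition side_conditions :: "real => nat => nat => nat => bool" where
  "side_conditions l d k k' \<longleftrightarrow> real k' < l^2 \<and>
     (k \<ge> 1 --> half_cert l (d - 2) (end_sol l (d - 1)) (k - 1)) \<and>
     (k \<ge> 2 --> half_cert l d (end_sol l (d + 1)) (k - 2))"

lemma continuous_on_chp [continuous_intros]:
  assumes "continuous_on A f"
  shows "continuous_on A (\<lambda>x. chp (f x) n)"
  by (induction n rule: induct_nat_012) (auto intro!: continuous_intros assms)

lemma end_sol_half_certI:
  assumes l: "l > 0" and n: "n \<ge> 2" and pos: "\<And>j. 1 \<le> j ==> j \<le> n ==> chp l j > 0"
    and W: "chp l (n + 1) \<ge> 0" "k > 0 ==> chp l (n + 1) > 0"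
    and le: "\<And>i. 1 \<le> i ==> i \<le> n - 1 ==> real k * (chp l (i + 1) * chp l (n - i)) \<le> l * chp l (n + 1)"
  shows "half_cert l (n - 1) (end_sol l n) k"
proof -
  have Weq: "l * chp l n - chp l (n - 1) = chp l (n + 1)"
    using n by (cases n) (simp_all add: algebra_simps)
  have recn: "chp l (n - (j + 2)) = l * chp l (n - (j + 1)) - chp l (n - j)" if "j < n - 1" for j
  proof -
    have "n - j = (n - (j + 2)) + 2" "n - (j + 1) = (n - (j + 2)) + 1" using that by auto
    then show ?thesis by (simp add: algebra_simps)
  qed
  have pj: "chp l (n - j) > 0" if "j \<le> n - 1" for j using that n by (intro pos) auto
  have a: "chp l (n - 1) \<le> l * chp l (n - 0)" using W Weq by simp
  have b: "chp l (n - 1) < l * chp l (n - 0)" if "k > 0" using W(2)[OF that] Weq by simp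
  have c: "real k * chp l (i + 1) * chp l (n - i) \<le> l * (l * chp l (n - 0) - chp l (n - 1))"
    if "1 \<le> i" "i \<le> n - 1" for i using le[OF that] Weq by (simp add: mult.assoc del: chp.simps)
  show ?thesis unfolding half_cert_def using l pj recn a b c by blast
qed

lemma end_sol_half_cert_path:
  assumes n: "n \<ge> 2" and l: "l > 0" "l \<ge> 2 * cos (pi / real (n + 1))"
  shows "half_cert l (n - 1) (end_sol l n) 0"
  by (rule end_sol_half_certI) (use chp_pos_of_ge_cos[of "n + 1" l] n l in auto)

lemma end_sol_half_cert_hyperbolic:
  assumes n: "n \<ge> 1" and l: "l \<ge> 2" "(real k)\<^sup>2 \<le> (l^2)\<^sup>2 - 4 * l^2"
  shows "half_cert l (n - 1) (end_sol l n) k"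
proof (rule half_cert_hyperbolic(1)[OF l(1) _ _ _ l(2)])
  show "chp l (n - (j + 2)) = l * chp l (n - (j + 1)) - chp l (n - j)" if "j < n - 1" for j
  proof -
    have "n - j = (n - (j + 2)) + 2" "n - (j + 1) = (n - (j + 2)) + 1" using that by auto
    then show ?thesis by (simp add: algebra_simps)
  qed
qed (use n in auto)

section \<open>Short halves, by explicit polynomials in \<open>l^2\<close>\<close>

lemma chp_values_8_9:
  "chp l 8 = l * (l^2 - 2) * ((l^2)\<^sup>2 - 4 * l^2 + 2)"
  "chp l 9 = (l^2)^4 - 7 * (l^2)^3 + 15 * (l^2)\<^sup>2 - 10 * l^2 + 1"
proof -
  have e: "chp l 8 = l * chp l 7 - chp l 6" "chp l 9 = l * chp l 8 - chp l 7"
    using chp_rec[of l 6] chp_rec[of l 7] by (simp_all del: chp.simps)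
  show c8: "chp l 8 = l * (l^2 - 2) * ((l^2)\<^sup>2 - 4 * l^2 + 2)"
    unfolding e(1) chp_values by Groebner_Basis.algebra
  show "chp l 9 = (l^2)^4 - 7 * (l^2)^3 + 15 * (l^2)\<^sup>2 - 10 * l^2 + 1"
    unfolding e(2) c8 chp_values by Groebner_Basis.algebra
qed

lemma nat_cases_upto_5:
  fixes j :: nat
  assumes "1 \<le> j" "j \<le> 5"
  shows "j = 1 \<or> j = 2 \<or> j = 3 \<or> j = 4 \<or> j = 5"
  using assms by linarith

text \<open>The hyperbolic criterion asks for \<open>l \<ge> 2\<close>. For short halves the load
  conditions are instead compared position by position, which also covers smaller
  \<open>l\<close>.\<close>

lemma half_cert_length_2:
  assumes l: "l > 0" and L: "l^2 \<ge> 2" and k: "real k \<le> l^2 - 2"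
  shows "half_cert l 2 (end_sol l 3) k"
proof -
  define L' where "L' = l^2"
  have LL: "l * l = L'" unfolding L'_def by (simp add: power2_eq_square)
  note v = chp_values[of l, folded L'_def]
  have "half_cert l (3 - 1) (end_sol l 3) k"
  proof (rule end_sol_half_certI)
    fix j :: nat assume "1 \<le> j" "j \<le> 3"
    then have "j = 1 \<or> j = 2 \<or> j = 3" by linarith
    then show "chp l j > 0" using l L v by (auto simp: L'_def)
  next
    fix i :: nat assume "1 \<le> i" "i \<le> 3 - 1"
    then have i: "i = 1 \<or> i = 2" by linarith
    have c2: "real k * (L' - 1) \<le> (L' - 2) * L'"
      using k L by (intro mult_mono) (auto simp: L'_def)
    have c1: "real k * L' \<le> (L' - 2) * L'" using k L by (intro mult_right_mono) (auto simp: L'_def)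
    have r: "l * chp l (3 + 1) = (L' - 2) * L'" using v LL by (simp add: mult.assoc[symmetric])
    show "real k * (chp l (i + 1) * chp l (3 - i)) \<le> l * chp l (3 + 1)"
      unfolding r using i c1 c2 v LL by (auto simp: numeral_eq_Suc[symmetric] simp del: chp.simps(3) One_nat_def)
  qed (use l L k v in \<open>auto simp: L'_def mult_pos_pos\<close>)
  then show ?thesis by simp
qed

lemma half_cert_length_3:
  assumes l: "l > 0" and L: "l^2 > 2" and k: "real k * (l^2 - 1) \<le> (l^2)\<^sup>2 - 3 * l^2 + 1"
  shows "half_cert l 3 (end_sol l 4) k"
proof -
  define L' where "L' = l^2"
  have LL: "l * l = L'" unfolding L'_def by (simp add: power2_eq_square)
  note v = chp_values[of l, folded L'_def]
  have L2: "L' > 2" using L by (simp add: L'_def)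
  have kL: "real k * (L' - 1) \<le> L'^2 - 3 * L' + 1" using k by (simp add: L'_def)
  have "half_cert l (4 - 1) (end_sol l 4) k"
  proof (rule end_sol_half_certI)
    fix j :: nat assume "1 \<le> j" "j \<le> 4"
    then have "j = 1 \<or> j = 2 \<or> j = 3 \<or> j = 4" by linarith
    then show "chp l j > 0" using l L2 v by auto
  next
    have "0 \<le> real k * (L' - 1)" using L2 by simp
    then show "chp l (4 + 1) \<ge> 0" using kL v by simp
    assume "k > 0"
    then have "0 < real k * (L' - 1)" using L2 by simp
    then show "chp l (4 + 1) > 0" using kL v by simp
  next
    fix i :: nat assume "1 \<le> i" "i \<le> 4 - 1"
    then have i: "i = 1 \<or> i = 2 \<or> i = 3" by linarith
    have c1: "real k * (l * (L' - 1)) \<le> l * (L'^2 - 3 * L' + 1)"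
      using mult_left_mono[OF kL, of l] l by (simp add: mult_ac)
    have "real k * (l * (L' - 2)) \<le> real k * (l * (L' - 1))"
      using l by (intro mult_left_mono) auto
    then have c3: "real k * (l * (L' - 2)) \<le> l * (L'^2 - 3 * L' + 1)" using c1 by linarith
    have "(4::nat) - 1 = 3" "(4::nat) - 2 = 2" "(4::nat) - 3 = 1" by auto
    then show "real k * (chp l (i + 1) * chp l (4 - i)) \<le> l * chp l (4 + 1)"
      using i c1 c3 v by (auto simp: mult_ac simp del: chp.simps(3) One_nat_def)
  qed (use l in auto)
  then show ?thesis by simp
qed

lemma half_cert_length_4:
  assumes l: "l > 0" and L: "l^2 \<ge> 3" and k: "real k \<le> l^2 - 3"
  shows "half_cert l 4 (end_sol l 5) k"
proof -
  define L' where "L' = l^2"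
  have LL: "l * l = L'" unfolding L'_def by (simp add: power2_eq_square)
  note v = chp_values[of l, folded L'_def]
  have L3: "L' \<ge> 3" and kL: "real k \<le> L' - 3" using L k by (auto simp: L'_def)
  have p5: "L'^2 - 3 * L' + 1 > 0" 
  proof -
    have "L'^2 - 3 * L' + 1 = L' * (L' - 3) + 1" by (simp add: power2_eq_square algebra_simps)
    moreover have "L' * (L' - 3) \<ge> 0" using L3 by simp
    ultimately show ?thesis by linarith
  qed
  have r: "l * chp l (5 + 1) = (L' - 3) * (L' * (L' - 1))" using v LL by (simp add: mult_ac)
  have "half_cert l (5 - 1) (end_sol l 5) k"
  proof (rule end_sol_half_certI)
    fix j :: nat assume j: "1 \<le> j" "j \<le> 5"
    show "chp l j > 0" using nat_cases_upto_5[OF j] l L3 v p5 by auto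
  next
    show "chp l (5 + 1) \<ge> 0" using v l L3 by simp
    assume "k > 0"
    then have "L' > 3" using kL by simp
    then show "chp l (5 + 1) > 0" using v l by simp
  next
    fix i :: nat assume "1 \<le> i" "i \<le> 5 - 1"
    then have i: "i = 1 \<or> i = 2 \<or> i = 3 \<or> i = 4" by linarith
    have b: "real k * c \<le> (L' - 3) * (L' * (L' - 1))" if "0 \<le> c" "c \<le> L' * (L' - 1)" for c
      using kL that L3 by (intro mult_mono) auto
    have c1: "real k * (l * (l * (L' - 2))) \<le> (L' - 3) * (L' * (L' - 1))"
      unfolding mult.assoc[symmetric, of l l] LL using L3 by (intro b mult_left_mono) auto
    have c2: "real k * ((L' - 1) * (L' - 1)) \<le> (L' - 3) * (L' * (L' - 1))"
      using L3 by (intro b mult_right_mono) auto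
    have c4: "real k * (L'^2 - 3 * L' + 1) \<le> (L' - 3) * (L' * (L' - 1))"
      using L3 p5 by (intro b) (auto simp: power2_eq_square algebra_simps)
    have "(5::nat) - 1 = 4" "(5::nat) - 2 = 3" "(5::nat) - 3 = 2" "(5::nat) - 4 = 1" by auto
    then show "real k * (chp l (i + 1) * chp l (5 - i)) \<le> l * chp l (5 + 1)"
      unfolding r using i c1 c2 c4 v by (auto simp: mult_ac simp del: chp.simps(3) One_nat_def)
  qed (use l in auto)
  then show ?thesis by simp
qed

lemma half_cert_length_5:
  assumes l: "l > 0" and L: "l^2 > 3" and q: "(l^2)\<^sup>2 - 5 * l^2 + 5 \<ge> 0" and k: "real k \<le> l^2 - 3"
  shows "half_cert l 5 (end_sol l 6) k"
proof -
  define L' where "L' = l^2"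
  have LL: "l * l = L'" unfolding L'_def by (simp add: power2_eq_square)
  note v = chp_values[of l, folded L'_def]
  have L3: "L' > 3" and kL: "real k \<le> L' - 3" and q': "L'^2 - 5 * L' + 5 \<ge> 0" using L k q by (auto simp: L'_def)
  have p5: "L'^2 - 3 * L' + 1 > 0" 
  proof -
    have "L'^2 - 3 * L' + 1 = L' * (L' - 3) + 1" by (simp add: power2_eq_square algebra_simps)
    moreover have "L' * (L' - 3) \<ge> 0" using L3 by simp
    ultimately show ?thesis by linarith
  qed
  \<comment> \<open>The first summand pays for the \<open>k\<close> leaves: divided by
    \<open>l\<close>, the load product at each position is at most \<open>L'^2 - 3 * L' + 2\<close>.
    The second summand is the quantity assumed to be nonnegative.\<close>
  have p7: "chp l 7 = (L' - 3) * (L'^2 - 3 * L' + 2) + (L'^2 - 5 * L' + 5)"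
    unfolding v by (simp add: power2_eq_square power3_eq_cube algebra_simps)
  have pp: "(L' - 3) * (L'^2 - 3 * L' + 2) > 0" using L3 p5 by simp
  have "half_cert l (6 - 1) (end_sol l 6) k"
  proof (rule end_sol_half_certI)
    fix j :: nat assume j: "1 \<le> j" "j \<le> 6"
    have "j = 6 \<or> j \<le> 5" using j by linarith
    then show "chp l j > 0" using nat_cases_upto_5[of j] j l L3 v p5 by auto
  next
    show "chp l (6 + 1) \<ge> 0" using p7 pp q' by simp
    show "chp l (6 + 1) > 0" using p7 pp q' by simp
  next
    fix i :: nat assume i: "1 \<le> i" "i \<le> 6 - 1"
    have b: "real k * (l * c) \<le> l * chp l 7" if "0 \<le> c" "c \<le> L'^2 - 3 * L' + 2" for c
    proof -
      have "real k * c \<le> (L' - 3) * (L'^2 - 3 * L' + 2)" using kL that L3 by (intro mult_mono) auto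
      then have "real k * c \<le> chp l 7" unfolding p7 using q' by linarith
      then show ?thesis using mult_left_mono[of "real k * c" "chp l 7" l] l by (simp add: mult_ac)
    qed
    have c1: "real k * (l * (L'^2 - 3 * L' + 1)) \<le> l * chp l 7" using p5 by (intro b) auto
    have n2: "0 \<le> (L' - 1) * (L' - 2)" and n5: "0 \<le> (L' - 1) * (L' - 3)" using L3 by auto
    have c2: "real k * (l * ((L' - 1) * (L' - 2))) \<le> l * chp l 7"
      using L3 by (intro b n2) (auto simp: power2_eq_square algebra_simps)
    have c5: "real k * (l * ((L' - 1) * (L' - 3))) \<le> l * chp l 7"
      using L3 by (intro b n5) (auto simp: power2_eq_square algebra_simps)
    have d: "(6::nat) - 1 = 5" "(6::nat) - 2 = 4" "(6::nat) - 3 = 3" "(6::nat) - 4 = 2" "(6::nat) - 5 = 1" by auto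
    have "chp l (i + 1) * chp l (6 - i) \<in> {l * (L'^2 - 3 * L' + 1), l * ((L' - 1) * (L' - 2)), l * ((L' - 1) * (L' - 3))}"
      using nat_cases_upto_5[of i] i d v(1-4) by (auto simp del: chp.simps(3) One_nat_def simp: mult_ac)
    then show "real k * (chp l (i + 1) * chp l (6 - i)) \<le> l * chp l (6 + 1)"
      using c1 c2 c5 by auto
  qed (use l in auto)
  then show ?thesis by simp
qed

section \<open>An even number of leaves\<close>

definition chpz :: "real => int => real" where
  "chpz m z = (if z \<ge> 0 then chp m (nat z) else - chp m (nat (- z)))"

text \<open>The odd extension keeps the recurrence valid across 0, so that a solution can be
  followed through its zero into the other half.\<close>

lemma chpz_rec: "chpz m (z + 1) = m * chpz m z - chpz m (z - 1)"
proof -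
  consider "z \<ge> 1" | "z = 0" | "z \<le> -1" by linarith
  then show ?thesis
  proof cases
    case 1
    then obtain n where n: "z = int n + 1" using zle_iff_zadd[of 1 z] by auto
    have "nat (z + 1) = n + 2" "nat z = n + 1" "nat (z - 1) = n" using n by auto
    then show ?thesis unfolding chpz_def using n by simp
  next
    case 2 then show ?thesis unfolding chpz_def by simp
  next
    case 3
    then obtain n where n: "- z = int n + 1" using zle_iff_zadd[of 1 "- z"] by auto
    have e: "nat (- (z - 1)) = n + 2" "nat (- z) = n + 1" "nat (- (z + 1)) = n" using n by auto
    have "chpz m (z + 1) = - chp m n" using n e(3) by (cases n) (auto simp: chpz_def)
    moreover have "chpz m z = - chp m (n + 1)" "chpz m (z - 1) = - chp m (n + 2)"
      using n e unfolding chpz_def by (auto simp del: chp.simps)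
    ultimately show ?thesis by simp
  qed
qed

text \<open>Every second value obeys the recurrence with parameter \<open>m^2 - 2\<close>, which for
  \<open>m = 2 * cos t\<close> is \<open>2 * cos (2 * t)\<close>.\<close>

lemma chpz_rec2: "chpz m (z - 2) = (m\<^sup>2 - 2) * chpz m z - chpz m (z + 2)"
proof -
  have "chpz m (z - 1) = m * chpz m z - chpz m (z + 1)" using chpz_rec[of m z] by simp
  moreover have "chpz m (z - 2) = m * chpz m (z - 1) - chpz m z" using chpz_rec[of m "z - 1"] by simp
  moreover have "chpz m (z + 2) = m * chpz m (z + 1) - chpz m z" using chpz_rec[of m "z + 1"] by (simp add: add.commute)
  ultimately show ?thesis by Groebner_Basis.algebra
qed

lemma chp_double: "chp (m\<^sup>2 - 2) n * m = chp m (2 * n)"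
proof (induction n rule: induct_nat_012)
  case (ge2 n)
  have a: "chp m (2 * Suc (Suc n)) = (m\<^sup>2 - 2) * chp m (2 * Suc n) - chp m (2 * n)"
    by (simp add: power2_eq_square algebra_simps)
  have "chp (m\<^sup>2 - 2) (Suc (Suc n)) * m =
      (m\<^sup>2 - 2) * (chp (m\<^sup>2 - 2) (Suc n) * m) - chp (m\<^sup>2 - 2) n * m"
    by (simp add: algebra_simps)
  then show ?case unfolding a ge2.IH .
qed (simp_all add: numeral_2_eq_2)

text \<open>Both halves are mirror images and the node is the centre of the path, which lies inside
  an edge if \<open>d\<close> is odd. Writing \<open>l = m^2 - 2\<close> halves the angle, so that
  \<open>chpz m (d - 2 * j)\<close> is a solution vanishing at the centre for either parity of
  \<open>d\<close>. The remaining unknown \<open>m\<close> is fixed by tightness at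
  \<open>i0\<close>.\<close>

lemma even_certificate:
  assumes d: "d \<ge> 4" and k: "k \<ge> 1"
  shows "\<exists>l p S p' S'. half_cert l p S k \<and> half_cert l p' S' k \<and> path_node d p S p' S' \<and> side_conditions l d k k \<and>
     (\<forall>i j. i < j --> j \<le> d --> (even_positions d i j \<longleftrightarrow> half_tight l p S k i \<and> half_tight l p' S' k (d - j)))"
proof -
  \<comment> \<open>As \<open>S m (2 * i)\<close> is \<open>chpz m (d - 4 * i)\<close>, the midpoint
    conditions ask for \<open>4 * i0 \<le> d \<le> 4 * i0 + 4\<close>; the maximum with 1 matters
    for \<open>d = 4\<close>. The upper end, \<open>d = 4 * i0 + 4\<close>, is the case of a
    tie.\<close>
  define i0 where "i0 = max 1 ((d - 1) div 4)"
  define p where "p = (d - 1) div 2"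
  define S where "S m j = chpz m (int d - 2 * int j)" for m j
  have i0: "1 \<le> i0" "i0 \<le> p" "2 * i0 + 2 \<le> d" using d by (auto simp: i0_def p_def)
  have sol: "S m (j + 2) = (m\<^sup>2 - 2) * S m (j + 1) - S m j" for m j
    using chpz_rec2[of m "int d - 2 * int (j + 1)"] unfolding S_def by (simp add: algebra_simps)
  have Sl: "S m j = chp m (d - 2 * j)" if "2 * j \<le> d" for m j
  proof -
    have "nat (int d - 2 * int j) = d - 2 * j" using that by linarith
    then show ?thesis using that unfolding S_def chpz_def by simp
  qed
  have Sr: "S m j = - chp m (2 * j - d)" if "d < 2 * j" for m j
  proof -
    have "nat (- (int d - 2 * int j)) = 2 * j - d" using that by linarith
    then show ?thesis using that unfolding S_def chpz_def by simp
  qed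
  have W: "(m\<^sup>2 - 2) * S m 0 - S m 1 = chp m (d + 2)" for m
  proof -
    have "nat (int d + 2) = d + 2" by simp
    then have "chpz m (int d + 2) = chp m (d + 2)" unfolding chpz_def by (simp del: chp.simps)
    then show ?thesis using chpz_rec2[of m "int d"] unfolding S_def by simp
  qed
  have p2: "2 * p < d" "d \<le> 2 * p + 2" using d by (auto simp: p_def)
  \<comment> \<open>\<open>g\<close> measures the failure of tightness at \<open>i0\<close>. It is
    positive at \<open>m0\<close>, where the Wronskian \<open>chp m (d + 2)\<close> vanishes, and at
    most 0 at \<open>m1\<close>, where \<open>l = k + 2\<close> and the hyperbolic criterion
    applies.\<close>
  define g where "g m = real k * chp (m\<^sup>2 - 2) (i0 + 1) * S m i0 - (m\<^sup>2 - 2) * chp m (d + 2)" for m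
  define t where "t = pi / real (d + 2)"
  define m0 where "m0 = 2 * cos t"
  define m1 where "m1 = sqrt (real k + 4)"
  have t: "0 < t" "t < pi / 2" using d by (auto simp: t_def divide_simps)
  have m0: "0 < m0" unfolding m0_def using t by (simp add: cos_gt_zero)
  have m0p: "chp m0 n > 0" if "1 \<le> n" "n < d + 2" for n
  proof -
    have "real n * t < real (d + 2) * t" using that t by simp
    also have "\<dots> = pi" by (simp add: t_def)
    finally show ?thesis unfolding m0_def using that t by (intro chp_cos_pos)
  qed
  have m0z: "chp m0 (d + 2) = 0"
  proof -
    have "real (d + 2) * t = pi" by (simp add: t_def)
    then have "chp m0 (d + 2) * sin t = sin pi" unfolding m0_def chp_cos by simp
    moreover have "sin t > 0" using t pi_gt_zero by (intro sin_gt_zero) linarith+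
    ultimately show ?thesis by simp
  qed
  have g0: "g m0 > 0"
  proof -
    have "chp (m0\<^sup>2 - 2) (i0 + 1) * m0 > 0" unfolding chp_double using m0p[of "2 * (i0 + 1)"] i0 by simp
    then have "chp (m0\<^sup>2 - 2) (i0 + 1) > 0" using m0 by (rule zero_less_mult_pos2)
    moreover have "S m0 i0 > 0" using Sl[of i0 m0] m0p[of "d - 2 * i0"] i0 by simp
    ultimately show ?thesis unfolding g_def m0z using k by simp
  qed
  have m1: "m1 \<ge> 2" "m1\<^sup>2 - 2 = real k + 2"
    unfolding m1_def by (auto intro: real_le_rsqrt)
  have g1: "g m1 \<le> 0"
  proof -
    let ?l = "m1\<^sup>2 - 2"
    have c1: "chp m1 n > 0" if "1 \<le> n" for n using chp_pos_ge_2[OF m1(1), of "n - 1"] that by simp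
    have "half_cert ?l p (S m1) k"
    proof (rule half_cert_hyperbolic(1))
      show "S m1 p > 0" using Sl[of p m1] c1[of "d - 2 * p"] p2 by simp
      show "S m1 (p + 1) \<le> 0"
      proof (cases "d = 2 * (p + 1)")
        case True then show ?thesis using Sl[of "p + 1" m1] by simp
      next
        case False
        then have "1 \<le> 2 * (p + 1) - d" using p2 by arith
        then show ?thesis using Sr[of "p + 1" m1] less_imp_le[OF c1] by simp
      qed
      have "(real k)\<^sup>2 \<le> (real k + 2)\<^sup>2" by (intro power_mono) auto
      also have "\<dots> * 1 \<le> (real k + 2)\<^sup>2 * ((real k + 2)\<^sup>2 - 4)"
      proof (intro mult_left_mono)
        have "(real k + 2)\<^sup>2 \<ge> 3\<^sup>2" using k by (intro power_mono) auto
        then show "1 \<le> (real k + 2)\<^sup>2 - 4" by simp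
      qed simp
      finally show "(real k)\<^sup>2 \<le> (?l^2)\<^sup>2 - 4 * ?l^2"
        unfolding m1(2) by (simp add: power2_eq_square algebra_simps)
    qed (use m1 sol in auto)
    from half_certD(6)[OF this i0(1,2)] show ?thesis unfolding g_def W by simp
  qed
  have "\<exists>x\<ge>m0. x \<le> m1 \<and> g x = 0"
  proof (rule IVT2')
    show "m0 \<le> m1" using m1(1) cos_le_one[of t] unfolding m0_def by linarith
    have "continuous_on {m0..m1} (\<lambda>m. real k * chp (m\<^sup>2 - 2) (i0 + 1) * chp m (d - 2 * i0) - (m\<^sup>2 - 2) * chp m (d + 2))"
      by (intro continuous_intros)
    then show "continuous_on {m0..m1} g" unfolding g_def using Sl[of i0] i0 by simp
  qed (use g0 g1 in auto)
  then obtain m where m: "m0 \<le> m" "g m = 0" by blast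
  have mp: "chp m n > 0" if "1 \<le> n" "n < d + 2" for n
    using chp_pos_of_ge_cos(1)[of "d + 2" m n] that m(1) m0 unfolding m0_def t_def by simp
  have mW: "chp m (d + 2) \<ge> 0"
    using chp_pos_of_ge_cos(2)[of "d + 2" m] m(1) m0 unfolding m0_def t_def by simp
  have mpos: "m > 0" using m m0 by linarith
  define l where "l = m\<^sup>2 - 2"
  have Sp: "S m j > 0" if "j \<le> p" for j using Sl[of j m] mp[of "d - 2 * j"] that p2 by simp
  have Srp: "S m j < 0" if "d < 2 * j" "2 * j < 2 * d + 2" for j
  proof -
    have "chp m (2 * j - d) > 0" by (rule mp) (use that in arith)+
    then show ?thesis using Sr[OF that(1), of m] by simp
  qed
  have Slp: "S m j > 0" if "2 * j < d" for j
  proof -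
    have "chp m (d - 2 * j) > 0" by (rule mp) (use that in arith)+
    then show ?thesis using Sl[of j m] that by simp
  qed
  have Sn: "S m j \<le> 0" if "d \<le> 2 * j" "2 * j < 2 * d + 2" for j
  proof (cases "d = 2 * j")
    case True then show ?thesis using Sl[of j m] by simp
  next
    case False then show ?thesis using Srp[of j] that by simp
  qed
  have tight: "real k * chp l (i0 + 1) * S m i0 = l * (l * S m 0 - S m 1)"
    using m(2) unfolding g_def l_def W by simp
  have "chp l (i0 + 1) * m > 0" unfolding l_def chp_double using mp[of "2 * (i0 + 1)"] i0 by simp
  then have Pi0: "chp l (i0 + 1) > 0" using mpos by (rule zero_less_mult_pos2)
  have "real k * chp l (i0 + 1) * S m i0 > 0" using Pi0 Sp[OF i0(2)] k by (intro mult_pos_pos) auto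
  then have "l * (l * S m 0 - S m 1) > 0" unfolding tight .
  then have lW: "l * chp m (d + 2) > 0" unfolding l_def W .
  have l: "l > 0" using lW mW by (simp add: zero_less_mult_iff)
  have sol': "S m (j + 2) = l * S m (j + 1) - S m j" for j using sol unfolding l_def .
  have neg: "S m (p + 1) \<le> 0" using Sn[of "p + 1"] p2 by simp
  have W': "S m 1 \<le> l * S m 0" using W[of m] mW unfolding l_def by simp
  have hi: "S m (2 * i0 + 2) \<le> 0" if "i0 < p" using that d by (intro Sn) (auto simp: i0_def p_def)
  have lo: "S m (2 * i0) \<ge> 0" if "1 < i0"
  proof -
    have "2 * (2 * i0) < d" using that by (auto simp: i0_def)
    then show ?thesis using Slp[of "2 * i0"] by simp
  qed
  have k0: "k > 0" using k by simp
  have hc: "half_cert l p (S m) k"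
    by (rule half_cert_midpoint(1)[where ?i0.0 = i0]) fact+
  have ht: "half_tight l p (S m) k i \<longleftrightarrow> 1 \<le> i \<and> i \<le> p \<and>
      (i = i0 \<or> (i = i0 + 1 \<and> S m (2 * i0 + 2) = 0) \<or> (i + 1 = i0 \<and> S m (2 * i0) = 0))" for i
    by (rule half_cert_midpoint(2)) fact+
  have z1: "S m (2 * i0 + 2) = 0 \<longleftrightarrow> d = 4 * i0 + 4" if "i0 < p"
  proof (cases "d = 4 * i0 + 4")
    case True then show ?thesis using Sl[of "2 * i0 + 2" m] by simp
  next
    case False
    have "d < 2 * (2 * i0 + 2)" using that d False by (auto simp: i0_def p_def)
    moreover have "2 * (2 * i0 + 2) < 2 * d + 2" using d by (auto simp: i0_def)
    ultimately show ?thesis using Srp[of "2 * i0 + 2"] False by simp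
  qed
  have z2: "\<not> (S m (2 * i0) = 0 \<and> 1 < i0)"
  proof
    assume a: "S m (2 * i0) = 0 \<and> 1 < i0"
    then have "2 * (2 * i0) < d" by (auto simp: i0_def)
    then show False using Slp[of "2 * i0"] a by simp
  qed
  have tight_iff: "half_tight l p (S m) k i \<longleftrightarrow> i = i0 \<or> (i = i0 + 1 \<and> i0 < p \<and> d = 4 * i0 + 4)" for i
    unfolding ht using z1 z2 i0 by (cases "i0 < p") auto
  have node: "path_node d p (S m) p (S m)"
  proof (cases "even d")
    case True
    then have e: "p + p + 2 = d" "2 * (p + 1) = d" using d unfolding p_def by presburger+
    then show ?thesis unfolding path_node_def using Sl[of "p + 1" m] by simp
  next
    case False
    then have e: "p + p + 1 = d" using d unfolding p_def by presburger
    then have "d - 2 * p = 1" "2 * (p + 1) - d = 1" by auto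
    then show ?thesis unfolding path_node_def using Sl[of p m] Sr[of "p + 1" m] e by simp
  qed
  have pos_iff: "even_positions d i j \<longleftrightarrow> half_tight l p (S m) k i \<and> half_tight l p (S m) k (d - j)"
    if ij: "i < j" "j \<le> d" for i j
  proof -
    consider "d = 4" | r where "d = 4 * r + 5" | r where "d = 4 * r + 6" | r where "d = 4 * r + 7" | r where "d = 4 * r + 8"
    proof -
      have "d = 4 \<or> (\<exists>r. d = 4 * r + 5) \<or> (\<exists>r. d = 4 * r + 6) \<or> (\<exists>r. d = 4 * r + 7) \<or> (\<exists>r. d = 4 * r + 8)"
        using d by presburger
      then show thesis using that by blast
    qed
    then show ?thesis
    proof cases
      case 1
      then have "i0 = 1" "p = 1" by (auto simp: i0_def p_def)
      then show ?thesis using 1 ij unfolding tight_iff even_positions_def by auto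
    next
      case (2 r)
      then have "i0 = r + 1" by (auto simp: i0_def)
      then show ?thesis using 2 ij unfolding tight_iff even_positions_def by auto
    next
      case (3 r)
      then have "i0 = r + 1" by (auto simp: i0_def)
      then show ?thesis using 3 ij unfolding tight_iff even_positions_def by auto
    next
      case (4 r)
      then have "i0 = r + 1" by (auto simp: i0_def)
      then show ?thesis using 4 ij unfolding tight_iff even_positions_def by auto
    next
      case (5 r)
      then have "i0 = r + 1" "p = 2 * r + 3" by (auto simp: i0_def p_def)
      then show ?thesis using 5 ij unfolding tight_iff even_positions_def by auto
    qed
  qed
  define L where "L = l^2"
  have lsq: "(l^2)\<^sup>2 - 4 * l^2 = L * (L - 4)" by (simp add: L_def power2_eq_square algebra_simps)
  note v = chp_values[of l, folded L_def]
  have p1: "p \<ge> 1" using i0 by simp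
  have Snn: "S m n \<ge> 0" if "2 * n \<le> d" for n
    using Sl[OF that, of m] Slp[of n] that by (cases "d = 2 * n") auto
  have L1: "real k + 1 \<le> L"
    using half_cert_lower_bound[OF hc, of 2] p1 Snn[of 2] d v(1) by simp
  have L2: "real k + 2 \<le> L" if "d \<ge> 6"
  proof -
    have "real k * chp l (3 - 1) \<le> chp l (3 + 1)"
      using that Snn[of 3] by (intro half_cert_lower_bound[OF hc]) (auto simp: p_def)
    then have "l * real k \<le> l * (L - 2)" using v(2) by (simp add: mult.commute)
    then show ?thesis using l by simp
  qed
  have L3: "real k * (L - 1) \<le> L^2 - 3 * L + 1" if "d \<ge> 8"
  proof -
    have "real k * chp l (4 - 1) \<le> chp l (4 + 1)"
      using that Snn[of 4] by (intro half_cert_lower_bound[OF hc]) (auto simp: p_def)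
    then show ?thesis using v by simp
  qed
  have l2: "l \<ge> 2" if "L \<ge> 4"
  proof (rule power2_le_imp_le)
    show "2\<^sup>2 \<le> l^2" using that by (simp add: L_def)
  qed (use l in simp)
  \<comment> \<open>For \<open>d = 5\<close> the tightness equation itself is used, because it is
    sharper than the lower bounds \<open>L1\<close> to \<open>L3\<close>.\<close>
  have d5: "real k * (l + 1) = l * L + L - 2 * l - 1" if "d = 5"
  proof -
    have M: "m\<^sup>2 = l + 2" by (simp add: l_def)
    have i1: "i0 = 1" using that by (simp add: i0_def)
    have S1: "S m 1 = chp m 3" using Sl[of 1 m] that by simp
    have w: "l * S m 0 - S m 1 = chp m 7" using W[of m] that unfolding l_def by simp
    have "real k * l * chp m 3 = l * chp m 7" using tight unfolding w unfolding i1 S1 by simp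
    then have "real k * chp m 3 = chp m 7" using l by simp
    then show ?thesis unfolding chp_values M L_def by Groebner_Basis.algebra
  qed
  have G3: "half_cert l (d - 2) (end_sol l (d - 1)) (k - 1)"
  proof -
    \<comment> \<open>Up to \<open>d = 7\<close> the half has a fixed length and is treated by
      polynomials. From \<open>d = 8\<close> on, \<open>L2\<close> and \<open>L3\<close> are strong
      enough for the hyperbolic criterion if \<open>k \<ge> 2\<close>, and \<open>k = 1\<close> is
      treated by trigonometry.\<close>
    consider "d = 4" | "d = 5" | "d = 6" | "d = 7" | "d \<ge> 8" using d by linarith
    then show ?thesis
    proof cases
      case 1
      then show ?thesis using half_cert_length_2[OF l, of "k - 1"] L1 k by (simp add: L_def of_nat_diff)
    next
      case 2
      have e: "(real k - 1) * (l + 1) = (l^2 - l - 1) * (l + 2)"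
        using d5[OF 2] by (simp add: L_def power2_eq_square algebra_simps)
      have "(l^2 - l - 1) * (l + 2) \<ge> 0" unfolding e[symmetric] using k l by simp
      then have q: "l^2 - l - 1 \<ge> 0" using l by (simp add: zero_le_mult_iff)
      have "L \<ge> 2" using L1 k by simp
      moreover have "L \<noteq> 2"
      proof
        assume "L = 2"
        then have "l \<le> 1" using q by (simp add: L_def)
        then have "L \<le> 1" using l power_mono[of l 1 2] by (simp add: L_def)
        then show False using \<open>L = 2\<close> by simp
      qed
      ultimately have L2: "l^2 > 2" by (simp add: L_def)
      have "real (k - 1) * (l^2 - 1) = (real k - 1) * (l + 1) * (l - 1)"
        using k by (simp add: of_nat_diff power2_eq_square algebra_simps)
      also have "\<dots> = (l^2)\<^sup>2 - 3 * l^2 + 1 - (l^2 - l - 1)"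
        unfolding e by (simp add: power2_eq_square algebra_simps)
      finally have "real (k - 1) * (l^2 - 1) \<le> (l^2)\<^sup>2 - 3 * l^2 + 1" using q by simp
      then show ?thesis using half_cert_length_3[OF l L2, of "k - 1"] 2 by simp
    next
      case 3
      then show ?thesis using half_cert_length_4[OF l, of "k - 1"] L2 k by (simp add: L_def of_nat_diff)
    next
      case 4
      show ?thesis
      proof (cases "k = 1")
        case True
        have M: "m\<^sup>2 = l + 2" by (simp add: l_def)
        have i1: "i0 = 1" using 4 by (simp add: i0_def)
        have S1: "S m 1 = chp m 5" using Sl[of 1 m] 4 by simp
        have w: "l * S m 0 - S m 1 = chp m 9" using W[of m] 4 unfolding l_def by simp
        have "l * chp m 5 = l * chp m 9" using tight unfolding w unfolding i1 S1 True by simp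
        then have "chp m 5 = chp m 9" using l by simp
        \<comment> \<open>Tightness makes \<open>l\<close> a root of a cubic that divides
          \<open>chp l 7\<close>, so the Wronskian of the unloaded half with 6 vertices is exactly
          0, the boundary case.\<close>
        then have "(l + 2) * (l^3 - l^2 - 2 * l + 1) = 0"
          unfolding chp_values chp_values_8_9 M by Groebner_Basis.algebra
        then have "l^3 - l^2 - 2 * l + 1 = 0" using l by simp
        moreover have "chp l 7 = (l^3 - l^2 - 2 * l + 1) * (l^3 + l^2 - 2 * l - 1)"
          unfolding chp_values by Groebner_Basis.algebra
        ultimately have c7: "chp l 7 = 0" by simp
        have L3: "L \<ge> 3" using L2 4 True by simp
        have "L \<noteq> 3"
        proof
          assume "L = 3"
          then show False using c7 v(5) by simp
        qed
        then have L3': "L > 3" using L3 by simp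
        have "half_cert l (6 - 1) (end_sol l 6) 0"
        proof (rule end_sol_half_certI)
          fix j :: nat assume j: "1 \<le> j" "j \<le> 6"
          have p5: "L^2 - 3 * L + 1 > 0"
          proof -
            have "L^2 - 3 * L + 1 = L * (L - 3) + 1" by (simp add: power2_eq_square algebra_simps)
            moreover have "L * (L - 3) \<ge> 0" using L3 by simp
            ultimately show ?thesis by linarith
          qed
          have "j = 6 \<or> j \<le> 5" using j by linarith
          then show "chp l j > 0" using nat_cases_upto_5[of j] j l L3' v(1-4) p5 by auto
        qed (use l c7 in auto)
        then show ?thesis using 4 True by simp
      next
        case False
        then have L4: "L \<ge> 4" using L2 4 k by simp
        have "L * (L - 4) - (L - 5) \<ge> 0"
        proof -
          have "L * (L - 4) - (L - 5) = (L - 4) * (L - 1) + 1" by (simp add: algebra_simps)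
          moreover have "(L - 4) * (L - 1) \<ge> 0" using L4 by simp
          ultimately show ?thesis by linarith
        qed
        then have "(l^2)\<^sup>2 - 5 * l^2 + 5 \<ge> 0" using lsq by (simp add: L_def)
        then show ?thesis using half_cert_length_5[OF l, of "k - 1"] L2 L4 4 k by (simp add: L_def of_nat_diff)
      qed
    next
      case 5
      consider "k = 1" | "k = 2" | "k \<ge> 3" using k by linarith
      then show ?thesis
      proof cases
        case 1
        \<comment> \<open>The half with \<open>d - 1\<close> vertices has to carry nothing here, but
          \<open>l\<close> must reach its spectral radius, for all \<open>d\<close> at once.
          Assuming the contrary, all quantities become sines of multiples of
          \<open>h = th / 2\<close>.\<close>
        have "l \<ge> 2 * cos (pi / real d)"
        proof (rule ccontr)
          assume less: "\<not> ?thesis"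
          have "cos (pi / real d) \<le> 1" by simp
          then have "l < 2" using less by linarith
          then obtain th where th: "0 < th" "th < pi / 2" "l = 2 * cos th" using cos_parametrization[OF l] by blast
          have "pi / real d < th"
          proof (rule ccontr)
            assume "\<not> ?thesis"
            moreover have "pi / real d \<le> pi" using 5 by (simp add: field_simps)
            ultimately have "cos (pi / real d) \<le> cos th" using th by (intro cos_monotone_0_pi_le) auto
            then show False using less th by simp
          qed
          then have dth: "pi < real d * th" using 5 by (simp add: field_simps)
          define h where "h = th / 2"
          have h: "0 < h" "h < pi / 4" using th by (auto simp: h_def)
          have mh: "m = 2 * cos h"
          proof -
            have "m\<^sup>2 = 2 + l" by (simp add: l_def)
            also have "\<dots> = (2 * cos h)\<^sup>2" unfolding th(3) h_def
              using cos_double_cos[of "th / 2"] by (simp add: power_mult_distrib)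
            finally have sq: "m\<^sup>2 = (2 * cos h)\<^sup>2" .
            have "cos h > 0" using h pi_gt_zero by (intro cos_gt_zero) linarith+
            then have "0 \<le> 2 * cos h" by simp
            then show ?thesis using power2_eq_imp_eq[OF sq less_imp_le[OF mpos]] by blast
          qed
          have "real (d + 2) * h \<le> pi"
          proof (rule ccontr)
            assume "\<not> ?thesis"
            then have "pi / real (d + 2) < h" by (simp add: field_simps)
            then have "cos h < cos (pi / real (d + 2))" using h pi_gt_zero by (intro cos_monotone_0_pi) auto
            then show False using m(1) unfolding mh m0_def t_def by simp
          qed
          then have phi: "real (d + 2) * h \<le> pi" .
          have sh: "sin h > 0" "sin th > 0" using h th pi_gt_zero by (auto intro!: sin_gt_zero)
          have e: "chp l (i0 + 1) * S m i0 = l * chp m (d + 2)" using tight 1 W[of m] unfolding l_def by simp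
          have Si: "S m i0 * sin h = sin (real (d - 2 * i0) * h)" using Sl[of i0 m] i0 unfolding mh by (simp add: chp_cos)
          have t1: "chp l (i0 + 1) * sin th = sin (real (i0 + 1) * th)" unfolding th(3) by (rule chp_cos)
          have t2: "chp m (d + 2) * sin h = sin (real (d + 2) * h)" unfolding mh by (rule chp_cos)
          have t3: "l * sin th = sin (2 * th)" unfolding th(3) by (simp add: sin_double)
          have "(chp l (i0 + 1) * sin th) * (S m i0 * sin h) = (l * sin th) * (chp m (d + 2) * sin h)"
            using e by (simp add: algebra_simps del: chp.simps)
          then have "sin (real (i0 + 1) * th) * sin (real (d - 2 * i0) * h) = sin (2 * th) * sin (real (d + 2) * h)"
            unfolding Si t1 t2 t3 .
          \<comment> \<open>The tightness equation as a difference of cosines. At the position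
            \<open>i0\<close> the difference of the two angles is at most \<open>th\<close> in
            absolute value whatever \<open>d\<close> is, while their sum is
            \<open>(d + 2) * h\<close>.\<close>
          then have e1: "cos (real (i0 + 1) * th - real (d - 2 * i0) * h) - cos (real (i0 + 1) * th + real (d - 2 * i0) * h)
              = 2 * sin (2 * th) * sin (real (d + 2) * h)"
            by (simp add: cos_diff cos_add)
          have e2: "real (i0 + 1) * th + real (d - 2 * i0) * h = real (d + 2) * h"
            using i0 unfolding h_def by (simp add: of_nat_diff field_simps)
          have e3: "cos (real (i0 + 1) * th - real (d - 2 * i0) * h) \<ge> cos th"
          proof -
            have a: "real (i0 + 1) * th - real (d - 2 * i0) * h = (real (4 * i0 + 2) - real d) * h"
              using i0 unfolding h_def by (simp add: of_nat_diff field_simps)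
            have "real (4 * i0 + 2) \<le> real (d + 1)" "real d \<le> real (4 * i0 + 4)"
              unfolding of_nat_le_iff using 5 by (auto simp: i0_def)
            then have "\<bar>real (4 * i0 + 2) - real d\<bar> \<le> 2" by simp
            then have "\<bar>(real (4 * i0 + 2) - real d) * h\<bar> \<le> 2 * h" unfolding abs_mult using h by (intro mult_mono) auto
            then have b: "\<bar>(real (4 * i0 + 2) - real d) * h\<bar> \<le> th" by (simp add: h_def)
            have "cos th \<le> cos \<bar>(real (4 * i0 + 2) - real d) * h\<bar>"
              using b th pi_gt_zero by (intro cos_monotone_0_pi_le) auto
            then show ?thesis unfolding a by simp
          qed
          have ineq: "cos th - cos (real (d + 2) * h) \<le> 2 * sin (2 * th) * sin (real (d + 2) * h)"
            using e1 e3 unfolding e2 by linarith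
          have ph: "pi / 2 + th < real (d + 2) * h" using dth unfolding h_def by (simp add: field_simps)
          have c1: "cos (real (d + 2) * h) < - sin th"
          proof -
            have "cos (real (d + 2) * h) < cos (pi / 2 + th)" using ph phi th by (intro cos_monotone_0_pi) auto
            also have "cos (pi / 2 + th) = - sin th" by (simp add: cos_add)
            finally show ?thesis .
          qed
          have c2: "sin (real (d + 2) * h) \<le> cos th"
          proof -
            have "sin (real (d + 2) * h) = cos (real (d + 2) * h - pi / 2)" by (simp add: cos_diff)
            also have "\<dots> \<le> cos th" using ph phi th by (intro cos_monotone_0_pi_le) auto
            finally show ?thesis .
          qed
          \<comment> \<open>Everything reduces to \<open>x + y < 4 * y * x^2\<close> for a point of
            the unit circle. It is refuted because \<open>L^2 - 4 * L + 2 \<ge> 0\<close> says that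
            \<open>cos (2 * th)\<close> is at least \<open>sin (2 * th)\<close>.\<close>
          define x y where "x = cos th" and "y = sin th"
          have xy: "x\<^sup>2 + y\<^sup>2 = 1" "x > 0" "y > 0" using sh th cos_gt_zero[of th] by (auto simp: x_def y_def)
          have s2: "sin (2 * th) = 2 * y * x" by (simp add: sin_double x_def y_def)
          have "2 * sin (2 * th) * sin (real (d + 2) * h) \<le> 2 * sin (2 * th) * x"
            unfolding s2 x_def[symmetric] using c2 xy by (intro mult_left_mono) (auto simp: x_def)
          then have main: "x + y < 4 * y * x\<^sup>2" using ineq c1 s2 unfolding x_def[symmetric] y_def[symmetric]
            by (simp add: power2_eq_square)
          have Lx: "L = 4 * x\<^sup>2" by (simp add: L_def th(3) x_def power_mult_distrib)
          have L8: "L^2 - 4 * L + 2 \<ge> 0" using L3[OF 5] 1 by simp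
          have L38: "L \<ge> 3" using L2 5 1 by simp
          have yx: "y\<^sup>2 = 1 - x\<^sup>2" using xy by simp
          have "(2 * x * y)\<^sup>2 \<le> (x\<^sup>2 - y\<^sup>2)\<^sup>2"
          proof -
            have "(x\<^sup>2 - y\<^sup>2)\<^sup>2 - (2 * x * y)\<^sup>2 = (L^2 - 4 * L + 2) / 2"
              unfolding power_mult_distrib yx Lx by (simp add: power2_eq_square algebra_simps)
            then show ?thesis using L8 by simp
          qed
          moreover have "x\<^sup>2 - y\<^sup>2 > 0" unfolding yx using Lx L38 by simp
          ultimately have q: "2 * x * y \<le> x\<^sup>2 - y\<^sup>2" using power2_le_imp_le by fastforce
          have "y < x" by (rule power2_less_imp_less) (use \<open>x\<^sup>2 - y\<^sup>2 > 0\<close> xy(2) in linarith)+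
          then have "(x - y) * (x\<^sup>2 - 2 * x * y - y\<^sup>2) \<ge> 0" using q by (intro mult_nonneg_nonneg) auto
          moreover have "(x + y) * (x\<^sup>2 + y\<^sup>2) - 4 * y * x\<^sup>2 = (x - y) * (x\<^sup>2 - 2 * x * y - y\<^sup>2)"
            by (simp add: power2_eq_square algebra_simps)
          ultimately show False using main xy by simp
        qed
        then have "half_cert l (d - 1 - 1) (end_sol l (d - 1)) 0" using 5 l by (intro end_sol_half_cert_path) auto
        then show ?thesis using 1 by (simp add: numeral_2_eq_2)
      next
        case 2
        have L4: "L \<ge> 4" using L2 5 2 by simp
        have "L^2 - 5 * L + 3 \<ge> 0" using L3[OF 5] 2 by simp
        then have "(real (k - 1))\<^sup>2 \<le> L * (L - 4)" using L4 2 by (simp add: power2_eq_square algebra_simps)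
        then have "half_cert l (d - 1 - 1) (end_sol l (d - 1)) (k - 1)"
          using l2[OF L4] 5 unfolding lsq[symmetric] by (intro end_sol_half_cert_hyperbolic) auto
        then show ?thesis by (simp add: numeral_2_eq_2)
      next
        case 3
        have Lk: "L \<ge> real k + 2" using L2 5 by simp
        then have L4: "L \<ge> 4" using 3 by simp
        have "(real k + 2) * (real k - 2) \<le> L * (L - 4)" using Lk 3 by (intro mult_mono) auto
        moreover have "(real (k - 1))\<^sup>2 \<le> (real k + 2) * (real k - 2)"
          using 3 by (simp add: of_nat_diff power2_eq_square algebra_simps)
        ultimately have "(real (k - 1))\<^sup>2 \<le> L * (L - 4)" by linarith
        then have "half_cert l (d - 1 - 1) (end_sol l (d - 1)) (k - 1)"
          using l2[OF L4] 5 unfolding lsq[symmetric] by (intro end_sol_half_cert_hyperbolic) auto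
        then show ?thesis by (simp add: numeral_2_eq_2)
      qed
    qed
  qed
  have G4: "half_cert l d (end_sol l (d + 1)) (k - 2)" if k2: "k \<ge> 2"
  proof -
    consider "d = 4" | "d = 5" | "d \<ge> 6" using d by linarith
    then show ?thesis
    proof cases
      case 1
      then show ?thesis using half_cert_length_4[OF l, of "k - 2"] L1 k2 by (simp add: L_def of_nat_diff)
    next
      case 2
      have q: "L^2 - 5 * L + 5 \<ge> 0 \<and> L > 3"
      proof (cases "k = 2")
        case True
        have e: "l * (L - 4) = 3 - L" using d5[OF 2] True by (simp add: algebra_simps)
        then have "L * (L - 4)\<^sup>2 = (3 - L)\<^sup>2" unfolding L_def by (metis power_mult_distrib)
        then have c: "(L - 4) * (L^2 - 5 * L + 5) = 3 * L - 11"
          by (simp add: power2_eq_square algebra_simps)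
        have L3: "L \<ge> 3" using L1 True by simp
        have "L \<noteq> 3" using e l by auto
        then have L3': "L > 3" using L3 by simp
        have "L^2 - 5 * L + 5 \<ge> 0"
        \<comment> \<open>If the quadratic were negative, \<open>L\<close> would be below 4; then
          \<open>c\<close> gives \<open>L > 11 / 3\<close>, and above that value the quadratic is
          positive.\<close>
        proof (rule ccontr)
          assume n: "\<not> ?thesis"
          have L4: "L < 4"
          proof (rule ccontr)
            assume "\<not> ?thesis"
            then have "(L - 4) * (L - 1) \<ge> 0" by simp
            then show False using n by (simp add: power2_eq_square algebra_simps)
          qed
          then have "(L - 4) * (L^2 - 5 * L + 5) > 0" using n by (intro mult_neg_neg) auto
          then have "L > 11 / 3" using c by simp
          then have "(L - 11 / 3) * (L - 4 / 3) \<ge> 0" by simp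
          then show False using n by (simp add: power2_eq_square algebra_simps)
        qed
        then show ?thesis using L3' by simp
      next
        case False
        then have L4: "L \<ge> 4" using L1 k2 by simp
        then have "(L - 4) * (L - 1) \<ge> 0" by simp
        then show ?thesis using L4 by (simp add: power2_eq_square algebra_simps)
      qed
      then show ?thesis using half_cert_length_5[OF l, of "k - 2"] L1 k2 2 by (simp add: L_def of_nat_diff)
    next
      case 3
      have Lk: "L \<ge> real k + 2" using L2 3 by simp
      then have L4: "L \<ge> 4" using k2 by simp
      have "(real k + 2) * (real k - 2) \<le> L * (L - 4)" using Lk k2 by (intro mult_mono) auto
      moreover have "(real (k - 2))\<^sup>2 \<le> (real k + 2) * (real k - 2)"
        using k2 by (simp add: of_nat_diff power2_eq_square algebra_simps)
      ultimately have "(real (k - 2))\<^sup>2 \<le> L * (L - 4)" by linarith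
      then have "half_cert l (d + 1 - 1) (end_sol l (d + 1)) (k - 2)"
        using l2[OF L4] unfolding lsq[symmetric] by (intro end_sol_half_cert_hyperbolic) auto
      then show ?thesis by simp
    qed
  qed
  have "side_conditions l d k k"
    unfolding side_conditions_def using L1 G3 G4 by (simp add: L_def)
  then show ?thesis using hc node pos_iff by blast
qed

section \<open>An odd number of leaves, at least three\<close>

text \<open>The free solution \<open>T\<close>, read from the right end, continues to the left the right half of the
  eigenvector with \<open>k + 1\<close> leaves at the neighbour of the end; on that neighbour's right it is not the
  eigenvector, as the leaves break the recurrence there.\<close>

definition right_sol :: "real => nat => int => real" where
  "right_sol l k z = (real k + 2 - l^2) * chpz l (z - 1) + l * chpz l (z - 2)"

lemma chpz_values: "chpz l 0 = 0" "chpz l 1 = 1" "chpz l (-1) = -1" "chpz l (-2) = - l"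
  by (simp_all add: chpz_def)

lemma right_sol_rec: "right_sol l k (z + 1) = l * right_sol l k z - right_sol l k (z - 1)"
proof -
  have idx: "z + 1 - 1 = z" "z + 1 - 2 = z - 1" "z - 1 - 1 = z - 2" "z - 1 - 2 = z - 3" by auto
  have a: "chpz l z = l * chpz l (z - 1) - chpz l (z - 2)"
    using chpz_rec[of l "z - 1"] by simp
  have b: "chpz l (z - 1) = l * chpz l (z - 2) - chpz l (z - 3)"
    using chpz_rec[of l "z - 2"] by simp
  show ?thesis unfolding right_sol_def idx using a b by Groebner_Basis.algebra
qed

text \<open>Index 0 is the right end. The scale is fixed by \<open>- l\<close> at 1, and tightness
  there with \<open>k + 1\<close> leaves forces \<open>- (k + 2)\<close> at 0. The zeros at 2 and 3
  locate the node: at distance 2 from the end for \<open>l^2 = k + 2\<close>, at distance 3 for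
  \<open>l^2 = k + 3\<close>, and inside the edge between them for values in between.\<close>

lemma right_sol_values:
  "right_sol l k 0 = - (real k + 2)" "right_sol l k 1 = - l" "right_sol l k 2 = real k + 2 - l^2"
  "right_sol l k 3 = l * (real k + 3 - l^2)"
  "right_sol l k 4 = l^2 * (real k + 3 - l^2) - (real k + 2 - l^2)"
proof -
  show a: "right_sol l k 0 = - (real k + 2)" "right_sol l k 1 = - l"
    by (simp_all add: right_sol_def chpz_values power2_eq_square)
  show b: "right_sol l k 2 = real k + 2 - l^2"
    by (simp add: right_sol_def chpz_values)
  show c: "right_sol l k 3 = l * (real k + 3 - l^2)"
    using right_sol_rec[of l k 2] a b by (simp add: algebra_simps)
  show "right_sol l k 4 = l^2 * (real k + 3 - l^2) - (real k + 2 - l^2)"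
    using right_sol_rec[of l k 3] b c by (simp add: algebra_simps power2_eq_square)
qed

text \<open>The halves are one free solution, read from the two ends with opposite signs, so the
  product condition of \<open>path_node\<close> is automatic. Tightness on the right is built into
  \<open>right_sol\<close>, and tightness at \<open>i0\<close> on the left is the only equation left
  for \<open>l\<close>.\<close>

lemma odd_core:
  fixes l :: real and d k p p' i0 :: nat
  defines "S \<equiv> \<lambda>j. right_sol l k (int d - int j)" and "S' \<equiv> \<lambda>j. - right_sol l k (int j)"
  assumes l: "l > 0" and k: "k \<ge> 1" and i0: "1 \<le> i0" "i0 \<le> p" and p': "1 \<le> p'"
    and nd: "(p + p' + 1 = d \<and> S (p + 1) < 0) \<or> (p + p' + 2 = d \<and> S (p + 1) = 0)"
    and pos: "\<And>j. j \<le> p ==> S j > 0" and W: "S 1 \<le> l * S 0"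
    and tight: "real k * chp l (i0 + 1) * S i0 = l * (l * S 0 - S 1)"
    and hi: "i0 < p ==> S (2 * i0 + 2) < 0" and lo: "1 < i0 ==> S (2 * i0) > 0"
    and rneg: "\<And>j. 2 \<le> j ==> j \<le> p' ==> S' j > 0" and r4: "1 < p' ==> S' 4 < 0"
  shows "half_cert l p S k" "half_cert l p' S' (k + 1)" "path_node d p S p' S'"
    "half_tight l p S k i \<longleftrightarrow> i = i0" "half_tight l p' S' (k + 1) i \<longleftrightarrow> i = 1"
proof -
  have sol: "S (j + 2) = l * S (j + 1) - S j" for j
    using right_sol_rec[of l k "int d - int (j + 1)"] unfolding S_def by (simp add: algebra_simps)
  have sol': "S' (j + 2) = l * S' (j + 1) - S' j" for j
    using right_sol_rec[of l k "int (j + 1)"] unfolding S'_def by (simp add: algebra_simps)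
  have SS': "S' j = - S (d - j)" if "j \<le> d" for j
    using that unfolding S_def S'_def by (simp add: of_nat_diff)
  have pd: "p + p' + 1 \<le> d" using nd by auto
  have neg: "S (p + 1) \<le> 0" using nd by auto
  have S'p: "S' (p' + 1) \<le> 0"
  proof -
    have "S' (p' + 1) = - S (d - (p' + 1))" using pd by (intro SS') simp
    moreover have "d - (p' + 1) = p \<or> (d - (p' + 1) = p + 1 \<and> S (p + 1) = 0)" using nd by auto
    ultimately show ?thesis using pos[of p] by auto
  qed
  show node: "path_node d p S p' S'"
  proof -
    have a: "S' (p' + 1) = - S (d - (p' + 1))" "S' p' = - S (d - p')" using pd by (auto intro: SS')
    from nd show ?thesis
    proof
      assume e: "p + p' + 1 = d \<and> S (p + 1) < 0"
      then have "d - (p' + 1) = p" "d - p' = p + 1" by auto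
      then show ?thesis unfolding path_node_def using a e by simp
    next
      assume e: "p + p' + 2 = d \<and> S (p + 1) = 0"
      then have "d - (p' + 1) = p + 1" by auto
      then show ?thesis unfolding path_node_def using a e by simp
    qed
  qed
  have hi': "S (2 * i0 + 2) \<le> 0" if "i0 < p" using hi[OF that] by simp
  have lo': "S (2 * i0) \<ge> 0" if "1 < i0" using lo[OF that] by simp
  have k0: "k > 0" using k by simp
  show "half_cert l p S k"
    by (rule half_cert_midpoint(1)[where ?i0.0 = i0]) fact+
  have "half_tight l p S k i \<longleftrightarrow> 1 \<le> i \<and> i \<le> p \<and>
      (i = i0 \<or> (i = i0 + 1 \<and> S (2 * i0 + 2) = 0) \<or> (i + 1 = i0 \<and> S (2 * i0) = 0))"
    by (rule half_cert_midpoint(2)) fact+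
  moreover have "\<not> (i = i0 + 1 \<and> i \<le> p \<and> S (2 * i0 + 2) = 0)" using hi by auto
  moreover have "\<not> (i + 1 = i0 \<and> 1 \<le> i \<and> S (2 * i0) = 0)" using lo by auto
  ultimately show "half_tight l p S k i \<longleftrightarrow> i = i0" using i0 by blast
  have v: "S' 0 = real k + 2" "S' 1 = l" unfolding S'_def by (simp_all add: right_sol_values)
  have pos': "S' j > 0" if "j \<le> p'" for j
  proof -
    consider "j = 0" | "j = 1" | "2 \<le> j" by linarith
    then show ?thesis using v l rneg[of j] that by cases auto
  qed
  have W': "S' 1 \<le> l * S' 0" using v l k by (simp add: algebra_simps)
  have tight': "real (k + 1) * chp l (1 + 1) * S' 1 = l * (l * S' 0 - S' 1)"
    unfolding v by (simp add: algebra_simps)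
  have hi1: "S' (2 * 1 + 2) \<le> 0" if "1 < p'" using r4[OF that] by simp
  have lo1: "S' (2 * 1) \<ge> 0" if "1 < (1::nat)" using that by simp
  show "half_cert l p' S' (k + 1)"
    by (rule half_cert_midpoint(1)[where ?i0.0 = 1]) (fact | simp)+
  have "half_tight l p' S' (k + 1) i \<longleftrightarrow> 1 \<le> i \<and> i \<le> p' \<and>
      (i = 1 \<or> (i = 1 + 1 \<and> S' (2 * 1 + 2) = 0) \<or> (i + 1 = 1 \<and> S' (2 * 1) = 0))"
    by (rule half_cert_midpoint(2)) (fact | simp)+
  moreover have "\<not> (i = 1 + 1 \<and> i \<le> p' \<and> S' (2 * 1 + 2) = 0)" using r4 by auto
  ultimately show "half_tight l p' S' (k + 1) i \<longleftrightarrow> i = 1" using p' by auto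
qed

text \<open>Coming down from \<open>b\<close>, the first of the values \<open>l S\<^sub>0 - S\<^sub>1, S\<^sub>0, \<dots>, S\<^sub>p\<close> to vanish could only
  be the first one, and there the tightness equation has its left-hand side too large; so its largest
  root comes before.\<close>

lemma tight_root_exists:
  fixes S :: "real => nat => real"
  assumes ab: "a \<le> b"
    and cont: "\<And>j. continuous_on {a..b} (\<lambda>l. S l j)"
    and rec: "\<And>l j. S l (j + 2) = l * S l (j + 1) - S l j"
    and Sp: "\<And>l. a \<le> l ==> l \<le> b ==> S l p > 0"
    and Sb: "\<And>j. j \<le> p ==> S b j > 0" and Wb: "S b 1 < b * S b 0" and i0: "i0 \<le> p" and k: "k > 0"
    and ga: "real k * chp a (i0 + 1) * S a i0 \<ge> a * (a * S a 0 - S a 1)"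
    and gb: "real k * chp b (i0 + 1) * S b i0 < b * (b * S b 0 - S b 1)"
  shows "\<exists>l\<ge>a. l < b \<and> real k * chp l (i0 + 1) * S l i0 = l * (l * S l 0 - S l 1) \<and>
    (\<forall>j\<le>p. S l j > 0) \<and> S l 1 \<le> l * S l 0"
proof -
  define g where "g l = real k * chp l (i0 + 1) * S l i0 - l * (l * S l 0 - S l 1)" for l
  have cg: "continuous_on {a..b} g" unfolding g_def by (intro continuous_intros cont)
  define Z where "Z = {l \<in> {a..b}. g l = 0}"
  have "\<exists>x\<ge>a. x \<le> b \<and> g x = 0"
    by (rule IVT2') (use ga gb ab cg in \<open>auto simp: g_def\<close>)
  then have Zne: "Z \<noteq> {}" by (auto simp: Z_def)
  have clZ: "closed Z"
  proof -
    have "Z = {a..b} \<inter> g -` {0}" by (auto simp: Z_def)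
    then show ?thesis using continuous_on_closed_vimage[of "{a..b}" g] cg
      by (metis closed_atLeastAtMost closed_singleton inf_commute)
  qed
  have "compact ({a..b} \<inter> Z)" using compact_Icc clZ by (rule compact_Int_closed)
  moreover have "{a..b} \<inter> Z = Z" by (auto simp: Z_def)
  ultimately obtain l where lZ: "l \<in> Z" and lmax: "\<And>y. y \<in> Z ==> y \<le> l"
    using compact_attains_sup[of Z] Zne by auto
  have l: "a \<le> l" "l \<le> b" "g l = 0" using lZ unfolding Z_def by auto
  have "l \<noteq> b" using l(3) gb unfolding g_def by auto
  then have lb: "l < b" using l by simp
  have gneg: "g x \<le> 0" if "l \<le> x" "x \<le> b" for x
  proof (rule ccontr)
    assume "\<not> ?thesis"
    then have gx: "g x > 0" by simp
    have "\<exists>y\<ge>x. y \<le> b \<and> g y = 0"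
    proof (rule IVT2')
      show "continuous_on {x..b} g" by (rule continuous_on_subset[OF cg]) (use that l in auto)
    qed (use gx gb that in \<open>auto simp: g_def\<close>)
    then obtain y where y: "x \<le> y" "y \<le> b" "g y = 0" by blast
    then have "y \<in> Z" using that l unfolding Z_def by auto
    then have "y \<le> l" by (rule lmax)
    then have "x = l" using y that by simp
    then show False using gx l by simp
  qed
  define R where "R x j = (case j of 0 => x * S x 0 - S x 1 | Suc i => S x i)" for x j
  have R0: "R x 0 = x * S x 0 - S x 1" and RS: "R x (j + 1) = S x j" for x j unfolding R_def by auto
  have Rrec: "R x (j + 2) = x * R x (j + 1) - R x j" for x j
    using rec[of x "j - 1"] by (cases j) (auto simp: R_def numeral_2_eq_2)
  have cR: "continuous_on {a..b} (\<lambda>x. R x j)" for j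
    by (cases j) (auto simp: R_def intro!: continuous_intros cont cont[of 1, simplified])
  define M where "M x = Min ((\<lambda>j. R x j) ` {..p + 1})" for x
  have Mpos: "M x > 0 \<longleftrightarrow> (\<forall>j\<le>p + 1. R x j > 0)" for x unfolding M_def by (auto simp: Min_gr_iff)
  have Mnn: "M x \<ge> 0 \<longleftrightarrow> (\<forall>j\<le>p + 1. R x j \<ge> 0)" for x unfolding M_def by (auto simp: Min_ge_iff)
  have cM: "continuous_on {a..b} M"
  proof -
    have "continuous_on {a..b} (\<lambda>x. Min ((\<lambda>j. R x j) ` {..q}))" for q
    proof (induction q)
      case 0 then show ?case using cR[of 0] by simp
    next
      case (Suc q)
      have "Min ((\<lambda>j. R x j) ` {..Suc q}) = min (R x (Suc q)) (Min ((\<lambda>j. R x j) ` {..q}))" for x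
        by (simp add: atMost_Suc)
      then show ?case using Suc cR[of "Suc q"] by (simp add: continuous_on_min)
    qed
    then show ?thesis unfolding M_def .
  qed
  have no_zero: "M x \<noteq> 0" if x: "l \<le> x" "x \<le> b" for x
  proof
    assume M0: "M x = 0"
    then have nn: "R x j \<ge> 0" if "j \<le> p + 1" for j using Mnn[of x] that by simp
    have "Min ((\<lambda>j. R x j) ` {..p + 1}) \<in> (\<lambda>j. R x j) ` {..p + 1}" by (intro Min_in) auto
    then obtain j where "j \<in> {..p + 1}" "Min ((\<lambda>j. R x j) ` {..p + 1}) = R x j" by (rule imageE)
    then have j: "j \<le> p + 1" "R x j = 0" using M0 unfolding M_def by auto
    have xp: "R x (p + 1) > 0" using Sp[of x] x l RS by simp
    have zero_above: "R x (i + n) = 0 \<and> R x (i + n + 1) = 0" if "R x i = 0" "R x (i + 1) = 0" for i n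
    proof (induction n)
      case (Suc n)
      then show ?case using Rrec[of x "i + n"] by simp
    qed (use that in simp)
    have next_pos: "R x (i + 1) > 0" if "i \<le> p + 1" "R x i = 0" for i
    proof -
      have "i \<noteq> p + 1" using that xp by auto
      then have ip: "i \<le> p" using that by simp
      have "R x (i + 1) \<noteq> 0"
      proof
        assume "R x (i + 1) = 0"
        then show False using zero_above[of i "p + 1 - i"] that ip xp by simp
      qed
      then show ?thesis using nn[of "i + 1"] ip by simp
    qed
    have only0: "i = 0" if "i \<le> p + 1" "R x i = 0" for i
    proof (rule ccontr)
      assume "i \<noteq> 0"
      then obtain q where q: "i = q + 1" by (metis Suc_eq_plus1 not0_implies_Suc)
      have "R x q = - R x (q + 2)" using Rrec[of x q] that q by simp
      then show False using next_pos[OF that] nn[of q] that q by simp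
    qed
    have W: "R x 0 = 0" using j only0 by auto
    have Si: "S x i0 > 0" using nn[of "i0 + 1"] only0[of "i0 + 1"] i0 RS[of x i0] by (cases "S x i0 = 0") auto
    have S0: "S x 0 > 0" using next_pos[OF _ W] RS[of x 0] by simp
    have "R x (i0 + 1) = R x 1 * chp x (i0 + 1) - R x 0 * chp x i0"
      by (rule solution_formula) (rule Rrec)
    then have "S x i0 = S x 0 * chp x (i0 + 1)" using W RS[of x i0] RS[of x 0] by simp
    then have "chp x (i0 + 1) > 0" using Si S0 by (simp add: zero_less_mult_iff)
    then have "g x > 0" using W Si k unfolding g_def R0[symmetric] by simp
    then show False using gneg[OF x] by simp
  qed
  have "M l > 0"
  proof (rule ccontr)
    assume "\<not> ?thesis"
    then have Ml: "M l \<le> 0" by simp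
    have Rb: "R b j > 0" if "j \<le> p + 1" for j using Sb[of "j - 1"] Wb that by (cases j) (auto simp: R_def)
    have "\<exists>x\<ge>l. x \<le> b \<and> M x = 0"
    proof (rule IVT')
      show "0 \<le> M b" using Mpos[of b] Rb by (simp add: less_imp_le)
      show "continuous_on {l..b} M" by (rule continuous_on_subset[OF cM]) (use l in auto)
    qed (use Ml lb in auto)
    then show False using no_zero by blast
  qed
  then have Rl: "R l j > 0" if "j \<le> p + 1" for j using Mpos that by blast
  have "\<forall>j\<le>p. S l j > 0" using Rl[of "j + 1" for j] RS by auto
  moreover have "S l 1 \<le> l * S l 0" using Rl[of 0] R0[of l] by simp
  ultimately show ?thesis using l lb unfolding g_def by (intro exI[of _ l]) auto
qed

text \<open>\<open>sqrt (k + 2)\<close> is the spectral radius of the star formed by a vertex, its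
  \<open>k\<close> leaves and its two path neighbours. At this \<open>l\<close> the factor on the
  left is \<open>k\<close>, and the bracket on the right is the excess of the load over what the
  half ending at \<open>n\<close> supports: the rest of the path pushes the true value of
  \<open>l\<close> upwards.\<close>

lemma star_identity:
  assumes "i \<ge> 1" "i + 2 \<le> n"
  shows "(l^2 - 2) * (chp l (i + 1) * chp l (n - i)) =
    l * chp l (n + 1) + (chp l (i - 1) * chp l (n - i) + chp l (i + 1) * chp l (n - i - 2))"
proof -
  have w: "chp l (i + 2) * chp l (n - i) - chp l (i + 1) * chp l (n - (i + 1)) = l * chp l (n - 0) - chp l (n - 1)"
  proof (rule chp_wronskian[of i "end_sol l n" l])
    fix j assume "j < i"
    then have "n - j = (n - (j + 2)) + 2" "n - (j + 1) = (n - (j + 2)) + 1" using assms by auto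
    then show "chp l (n - (j + 2)) = l * chp l (n - (j + 1)) - chp l (n - j)" by simp
  qed
  obtain m where m: "n = m + 1" using assms by (metis Suc_eq_plus1 le_zero_eq not0_implies_Suc add_is_0 zero_neq_numeral)
  have c: "l * chp l (n - 0) - chp l (n - 1) = chp l (n + 1)" using m by simp
  obtain q where q: "i = q + 1" using assms by (metis add.commute le_add_diff_inverse)
  have a: "chp l (i + 2) = l * chp l (i + 1) - chp l i" "chp l (i + 1) = l * chp l i - chp l (i - 1)" using q by simp_all
  obtain r where r: "n - i = r + 2" using assms by (metis add.commute le_add_diff_inverse add_le_imp_le_diff)
  have e: "n - (i + 1) = r + 1" "n - i - 2 = r" using r by auto
  have b: "chp l (n - i) = l * chp l (n - (i + 1)) - chp l (n - i - 2)" unfolding r e by simp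
  have "y = l * x - u ==> x = l * u - v ==> Q = l * R - T ==> y * Q - x * R = C ==>
      (l^2 - 2) * (x * Q) = l * C + (v * Q + x * T)" for x Q R T y u v C :: real
    by Groebner_Basis.algebra
  from this[OF a b w[unfolded c]] show ?thesis .
qed

lemma continuous_on_right_sol: "continuous_on A (\<lambda>l. right_sol l k z)"
proof -
  have c: "continuous_on A (\<lambda>l. chpz l z)" for z
    unfolding chpz_def by (cases "z \<ge> 0") (auto intro!: continuous_intros)
  show ?thesis unfolding right_sol_def by (intro continuous_intros c)
qed

lemma chp_at_2: "chp 2 n = real n"
  by (induction n rule: induct_nat_012) auto

lemma right_sol_at_2: "right_sol 2 (Suc 0) z = real_of_int z - 3"
proof -
  have "chpz 2 z = real_of_int z" for z unfolding chpz_def by (auto simp: chp_at_2)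
  then show ?thesis by (simp add: right_sol_def)
qed

text \<open>Collects what \<open>odd_core\<close> asks for, so that a suitable \<open>l\<close> can
  be found separately for each range of \<open>d\<close> and \<open>k\<close>.\<close>

definition odd_data :: "real => nat => nat => nat => nat => nat => bool" where
  "odd_data l d k p p' i0 \<longleftrightarrow> (let S = (\<lambda>j. right_sol l k (int d - int j)) in
     l > 0 \<and> 1 \<le> i0 \<and> i0 \<le> p \<and> 1 \<le> p' \<and>
     ((p + p' + 1 = d \<and> S (p + 1) < 0) \<or> (p + p' + 2 = d \<and> S (p + 1) = 0)) \<and>
     (\<forall>j\<le>p. S j > 0) \<and> S 1 \<le> l * S 0 \<and>
     real k * chp l (i0 + 1) * S i0 = l * (l * S 0 - S 1) \<and>
     (i0 < p --> S (2 * i0 + 2) < 0) \<and> (1 < i0 --> S (2 * i0) > 0) \<and>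
     (\<forall>j. 2 \<le> j --> j \<le> p' --> right_sol l k (int j) < 0) \<and> (1 < p' --> right_sol l k 4 > 0))"

lemma odd_dataI:
  assumes "l > 0" "1 \<le> i0" "i0 \<le> p" "1 \<le> p'"
    and "(p + p' + 1 = d \<and> right_sol l k (int d - int (p + 1)) < 0) \<or>
      (p + p' + 2 = d \<and> right_sol l k (int d - int (p + 1)) = 0)"
    and pos: "\<And>j. j \<le> p ==> right_sol l k (int d - int j) > 0"
    and W: "right_sol l k (int d - 1) \<le> l * right_sol l k (int d)"
    and t: "real k * chp l (i0 + 1) * right_sol l k (int d - int i0) =
      l * (l * right_sol l k (int d) - right_sol l k (int d - 1))"
    and hi: "i0 < p ==> right_sol l k (int d - int (2 * i0 + 2)) < 0"
    and lo: "1 < i0 ==> right_sol l k (int d - int (2 * i0)) > 0"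
    and r: "\<And>j. 2 \<le> j ==> j \<le> p' ==> right_sol l k (int j) < 0"
    and t4: "1 < p' ==> right_sol l k 4 > 0"
  shows "odd_data l d k p p' i0"
proof -
  have e: "int d - int 0 = int d" "int d - int 1 = int d - 1" by simp_all
  show ?thesis unfolding odd_data_def Let_def e
    by (intro conjI allI impI) (rule assms; assumption)+
qed

lemma odd_data_certs:
  assumes "odd_data l d k p p' i0" and k: "k \<ge> 1"
  defines "S \<equiv> \<lambda>j. right_sol l k (int d - int j)" and "S' \<equiv> \<lambda>j. - right_sol l k (int j)"
  shows "half_cert l p S k" "half_cert l p' S' (k + 1)" "path_node d p S p' S'"
    "half_tight l p S k i \<longleftrightarrow> i = i0" "half_tight l p' S' (k + 1) i \<longleftrightarrow> i = 1"
proof -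
  have e: "int d - int 0 = int d" "int d - int 1 = int d - 1" by simp_all
  note D = assms(1)[unfolded odd_data_def Let_def]
  note D1 = D[THEN conjunct1] D[THEN conjunct2, THEN conjunct1] D[THEN conjunct2, THEN conjunct2, THEN conjunct1]
  note E = D[THEN conjunct2, THEN conjunct2, THEN conjunct2]
  note D2 = E[THEN conjunct1] E[THEN conjunct2, THEN conjunct1]
    E[THEN conjunct2, THEN conjunct2, THEN conjunct1, rule_format]
  note F = E[THEN conjunct2, THEN conjunct2, THEN conjunct2]
  note D3 = F[THEN conjunct1] F[THEN conjunct2, THEN conjunct1]
    F[THEN conjunct2, THEN conjunct2, THEN conjunct1, rule_format]
  note G = F[THEN conjunct2, THEN conjunct2, THEN conjunct2]
  note D4 = G[THEN conjunct1, rule_format] G[THEN conjunct2, THEN conjunct1, rule_format]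
    G[THEN conjunct2, THEN conjunct2, rule_format]
  have r: "- right_sol l k (int j) > 0" if "2 \<le> j" "j \<le> p'" for j using D4(2)[OF that] by simp
  have r4: "- right_sol l k (int 4) < 0" if "1 < p'" using D4(3)[OF that] by simp
  note core = odd_core[OF D1(1) k D1(2,3) D2, OF _ D3(1,2,3) D4(1) r r4]
  show "half_cert l p S k" "half_cert l p' S' (k + 1)" "path_node d p S p' S'"
    "half_tight l p S k i \<longleftrightarrow> i = i0" "half_tight l p' S' (k + 1) i \<longleftrightarrow> i = 1"
    unfolding S_def S'_def by (rule core; assumption)+
qed

lemma right_sol_step: "right_sol l k (int d - int (j + 2)) = l * right_sol l k (int d - int (j + 1)) - right_sol l k (int d - int j)"
  using right_sol_rec[of l k "int d - int (j + 1)"] by (simp add: algebra_simps)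

lemma right_sol_lW: "l * right_sol l k (int d) - right_sol l k (int d - 1) = right_sol l k (int d + 1)"
  using right_sol_rec[of l k "int d"] by simp

text \<open>For \<open>l^2\<close> strictly between \<open>k + 2\<close> and \<open>k + 3\<close>
  the node lies in the edge between distances 2 and 3 from the right end, and then the midpoint rule
  selects \<open>(d - 3) div 2\<close>.\<close>

lemma odd_data_tail:
  assumes d: "d \<ge> 6" and l: "l > 0" and L: "real k + 2 < l^2" "l^2 < real k + 3"
    and pos: "\<And>j. j \<le> d - 4 ==> right_sol l k (int d - int j) > 0"
    and W: "right_sol l k (int d - 1) \<le> l * right_sol l k (int d)"
    and tight: "real k * chp l ((d - 3) div 2 + 1) * right_sol l k (int d - int ((d - 3) div 2)) =
      l * (l * right_sol l k (int d) - right_sol l k (int d - 1))"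
  shows "odd_data l d k (d - 3) 2 ((d - 3) div 2)"
proof -
  let ?i = "(d - 3) div 2"
  note v = right_sol_values[of l k]
  have t3: "right_sol l k 3 > 0" using v(4) l L by simp
  have t2: "right_sol l k 2 < 0" using v(3) L by simp
  have t4: "right_sol l k 4 > 0"
  proof -
    have "l^2 * (real k + 3 - l^2) \<ge> 0" using L by simp
    then show ?thesis unfolding v(5) using L by linarith
  qed
  have t1: "right_sol l k 1 < 0" using v l by simp
  have pos': "right_sol l k (int d - int j) > 0" if "j \<le> d - 3" for j
  proof (cases "j = d - 3")
    case True
    then have "int d - int j = 3" using d by simp
    then show ?thesis using t3 by simp
  next
    case False then show ?thesis using that by (intro pos) auto
  qed
  have nd: "int d - int (d - 3 + 1) = 2" using d by simp
  have hi: "right_sol l k (int d - int (2 * ?i + 2)) < 0"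
  proof -
    have "int d - int (2 * ?i + 2) = 1 \<or> int d - int (2 * ?i + 2) = 2" using d by presburger
    then show ?thesis using t1 t2 by (elim disjE) (simp_all only:)
  qed
  have lo: "right_sol l k (int d - int (2 * ?i)) > 0"
  proof -
    have "int d - int (2 * ?i) = 3 \<or> int d - int (2 * ?i) = 4" using d by presburger
    then show ?thesis using t3 t4 by (elim disjE) (simp_all only:)
  qed
  have r: "right_sol l k (int j) < 0" if "2 \<le> j" "j \<le> 2" for j
  proof -
    have "int j = 2" using that by simp
    then show ?thesis using t2 by simp
  qed
  have i: "1 \<le> ?i" "?i \<le> d - 3" "d - 3 + 2 + 1 = d" "(1::nat) \<le> 2" using d by auto
  have n: "right_sol l k (int d - int (d - 3 + 1)) < 0" unfolding nd using t2 .
  show ?thesis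
    by (rule odd_dataI; (rule l i(1,2,4) disjI1[OF conjI[OF i(3) n]] lo hi pos' W tight r t4); assumption?)
qed

lemma odd_exists_4:
  assumes k: "k \<ge> 1"
  shows "\<exists>l. odd_data l 4 k 2 1 1 \<and> l^2 > real k + 1"
proof -
  \<comment> \<open>Substituting \<open>l^2 = k + 1 + u\<close> turns tightness at 1 into
    \<open>u^2 = 3 * u - 1\<close>, independently of \<open>k\<close>; this is its root below
    1.\<close>
  define u :: real where "u = (3 - sqrt 5) / 2"
  have s5: "sqrt 5 < 3" "1 < sqrt (5::real)" by (auto intro: real_less_lsqrt real_less_rsqrt)
  have u: "0 < u" "u < 1" using s5 by (auto simp: u_def)
  have uu: "u * u = 3 * u - 1"
  proof -
    have "2 * u = 3 - s ==> s * s = 5 ==> u * u = 3 * u - 1" for s :: real by Groebner_Basis.algebra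
    from this[of "sqrt 5"] show ?thesis by (simp add: u_def)
  qed
  define l where "l = sqrt (real k + 1 + u)"
  have L: "l^2 = real k + 1 + u" unfolding l_def using u by simp
  have l: "l > 0" unfolding l_def using u by simp
  have ll: "l * l = real k + 1 + u" using L by (simp add: power2_eq_square)
  note v = right_sol_values[of l k, unfolded L]
  have t2: "right_sol l k 2 > 0" using v(3) u by simp
  have t3: "right_sol l k 3 = l * (2 - u)" using v(4) by simp
  have t4: "right_sol l k 4 = (real k + 1 + u) * (2 - u) - (1 - u)" using v(5) by simp
  have t4b: "right_sol l k 4 = 2 * real k + 2 - real k * u - u" unfolding t4 by (simp add: algebra_simps uu)
  have ku: "real k * u \<le> real k" using u by (simp add: mult_left_le)
  have t4p: "right_sol l k 4 > 0" unfolding t4b using ku u by linarith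
  have W: "l * right_sol l k 4 - right_sol l k 3 = l * (2 * real k - real k * u)"
    unfolding t4b t3 by (simp add: algebra_simps)
  have Wp: "l * right_sol l k 4 - right_sol l k 3 \<ge> 0"
    unfolding W using l ku by simp
  have tight: "real k * chp l (1 + 1) * right_sol l k 3 = l * (l * right_sol l k 4 - right_sol l k 3)"
    unfolding W unfolding t3 by (simp add: algebra_simps)
  have pos: "right_sol l k (int 4 - int j) > 0" if "j \<le> 2" for j
  proof -
    have "j = 0 \<or> j = 1 \<or> j = 2" using that by linarith
    then show ?thesis using t2 t3 t4p l u by auto
  qed
  have "odd_data l 4 k 2 1 1"
  proof (rule odd_dataI)
    have "int 4 - int (2 + 1) = 1" "int 4 - int (2 * 1 + 2) = 0" by simp_all
    then show "(2 + 1 + 1 = 4 \<and> right_sol l k (int 4 - int (2 + 1)) < 0) \<or>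
        (2 + 1 + 2 = 4 \<and> right_sol l k (int 4 - int (2 + 1)) = 0)"
      "right_sol l k (int 4 - int (2 * 1 + 2)) < 0" using v(1,2) l by simp_all
  qed (use l pos Wp tight in simp_all)
  then show ?thesis using L u by (intro exI[of _ l]) simp
qed

text \<open>The one diameter for which the node is exactly the vertex at distance 2 from the right
  end, which makes \<open>l\<close> explicit.\<close>

lemma odd_exists_5:
  assumes k: "k \<ge> 1"
  shows "\<exists>l. odd_data l 5 k 2 1 1 \<and> l^2 = real k + 2"
proof -
  define l where "l = sqrt (real k + 2)"
  have L: "l^2 = real k + 2" unfolding l_def by simp
  have l: "l > 0" unfolding l_def by simp
  note v = right_sol_values[of l k, unfolded L]
  have t2: "right_sol l k 2 = 0" using v(3) by simp
  have t3: "right_sol l k 3 = l" using v(4) by simp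
  have t4: "right_sol l k 4 = real k + 2" using v(5) by simp
  have t5: "right_sol l k 5 = l * (real k + 1)" using right_sol_rec[of l k 4] t3 t4 by (simp add: algebra_simps)
  have W: "l * right_sol l k 5 - right_sol l k 4 = (real k + 2) * real k"
  proof -
    have "l * right_sol l k 5 = l^2 * (real k + 1)" unfolding t5 by (simp add: power2_eq_square)
    then show ?thesis unfolding L t4 by (simp add: algebra_simps)
  qed
  have tight: "real k * chp l (1 + 1) * right_sol l k 4 = l * (l * right_sol l k 5 - right_sol l k 4)"
    unfolding W unfolding t4 by (simp add: algebra_simps)
  have Wp: "l * right_sol l k 5 - right_sol l k 4 \<ge> 0" unfolding W by simp
  have pos: "right_sol l k (int 5 - int j) > 0" if "j \<le> 2" for j
  proof -
    have "j = 0 \<or> j = 1 \<or> j = 2" using that by linarith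
    then show ?thesis using t3 t4 t5 l by auto
  qed
  have "odd_data l 5 k 2 1 1"
  proof (rule odd_dataI)
    have "int 5 - int (2 + 1) = 2" "int 5 - int (2 * 1 + 2) = 1" by simp_all
    then show "(2 + 1 + 1 = 5 \<and> right_sol l k (int 5 - int (2 + 1)) < 0) \<or>
        (2 + 1 + 2 = 5 \<and> right_sol l k (int 5 - int (2 + 1)) = 0)"
      "right_sol l k (int 5 - int (2 * 1 + 2)) < 0" using v(1,2) t2 l by simp_all
  qed (use l pos Wp tight in simp_all)
  then show ?thesis using L by blast
qed

text \<open>At \<open>l^2 = k + 2\<close> the solution \<open>right_sol\<close> is a multiple of
  \<open>chpz\<close> shifted by 2, so that it vanishes at distance 2 from the end, and
  \<open>star_identity\<close> decides the sign of the tightness equation.\<close>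

lemma right_sol_star:
  assumes d: "d \<ge> 6" and l: "l > 0" "l^2 = real k + 2"
    and pos: "\<And>n. 1 \<le> n ==> n \<le> d div 2 ==> chp l n > 0"
  shows "l * (l * right_sol l k (int d) - right_sol l k (int d - 1)) <
    real k * chp l ((d - 3) div 2 + 1) * right_sol l k (int d - int ((d - 3) div 2))"
proof -
  let ?i = "(d - 3) div 2"
  define n where "n = d - 2"
  have i: "?i \<ge> 1" "?i + 3 \<le> n" using d by (auto simp: n_def)
  have T: "right_sol l k z = l * chpz l (z - 2)" for z using l unfolding right_sol_def by simp
  have a: "right_sol l k (int d - int ?i) = l * chp l (n - ?i)"
  proof -
    have "nat (int d - int ?i - 2) = n - ?i" "int d - int ?i - 2 \<ge> 0" using d unfolding n_def by auto
    then show ?thesis unfolding T chpz_def by simp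
  qed
  have b: "l * right_sol l k (int d) - right_sol l k (int d - 1) = l * chp l (n + 1)"
  proof -
    have "nat (int d + 1 - 2) = n + 1" "int d + 1 - 2 \<ge> 0" using d unfolding n_def by auto
    then show ?thesis unfolding right_sol_lW unfolding T chpz_def by simp
  qed
  have st: "real k * (chp l (?i + 1) * chp l (n - ?i)) =
    l * chp l (n + 1) + (chp l (?i - 1) * chp l (n - ?i) + chp l (?i + 1) * chp l (n - ?i - 2))"
    using star_identity[of ?i n l] i l by simp
  have p1: "chp l (?i + 1) > 0" "chp l (n - ?i - 2) > 0" using d by (auto intro!: pos simp: n_def)
  have p2: "chp l (?i - 1) * chp l (n - ?i) \<ge> 0"
  proof (cases "?i = 1")
    case False
    have "chp l (?i - 1) > 0" using False i d by (intro pos; presburger)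
    moreover have "chp l (n - ?i) > 0" using d by (intro pos) (auto simp: n_def)
    ultimately show ?thesis by simp
  qed simp
  have "chp l (?i + 1) * chp l (n - ?i - 2) > 0" using p1 by simp
  then have "l * (l * chp l (n + 1)) < l * (real k * (chp l (?i + 1) * chp l (n - ?i)))"
    unfolding st using p2 l by simp
  then show ?thesis unfolding a b by (simp add: mult_ac del: chp.simps)
qed

text \<open>The load is too large at \<open>l^2 = k + 2\<close> by \<open>right_sol_star\<close>. At
  \<open>l^2 = k + 3\<close> it is too small by the hyperbolic criterion, because
  \<open>(k + 3) * (k - 1) > k^2\<close> for \<open>k \<ge> 2\<close>. On the whole interval
  \<open>l \<ge> 2\<close>, which also keeps \<open>S\<close> positive.\<close>

lemma odd_exists_large_load:
  assumes d: "d \<ge> 6" and k: "k \<ge> 2"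
  shows "\<exists>l. odd_data l d k (d - 3) 2 ((d - 3) div 2) \<and> l^2 > real k + 2"
proof -
  let ?i = "(d - 3) div 2"
  let ?g = "\<lambda>l. real k * chp l (?i + 1) * right_sol l k (int d - int ?i) -
    l * (l * right_sol l k (int d) - right_sol l k (int d - 1))"
  define a where "a = sqrt (real k + 2)"
  define b where "b = sqrt (real k + 3)"
  have a2: "a\<^sup>2 = real k + 2" "a > 0" "a \<ge> 2" and b2: "b\<^sup>2 = real k + 3" "b > 0" "b \<ge> 2" and ab: "a \<le> b"
    using k unfolding a_def b_def by (auto intro: real_le_rsqrt)
  have ga: "?g a > 0"
  proof -
    have apos: "chp a n > 0" if "1 \<le> n" for n using chp_pos_ge_2[OF a2(3), of "n - 1"] that by simp
    have "a * (a * right_sol a k (int d) - right_sol a k (int d - 1)) <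
      real k * chp a (?i + 1) * right_sol a k (int d - int ?i)"
      by (rule right_sol_star[OF d a2(2,1)]) (rule apos)
    then show ?thesis by simp
  qed
  have gb: "?g b < 0"
  proof -
    have "real k * chp b (?i + 1) * right_sol b k (int d - int ?i) <
        b * (b * right_sol b k (int d - int 0) - right_sol b k (int d - int 1))"
    proof (rule half_cert_hyperbolic(3)[OF b2(3)])
      show "right_sol b k (int d - int (j + 2)) = b * right_sol b k (int d - int (j + 1)) - right_sol b k (int d - int j)" for j
        by (rule right_sol_step)
      have "int d - int (d - 4) = 4" "int d - int (d - 4 + 1) = 3" using d by auto
      then show "0 < right_sol b k (int d - int (d - 4))" "right_sol b k (int d - int (d - 4 + 1)) \<le> 0"
        using right_sol_values(4,5)[of b k] b2(1) by simp_all
      have s: "(b\<^sup>2)\<^sup>2 - 4 * b\<^sup>2 = (real k)\<^sup>2 + 2 * real k - 3"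
        unfolding b2(1) by (simp add: power2_eq_square algebra_simps)
      show "(real k)\<^sup>2 \<le> (b\<^sup>2)\<^sup>2 - 4 * b\<^sup>2" "(real k)\<^sup>2 < (b\<^sup>2)\<^sup>2 - 4 * b\<^sup>2" unfolding s using k by simp_all
    qed (use d in simp)
    then show ?thesis by simp
  qed
  have "continuous_on {a..b} ?g" by (intro continuous_intros continuous_on_right_sol)
  then have "\<exists>x\<ge>a. x \<le> b \<and> ?g x = 0"
    using ga gb by (intro IVT2'[OF _ _ ab]) (simp_all only: less_imp_le)
  then obtain l where l: "a \<le> l" "l \<le> b" "?g l = 0" by blast
  have "l \<noteq> a" using l(3) ga by auto
  moreover have "l \<noteq> b" using l(3) gb by auto
  ultimately have lab: "a < l" "l < b" using l by auto
  have l2: "l \<ge> 2" using l a2 by simp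
  have L: "real k + 2 < l^2" "l^2 < real k + 3"
    using power_strict_mono[OF lab(1), of 2] power_strict_mono[OF lab(2), of 2] a2 b2 l2 by simp_all
  have hc: "half_cert l (d - 3) (\<lambda>j. right_sol l k (int d - int j)) 0"
  proof (rule half_cert_hyperbolic(1)[OF l2])
    have "int d - int (d - 3) = 3" "int d - int (d - 3 + 1) = 2" using d by auto
    then show "0 < right_sol l k (int d - int (d - 3))" "right_sol l k (int d - int (d - 3 + 1)) \<le> 0"
      using right_sol_values(3,4)[of l k] L l2 by simp_all
    have "l^2 * (l^2 - 4) \<ge> 0" using L k by simp
    then show "(real 0)\<^sup>2 \<le> (l^2)\<^sup>2 - 4 * l^2" by (simp add: power2_eq_square algebra_simps)
  qed (rule right_sol_step)
  have "odd_data l d k (d - 3) 2 ?i"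
    by (rule odd_data_tail[OF d _ L]) (use half_certD(2,4)[OF hc] l(3) l2 in \<open>auto simp del: chp.simps\<close>)
  then show ?thesis using L by blast
qed

text \<open>Here the root lies between \<open>sqrt 3\<close> and 2, out of reach of the hyperbolic
  criterion, so \<open>tight_root_exists\<close> has to keep track of positivity. At 2 the solutions
  are linear in the index.\<close>

lemma odd_exists_three_short:
  assumes d: "6 \<le> d" "d \<le> 9"
  shows "\<exists>l. odd_data l d 1 (d - 3) 2 ((d - 3) div 2) \<and> l^2 > 3"
proof -
  let ?i = "(d - 3) div 2"
  define a where "a = sqrt (3::real)"
  have a2: "a\<^sup>2 = 3" "a > 0" "a \<le> 2" unfolding a_def by (auto intro: real_le_lsqrt)
  let ?S = "\<lambda>l j. right_sol l 1 (int d - int j)"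
  have apos: "chp a n > 0" if "1 \<le> n" "n \<le> d div 2" for n
  proof -
    have "n = 1 \<or> n = 2 \<or> n = 3 \<or> n = 4" using that d by auto
    then show ?thesis using a2 chp_values[of a] by auto
  qed
  have ga: "a * (a * ?S a 0 - ?S a 1) < real 1 * chp a (?i + 1) * ?S a ?i"
    using right_sol_star[of d a 1] d a2 apos by simp
  have "\<exists>l\<ge>a. l < 2 \<and> real 1 * chp l (?i + 1) * ?S l ?i = l * (l * ?S l 0 - ?S l 1) \<and>
    (\<forall>j\<le>d - 4. ?S l j > 0) \<and> ?S l 1 \<le> l * ?S l 0"
  proof (rule tight_root_exists)
    show "?S l (d - 4) > 0" if "a \<le> l" "l \<le> 2" for l
    proof -
      have e: "int d - int (d - 4) = 4" using d by simp
      have L: "3 \<le> l^2" "l^2 \<le> 4"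
        using power_mono[OF that(1), of 2] power_mono[OF that(2), of 2] a2 that by auto
      have "3 * (4 - l^2) \<le> l^2 * (4 - l^2)" using L by (intro mult_right_mono) auto
      then show ?thesis unfolding e right_sol_values(5) using L by simp
    qed
    show "?S 2 1 < 2 * ?S 2 0" using d by (simp add: right_sol_at_2)
    show "?S 2 j > 0" if "j \<le> d - 4" for j
      using that d by (simp add: right_sol_at_2)
    have "d = 6 \<or> d = 7 \<or> d = 8 \<or> d = 9" using d by linarith
    then show "real 1 * chp 2 (?i + 1) * ?S 2 ?i < 2 * (2 * ?S 2 0 - ?S 2 1)"
      by (elim disjE) (simp_all add: right_sol_at_2 chp_at_2 del: chp.simps)
    show "continuous_on {a..2} (\<lambda>l. ?S l j)" for j by (rule continuous_on_right_sol)
    show "?S l (j + 2) = l * ?S l (j + 1) - ?S l j" for l j by (rule right_sol_step)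
    show "a * (a * ?S a 0 - ?S a 1) \<le> real 1 * chp a (?i + 1) * ?S a ?i" using ga by simp
    show "?i \<le> d - 4" using d by auto
  qed (use a2 in auto)
  then obtain l where l: "a \<le> l" "l < 2" "real 1 * chp l (?i + 1) * ?S l ?i = l * (l * ?S l 0 - ?S l 1)"
    "\<forall>j\<le>d - 4. ?S l j > 0" "?S l 1 \<le> l * ?S l 0" by blast
  have "l \<noteq> a" using l(3) ga by auto
  then have al: "a < l" using l(1) by simp
  have L: "3 < l^2" "l^2 < 4"
    using power_strict_mono[OF al, of 2] power_strict_mono[OF l(2), of 2] a2 al by auto
  have "odd_data l d 1 (d - 3) 2 ?i"
    by (rule odd_data_tail) (use d l L al a2 in auto)
  then show ?thesis using L by blast
qed

text \<open>The transition between the two regimes: the root is exactly 2, and the node is the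
  vertex at distance 3 from the right end.\<close>

lemma odd_exists_three_10: "odd_data 2 10 1 6 2 3"
proof -
  have w: "right_sol 2 (Suc 0) z = real_of_int z - 3" for z by (rule right_sol_at_2)
  show ?thesis by (rule odd_dataI) (simp_all add: w chp_at_2 del: chp.simps)
qed

text \<open>From \<open>d = 11\<close> on the root exceeds 2, that is, \<open>l^2 > k + 3\<close>.
  The node has passed into the edge between distances 3 and 4, which shifts the midpoint from
  \<open>(d - 3) div 2\<close> to \<open>(d - 4) div 2\<close>.\<close>

lemma odd_exists_three_long:
  assumes d: "d \<ge> 11"
  shows "\<exists>l. odd_data l d 1 (d - 4) 3 ((d - 4) div 2) \<and> l > 2"
proof -
  let ?i = "(d - 4) div 2"
  let ?g = "\<lambda>l. real 1 * chp l (?i + 1) * right_sol l 1 (int d - int ?i) -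
    l * (l * right_sol l 1 (int d) - right_sol l 1 (int d - 1))"
  \<comment> \<open>The upper end has to satisfy \<open>b^2 * (b^2 - 4) \<ge> 1\<close>, so that one
    leaf is supported, and \<open>(b^2 - 4) * (b^2 - 1) < 1\<close>, so that
    \<open>right_sol\<close> stays positive at 4. The value \<open>17 / 4\<close> for
    \<open>b^2\<close> does both.\<close>
  define b where "b = sqrt (17 / 4 :: real)"
  have b2: "b\<^sup>2 = 17 / 4" "b \<ge> 2" unfolding b_def by (auto intro: real_le_rsqrt)
  have ga: "?g 2 > 0"
  proof -
    have "?g 2 = (real ?i + 1) * (real d - real ?i - 3) - 2 * (real d - 2)"
      by (simp add: right_sol_at_2 chp_at_2 del: chp.simps)
    moreover have "\<exists>r. r \<ge> 5 \<and> ((d = 2 * r \<and> r \<ge> 6 \<and> ?i = r - 2) \<or> (d = 2 * r + 1 \<and> ?i = r - 2))"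
      using d by presburger
    then obtain r where r: "r \<ge> 5" "(d = 2 * r \<and> r \<ge> 6 \<and> ?i = r - 2) \<or> (d = 2 * r + 1 \<and> ?i = r - 2)" by blast
    define x where "x = real r"
    from r(2) have "(real ?i + 1) * (real d - real ?i - 3) - 2 * (real d - 2) > 0"
    proof
      assume a: "d = 2 * r \<and> r \<ge> 6 \<and> ?i = r - 2"
      then have e: "real d = 2 * x" "real ?i = x - 2" "x \<ge> 6" by (auto simp: x_def of_nat_diff)
      have "(x - 1) * (x - 5) > 0" using e by simp
      then show ?thesis unfolding e(1,2) by (simp add: algebra_simps)
    next
      assume a: "d = 2 * r + 1 \<and> ?i = r - 2"
      then have e: "real d = 2 * x + 1" "real ?i = x - 2" "x \<ge> 5" using r by (auto simp: x_def of_nat_diff)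
      have "x * (x - 5) \<ge> 0" using e by simp
      then show ?thesis unfolding e(1,2) by (simp add: algebra_simps)
    qed
    ultimately show ?thesis by linarith
  qed
  have e: "int d - int (d - 4) = 4" "int d - int (d - 4 + 1) = 3" using d by auto
  have hyp: "half_cert l (d - 4) (\<lambda>j. right_sol l 1 (int d - int j)) n"
    if l: "2 \<le> l" "l \<le> b" and n: "(real n)\<^sup>2 \<le> (l^2)\<^sup>2 - 4 * l^2" for l n
  proof (rule half_cert_hyperbolic(1)[OF l(1)])
    have L: "4 \<le> l^2" "l^2 \<le> 17 / 4"
      using power_mono[OF l(1), of 2] power_mono[OF l(2), of 2] l b2 by auto
    have "(l^2 - 4) * (l^2 - 1) \<le> 1 / 4 * (13 / 4)" using L by (intro mult_mono) auto
    then have "0 < right_sol l 1 4" unfolding right_sol_values(5) by (simp add: algebra_simps)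
    then show "0 < right_sol l 1 (int d - int (d - 4))" unfolding e .
    have "l * (4 - l^2) \<le> 0" using l L by (intro mult_nonneg_nonpos) auto
    then show "right_sol l 1 (int d - int (d - 4 + 1)) \<le> 0"
      unfolding e right_sol_values(4) by simp
  qed (rule right_sol_step, rule n)
  have gb: "?g b \<le> 0"
  proof -
    have "(real 1)\<^sup>2 \<le> (b\<^sup>2)\<^sup>2 - 4 * b\<^sup>2" unfolding b2(1) by (simp add: power2_eq_square)
    from half_certD(6)[OF hyp[OF b2(2) order.refl this], of ?i] d
    show ?thesis by (simp del: chp.simps)
  qed
  have "continuous_on {2..b} ?g" by (intro continuous_intros continuous_on_right_sol)
  then have "\<exists>x\<ge>2. x \<le> b \<and> ?g x = 0"
    using ga gb by (intro IVT2'[OF _ _ b2(2)]) (simp_all only: less_imp_le)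
  then obtain l where l: "2 \<le> l" "l \<le> b" "?g l = 0" by blast
  have "l \<noteq> 2" using l(3) ga by auto
  then have l2: "l > 2" using l by simp
  have L: "4 < l^2" using power_strict_mono[OF l2, of 2] by simp
  have "l^2 * (l^2 - 4) \<ge> 0" using L by simp
  then have "(real 0)\<^sup>2 \<le> (l^2)\<^sup>2 - 4 * l^2" by (simp add: power2_eq_square algebra_simps)
  note hc = half_certD(2,4)[OF hyp[OF l(1,2) this]]
  have t2: "right_sol l 1 2 < 0" unfolding right_sol_values using L by simp
  have t3: "right_sol l 1 3 < 0" unfolding right_sol_values using L l2 by (simp add: mult_pos_neg)
  have t4: "right_sol l 1 4 > 0" using hc(1)[of "d - 4"] e by simp
  have t5: "right_sol l 1 5 > 0"
  proof -
    have "right_sol l 1 5 = l * right_sol l 1 4 - right_sol l 1 3" using right_sol_rec[of l 1 4] by simp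
    moreover have "l * right_sol l 1 4 > 0" using t4 l2 by simp
    ultimately show ?thesis using t3 by linarith
  qed
  have hi: "right_sol l 1 (int d - int (2 * ?i + 2)) < 0"
  proof -
    have "int d - int (2 * ?i + 2) = 2 \<or> int d - int (2 * ?i + 2) = 3" using d by presburger
    then show ?thesis using t2 t3 by (elim disjE) (simp_all only:)
  qed
  have lo: "right_sol l 1 (int d - int (2 * ?i)) > 0"
  proof -
    have "int d - int (2 * ?i) = 4 \<or> int d - int (2 * ?i) = 5" using d by presburger
    then show ?thesis using t4 t5 by (elim disjE) (simp_all only:)
  qed
  have r: "right_sol l 1 (int j) < 0" if "2 \<le> j" "j \<le> 3" for j
  proof -
    have "int j = 2 \<or> int j = 3" using that by auto
    then show ?thesis using t2 t3 by (elim disjE) (simp_all only:)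
  qed
  have tight: "real 1 * chp l (?i + 1) * right_sol l 1 (int d - int ?i) =
     l * (l * right_sol l 1 (int d - int 0) - right_sol l 1 (int d - int 1))" using l(3) by simp
  have i: "1 \<le> ?i" "?i \<le> d - 4" "d - 4 + 3 + 1 = d" "d - 4 + 1 \<noteq> d" "l > 0" using d l2 by auto
  have nd: "right_sol l 1 (int d - int (d - 4 + 1)) < 0" unfolding e using t3 .
  have W: "right_sol l 1 (int d - int 1) \<le> l * right_sol l 1 (int d - int 0)" using hc(2) .
  have e0: "int d - int 0 = int d" "int d - int 1 = int d - 1" by simp_all
  have p1: "(1::nat) \<le> 3" by simp
  have "odd_data l d 1 (d - 4) 3 ?i"
    by (rule odd_dataI; (rule i(5,1,2) p1 disjI1[OF conjI[OF i(3) nd]] lo hi hc(1) r W[unfolded e0] tight[unfolded e0] t4);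
        assumption?)
  then show ?thesis using l2 by (intro exI conjI)
qed

text \<open>With many leaves, or for large \<open>d\<close>, the hyperbolic criterion suffices. Some
  small cases need more than the bound \<open>L\<close>; for them
  \<open>half_cert_lower_bound\<close> extracts sharper polynomial inequalities from the certificate
  of the left half.\<close>

lemma odd_side_conditions:
  assumes d: "d \<ge> 5" and k: "k \<ge> 1" and l: "l > 0" and L: "l^2 \<ge> real k + 2"
    and hc: "7 \<le> d ==> k = 2 \<or> (k = 1 \<and> d \<le> 9) ==> half_cert l (d - 3) S k"
    and l2: "k = 1 ==> d \<ge> 10 ==> l \<ge> 2"
  shows "side_conditions l d k (k + 1)"
proof -
  define L' where "L' = l^2"
  have LL: "l * l = L'" unfolding L'_def by (simp add: power2_eq_square)
  note v = chp_values[of l, folded L'_def]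
  have Lk: "L' \<ge> real k + 2" using L by (simp add: L'_def)
  have ge2: "l \<ge> 2" if "L' \<ge> 4"
    using that l unfolding L'_def by (intro power2_le_imp_le[of 2 l]) auto
  have bound4: "real k * (L' - 1) \<le> L'^2 - 3 * L' + 1" if "7 \<le> d" "k = 2 \<or> (k = 1 \<and> d \<le> 9)"
  proof -
    have h: "half_cert l (d - 3) S k" by (rule hc) fact+
    have "S 4 > 0" using half_certD(2)[OF h, of 4] that(1) by simp
    then have "real k * chp l (4 - 1) \<le> chp l (4 + 1)"
      using that(1) by (intro half_cert_lower_bound[OF h]) auto
    then show ?thesis using v by simp
  qed
  have bound5: "L'^2 - 5 * L' + 5 \<ge> 0" if "d = 9" "k = 1"
  proof -
    have h: "half_cert l (d - 3) S k" by (rule hc) (use that in auto)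
    have "real k * chp l (5 - 1) \<le> chp l (5 + 1)"
      by (rule half_cert_lower_bound[OF h]) (use that half_certD(2)[OF h, of 5] in auto)
    then have "l * (L' - 2) \<le> l * ((L' - 1) * (L' - 3))" using v that by (simp add: mult_ac)
    then have "L' - 2 \<le> (L' - 1) * (L' - 3)" using l by simp
    then show ?thesis by (simp add: power2_eq_square algebra_simps)
  qed
  have hyp: "half_cert l (n - 1) (end_sol l n) q" if "n \<ge> 1" "L' \<ge> 4" "(real q)\<^sup>2 \<le> L' * (L' - 4)" for n q
    using that ge2 by (intro end_sol_half_cert_hyperbolic) (auto simp: L'_def power2_eq_square algebra_simps)
  have big: "(real k + 2) * (real k - 2) \<le> L' * (L' - 4)" if "k \<ge> 2"
    using Lk that by (intro mult_mono) auto
  have pos7: "chp l j > 0" if q: "L'^2 - 4 * L' + 2 \<ge> 0" and L3: "L' \<ge> 3" and j: "1 \<le> j" "j \<le> 7" for j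
  proof -
    have c7: "chp l 7 = (L' - 1) * (L'^2 - 4 * L' + 2) + 1"
      unfolding v by (simp add: power2_eq_square power3_eq_cube algebra_simps)
    have c5: "chp l 5 = (L'^2 - 4 * L' + 2) + (L' - 1)" unfolding v by simp
    have p: "chp l 5 > 0" "chp l 7 > 0" unfolding c5 c7 using q L3 by (simp_all add: add_nonneg_pos)
    have c6: "chp l 6 > 0" if "L' \<noteq> 3" using v(4) l L3 that by simp
    have "L' \<noteq> 3" using q by auto
    moreover have "j = 6 \<or> j = 7 \<or> j \<le> 5" using j by linarith
    ultimately show ?thesis using nat_cases_upto_5[of j] j l L3 v(1,2) p c6 by auto
  qed
  have "half_cert l (d - 1 - 1) (end_sol l (d - 1)) (k - 1)"
  proof -
    have "d = 5 \<or> d = 6 \<or> (d \<ge> 7 \<and> k \<ge> 3) \<or> (d = 7 \<and> k = 2) \<or> (d \<ge> 8 \<and> k = 2) \<or>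
      (d = 7 \<and> k = 1) \<or> (d = 8 \<and> k = 1) \<or> (d = 9 \<and> k = 1) \<or> (d \<ge> 10 \<and> k = 1)"
    proof -
      have "d = 5 \<or> d = 6 \<or> d = 7 \<or> d = 8 \<or> d = 9 \<or> d \<ge> 10" using d by linarith
      moreover have "k = 1 \<or> k = 2 \<or> k \<ge> 3" using k by linarith
      ultimately show ?thesis by (elim disjE) simp_all
    qed
    then consider "d = 5" | "d = 6" | "d \<ge> 7" "k \<ge> 3" | "d = 7" "k = 2" | "d \<ge> 8" "k = 2"
      | "d = 7" "k = 1" | "d = 8" "k = 1" | "d = 9" "k = 1" | "d \<ge> 10" "k = 1" by blast
    then show ?thesis
    proof cases
      case 1
      have "(real k - 1) * (L' - 1) \<le> (L' - 3) * (L' - 1)" using Lk k by (intro mult_right_mono) auto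
      then have "real (k - 1) * (L' - 1) \<le> L'^2 - 3 * L' + 1"
        using Lk k by (simp add: of_nat_diff power2_eq_square algebra_simps)
      then show ?thesis using half_cert_length_3[OF l, of "k - 1"] Lk k 1 by (simp add: L'_def)
    next
      case 2
      then show ?thesis using half_cert_length_4[OF l, of "k - 1"] Lk k by (simp add: L'_def of_nat_diff)
    next
      case 3
      have "(real (k - 1))\<^sup>2 \<le> (real k + 2) * (real k - 2)"
        using 3 by (simp add: of_nat_diff power2_eq_square algebra_simps)
      then show ?thesis using 3 Lk big by (intro hyp) auto
    next
      case 4
      have "(L' - 4) * (L' - 1) \<ge> 0" using Lk 4 by simp
      then have "L'^2 - 5 * L' + 5 \<ge> 0" by (simp add: power2_eq_square algebra_simps)
      then show ?thesis using half_cert_length_5[OF l, of "k - 1"] Lk 4 by (simp add: L'_def)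
    next
      case 5
      have "L' * (L' - 4) \<ge> L' - 3" using bound4 5 by (simp add: power2_eq_square algebra_simps)
      then have "(real (k - 1))\<^sup>2 \<le> L' * (L' - 4)" using Lk 5 by simp
      then show ?thesis using 5 Lk by (intro hyp) auto
    next
      case 6
      have q: "L'^2 - 4 * L' + 2 \<ge> 0" using bound4 6 by simp
      have L3: "L' \<ge> 3" using Lk 6 by simp
      note pos = pos7[OF q L3]
      have "half_cert l (6 - 1) (end_sol l 6) 0"
        by (rule end_sol_half_certI[OF l]) (use less_imp_le[OF pos[of 7]] pos l in auto)
      then show ?thesis using 6 by simp
    next
      case 7
      have q: "L'^2 - 4 * L' + 2 \<ge> 0" using bound4 7 by simp
      have L3: "L' \<ge> 3" using Lk 7 by simp
      note pos = pos7[OF q L3]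
      have c8: "chp l 8 \<ge> 0" unfolding chp_values_8_9 using q l L3 by (simp add: L'_def)
      have "half_cert l (7 - 1) (end_sol l 7) 0"
        by (rule end_sol_half_certI[OF l]) (use pos c8 l in auto)
      then show ?thesis using 7 by simp
    next
      case 8
      have q: "L'^2 - 5 * L' + 5 \<ge> 0" using bound5 8 by simp
      have L3: "L' \<ge> 3" using Lk 8 by simp
      have L3': "L' \<noteq> 3" using q by auto
      have q4: "L'^2 - 4 * L' + 2 > 0" using q L3 L3' by linarith
      have c7: "chp l 7 = (L' - 1) * (L'^2 - 4 * L' + 2) + 1"
        unfolding v by (simp add: power2_eq_square power3_eq_cube algebra_simps)
      have c5: "chp l 5 = (L'^2 - 4 * L' + 2) + (L' - 1)" unfolding v by simp
      have c9: "chp l 9 = (L'^2 - 5 * L' + 5) * (L' * (L' - 2)) + 1"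
        unfolding chp_values_8_9 L'_def by Groebner_Basis.algebra
      have p: "chp l 5 > 0" "chp l 7 > 0" "chp l 6 > 0" "chp l 8 > 0"
        unfolding c5 c7 chp_values_8_9 using q q4 l L3 L3' v(4) by (simp_all add: add_nonneg_pos L'_def)
      have p9: "chp l 9 \<ge> 0" unfolding c9 using q L3 by simp
      have pos: "chp l j > 0" if "1 \<le> j" "j \<le> 8" for j
      proof -
        have "j = 6 \<or> j = 7 \<or> j = 8 \<or> j \<le> 5" using that by linarith
        then show ?thesis using nat_cases_upto_5[of j] that l L3 v(1,2) p by auto
      qed
      have "half_cert l (8 - 1) (end_sol l 8) 0"
        by (rule end_sol_half_certI[OF l]) (use pos p9 l in auto)
      then show ?thesis using 8 by simp
    next
      case 9
      have "l \<ge> 2" using l2 9 by simp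
      then have "L' \<ge> 4" unfolding L'_def using power_mono[of 2 l 2] by simp
      then show ?thesis using 9 by (intro hyp) auto
    qed
  qed
  moreover have "half_cert l (d + 1 - 1) (end_sol l (d + 1)) (k - 2)" if "k \<ge> 2"
  proof -
    have "(real (k - 2))\<^sup>2 \<le> (real k + 2) * (real k - 2)"
      using that by (simp add: of_nat_diff power2_eq_square algebra_simps)
    then show ?thesis using that Lk big by (intro hyp) auto
  qed
  moreover have "d - 1 - 1 = d - 2" by simp
  ultimately show ?thesis unfolding side_conditions_def using L by simp
qed

lemma odd_certificate:
  assumes d: "d \<ge> 4" and k: "k \<ge> 1"
  shows "\<exists>l p S p' S'. half_cert l p S k \<and> half_cert l p' S' (k + 1) \<and> path_node d p S p' S' \<and>
    side_conditions l d k (k + 1) \<and>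
    (\<forall>i j. i < j --> j \<le> d -->
      (odd_positions (2 * k + 1) d i j \<longleftrightarrow> half_tight l p S k i \<and> half_tight l p' S' (k + 1) (d - j)))"
proof -
  have "\<exists>l p p' i0. odd_data l d k p p' i0 \<and> side_conditions l d k (k + 1) \<and>
    (\<forall>i j. odd_positions (2 * k + 1) d i j \<longleftrightarrow> i = i0 \<and> j = d - 1)"
  proof -
    have side: "side_conditions l d k (k + 1)" if o: "odd_data l d k (d - 3) p' i0" and "d \<ge> 5"
      "l^2 \<ge> real k + 2" "k = 1 ==> d \<ge> 10 ==> l \<ge> 2" for l p' i0
      by (rule odd_side_conditions[OF that(2) k _ that(3) odd_data_certs(1)[OF o k] that(4)])
        (use o in \<open>auto simp: odd_data_def Let_def\<close>)
    have "d = 4 \<or> d = 5 \<or> (d \<ge> 6 \<and> k \<ge> 2) \<or> (6 \<le> d \<and> d \<le> 9 \<and> k = 1) \<or> (d = 10 \<and> k = 1) \<or> (d \<ge> 11 \<and> k = 1)"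
      using d k by arith
    then consider "d = 4" | "d = 5" | "d \<ge> 6" "k \<ge> 2" | "6 \<le> d" "d \<le> 9" "k = 1" | "d = 10" "k = 1" | "d \<ge> 11" "k = 1"
      by blast
    then show ?thesis
    proof cases
      case 1
      obtain l where o: "odd_data l 4 k 2 1 1" and L: "l^2 > real k + 1" using odd_exists_4[OF k] by blast
      have l: "l > 0" using o by (auto simp: odd_data_def Let_def)
      have g3: "half_cert l 2 (end_sol l 3) (k - 1)"
        by (rule half_cert_length_2) (use l L k in \<open>auto simp: of_nat_diff\<close>)
      have g4: "half_cert l 4 (end_sol l 5) (k - 2)" if "k \<ge> 2"
        by (rule half_cert_length_4) (use l L that in \<open>auto simp: of_nat_diff\<close>)
      have "side_conditions l d k (k + 1)" unfolding side_conditions_def 1 using g3 g4 L by simp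
      moreover have "\<forall>i j. odd_positions (2 * k + 1) d i j \<longleftrightarrow> i = 1 \<and> j = d - 1"
        unfolding odd_positions_def 1 by simp
      ultimately show ?thesis using o 1 by blast
    next
      case 2
      obtain l where o: "odd_data l 5 k 2 1 1" and L: "l^2 = real k + 2" using odd_exists_5[OF k] by blast
      have "side_conditions l d k (k + 1)" by (rule side[of l 1 1]) (use o L 2 in simp_all)
      moreover have "\<forall>i j. odd_positions (2 * k + 1) d i j \<longleftrightarrow> i = 1 \<and> j = d - 1"
        unfolding odd_positions_def 2 using k by auto
      ultimately show ?thesis using o 2 by blast
    next
      case 3
      obtain l where o: "odd_data l d k (d - 3) 2 ((d - 3) div 2)" and L: "l^2 > real k + 2"
        using odd_exists_large_load[OF 3] by blast
      have "side_conditions l d k (k + 1)" by (rule side[OF o]) (use L 3 in simp_all)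
      moreover have "\<forall>i j. odd_positions (2 * k + 1) d i j \<longleftrightarrow> i = (d - 3) div 2 \<and> j = d - 1"
        unfolding odd_positions_def using 3 by auto
      ultimately show ?thesis using o by blast
    next
      case 4
      obtain l where o: "odd_data l d k (d - 3) 2 ((d - 3) div 2)" and L: "l^2 > 3"
        using odd_exists_three_short[OF 4(1,2)] 4(3) by auto
      have "side_conditions l d k (k + 1)" by (rule side[OF o]) (use L 4 in simp_all)
      moreover have "\<forall>i j. odd_positions (2 * k + 1) d i j \<longleftrightarrow> i = (d - 3) div 2 \<and> j = d - 1"
        unfolding odd_positions_def using 4 by auto
      ultimately show ?thesis using o by blast
    next
      case 5
      have "side_conditions 2 d k (k + 1)" by (rule odd_side_conditions) (use 5 in auto)
      moreover have "\<forall>i j. odd_positions (2 * k + 1) d i j \<longleftrightarrow> i = 3 \<and> j = d - 1"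
        unfolding odd_positions_def using 5 by auto
      moreover have "odd_data 2 d k 6 2 3" using odd_exists_three_10 5 by simp
      ultimately show ?thesis by blast
    next
      case 6
      obtain l where o: "odd_data l d k (d - 4) 3 ((d - 4) div 2)" and l: "l > 2"
        using odd_exists_three_long[OF 6(1)] 6(2) by auto
      have "l^2 \<ge> 4" using power_mono[of 2 l 2] l by simp
      then have "side_conditions l d k (k + 1)" by (intro odd_side_conditions) (use 6 l in auto)
      moreover have "\<forall>i j. odd_positions (2 * k + 1) d i j \<longleftrightarrow> i = (d - 4) div 2 \<and> j = d - 1"
        unfolding odd_positions_def using 6 by auto
      ultimately show ?thesis using o by blast
    qed
  qed
  then obtain l p p' i0 where o: "odd_data l d k p p' i0" and s: "side_conditions l d k (k + 1)"
    and pos: "\<And>i j. odd_positions (2 * k + 1) d i j \<longleftrightarrow> i = i0 \<and> j = d - 1" by blast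
  note c = odd_data_certs[OF o k]
  have "d - j = 1 \<longleftrightarrow> j = d - 1" if "i < j" "j \<le> d" for i j using that d by auto
  then have "odd_positions (2 * k + 1) d i j \<longleftrightarrow> half_tight l p (\<lambda>j. right_sol l k (int d - int j)) k i \<and>
    half_tight l p' (\<lambda>j. - right_sol l k (int j)) (k + 1) (d - j)" if "i < j" "j \<le> d" for i j
    unfolding c pos using that by simp
  then show ?thesis using c(1-3) s by blast
qed

section \<open>A single attached leaf\<close>

lemma chpz_cos: "chpz (2 * cos t) z * sin t = sin (real_of_int z * t)"
proof (cases "z \<ge> 0")
  case True
  then show ?thesis using chp_cos[of t "nat z"] unfolding chpz_def by simp
next
  case False
  then show ?thesis using chp_cos[of t "nat (- z)"] unfolding chpz_def by simp
qed

text \<open>The left half carries nothing, so its solution, proportional to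
  \<open>sin ((j + 1) * t)\<close>, is determined by the end and simply continues with the opposite
  sign as the right half. The node is the first zero of this sine, and tightness on the right
  becomes an equation between sines.\<close>

lemma single_core:
  fixes t :: real and d i0 :: nat
  defines "l \<equiv> 2 * cos t"
  defines "S \<equiv> \<lambda>j. chp l (j + 1)" and "S' \<equiv> \<lambda>j. - chpz l (int d + 1 - int j)"
  assumes t: "0 < t" "t < pi / 2" and up: "(real d + 2) * t \<le> 2 * pi" and i0: "1 \<le> i0" "2 * i0 + 1 \<le> d"
    and in0: "(real d + 1 - real i0) * t > pi" and hi: "(real d - 1 - 2 * real i0) * t \<le> pi"
    and lo: "1 < i0 ==> (real d + 1 - 2 * real i0) * t \<ge> pi"
    and tight: "sin ((real d + 2) * t) * sin (2 * t) = sin ((real d + 1 - real i0) * t) * sin ((real i0 + 1) * t)"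
  shows "\<exists>p p'. half_cert l p S 0 \<and> half_cert l p' S' 1 \<and> path_node d p S p' S' \<and>
    (\<forall>i\<le>d. half_tight l p' S' 1 i \<longleftrightarrow> 1 \<le> i \<and> (real d + 1 - real i) * t > pi \<and>
      (i = i0 \<or> (i = i0 + 1 \<and> sin ((real d - 1 - 2 * real i0) * t) = 0) \<or>
       (i + 1 = i0 \<and> sin ((real d + 1 - 2 * real i0) * t) = 0)))"
proof -
  have st: "sin t > 0" using t by (intro sin_gt_zero) auto
  have ct: "cos t > 0" using t by (intro cos_gt_zero) auto
  have l: "l > 0" using ct by (simp add: l_def)
  have chps: "chp l n * sin t = sin (real n * t)" for n unfolding l_def by (rule chp_cos)
  have S's: "S' j * sin t = - sin ((real d + 1 - real j) * t)" for j
    using chpz_cos[of t "int d + 1 - int j"] unfolding S'_def l_def by simp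
  have sgn: "x > 0 \<longleftrightarrow> y > 0" "x \<ge> 0 \<longleftrightarrow> y \<ge> 0" "x = 0 \<longleftrightarrow> y = 0" "x < 0 \<longleftrightarrow> y < 0" "x \<le> 0 \<longleftrightarrow> y \<le> 0"
    if "x * sin t = y" for x y
    using st that by (auto simp: zero_less_mult_iff zero_le_mult_iff mult_less_0_iff mult_le_0_iff)
  have sinneg: "sin x < 0" if "pi < x" "x < 2 * pi" for x
  proof -
    have "sin (x - pi) > 0" using that by (intro sin_gt_zero) auto
    then show ?thesis by simp
  qed
  have sinneg0: "sin x \<le> 0" if "pi \<le> x" "x \<le> 2 * pi" for x
    using that sinneg[of x] by (cases "x = pi \<or> x = 2 * pi") auto
  have solS: "S (j + 2) = l * S (j + 1) - S j" for j unfolding S_def by (simp add: numeral_eq_Suc)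
  have solS': "S' (j + 2) = l * S' (j + 1) - S' j" for j
    using chpz_rec[of l "int d - int j"] unfolding S'_def by (simp add: algebra_simps)
  \<comment> \<open>\<open>N\<close> is the first multiple of \<open>t\<close> to reach
    \<open>pi\<close>. Since the vertex \<open>j\<close> has the angle \<open>(j + 1) * t\<close>,
    the vertex \<open>N - 1\<close> is the node if \<open>N * t = pi\<close>, and otherwise the
    first vertex of the right half; the two values of \<open>p'\<close> reflect this.\<close>
  define N where "N = nat \<lceil>pi / t\<rceil>"
  have N1: "real N * t \<ge> pi"
  proof -
    have "pi / t \<le> real N" unfolding N_def by (rule real_nat_ceiling_ge)
    then show ?thesis using t by (simp add: field_simps)
  qed
  have N2: "(real n) * t < pi" if "n < N" for n
  proof (rule ccontr)
    assume "\<not> ?thesis"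
    then have "pi / t \<le> real n" using t by (simp add: field_simps)
    then have "N \<le> n" unfolding N_def by (simp add: nat_ceiling_le_eq)
    then show False using that by simp
  qed
  have N3: "N \<le> n" if "real n * t \<ge> pi" for n using N2[of n] that by (cases "n < N") auto
  have Nge: "N \<ge> 3"
  proof (rule ccontr)
    assume "\<not> ?thesis"
    then have "real N \<le> 2" by simp
    then have "real N * t \<le> 2 * t" using t by (intro mult_right_mono) auto
    then show False using N1 t by linarith
  qed
  have Ni: "N \<le> d + 1 - i0"
  proof (rule N3)
    have "real (d + 1 - i0) = real d + 1 - real i0" using i0 by (simp add: of_nat_diff)
    then show "real (d + 1 - i0) * t \<ge> pi" using in0 by simp
  qed
  define p where "p = N - 2"
  define p' where "p' = (if real N * t = pi then d - N else d + 1 - N)"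
  have Nd: "N \<le> d" using Ni i0 by simp
  have ip': "i \<le> p' \<longleftrightarrow> (real d + 1 - real i) * t > pi" if "i \<le> d" for i
  proof -
    have e: "real d + 1 - real i = real (d + 1 - i)" using that by (simp add: of_nat_diff)
    show ?thesis
    proof (cases "real N * t = pi")
      case True
      have "real (d + 1 - i) * t > real N * t \<longleftrightarrow> d + 1 - i > N" using t by simp
      then show ?thesis unfolding e p'_def using True Nd that by auto
    next
      case False
      then have "real N * t > pi" using N1 by simp
      have "real (d + 1 - i) * t > pi" if "d + 1 - i \<ge> N"
      proof -
        have "real N * t \<le> real (d + 1 - i) * t" using that t by (intro mult_right_mono) auto
        then show ?thesis using \<open>real N * t > pi\<close> by linarith
      qed
      then have "real (d + 1 - i) * t > pi \<longleftrightarrow> d + 1 - i \<ge> N"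
        using N3[of "d + 1 - i"] less_imp_le by blast
      then show ?thesis unfolding e p'_def using False Nd that by auto
    qed
  qed
  have p'd: "p' \<le> d" unfolding p'_def using Nge by auto
  have lS: "S j > 0" if "j \<le> p" for j
  proof -
    have "j + 1 < N" using that Nge unfolding p_def by simp
    then have "sin (real (j + 1) * t) > 0" using N2[of "j + 1"] t by (intro sin_gt_zero) auto
    then show ?thesis unfolding S_def using sgn(1)[OF chps] by simp
  qed
  have hcl: "half_cert l p S 0"
    unfolding half_cert_def
    using l lS solS by (auto simp: S_def numeral_eq_Suc intro: less_imp_le)
  have lt2: "(real d + 1 - real j) * t < 2 * pi" for j
  proof -
    have "(real d + 1 - real j) * t < (real d + 2) * t" using t by (intro mult_strict_right_mono) auto
    then show ?thesis using up by simp
  qed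
  have pos': "S' j > 0" if "j \<le> p'" for j
  proof -
    have "(real d + 1 - real j) * t > pi" using ip'[of j] that p'd by simp
    then have "sin ((real d + 1 - real j) * t) < 0" using lt2 by (intro sinneg) auto
    then show ?thesis using sgn(1)[OF S's[of j]] by simp
  qed
  have Nn: "int d + 1 - int (d + 1 - N) = int N" "int d + 1 - int (d + 1 - (N - 1)) = int (N - 1)" using Nd Nge by auto
  have Sp1: "S (p + 1) = chp l N" "S p = chp l (N - 1)" 
  proof -
    have "N - 2 + 1 + 1 = N" "N - 2 + 1 = N - 1" using Nge by auto
    then show "S (p + 1) = chp l N" "S p = chp l (N - 1)" unfolding S_def p_def by simp_all
  qed
  have cN: "chp l N \<le> 0" using N1 N2[of "N - 1"] sgn(5)[OF chps[of N]] sinneg0[of "real N * t"] Nge t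
  proof -
    have "real N * t = real (N - 1) * t + t" using Nge by (simp add: of_nat_diff algebra_simps)
    then have "real N * t \<le> 2 * pi" using N2[of "N - 1"] Nge t by simp
    then show ?thesis using sgn(5)[OF chps[of N]] sinneg0[of "real N * t"] N1 by simp
  qed
  have cN0: "chp l N = 0" if "real N * t = pi" using sgn(3)[OF chps[of N]] that by simp
  have cN1: "chp l N < 0" if "real N * t \<noteq> pi"
  proof -
    have "real N * t = real (N - 1) * t + t" using Nge by (simp add: of_nat_diff algebra_simps)
    then have "real N * t < 2 * pi" using N2[of "N - 1"] Nge t by simp
    then show ?thesis using sgn(4)[OF chps[of N]] sinneg[of "real N * t"] N1 that by simp
  qed
  have node: "path_node d p S p' S'"
  proof (cases "real N * t = pi")
    case True
    have "S' (d - N + 1) = - chp l N" unfolding S'_def chpz_def using Nd by simp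
    then have "S' (p' + 1) = - chp l N" unfolding p'_def using True by simp
    then show ?thesis unfolding path_node_def Sp1 using cN0[OF True] True Nge Nd unfolding p_def p'_def by simp
  next
    case False
    have "S' (d + 1 - N + 1) = - chp l (N - 1)" "S' (d + 1 - N) = - chp l N"
      unfolding S'_def chpz_def using Nd Nge by (simp_all add: nat_diff_distrib)
    then have "S' (p' + 1) = - chp l (N - 1)" "S' p' = - chp l N" unfolding p'_def using False by simp_all
    moreover have "p + p' + 1 = d" unfolding p_def p'_def using False Nge Nd by simp
    ultimately show ?thesis unfolding path_node_def Sp1 using cN1[OF False] by simp
  qed
  have neg': "S' (p' + 1) \<le> 0" using path_node_neg(1)[OF node] lS[of p] pos'[of p'] by simp
  have i0p: "i0 \<le> p'" using ip'[of i0] in0 i0 by simp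
  have e22: "real d + 1 - real (2 * i0 + 2) = real d - 1 - 2 * real i0" by simp
  have hi': "S' (2 * i0 + 2) \<le> 0"
  proof -
    have "sin ((real d - 1 - 2 * real i0) * t) \<ge> 0" 
      using hi t i0 by (intro sin_ge_zero mult_nonneg_nonneg) auto
    then show ?thesis using sgn(5)[OF S's[of "2 * i0 + 2", unfolded e22]] by simp
  qed
  have lo': "S' (2 * i0) \<ge> 0" if "1 < i0"
  proof -
    have "sin ((real d + 1 - 2 * real i0) * t) \<le> 0"
      using lo[OF that] lt2[of "2 * i0"] by (intro sinneg0) auto
    then show ?thesis using sgn(2)[OF S's[of "2 * i0"]] by simp
  qed
  have W0: "(l * S' 0 - S' 1) * sin t = - sin ((real d + 2) * t)"
  proof -
    have "l * S' 0 - S' 1 = - chpz l (int d + 2)"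
      using chpz_rec[of l "int d + 1"] unfolding S'_def by (simp add: add.commute)
    then show ?thesis using chpz_cos[of t "int d + 2"] unfolding l_def by simp
  qed
  have pi2: "(real d + 2) * t > pi"
  proof -
    have "(real d + 1 - real i0) * t < (real d + 2) * t" using t i0 by (intro mult_strict_right_mono) auto
    then show ?thesis using in0 by simp
  qed
  have W: "S' 1 \<le> l * S' 0" using sgn(2)[OF W0] sinneg0[OF _ up] pi2 by simp
  have l2: "l * sin t = sin (2 * t)" unfolding l_def by (simp add: sin_double)
  have tight': "real 1 * chp l (i0 + 1) * S' i0 = l * (l * S' 0 - S' 1)"
  proof -
    have "(chp l (i0 + 1) * sin t) * (S' i0 * sin t) = (l * sin t) * ((l * S' 0 - S' 1) * sin t)"
      unfolding W0 l2 chps S's using tight by (simp add: algebra_simps)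
    then have "(sin t * sin t) * (chp l (i0 + 1) * S' i0) = (sin t * sin t) * (l * (l * S' 0 - S' 1))"
      by (simp only: mult_ac)
    then show ?thesis using st by simp
  qed
  have hcr: "half_cert l p' S' 1"
    by (rule half_cert_midpoint(1)[OF l solS' pos' neg' W i0(1) i0p hi' lo' _ tight']) simp_all
  have ti: "half_tight l p' S' 1 i \<longleftrightarrow> 1 \<le> i \<and> i \<le> p' \<and>
      (i = i0 \<or> (i = i0 + 1 \<and> S' (2 * i0 + 2) = 0) \<or> (i + 1 = i0 \<and> S' (2 * i0) = 0))" for i
    by (rule half_cert_midpoint(2)[OF l solS' pos' neg' W i0(1) i0p hi' lo' _ tight']) simp_all
  have z: "S' (2 * i0 + 2) = 0 \<longleftrightarrow> sin ((real d - 1 - 2 * real i0) * t) = 0"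
    "S' (2 * i0) = 0 \<longleftrightarrow> sin ((real d + 1 - 2 * real i0) * t) = 0"
    using sgn(3)[OF S's[of "2 * i0 + 2", unfolded e22]] sgn(3)[OF S's[of "2 * i0"]] by simp_all
  have "\<forall>i\<le>d. half_tight l p' S' 1 i \<longleftrightarrow> 1 \<le> i \<and> (real d + 1 - real i) * t > pi \<and>
      (i = i0 \<or> (i = i0 + 1 \<and> sin ((real d - 1 - 2 * real i0) * t) = 0) \<or>
       (i + 1 = i0 \<and> sin ((real d + 1 - 2 * real i0) * t) = 0))"
    unfolding ti z using ip' by blast
  then show ?thesis using hcl hcr node by blast
qed

text \<open>\<open>i0\<close> counts from the right end, so \<open>j = d - i0\<close>. For
  \<open>i0 > 1\<close> the position is optimal for angles between
  \<open>pi / (d + 1 - 2 * i0)\<close> and \<open>pi / (d - 1 - 2 * i0)\<close>, where the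
  increments to its neighbours vanish; for \<open>i0 = 1\<close> only the upper end restricts. The
  values of \<open>d\<close> where the optimal position changes are those for which the root sits at
  an end of this range.\<close>

lemma single_certificate:
  assumes d: "d \<ge> 3"
  shows "\<exists>l p S p' S'. half_cert l p S 0 \<and> half_cert l p' S' 1 \<and> path_node d p S p' S' \<and> S 1 = l * S 0 \<and>
    (\<forall>j. 1 \<le> j --> j \<le> d --> (single_positions d j \<longleftrightarrow> half_tight l p' S' 1 (d - j)))"
proof -
  have fin: ?thesis
    if *: "0 < t" "t < pi / 2" "(real d + 2) * t \<le> 2 * pi" "1 \<le> i0" "2 * i0 + 1 \<le> d"
      "(real d + 1 - real i0) * t > pi" "(real d - 1 - 2 * real i0) * t \<le> pi"
      "1 < i0 ==> (real d + 1 - 2 * real i0) * t \<ge> pi"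
      "sin ((real d + 2) * t) * sin (2 * t) = sin ((real d + 1 - real i0) * t) * sin ((real i0 + 1) * t)"
      and pos: "\<And>j. 1 \<le> j ==> j \<le> d ==> single_positions d j \<longleftrightarrow> 1 \<le> d - j \<and>
        (real d + 1 - real (d - j)) * t > pi \<and>
        (d - j = i0 \<or> (d - j = i0 + 1 \<and> sin ((real d - 1 - 2 * real i0) * t) = 0) \<or>
         (d - j + 1 = i0 \<and> sin ((real d + 1 - 2 * real i0) * t) = 0))" for t i0
  proof -
    from single_core[OF *] obtain p p' where h: "half_cert (2 * cos t) p (\<lambda>j. chp (2 * cos t) (j + 1)) 0"
      "half_cert (2 * cos t) p' (\<lambda>j. - chpz (2 * cos t) (int d + 1 - int j)) 1"
      "path_node d p (\<lambda>j. chp (2 * cos t) (j + 1)) p' (\<lambda>j. - chpz (2 * cos t) (int d + 1 - int j))"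
      and ti: "\<And>i. i \<le> d ==> half_tight (2 * cos t) p' (\<lambda>j. - chpz (2 * cos t) (int d + 1 - int j)) 1 i \<longleftrightarrow>
        1 \<le> i \<and> (real d + 1 - real i) * t > pi \<and>
        (i = i0 \<or> (i = i0 + 1 \<and> sin ((real d - 1 - 2 * real i0) * t) = 0) \<or>
         (i + 1 = i0 \<and> sin ((real d + 1 - 2 * real i0) * t) = 0))" by blast
    have "\<forall>j. 1 \<le> j --> j \<le> d --> (single_positions d j \<longleftrightarrow>
        half_tight (2 * cos t) p' (\<lambda>j. - chpz (2 * cos t) (int d + 1 - int j)) 1 (d - j))"
      using ti pos by (metis diff_le_self)
    moreover have "chp (2 * cos t) (1 + 1) = 2 * cos t * chp (2 * cos t) (0 + 1)" by simp
    ultimately show ?thesis using h by blast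
  qed
  define h2 where "h2 t = sin ((real d + 2) * t) * sin (2 * t) - sin ((real d - 1) * t) * sin (3 * t)" for t
  define h3 where "h3 t = sin ((real d + 2) * t) * sin (2 * t) - sin ((real d - 2) * t) * sin (4 * t)" for t
  have shift: "sin ((real d + a) * t) = - sin (b * t)" if "(real d + a - b) * t = pi" for a b t
  proof -
    have "(real d + a) * t = pi + b * t" using that by (simp add: algebra_simps)
    then show ?thesis by simp
  qed
  have pp: "sin x * cos y = (sin (x + y) + sin (x - y)) / 2" for x y :: real
    by (simp add: sin_add sin_diff)
  \<comment> \<open>At the ends of the admissible range \<open>shift\<close> turns all angles into
    small multiples of \<open>t\<close>; these identities then factor the tightness equations and
    show their signs.\<close>
  have id1: "sin (3 * t) - sin (5 * t) = - 2 * cos (4 * t) * sin t" for t :: real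
    using pp[of t "4 * t"] by (simp add: algebra_simps sin_minus[of "3 * t", symmetric])
  have id2: "sin (4 * t) * sin (3 * t) - sin (7 * t) * sin (2 * t) = - (sin t * sin (2 * t) * (2 * cos (6 * t) - 1))" for t :: real
  proof -
    have s4: "sin (4 * t) = 2 * sin (2 * t) * cos (2 * t)" using sin_double[of "2 * t"] by simp
    have a: "2 * (sin (3 * t) * cos (2 * t)) = sin (5 * t) + sin t" using pp[of "3 * t" "2 * t"] by (simp add: algebra_simps)
    have b: "2 * (sin t * cos (6 * t)) = sin (7 * t) - sin (5 * t)"
      using pp[of t "6 * t"] sin_minus[of "5 * t"] by (simp add: algebra_simps)
    show ?thesis unfolding s4 using a b by Groebner_Basis.algebra
  qed
  have id3: "sin (5 * t) * sin (4 * t) - sin (9 * t) * sin (2 * t) = sin (2 * t) * sin t * (1 + 2 * cos (2 * t) - 2 * cos (8 * t))" for t :: real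
  proof -
    have s4: "sin (4 * t) = 2 * sin (2 * t) * cos (2 * t)" using sin_double[of "2 * t"] by simp
    have a: "2 * (sin (5 * t) * cos (2 * t)) = sin (7 * t) + sin (3 * t)" using pp[of "5 * t" "2 * t"] by (simp add: algebra_simps)
    have b: "2 * (sin t * cos (8 * t)) = sin (9 * t) - sin (7 * t)"
      using pp[of t "8 * t"] sin_minus[of "7 * t"] by (simp add: algebra_simps)
    have c: "2 * (sin t * cos (2 * t)) = sin (3 * t) - sin t"
      using pp[of t "2 * t"] sin_minus[of t] by (simp add: algebra_simps)
    show ?thesis unfolding s4 using a b c by Groebner_Basis.algebra
  qed
  have spos: "sin (c * t) > 0" if "c > 0" "0 < t" "c * t < pi" for c t :: real
    using that by (intro sin_gt_zero) auto
  have root: "\<exists>t>a. t < b \<and> h t = 0"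
    if "a < b" "h a < 0" "h b > 0" and c: "\<And>x. isCont h x" for h :: "real => real" and a b
  proof -
    have "\<exists>t\<ge>a. t \<le> b \<and> h t = 0" by (rule IVT) (use that in auto)
    then obtain t where "a \<le> t" "t \<le> b" "h t = 0" by blast
    moreover from this that have "t \<noteq> a" "t \<noteq> b" by auto
    ultimately show ?thesis by (intro exI[of _ t]) auto
  qed
  have c2: "isCont h2 x" and c3: "isCont h3 x" for x unfolding h2_def[abs_def] h3_def[abs_def] by (intro continuous_intros)+
  consider "d \<le> 11" | "12 \<le> d" "d \<le> 22" | "d = 23" | "d \<ge> 24" by linarith
  then show ?thesis
  proof cases
    case 1
    \<comment> \<open>For \<open>i0 = 1\<close> the equation reduces to
      \<open>sin ((d + 2) * t) = sin (d * t)\<close>, solved by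
      \<open>cos ((d + 1) * t) = 0\<close>. With \<open>(d + 1) * t = 3 * pi / 2\<close>, the tie
      condition \<open>(d - 3) * t = pi\<close> holds exactly for \<open>d = 11\<close>.\<close>
    define t where "t = 3 * pi / (2 * (real d + 1))"
    have tm: "(real d + 1) * t = 3 * pi / 2" unfolding t_def by (simp add: field_simps)
    have t0: "0 < t" by (simp add: t_def add_pos_pos)
    have dt: "real d * t + t = 3 * pi / 2" using tm by (simp add: algebra_simps)
    have d3: "3 * t \<le> real d * t" using d t0 by (intro mult_right_mono) auto
    have d11: "real d * t \<le> 11 * t" using 1 t0 by (intro mult_right_mono) auto
    have s1: "sin ((real d + 2) * t) = - cos t"
    proof -
      have "(real d + 2) * t = (pi + pi / 2) + t" using dt by (simp add: algebra_simps)
      then show ?thesis by (simp only: sin_add cos_add) simp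
    qed
    have s2: "sin (real d * t) = - cos t"
    proof -
      have "real d * t = (pi + pi / 2) - t" using dt by (simp add: algebra_simps)
      then show ?thesis by (simp only: sin_add cos_add sin_diff) simp
    qed
    have up: "(real d - 3) * t \<le> pi" using dt d11 by (simp add: algebra_simps)
    have z: "sin ((real d - 3) * t) = 0 \<longleftrightarrow> d = 3 \<or> d = 11"
    proof -
      have "sin ((real d - 3) * t) > 0" if "d \<noteq> 3" "d \<noteq> 11"
      proof (rule spos)
        have "real d * t < 11 * t" using 1 t0 that by (intro mult_strict_right_mono) auto
        then show "(real d - 3) * t < pi" using dt by (simp add: algebra_simps)
      qed (use d t0 that in auto)
      moreover have "sin ((real d - 3) * t) = 0" if "d = 11"
      proof -
        have "(real d - 3) * t = pi" using dt that by simp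
        then show ?thesis by simp
      qed
      moreover have "sin ((real d - 3) * t) = 0" if "d = 3" using that by simp
      ultimately show ?thesis by (metis less_irrefl)
    qed
    have tb: "t < pi / 2" "real d * t + 2 * t \<le> 2 * pi" "pi < real d * t"
      using dt d3 t0 pi_gt_zero by linarith+
    have dist: "(real d + 2) * t = real d * t + 2 * t" "(real d + 1 - real 1) * t = real d * t"
      "(real d + 1 - real 2) * t = real d * t - t" by (simp_all add: algebra_simps)
    show ?thesis
    proof (rule fin[of t 1])
      show "t < pi / 2" "(real d + 2) * t \<le> 2 * pi" "pi < (real d + 1 - real 1) * t" 
        unfolding dist using tb by auto
      show "sin ((real d + 2) * t) * sin (2 * t) = sin ((real d + 1 - real 1) * t) * sin ((real 1 + 1) * t)"
        using s1 s2 by simp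
      fix j assume j: "1 \<le> j" "j \<le> d"
      have e: "real d - 1 - 2 * real 1 = real d - 3" by simp
      have g11: "(real d + 1 - real 2) * t > pi" if "d = 11"
        unfolding dist using that dt t0 by simp
      have g3: "\<not> (real d + 1 - real 2) * t > pi" if "d = 3"
        unfolding dist using that dt t0 by simp
      have g: "(real d + 1 - real (d - j)) * t > pi" if "d - j = 1 \<or> (d - j = 2 \<and> d = 11)"
        using that g11 tb(3) dist(2) by metis
      have "single_positions d j \<longleftrightarrow> d - j = 1 \<or> (d - j = 2 \<and> d = 11)"
        unfolding single_positions_def using 1 d j by auto
      also have "\<dots> \<longleftrightarrow> 1 \<le> d - j \<and> (real d + 1 - real (d - j)) * t > pi \<and>
        (d - j = 1 \<or> (d - j = 1 + 1 \<and> sin ((real d - 3) * t) = 0) \<or>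
         (d - j + 1 = 1 \<and> sin ((real d + 1 - 2 * real 1) * t) = 0))"
      proof -
        have g2: "(real d + 1 - real (d - j)) * t > pi ==> d - j = 2 ==> d \<noteq> 3" using g3 by metis
        have "q = 1 \<or> (q = 2 \<and> d = 11) \<longleftrightarrow> 1 \<le> q \<and> A \<and>
            (q = 1 \<or> (q = 1 + 1 \<and> (d = 3 \<or> d = 11)) \<or> (q + 1 = 1 \<and> B))"
          if "A ==> q = 2 ==> d \<noteq> 3" "q = 1 \<or> (q = 2 \<and> d = 11) ==> A" for A B and q :: nat
          using that by auto
        from this[OF g2 g] show ?thesis unfolding z .
      qed
      finally show "single_positions d j \<longleftrightarrow> 1 \<le> d - j \<and> (real d + 1 - real (d - j)) * t > pi \<and>
        (d - j = 1 \<or> (d - j = 1 + 1 \<and> sin ((real d - 1 - 2 * real 1) * t) = 0) \<or>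
         (d - j + 1 = 1 \<and> sin ((real d + 1 - 2 * real 1) * t) = 0))" unfolding e .
    qed (use d t0 up in auto)
  next
    case 2
    define a b where "a = pi / (real d - 3)" and "b = pi / (real d - 5)"
    have ab: "0 < a" "a < b" "(real d - 3) * a = pi" "(real d - 5) * b = pi"
      unfolding a_def b_def using 2 by (auto intro!: divide_strict_left_mono)
    have a9: "9 * a \<le> pi" using mult_right_mono[of 9 "real d - 3" a] ab 2 by simp
    have b7: "7 * b \<le> pi" "17 * b \<ge> pi"
      using mult_right_mono[of 7 "real d - 5" b] mult_right_mono[of "real d - 5" 17 b] ab 2 by simp_all
    \<comment> \<open>The sign is opposite to that of \<open>cos (4 * a)\<close>, which is positive
      as soon as \<open>d - 3 > 8\<close>; this is the threshold 11.\<close>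
    have ha: "h2 a < 0"
    proof -
      have "h2 a = sin (2 * a) * (sin (3 * a) - sin (5 * a))"
        unfolding h2_def using shift[of 2 5 a] shift[of "-1" 2 a] ab by (simp add: algebra_simps)
      also have "\<dots> = - (2 * sin (2 * a) * cos (4 * a) * sin (1 * a))" unfolding id1 by simp
      finally show ?thesis using spos[of 2 a] spos[of 1 a] cos_gt_zero[of "4 * a"] ab a9 by simp
    qed
    \<comment> \<open>The sign is that of \<open>1 - 2 * cos (6 * b)\<close>, positive when
      \<open>6 * b > pi / 3\<close>, that is, \<open>d - 5 < 18\<close>; this is the threshold
      23.\<close>
    have hb: "h2 b > 0"
    proof -
      have "h2 b = sin (4 * b) * sin (3 * b) - sin (7 * b) * sin (2 * b)"
        unfolding h2_def using shift[of 2 7 b] shift[of "-1" 4 b] ab by (simp add: algebra_simps)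
      also have "\<dots> = sin (1 * b) * sin (2 * b) * (1 - 2 * cos (6 * b))" unfolding id2 by (simp add: algebra_simps)
      finally have e: "h2 b = sin (1 * b) * sin (2 * b) * (1 - 2 * cos (6 * b))" .
      have "cos (6 * b) < cos (pi / 3)" using b7 ab by (intro cos_monotone_0_pi) auto
      then show ?thesis unfolding e using spos[of 2 b] spos[of 1 b] ab b7 by (simp add: cos_60)
    qed
    obtain t where t: "a < t" "t < b" "h2 t = 0" using root[OF ab(2) ha hb c2] by blast
    have ta: "(real d - 3) * t > pi" using mult_strict_left_mono[OF t(1), of "real d - 3"] ab 2 by simp
    have tb: "(real d - 5) * t < pi" using mult_strict_left_mono[OF t(2), of "real d - 5"] ab 2 by simp
    have t0: "t > 0" using t ab by simp
    have "7 * t \<le> (real d - 5) * t" using t0 2 by (intro mult_right_mono) auto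
    then have t7: "7 * t < pi" using tb by linarith
    have n5: "sin ((real d - 5) * t) \<noteq> 0" using spos[of "real d - 5" t] tb t0 2 by simp
    have n3: "sin ((real d - 3) * t) \<noteq> 0"
    proof -
      have "sin ((real d - 3) * t - pi) > 0" by (rule sin_gt_zero) (use ta tb t7 t0 in \<open>auto simp: algebra_simps\<close>)
      then show ?thesis by simp
    qed
    show ?thesis
    proof (rule fin[of t 2])
      show "t < pi / 2" "(real d + 2) * t \<le> 2 * pi" "pi < (real d + 1 - real 2) * t"
        using ta tb t0 t7 by (simp_all add: algebra_simps)
      show "sin ((real d + 2) * t) * sin (2 * t) = sin ((real d + 1 - real 2) * t) * sin ((real 2 + 1) * t)"
        using t(3) unfolding h2_def by simp
      fix j assume j: "1 \<le> j" "j \<le> d"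
      have e: "real d - 1 - 2 * real 2 = real d - 5" "real d + 1 - 2 * real 2 = real d - 3" by simp_all
      have g: "(real d + 1 - real 2) * t > pi" using ta t0 by (simp add: algebra_simps)
      have "single_positions d j \<longleftrightarrow> d - j = 2"
        unfolding single_positions_def using 2 d j by auto
      then show "single_positions d j \<longleftrightarrow> 1 \<le> d - j \<and> (real d + 1 - real (d - j)) * t > pi \<and>
        (d - j = 2 \<or> (d - j = 2 + 1 \<and> sin ((real d - 1 - 2 * real 2) * t) = 0) \<or>
         (d - j + 1 = 2 \<and> sin ((real d + 1 - 2 * real 2) * t) = 0))"
        unfolding e using n3 n5 g by auto
    qed (use 2 t0 ta tb in \<open>auto simp: algebra_simps\<close>)
  next
    case 3
    \<comment> \<open>At this angle \<open>cos (6 * t) = 1 / 2\<close> solves the equation and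
      \<open>(d - 5) * t = pi\<close> is the tie, so the positions 2 and 3 are equally good.\<close>
    define t where "t = pi / 18"
    have t18: "18 * t = pi" by (simp add: t_def)
    have t0: "t > 0" by (simp add: t_def)
    have h: "h2 t = 0"
    proof -
      have "h2 t = sin (4 * t) * sin (3 * t) - sin (7 * t) * sin (2 * t)"
        unfolding h2_def using shift[of 2 7 t] shift[of "-1" 4 t] t18 3 by (simp add: algebra_simps)
      also have "\<dots> = 0" unfolding id2 by (simp add: t_def cos_60)
      finally show ?thesis .
    qed
    have n5: "sin ((real d - 5) * t) = 0" using t18 3 by simp
    have n3: "sin ((real d - 3) * t) \<noteq> 0"
    proof -
      have "sin ((real d - 3) * t - pi) > 0" by (rule sin_gt_zero) (use t18 t0 3 in \<open>auto simp: algebra_simps\<close>)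
      then show ?thesis by simp
    qed
    show ?thesis
    proof (rule fin[of t 2])
      show "t < pi / 2" "(real d + 2) * t \<le> 2 * pi" "pi < (real d + 1 - real 2) * t"
        using t18 t0 3 by (simp_all add: algebra_simps)
      show "sin ((real d + 2) * t) * sin (2 * t) = sin ((real d + 1 - real 2) * t) * sin ((real 2 + 1) * t)"
        using h unfolding h2_def by simp
      fix j assume j: "1 \<le> j" "j \<le> d"
      have e: "real d - 1 - 2 * real 2 = real d - 5" "real d + 1 - 2 * real 2 = real d - 3" by simp_all
      have g: "(real d + 1 - real 2) * t > pi" "(real d + 1 - real 3) * t > pi" using t18 t0 3 by (simp_all add: algebra_simps)
      have "single_positions d j \<longleftrightarrow> d - j = 2 \<or> d - j = 3"
        unfolding single_positions_def using 3 j by auto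
      then show "single_positions d j \<longleftrightarrow> 1 \<le> d - j \<and> (real d + 1 - real (d - j)) * t > pi \<and>
        (d - j = 2 \<or> (d - j = 2 + 1 \<and> sin ((real d - 1 - 2 * real 2) * t) = 0) \<or>
         (d - j + 1 = 2 \<and> sin ((real d + 1 - 2 * real 2) * t) = 0))"
        unfolding e using n3 n5 g by auto
    qed (use 3 t0 t18 in \<open>auto simp: algebra_simps\<close>)
  next
    case 4
    define a b where "a = pi / (real d - 5)" and "b = pi / (real d - 7)"
    have ab: "0 < a" "a < b" "(real d - 5) * a = pi" "(real d - 7) * b = pi"
      unfolding a_def b_def using 4 by (auto intro!: divide_strict_left_mono)
    have a19: "19 * a \<le> pi" using mult_right_mono[of 19 "real d - 5" a] ab 4 by simp
    have b17: "17 * b \<le> pi" using mult_right_mono[of 17 "real d - 7" b] ab 4 by simp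
    have ha: "h3 a < 0"
    proof -
      have "h3 a = sin (4 * a) * sin (3 * a) - sin (7 * a) * sin (2 * a)"
        unfolding h3_def using shift[of 2 7 a] shift[of "-2" 3 a] ab by (simp add: algebra_simps)
      also have "\<dots> = - (sin (1 * a) * sin (2 * a) * (2 * cos (6 * a) - 1))" unfolding id2 by simp
      finally have e: "h3 a = - (sin (1 * a) * sin (2 * a) * (2 * cos (6 * a) - 1))" .
      \<comment> \<open>Again the threshold 23, now from above: \<open>6 * a < pi / 3\<close>
        because \<open>d - 5 > 18\<close>.\<close>
      have "cos (pi / 3) < cos (6 * a)" using a19 ab by (intro cos_monotone_0_pi) auto
      then show ?thesis unfolding e using spos[of 2 a] spos[of 1 a] ab a19 by (simp add: cos_60)
    qed
    have hb: "h3 b > 0"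
    proof -
      have "h3 b = sin (5 * b) * sin (4 * b) - sin (9 * b) * sin (2 * b)"
        unfolding h3_def using shift[of 2 9 b] shift[of "-2" 5 b] ab by (simp add: algebra_simps)
      also have "\<dots> = sin (2 * b) * sin (1 * b) * (1 + 2 * cos (2 * b) - 2 * cos (8 * b))" unfolding id3 by simp
      finally have e: "h3 b = sin (2 * b) * sin (1 * b) * (1 + 2 * cos (2 * b) - 2 * cos (8 * b))" .
      have "cos (8 * b) \<le> cos (2 * b)" using b17 ab by (intro cos_monotone_0_pi_le) auto
      then show ?thesis unfolding e using spos[of 2 b] spos[of 1 b] ab b17 by simp
    qed
    obtain t where t: "a < t" "t < b" "h3 t = 0" using root[OF ab(2) ha hb c3] by blast
    have ta: "(real d - 5) * t > pi" using mult_strict_left_mono[OF t(1), of "real d - 5"] ab 4 by simp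
    have tb: "(real d - 7) * t < pi" using mult_strict_left_mono[OF t(2), of "real d - 7"] ab 4 by simp
    have t0: "t > 0" using t ab by simp
    have "17 * t \<le> (real d - 7) * t" using t0 4 by (intro mult_right_mono) auto
    then have t17: "17 * t < pi" using tb by linarith
    have n7: "sin ((real d - 7) * t) \<noteq> 0" using spos[of "real d - 7" t] tb t0 4 by simp
    have n5: "sin ((real d - 5) * t) \<noteq> 0"
    proof -
      have "sin ((real d - 5) * t - pi) > 0" by (rule sin_gt_zero) (use ta tb t17 t0 in \<open>auto simp: algebra_simps\<close>)
      then show ?thesis by simp
    qed
    show ?thesis
    proof (rule fin[of t 3])
      show "t < pi / 2" "(real d + 2) * t \<le> 2 * pi" "pi < (real d + 1 - real 3) * t"
        using ta tb t0 t17 by (simp_all add: algebra_simps)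
      show "sin ((real d + 2) * t) * sin (2 * t) = sin ((real d + 1 - real 3) * t) * sin ((real 3 + 1) * t)"
        using t(3) unfolding h3_def by simp
      fix j assume j: "1 \<le> j" "j \<le> d"
      have e: "real d - 1 - 2 * real 3 = real d - 7" "real d + 1 - 2 * real 3 = real d - 5" by simp_all
      have g: "(real d + 1 - real 3) * t > pi" using ta t0 by (simp add: algebra_simps)
      have "single_positions d j \<longleftrightarrow> d - j = 3"
        unfolding single_positions_def using 4 j by auto
      then show "single_positions d j \<longleftrightarrow> 1 \<le> d - j \<and> (real d + 1 - real (d - j)) * t > pi \<and>
        (d - j = 3 \<or> (d - j = 3 + 1 \<and> sin ((real d - 1 - 2 * real 3) * t) = 0) \<or>
         (d - j + 1 = 3 \<and> sin ((real d + 1 - 2 * real 3) * t) = 0))"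
        unfolding e using n5 n7 g by auto
    qed (use 4 t0 ta tb in \<open>auto simp: algebra_simps\<close>)
  qed
qed

section \<open>Diameter three\<close>

lemma half_cert_length_1:
  assumes l: "l > 0" and t: "t > 0" and k: "real k + 1 \<le> l^2 + l * t" and S: "S 0 = l^2 + l * t" "S 1 = l" "S 2 = - (l * t)"
  shows "half_cert l 1 S k" "half_tight l 1 S k i \<longleftrightarrow> i = 1 \<and> real k + 1 = l^2 + l * t"
    "real k + 1 < l^2 + l * t ==> half_strict l 1 S k"
proof -
  have W: "l * S 0 - S 1 = l * (l^2 + l * t - 1)" unfolding S by (simp add: algebra_simps)
  have c: "real k * chp l (1 + 1) * S 1 = l * (l * real k)" using S by (simp add: mult_ac)
  have e: "real k * chp l (1 + 1) * S 1 \<le> l * (l * S 0 - S 1) \<longleftrightarrow> real k + 1 \<le> l^2 + l * t"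
    "real k * chp l (1 + 1) * S 1 = l * (l * S 0 - S 1) \<longleftrightarrow> real k + 1 = l^2 + l * t"
    "real k * chp l (1 + 1) * S 1 < l * (l * S 0 - S 1) \<longleftrightarrow> real k + 1 < l^2 + l * t"
    unfolding c W using l by auto
  have one: "j = 1" if "1 \<le> j" "j \<le> 1" for j :: nat using that by simp
  have pos: "S j > 0" if "j \<le> 1" for j
  proof -
    have "j = 0 \<or> j = 1" using that by linarith
    then show ?thesis using S l t by (auto simp: add_pos_pos)
  qed
  have rec: "S (j + 2) = l * S (j + 1) - S j" if "j < 1" for j
    using that S by (simp add: power2_eq_square numeral_2_eq_2)
  have W0: "S 1 \<le> l * S 0" "k > 0 ==> S 1 < l * S 0"
  proof -
    have "l * (l^2 + l * t - 1) \<ge> 0" using l k by simp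
    then show "S 1 \<le> l * S 0" using W by simp
    have "l * (l^2 + l * t - 1) > 0" if "k > 0" using l k that by simp
    then show "k > 0 ==> S 1 < l * S 0" using W by simp
  qed
  have le: "real k * chp l (j + 1) * S j \<le> l * (l * S 0 - S 1)" if "1 \<le> j" "j \<le> 1" for j
    using e(1) k one[OF that] by simp
  show hc: "half_cert l 1 S k" unfolding half_cert_def using l pos rec W0 le by blast
  show "half_tight l 1 S k i \<longleftrightarrow> i = 1 \<and> real k + 1 = l^2 + l * t"
    unfolding half_tight_def using e(2) one[of i] by auto
  assume s: "real k + 1 < l^2 + l * t"
  have "l * (l^2 + l * t - 1) > 0" using l s by simp
  then have "S 1 \<noteq> l * S 0" using W by auto
  moreover have "\<not> half_tight l 1 S k j" for j unfolding half_tight_def using e(2) one[of j] s by auto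
  ultimately show "half_strict l 1 S k" unfolding half_strict_def using hc by blast
qed

text \<open>Moving \<open>r\<close> leaves to the heavier side moves the node along the middle edge by more than the
  lighter side needs.\<close>

lemma diameter_3_certificate:
  assumes k: "k \<ge> 1" "k \<le> k'" "k' \<le> k + 1"
  shows "\<exists>l p S p' S'. half_cert l p S k \<and> half_cert l p' S' k' \<and> path_node 3 p S p' S' \<and>
    coverable l 3 k k' p S p' S' \<and>
    (\<forall>i j. i < j --> j \<le> 3 --> (i = 1 \<and> j = 2 \<longleftrightarrow> half_tight l p S k i \<and> half_tight l p' S' k' (3 - j)))"
proof -
  \<comment> \<open>A half has the values \<open>l^2 + l * t\<close>, \<open>l\<close>,
    \<open>- l * t\<close>, and is tight with \<open>k\<close> leaves iff
    \<open>l * t = k + 1 - l^2\<close>. The other half has \<open>1 / t\<close> in place of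
    \<open>t\<close>, so multiplying the two equations eliminates \<open>t\<close> and leaves
    \<open>f L = 0\<close>.\<close>
  define f where "f x = (real k + 1 - x) * (real k' + 1 - x) - x" for x
  have "\<exists>x\<ge>0. x \<le> real k + 1 \<and> f x = 0"
    by (rule IVT2') (auto simp: f_def intro!: continuous_intros)
  then obtain L where L: "0 \<le> L" "L \<le> real k + 1" "f L = 0" by blast
  have "L \<noteq> 0" using L(3) unfolding f_def by (auto simp: add_nonneg_eq_0_iff)
  moreover have "L \<noteq> real k + 1" using L(3) unfolding f_def by auto
  ultimately have L0: "0 < L" "L < real k + 1" using L by auto
  define l where "l = sqrt L"
  have l: "l > 0" "l^2 = L" using L0 unfolding l_def by auto
  define t where "t = (real k + 1 - L) / l"
  have t: "t > 0" "l * t = real k + 1 - L" using L0 l unfolding t_def by auto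
  have t': "l * (1 / t) = real k' + 1 - L"
  proof -
    have "(l * t) * (real k' + 1 - L) = l * l" using L(3) t(2) l(2) unfolding f_def by (simp add: power2_eq_square)
    then have "t * (real k' + 1 - L) = l" using l by simp
    then show ?thesis using t by (simp add: field_simps)
  qed
  have t1: "t \<le> 1"
  proof -
    have "l * t \<le> l * (1 / t)" unfolding t' t(2) using k by simp
    then have "t \<le> 1 / t" using l by (simp only: mult_le_cancel_left_pos)
    then have "t * t \<le> 1" using t by (simp add: field_simps)
    then show ?thesis by (metis abs_le_square_iff abs_of_pos one_power2 power2_eq_square t(1) abs_one)
  qed
  define V where "V u j = (if j = 0 then l^2 + l * u else if j = 1 then l else - (l * u))" for u and j :: nat
  have V: "V u 0 = l^2 + l * u" "V u 1 = l" "V u 2 = - (l * u)" for u unfolding V_def by auto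
  have node: "path_node 3 1 (V u) 1 (V (1 / u))" if "u > 0" for u
    unfolding path_node_def using V l that by (simp add: numeral_2_eq_2)
  have e: "real k + 1 = l^2 + l * t" "real k' + 1 = l^2 + l * (1 / t)" using t t' l by auto
  have t2: "1 / t > 0" using t by simp
  note left = half_cert_length_1[where S = "V t", OF l(1) t(1) eq_refl[OF e(1)] V]
    and right = half_cert_length_1[where S = "V (1 / t)", OF l(1) t2 eq_refl[OF e(2)] V]
  note hl = left(1) and hr = right(1)
  have s2: "(\<Sum>j\<le>1. w j) = w 0 + w 1" for w :: "nat => nat" by simp
  have s3: "(\<Sum>j\<le>3. w j) = w 0 + w 1 + w 2 + w 3" for w :: "nat => nat" by (simp add: numeral_3_eq_3 numeral_2_eq_2)
  have main: "load_cert l 3 1 (V t) k 1 (V (1 / t)) k' w \<or> strict_load_cert l 3 w"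
    if w: "w 0 = 0" "w 3 = 0" "w 1 + w 2 = k + k'" "w 1 \<le> k" for w :: "nat => nat"
  proof (cases "w 1 = k")
    case True
    then show ?thesis unfolding load_cert_def s2 using w hl hr node[OF t(1)] by simp
  next
    case False
    define r where "r = k - w 1"
    have r: "r \<ge> 1" "w 1 = k - r" "r \<le> k" "w 2 = k' + r" using w False unfolding r_def by auto
    \<comment> \<open>The new parameter \<open>u\<close> satisfies
      \<open>1 / u = 1 / t + r / l\<close>, which makes the heavier side exactly tight with
      \<open>k' + r\<close> leaves. The lighter side keeps a margin because
      \<open>t \<le> 1\<close>, a consequence of \<open>k \<le> k'\<close>.\<close>
    define q where "q = l + real r * t"
    have q: "q > 0" unfolding q_def using l t by (simp add: add_pos_nonneg)
    define u where "u = l * t / q"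
    have u: "u > 0" "1 / u = 1 / t + real r / l" 
      unfolding u_def using l t q by (simp_all add: q_def field_simps)
    have a: "real (k' + r) + 1 = l^2 + l * (1 / u)" unfolding u(2) using e(2) l by (simp add: distrib_left)
    have b: "real (k - r) + 1 < l^2 + l * u"
    proof -
      have "t * t \<le> 1" using t t1 by (intro mult_le_one) auto
      then have "l * (t * t) \<le> l" using l by simp
      moreover have "real r * t > 0" using r t by simp
      ultimately have "l * (t * t) < q" unfolding q_def by linarith
      then have "real r * (l * (t * t)) < real r * q" using r by simp
      then have "l * t * q - real r * q < l * t * l" unfolding q_def by (simp add: algebra_simps)
      then have "(l * t - real r) * q < l * t * l" by (simp add: algebra_simps)
      then have "l * t - real r < l * u" unfolding u_def using q by (simp add: field_simps)
      then show ?thesis using e(1) r by (simp add: of_nat_diff)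
    qed
    have u2: "1 / u > 0" using u(1) by simp
    note st = half_cert_length_1(3)[where S = "V u", OF l(1) u(1) less_imp_le[OF b] V b]
    note half_cert_length_1(1)[where S = "V (1 / u)", OF l(1) u2 eq_refl[OF a] V]
    then have "load_cert l 3 1 (V u) (k - r) 1 (V (1 / u)) (k' + r) w"
      unfolding load_cert_def s2 using st[unfolded half_strict_def] node[OF u(1)] w(1,2) r by simp
    then show ?thesis unfolding strict_load_cert_def using st by blast
  qed
  have cov: "coverable l 3 k k' 1 (V t) 1 (V (1 / t))"
    unfolding coverable_def s3
  proof (intro allI impI)
    fix w :: "nat => nat" assume w: "w 0 = 0" "w 3 = 0" "w 0 + w 1 + w 2 + w 3 = k + k'"
    define w' where "w' = (\<lambda>j. w (3 - j))"
    have w': "w' 0 = w 3" "w' 3 = w 0" "w' 1 = w 2" "w' 2 = w 1" unfolding w'_def by (simp_all add: numeral_2_eq_2)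
    have "w 1 \<le> k \<or> w' 1 \<le> k" using w w' k by linarith
    then have "\<exists>u\<in>{w, w'}. load_cert l 3 1 (V t) k 1 (V (1 / t)) k' u \<or> strict_load_cert l 3 u"
      using main[of w] main[of w'] w w' by (elim disjE) auto
    then show "\<exists>u\<in>{w, \<lambda>j. w (3 - j)}. load_cert l 3 1 (V t) k 1 (V (1 / t)) k' u \<or> strict_load_cert l 3 u"
      unfolding w'_def .
  qed
  have ti: "half_tight l 1 (V t) k i \<longleftrightarrow> i = 1" "half_tight l 1 (V (1 / t)) k' i \<longleftrightarrow> i = 1" for i
    unfolding left(2) right(2) using e by blast+
  have "3 - j = 1 \<longleftrightarrow> j = 2" if "j \<le> 3" for j :: nat using that by arith
  then have "\<forall>i j. i < j --> j \<le> 3 -->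
    (i = 1 \<and> j = 2 \<longleftrightarrow> half_tight l 1 (V t) k i \<and> half_tight l 1 (V (1 / t)) k' (3 - j))"
    unfolding ti by blast
  then show ?thesis using hl hr node[OF t(1)] cov by blast
qed

text \<open>All parities and diameters in one statement, so that the part on graphs is free of case
  distinctions. Side conditions are claimed from \<open>d = 4\<close> on because for
  \<open>d = 3\<close> every branch is a single leaf.\<close>

lemma extremal_certificate:
  assumes d: "d \<ge> 3" and m: "m \<ge> 1"
  defines "k \<equiv> m div 2" and "k' \<equiv> (m + 1) div 2"
  shows "\<exists>l p S p' S'. half_cert l p S k \<and> half_cert l p' S' k' \<and> path_node d p S p' S' \<and>
    coverable l d k k' p S p' S' \<and> (m = 1 --> S 1 = l * S 0) \<and>
    (d \<ge> 4 \<and> m \<ge> 2 --> side_conditions l d k k') \<and>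
    (\<forall>i j. i < j --> j \<le> d -->
      (maximizer_positions m d i j \<longleftrightarrow> (m \<ge> 2 --> half_tight l p S k i) \<and> half_tight l p' S' k' (d - j)))"
proof -
  have kk: "k \<le> k'" "k' \<le> k + 1" unfolding k_def k'_def by auto
  consider "m = 1" | "m \<ge> 2" "d = 3" | "m \<ge> 2" "d \<ge> 4" "even m" | "m \<ge> 2" "d \<ge> 4" "odd m" using m d by linarith
  then show ?thesis
  proof cases
    case 1
    have k01: "k = 0" "k' = 1" unfolding k_def k'_def using 1 by auto
    obtain l p S p' S' where c: "half_cert l p S 0" "half_cert l p' S' 1" "path_node d p S p' S'"
      and W: "S 1 = l * S 0" and c4: "\<And>j. 1 \<le> j ==> j \<le> d ==> single_positions d j \<longleftrightarrow> half_tight l p' S' 1 (d - j)"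
      using single_certificate[OF d] by blast
    have "coverable l d 0 1 p S p' S'" by (rule coverableI[OF c(1-3)]) auto
    moreover have "\<forall>i j. i < j --> j \<le> d -->
      (maximizer_positions m d i j \<longleftrightarrow> (m \<ge> 2 --> half_tight l p S 0 i) \<and> half_tight l p' S' 1 (d - j))"
      unfolding maximizer_positions_def using 1 c4 by auto
    moreover have "d \<ge> 4 \<and> m \<ge> 2 --> side_conditions l d 0 1" using 1 by simp
    moreover have "m = 1 --> S 1 = l * S 0" using W by blast
    ultimately show ?thesis unfolding k01 using c(1-3) by blast
  next
    case 2
    have k1: "k \<ge> 1" unfolding k_def using 2 by simp
    obtain l p S p' S' where c: "half_cert l p S k" "half_cert l p' S' k'" "path_node 3 p S p' S'"
      "coverable l 3 k k' p S p' S'"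
      "\<And>i j. i < j ==> j \<le> 3 ==> i = 1 \<and> j = 2 \<longleftrightarrow> half_tight l p S k i \<and> half_tight l p' S' k' (3 - j)"
      using diameter_3_certificate[OF k1 kk] by blast
    have "maximizer_positions m 3 i j \<longleftrightarrow> i = 1 \<and> j = 2" for i j
      unfolding maximizer_positions_def even_positions_def odd_positions_def using 2
      by (cases "even m") (auto elim: oddE)
    then have "\<forall>i j. i < j --> j \<le> d -->
      (maximizer_positions m d i j \<longleftrightarrow> (m \<ge> 2 --> half_tight l p S k i) \<and> half_tight l p' S' k' (d - j))"
      unfolding 2(2) using c(5) 2(1) by simp
    moreover have "d \<ge> 4 \<and> m \<ge> 2 --> side_conditions l d k k'" using 2 by simp
    moreover have "m = 1 --> S 1 = l * S 0" using 2(1) by simp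
    ultimately show ?thesis using c(1-4)[folded 2(2)] by blast
  next
    case 3
    have k1: "k \<ge> 1" "k' = k" unfolding k_def k'_def using 3 by (auto elim: evenE)
    obtain l p S p' S' where c: "half_cert l p S k" "half_cert l p' S' k" "path_node d p S p' S'"
      "side_conditions l d k k"
      "\<And>i j. i < j ==> j \<le> d ==> even_positions d i j \<longleftrightarrow> half_tight l p S k i \<and> half_tight l p' S' k (d - j)"
      using even_certificate[OF 3(2) k1(1)] by blast
    have "coverable l d k k p S p' S'"
      by (rule coverableI[OF c(1-3)]) (use c(4) in \<open>auto simp: side_conditions_def\<close>)
    moreover have "maximizer_positions m d i j \<longleftrightarrow> even_positions d i j" if "i < j" for i j
      unfolding maximizer_positions_def using 3 that by auto
    then have "\<forall>i j. i < j --> j \<le> d -->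
      (maximizer_positions m d i j \<longleftrightarrow> (m \<ge> 2 --> half_tight l p S k i) \<and> half_tight l p' S' k (d - j))"
      using c(5) 3(1) by simp
    moreover have "m = 1 --> S 1 = l * S 0" using \<open>m \<ge> 2\<close> by simp
    ultimately show ?thesis unfolding k1(2) using c(1-4) by blast
  next
    case 4
    have k1: "k \<ge> 1" "k' = k + 1" "2 * k + 1 = m" unfolding k_def k'_def using 4 by (auto elim!: oddE)
    obtain l p S p' S' where c: "half_cert l p S k" "half_cert l p' S' (k + 1)" "path_node d p S p' S'"
      "side_conditions l d k (k + 1)"
      "\<And>i j. i < j ==> j \<le> d ==> odd_positions m d i j \<longleftrightarrow> half_tight l p S k i \<and> half_tight l p' S' (k + 1) (d - j)"
      using odd_certificate[OF 4(2) k1(1)] unfolding k1(3) by blast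
    have "coverable l d k (k + 1) p S p' S'"
      by (rule coverableI[OF c(1-3)]) (use c(4) in \<open>auto simp: side_conditions_def\<close>)
    moreover have "maximizer_positions m d i j \<longleftrightarrow> odd_positions m d i j" if "i < j" for i j
      unfolding maximizer_positions_def using 4 k1 that by auto
    then have "\<forall>i j. i < j --> j \<le> d -->
      (maximizer_positions m d i j \<longleftrightarrow> (m \<ge> 2 --> half_tight l p S k i) \<and> half_tight l p' S' (k + 1) (d - j))"
      using c(5) 4(1) by simp
    moreover have "m = 1 --> S 1 = l * S 0" using \<open>m \<ge> 2\<close> by simp
    ultimately show ?thesis unfolding k1(2) using c(1-4) by blast
  qed
qed

section \<open>Pushing branches onto the path\<close>

text \<open>A graph consisting of a path and of branches hanging off its inner vertices; \<open>rk\<close> excludes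
  cycles among the parents.\<close>

locale path_decomposition =
  fixes T :: "'a pair_pre_digraph" and d :: nat and v :: "nat => 'a" and X :: "'a set"
    and par :: "'a => 'a" and rk :: "'a => nat"
  assumes inj: "inj_on v {..d}" and finX: "finite X" and disj: "X \<inter> v ` {..d} = {}"
    and verts: "pverts T = v ` {..d} \<union> X"
    and arcs: "parcs T = {(v a, v b) | a b. a \<le> d \<and> b \<le> d \<and> (b = a + 1 \<or> a = b + 1)} \<union>
      {(u, par u) | u. u \<in> X} \<union> {(par u, u) | u. u \<in> X}"
    and par_in: "\<And>u. u \<in> X ==> par u \<in> X \<union> v ` {0<..<d}"
    and rk_par: "\<And>u. u \<in> X ==> par u \<in> X ==> rk (par u) < rk u"
begin

text \<open>The edges from \<open>F\<close> to the parents are cut; \<open>bsize F u\<close> counts what still hangs at \<open>u\<close>.\<close>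

definition chain :: "'a set => ('a \<times> 'a) set" where
  "chain F = {(x, par x) | x. x \<in> X - F}"

definition bsize :: "'a set => 'a => nat" where
  "bsize F u = card {x \<in> X. (x, u) \<in> (chain F)\<^sup>*}"

definition children :: "'a set => 'a => 'a set" where
  "children F y = {c \<in> X - F. par c = y}"

definition load :: "'a set => nat => nat" where
  "load F j = (\<Sum>c\<in>children F (v j). bsize F c)"

section \<open>Sizes of branches and the loads they put on the path\<close>

lemma v_eq: "i \<le> d ==> j \<le> d ==> v i = v j \<longleftrightarrow> i = j"
  using inj by (auto simp: inj_on_def)

lemma v_notin: "j \<le> d ==> v j \<notin> X"
  using disj by auto

lemma fin_children [simp]: "finite (children F y)"
  using finX unfolding children_def by auto

lemma par_path:
  assumes "u \<in> X" "par u \<notin> X"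
  obtains j where "0 < j" "j < d" "par u = v j"
  using par_in[OF assms(1)] assms(2) by auto

lemma single_valued_chain: "single_valued (chain F)"
  unfolding chain_def single_valued_def by auto

lemma chain_rk: "(x, y) \<in> (chain F)\<^sup>* ==> y \<in> X ==> rk y \<le> rk x \<and> (x \<noteq> y --> rk y < rk x) \<and> x \<in> X"
proof (induction rule: converse_rtrancl_induct)
  case (step x z)
  then have "x \<in> X" "z = par x" unfolding chain_def by auto
  then show ?case using step rk_par[of x] by auto
qed simp

text \<open>What hangs at distinct children is disjoint, since a vertex has only one way up in
  \<open>chain\<close>: two of its ancestors are comparable, and \<open>rk\<close> forbids
  comparable children.\<close>

lemma bsize_rec:
  assumes u: "u \<in> X"
  shows "bsize F u = 1 + (\<Sum>c\<in>children F u. bsize F c)"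
proof -
  define D where "D y = {x \<in> X. (x, y) \<in> (chain F)\<^sup>*}" for y
  have fin: "finite (D y)" for y unfolding D_def using finX by simp
  have Du: "D u = insert u (\<Union>c\<in>children F u. D c)"
  proof (intro equalityI subsetI)
    fix x assume "x \<in> D u"
    then have x: "x \<in> X" "(x, u) \<in> (chain F)\<^sup>*" unfolding D_def by auto
    from x(2) show "x \<in> insert u (\<Union>c\<in>children F u. D c)"
    proof (cases rule: rtranclE)
      case (step c)
      then have "c \<in> children F u" unfolding chain_def children_def by auto
      then show ?thesis using step x unfolding D_def by auto
    qed simp
  next
    fix x assume x: "x \<in> insert u (\<Union>c\<in>children F u. D c)"
    have "(c, u) \<in> chain F" if "c \<in> children F u" for c using that unfolding chain_def children_def by auto
    then show "x \<in> D u" using x u unfolding D_def by (auto intro: rtrancl_into_rtrancl)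
  qed
  have below: "rk u < rk c" if "c \<in> children F u" for c
    using that rk_par[of c] u unfolding children_def by auto
  have cX: "c \<in> X" if "c \<in> children F u" for c using that unfolding children_def by auto
  have uD: "(u, c) \<notin> (chain F)\<^sup>*" if "c \<in> children F u" for c
    using chain_rk[of u c F] below[OF that] cX[OF that] by auto
  have dis: "D c \<inter> D c' = {}" if c: "c \<in> children F u" "c' \<in> children F u" "c \<noteq> c'" for c c'
  proof (rule ccontr)
    have *: False if h: "c \<in> children F u" "c' \<in> children F u" "c \<noteq> c'" "(c, c') \<in> (chain F)\<^sup>*" for c c'
    proof -
      obtain z where "(c, z) \<in> chain F" "(z, c') \<in> (chain F)\<^sup>*"
        using h(3,4) by (auto elim: converse_rtranclE)
      then have "(u, c') \<in> (chain F)\<^sup>*" using h(1) unfolding chain_def children_def by auto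
      then show False using uD[OF h(2)] by simp
    qed
    assume "\<not> ?thesis"
    then obtain x where "(x, c) \<in> (chain F)\<^sup>*" "(x, c') \<in> (chain F)\<^sup>*" unfolding D_def by auto
    then have "(c, c') \<in> (chain F)\<^sup>* \<or> (c', c) \<in> (chain F)\<^sup>*"
      by (rule single_valued_confluent[OF single_valued_chain])
    then show False using *[of c c'] *[of c' c] c by auto
  qed
  have "u \<notin> (\<Union>c\<in>children F u. D c)" using uD unfolding D_def by auto
  then have "card (D u) = 1 + card (\<Union>c\<in>children F u. D c)" unfolding Du using fin by simp
  also have "card (\<Union>c\<in>children F u. D c) = (\<Sum>c\<in>children F u. card (D c))"
    by (rule card_UN_disjoint) (use fin dis in auto)
  finally show ?thesis unfolding bsize_def D_def .
qed

lemma bsize_pos: "u \<in> X ==> bsize F u \<ge> 1"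
  using bsize_rec[of u F] by simp

lemma sum_children:
  fixes g h :: "'a => 'b :: comm_semiring_0"
  shows "(\<Sum>u\<in>X. (\<Sum>c\<in>children F u. g c) * h u) = (\<Sum>c\<in>{c \<in> X - F. par c \<in> X}. g c * h (par c))"
    and "(\<Sum>j\<le>d. (\<Sum>c\<in>children F (v j). g c) * h (v j)) = (\<Sum>c\<in>{c \<in> X - F. par c \<notin> X}. g c * h (par c))"
proof -
  have grp: "(\<Sum>y\<in>Y. (\<Sum>c\<in>children F y. g c) * h y) = (\<Sum>c\<in>{c \<in> X - F. par c \<in> Y}. g c * h (par c))"
    if "finite Y" for Y
  proof -
    have "(\<Sum>y\<in>Y. (\<Sum>c\<in>children F y. g c) * h y) = (\<Sum>y\<in>Y. \<Sum>c\<in>children F y. g c * h (par c))"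
      by (intro sum.cong refl) (simp add: sum_distrib_right children_def)
    also have "\<dots> = (\<Sum>y\<in>Y. \<Sum>c\<in>{c \<in> {c \<in> X - F. par c \<in> Y}. par c = y}. g c * h (par c))"
      by (intro sum.cong refl) (auto simp: children_def)
    also have "\<dots> = (\<Sum>c\<in>{c \<in> X - F. par c \<in> Y}. g c * h (par c))"
      by (rule sum.group) (use that finX in auto)
    finally show ?thesis .
  qed
  show "(\<Sum>u\<in>X. (\<Sum>c\<in>children F u. g c) * h u) = (\<Sum>c\<in>{c \<in> X - F. par c \<in> X}. g c * h (par c))"
    by (rule grp[OF finX])
  have "(\<Sum>j\<le>d. (\<Sum>c\<in>children F (v j). g c) * h (v j)) = (\<Sum>y\<in>v ` {..d}. (\<Sum>c\<in>children F y. g c) * h y)"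
    by (rule sum.reindex[OF inj, unfolded o_def, symmetric])
  also have "\<dots> = (\<Sum>c\<in>{c \<in> X - F. par c \<in> v ` {..d}}. g c * h (par c))" by (rule grp) simp
  also have "{c \<in> X - F. par c \<in> v ` {..d}} = {c \<in> X - F. par c \<notin> X}"
    using par_in disj by fastforce
  finally show "(\<Sum>j\<le>d. (\<Sum>c\<in>children F (v j). g c) * h (v j)) =
      (\<Sum>c\<in>{c \<in> X - F. par c \<notin> X}. g c * h (par c))" .
qed

lemma sum_cut:
  fixes g :: "'a => 'b :: comm_monoid_add"
  assumes "F \<subseteq> X"
  shows "(\<Sum>u\<in>X. g u) = (\<Sum>c\<in>{c \<in> X - F. par c \<in> X}. g c) + (\<Sum>c\<in>{c \<in> X - F. par c \<notin> X}. g c) + (\<Sum>u\<in>F. g u)"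
proof -
  have "X = ({c \<in> X - F. par c \<in> X} \<union> {c \<in> X - F. par c \<notin> X}) \<union> F" using assms by auto
  then have "(\<Sum>u\<in>X. g u) = (\<Sum>u\<in>({c \<in> X - F. par c \<in> X} \<union> {c \<in> X - F. par c \<notin> X}) \<union> F. g u)" by simp
  also have "\<dots> = (\<Sum>u\<in>{c \<in> X - F. par c \<in> X} \<union> {c \<in> X - F. par c \<notin> X}. g u) + (\<Sum>u\<in>F. g u)"
    by (rule sum.union_disjoint) (use finX assms in \<open>auto intro: finite_subset\<close>)
  also have "(\<Sum>u\<in>{c \<in> X - F. par c \<in> X} \<union> {c \<in> X - F. par c \<notin> X}. g u) =
      (\<Sum>c\<in>{c \<in> X - F. par c \<in> X}. g c) + (\<Sum>c\<in>{c \<in> X - F. par c \<notin> X}. g c)"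
    by (rule sum.union_disjoint) (use finX in auto)
  finally show ?thesis .
qed

text \<open>Summing \<open>bsize_rec\<close> over \<open>X\<close> telescopes. What survives are the
  branches attached to the path, which make up the loads, and the parts that have been cut
  off.\<close>

lemma sum_load:
  assumes F: "F \<subseteq> X"
  shows "(\<Sum>j\<le>d. load F j) + (\<Sum>u\<in>F. bsize F u) = card X"
proof -
  have "(\<Sum>u\<in>X. bsize F u) = card X + (\<Sum>u\<in>X. (\<Sum>c\<in>children F u. bsize F c) * 1)"
  proof -
    have "(\<Sum>u\<in>X. bsize F u) = (\<Sum>u\<in>X. 1 + (\<Sum>c\<in>children F u. bsize F c))"
      by (intro sum.cong refl bsize_rec)
    then show ?thesis by (simp add: sum_Suc)
  qed
  also have "(\<Sum>u\<in>X. (\<Sum>c\<in>children F u. bsize F c) * 1) = (\<Sum>c\<in>{c \<in> X - F. par c \<in> X}. bsize F c)"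
    unfolding sum_children(1)[where h = "\<lambda>_. 1"] by simp
  finally have "(\<Sum>c\<in>{c \<in> X - F. par c \<notin> X}. bsize F c) + (\<Sum>u\<in>F. bsize F u) = card X"
    unfolding sum_cut[OF F, of "bsize F"] by simp
  moreover have "(\<Sum>j\<le>d. load F j) = (\<Sum>c\<in>{c \<in> X - F. par c \<notin> X}. bsize F c)"
    using sum_children(2)[where F = F and g = "bsize F" and h = "\<lambda>_. 1"] unfolding load_def by simp
  ultimately show ?thesis by simp
qed

lemma load_ends: "load F 0 = 0" "load F d = 0"
proof -
  have "children F (v j) = {}" if "j = 0 \<or> j = d" for j
  proof -
    have False if c: "c \<in> X" "par c = v j" for c
    proof -
      have "par c \<notin> X" using c v_notin \<open>j = 0 \<or> j = d\<close> by auto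
      then obtain i where "0 < i" "i < d" "par c = v i" using par_path[OF c(1)] by blast
      then show False using c(2) \<open>j = 0 \<or> j = d\<close> v_eq[of i j] by auto
    qed
    then show ?thesis unfolding children_def by auto
  qed
  then show "load F 0 = 0" "load F d = 0" unfolding load_def by simp_all
qed

lemma fin_verts: "finite (pverts T)" and sym_arcs: "sym (parcs T)"
proof -
  show "finite (pverts T)" using verts finX by simp
  show "sym (parcs T)" unfolding arcs sym_def by auto
qed

lemma sum_verts:
  fixes g :: "'a => 'b :: comm_monoid_add"
  shows "(\<Sum>y\<in>pverts T. g y) = (\<Sum>j\<le>d. g (v j)) + (\<Sum>u\<in>X. g u)"
proof -
  have "(\<Sum>y\<in>pverts T. g y) = (\<Sum>y\<in>v ` {..d}. g y) + (\<Sum>u\<in>X. g u)"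
    unfolding verts by (rule sum.union_disjoint) (use finX disj in auto)
  also have "(\<Sum>y\<in>v ` {..d}. g y) = (\<Sum>j\<le>d. g (v j))"
    by (rule sum.reindex[OF inj, unfolded o_def])
  finally show ?thesis .
qed

section \<open>The adjacency form of a path with branches\<close>

lemma arcs_verts: "parcs T \<subseteq> pverts T \<times> pverts T"
  using par_in unfolding arcs verts by fastforce

lemma adj_sum_eq: "y \<in> pverts T ==> adj_sum T x y = (\<Sum>z\<in>{z. (y, z) \<in> parcs T}. x z)"
proof -
  have "{z. (y, z) \<in> parcs T} = {z \<in> pverts T. (y, z) \<in> parcs T}" using arcs_verts by auto
  then show ?thesis unfolding adj_sum_def by (simp add: sum.If_cases[OF fin_verts] Int_def)
qed

lemma adj_sum_branch:
  assumes u: "u \<in> X"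
  shows "adj_sum T x u = x (par u) + (\<Sum>c\<in>children {} u. x c)"
proof -
  have uv: "u \<noteq> v j" if "j \<le> d" for j using u v_notin[OF that] by auto
  have N: "{z. (u, z) \<in> parcs T} = insert (par u) (children {} u)"
    unfolding arcs children_def using u uv by auto
  have "par u \<notin> children {} u"
  proof
    assume "par u \<in> children {} u"
    then have "par u \<in> X" "par (par u) = u" unfolding children_def by auto
    then show False using rk_par[of u] rk_par[of "par u"] u by auto
  qed
  then show ?thesis using adj_sum_eq[of u x] u verts N by simp
qed

lemma adj_sum_path:
  assumes j: "0 < j" "j < d"
  shows "adj_sum T x (v j) = x (v (j - 1)) + x (v (j + 1)) + (\<Sum>c\<in>children {} (v j). x c)"
proof -
  have uv: "v j \<notin> X" using v_notin j by auto
  have e: "v j = v a \<longleftrightarrow> a = j" if "a \<le> d" for a using v_eq[of j a] that j by auto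
  have N: "{z. (v j, z) \<in> parcs T} = {v (j - 1), v (j + 1)} \<union> children {} (v j)"
  proof (intro equalityI subsetI)
    fix z assume "z \<in> {z. (v j, z) \<in> parcs T}"
    then consider a b where "v j = v a" "z = v b" "a \<le> d" "b \<le> d" "b = a + 1 \<or> a = b + 1" | "z \<in> X" "par z = v j"
      unfolding arcs using uv by auto
    then show "z \<in> {v (j - 1), v (j + 1)} \<union> children {} (v j)"
    proof cases
      case 1
      then have "a = j" using e by simp
      then have "b = j + 1 \<or> b = j - 1" using 1(5) by auto
      then show ?thesis using 1(2) by auto
    next
      case 2 then show ?thesis unfolding children_def by simp
    qed
  next
    fix z assume "z \<in> {v (j - 1), v (j + 1)} \<union> children {} (v j)"
    then consider "z = v (j - 1)" | "z = v (j + 1)" | "z \<in> X" "par z = v j" unfolding children_def by auto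
    then show "z \<in> {z. (v j, z) \<in> parcs T}"
    proof cases
      case 1
      have "j \<le> d \<and> j - 1 \<le> d \<and> (j - 1 = j + 1 \<or> j = j - 1 + 1)" using j by auto
      then show ?thesis unfolding arcs 1 by blast
    next
      case 2
      have "j \<le> d \<and> j + 1 \<le> d \<and> (j + 1 = j + 1 \<or> j = j + 1 + 1)" using j by auto
      then show ?thesis unfolding arcs 2 by blast
    next
      case 3 then show ?thesis unfolding arcs by auto
    qed
  qed
  have ne: "v (j - 1) \<noteq> v (j + 1)" using v_eq[of "j - 1" "j + 1"] j by auto
  have nc: "v (j - 1) \<notin> children {} (v j)" "v (j + 1) \<notin> children {} (v j)"
    unfolding children_def using v_notin[of "j - 1"] v_notin[of "j + 1"] j by auto
  have "(\<Sum>z\<in>{v (j - 1), v (j + 1)} \<union> children {} (v j). x z) =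
      (\<Sum>z\<in>{v (j - 1), v (j + 1)}. x z) + (\<Sum>c\<in>children {} (v j). x c)"
    by (rule sum.union_disjoint) (use nc in auto)
  then show ?thesis using adj_sum_eq[of "v j" x] verts j N ne by simp
qed

lemma adj_form_eq:
  "adj_form T x = 2 * (\<Sum>j<d. x (v j) * x (v (j + 1))) + 2 * (\<Sum>u\<in>X. x u * x (par u))"
proof -
  define g where "g = (\<lambda>(a, b). x a * x b)"
  have "adj_form T x = (\<Sum>y\<in>pverts T. \<Sum>z\<in>pverts T. if (y, z) \<in> parcs T then x y * x z else 0)"
    unfolding adj_form_def adj_sum_def by (simp add: sum_distrib_left if_distrib cong: if_cong)
  also have "\<dots> = (\<Sum>e\<in>pverts T \<times> pverts T. if e \<in> parcs T then g e else 0)"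
    unfolding sum.cartesian_product g_def by (intro sum.cong) auto
  also have "\<dots> = (\<Sum>e\<in>parcs T. g e)"
  proof -
    have "(pverts T \<times> pverts T) \<inter> {e. e \<in> parcs T} = parcs T" using arcs_verts by auto
    then show ?thesis using fin_verts by (simp add: sum.If_cases)
  qed
  finally have form: "adj_form T x = (\<Sum>e\<in>parcs T. g e)" .
  define A1 where "A1 = (\<lambda>j. (v j, v (j + 1))) ` {..<d}"
  define A2 where "A2 = (\<lambda>j. (v (j + 1), v j)) ` {..<d}"
  define B1 where "B1 = (\<lambda>u. (u, par u)) ` X"
  define B2 where "B2 = (\<lambda>u. (par u, u)) ` X"
  have P: "parcs T = (A1 \<union> A2) \<union> (B1 \<union> B2)"
  proof -
    have "{(v a, v b) | a b. a \<le> d \<and> b \<le> d \<and> (b = a + 1 \<or> a = b + 1)} = A1 \<union> A2"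
    proof (intro equalityI subsetI)
      fix e assume "e \<in> A1 \<union> A2"
      then obtain j where j: "j < d" "e = (v j, v (j + 1)) \<or> e = (v (j + 1), v j)" unfolding A1_def A2_def by auto
      then have "j \<le> d \<and> j + 1 \<le> d" by simp
      then show "e \<in> {(v a, v b) | a b. a \<le> d \<and> b \<le> d \<and> (b = a + 1 \<or> a = b + 1)}" using j(2) by blast
    qed (auto simp: A1_def A2_def)
    then show ?thesis unfolding arcs B1_def B2_def by auto
  qed
  have dA: "A1 \<inter> A2 = {}"
  proof -
    have False if "j < d" "i < d" "v j = v (i + 1)" "v (j + 1) = v i" for i j
      using that v_eq[of j "i + 1"] v_eq[of "j + 1" i] by auto
    then show ?thesis unfolding A1_def A2_def by auto
  qed
  have dB: "B1 \<inter> B2 = {}"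
  proof -
    have False if "u \<in> X" "u' \<in> X" "u = par u'" "par u = u'" for u u'
      using that rk_par[of u] rk_par[of u'] by auto
    then show ?thesis unfolding B1_def B2_def by auto
  qed
  have dAB: "(A1 \<union> A2) \<inter> (B1 \<union> B2) = {}"
  proof -
    have "fst e \<notin> X \<and> snd e \<notin> X" if "e \<in> A1 \<union> A2" for e
      using that v_notin unfolding A1_def A2_def by auto
    moreover have "fst e \<in> X \<or> snd e \<in> X" if "e \<in> B1 \<union> B2" for e
      using that unfolding B1_def B2_def by auto
    ultimately show ?thesis by blast
  qed
  have fin: "finite A1" "finite A2" "finite B1" "finite B2"
    unfolding A1_def A2_def B1_def B2_def using finX by auto
  have inj': "inj_on (\<lambda>j. (v j, v (j + 1))) {..<d}" "inj_on (\<lambda>j. (v (j + 1), v j)) {..<d}"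
    by (auto simp: inj_on_def v_eq)
  have "(\<Sum>e\<in>A1. g e) = (\<Sum>j<d. x (v j) * x (v (j + 1)))"
    unfolding A1_def sum.reindex[OF inj'(1)] by (simp add: g_def)
  moreover have "(\<Sum>e\<in>A2. g e) = (\<Sum>j<d. x (v j) * x (v (j + 1)))"
    unfolding A2_def sum.reindex[OF inj'(2)] by (simp add: g_def mult.commute)
  moreover have "(\<Sum>e\<in>B1. g e) = (\<Sum>u\<in>X. x u * x (par u))"
    unfolding B1_def by (subst sum.reindex) (auto simp: g_def inj_on_def)
  moreover have "(\<Sum>e\<in>B2. g e) = (\<Sum>u\<in>X. x u * x (par u))"
    unfolding B2_def by (subst sum.reindex) (auto simp: g_def inj_on_def mult.commute)
  ultimately show ?thesis
    unfolding form P sum.union_disjoint[OF finite_UnI[OF fin(1,2)] finite_UnI[OF fin(3,4)] dAB]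
      sum.union_disjoint[OF fin(1,2) dA] sum.union_disjoint[OF fin(3,4) dB] by simp
qed

text \<open>What is left on the edge above \<open>u\<close> after
  \<open>s / l * (x (par u))^2\<close> has been charged to the parent and
  \<open>(s - 1) / l * (x u)^2\<close> has been taken over from the children. A cut edge charges
  nothing, so it tolerates one vertex more: \<open>s\<close> up to \<open>l^2 + 1\<close> instead of
  \<open>l^2\<close>.\<close>

definition slack :: "real => 'a set => ('a => real) => 'a => real" where
  "slack l F x u = (let s = real (bsize F u) in
     if u \<in> F then (l^2 + 1 - s) / l * (x u)\<^sup>2
     else ((s * x (par u) - l * x u)\<^sup>2 + (s - 1) * (l^2 - s) * (x u)\<^sup>2) / (l * s))"

text \<open>Weighted AM--GM on every branch edge pushes the branches onto the path as loads.\<close>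

lemma form_decomposition:
  assumes l: "l > 0" and F: "F \<subseteq> X" and cut: "\<And>u. u \<in> F ==> x u * x (par u) = 0"
  shows "l * (\<Sum>y\<in>pverts T. (x y)\<^sup>2) - adj_form T x =
    (path_form l d (\<lambda>j. x (v j)) - (\<Sum>j\<le>d. real (load F j) * (x (v j))\<^sup>2) / l) + (\<Sum>u\<in>X. slack l F x u)"
proof -
  let ?s = "\<lambda>u. real (bsize F u)"
  have edge: "l * (x u)\<^sup>2 - 2 * (x u * x (par u)) =
      slack l F x u - (if u \<in> F then 0 else ?s u * (x (par u))\<^sup>2 / l) + (?s u - 1) * (x u)\<^sup>2 / l" if u: "u \<in> X" for u
  proof (cases "u \<in> F")
    case True
    then show ?thesis using cut[OF True] l unfolding slack_def Let_def
      by (simp add: field_simps power2_eq_square)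
  next
    case False
    have s: "?s u > 0" using bsize_pos[OF u, of F] by linarith
    have "((s * b - l * a)\<^sup>2 + (s - 1) * (l^2 - s) * a\<^sup>2) / (l * s) - s * b\<^sup>2 / l + (s - 1) * a\<^sup>2 / l =
        l * a\<^sup>2 - 2 * (a * b)" if "s > 0" for s a b :: real
      using that l by (simp add: field_simps power2_eq_square)
    from this[OF s, of "x (par u)" "x u"] show ?thesis unfolding slack_def Let_def using False by simp
  qed
  have a: "(\<Sum>u\<in>X. if u \<in> F then 0 else ?s u * (x (par u))\<^sup>2) =
      (\<Sum>c\<in>{c \<in> X - F. par c \<in> X}. ?s c * (x (par c))\<^sup>2) + (\<Sum>c\<in>{c \<in> X - F. par c \<notin> X}. ?s c * (x (par c))\<^sup>2)"
    unfolding sum_cut[OF F, of "\<lambda>u. if u \<in> F then 0 else ?s u * (x (par u))\<^sup>2"] by simp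
  have b: "(\<Sum>u\<in>X. (?s u - 1) * (x u)\<^sup>2) = (\<Sum>c\<in>{c \<in> X - F. par c \<in> X}. ?s c * (x (par c))\<^sup>2)"
    unfolding sum_children(1)[where F = F and g = ?s and h = "\<lambda>u. (x u)\<^sup>2", symmetric]
    by (intro sum.cong refl) (simp add: bsize_rec)
  have c: "(\<Sum>j\<le>d. real (load F j) * (x (v j))\<^sup>2) = (\<Sum>c\<in>{c \<in> X - F. par c \<notin> X}. ?s c * (x (par c))\<^sup>2)"
    unfolding sum_children(2)[where F = F and g = ?s and h = "\<lambda>u. (x u)\<^sup>2", symmetric] load_def by simp
  have "(\<Sum>u\<in>X. l * (x u)\<^sup>2 - 2 * (x u * x (par u))) =
      (\<Sum>u\<in>X. slack l F x u - (if u \<in> F then 0 else ?s u * (x (par u))\<^sup>2 / l) + (?s u - 1) * (x u)\<^sup>2 / l)"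
    by (intro sum.cong refl edge)
  also have "\<dots> = (\<Sum>u\<in>X. slack l F x u) - (\<Sum>u\<in>X. if u \<in> F then 0 else ?s u * (x (par u))\<^sup>2) / l +
      (\<Sum>u\<in>X. (?s u - 1) * (x u)\<^sup>2) / l"
    unfolding sum_divide_distrib by (simp add: sum.distrib sum_subtractf if_distrib[where f = "\<lambda>t. t / l"] cong: if_cong)
  also have "\<dots> = (\<Sum>u\<in>X. slack l F x u) - (\<Sum>j\<le>d. real (load F j) * (x (v j))\<^sup>2) / l"
    unfolding a b c by (simp add: add_divide_distrib)
  finally show ?thesis unfolding adj_form_eq sum_verts path_form_def
    by (simp add: sum_subtractf sum_distrib_left algebra_simps)
qed

lemma slack_nonneg:
  assumes l: "l > 0" and u: "u \<in> X" and s: "u \<notin> F ==> bsize F u = 1 \<or> real (bsize F u) < l^2"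
    "u \<in> F ==> real (bsize F u) < l^2 + 1"
  shows "slack l F x u \<ge> 0"
    and "slack l F x u = 0 ==> u \<in> F ==> x u = 0"
    and "slack l F x u = 0 ==> u \<notin> F ==> l * x u = real (bsize F u) * x (par u) \<and> (bsize F u = 1 \<or> x u = 0)"
proof -
  let ?s = "real (bsize F u)"
  have s1: "?s \<ge> 1" using bsize_pos[OF u, of F] by linarith
  have e1: "slack l F x u = (l^2 + 1 - ?s) / l * (x u)\<^sup>2" if "u \<in> F" using that unfolding slack_def Let_def by simp
  have e2: "slack l F x u = ((?s * x (par u) - l * x u)\<^sup>2 + (?s - 1) * (l^2 - ?s) * (x u)\<^sup>2) / (l * ?s)" if "u \<notin> F"
    using that unfolding slack_def Let_def by simp
  have c: "(?s - 1) * (l^2 - ?s) \<ge> 0" if "u \<notin> F" using s(1)[OF that] s1 by auto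
  show "slack l F x u \<ge> 0" using e1 e2 c s(2) l s1 by (cases "u \<in> F") (auto intro!: divide_nonneg_nonneg add_nonneg_nonneg mult_nonneg_nonneg)
  show "x u = 0" if "slack l F x u = 0" "u \<in> F" using that e1 s(2) l by auto
  show "l * x u = ?s * x (par u) \<and> (bsize F u = 1 \<or> x u = 0)" if z: "slack l F x u = 0" and n: "u \<notin> F"
  proof -
    have "(?s * x (par u) - l * x u)\<^sup>2 + (?s - 1) * (l^2 - ?s) * (x u)\<^sup>2 = 0" using z e2[OF n] l s1 by simp
    moreover have "(?s - 1) * (l^2 - ?s) * (x u)\<^sup>2 \<ge> 0" using c[OF n] by simp
    ultimately have "(?s * x (par u) - l * x u)\<^sup>2 = 0" and z2: "(?s - 1) * (l^2 - ?s) * (x u)\<^sup>2 = 0"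
      using zero_le_power2[of "?s * x (par u) - l * x u"] by linarith+
    then have "l * x u = ?s * x (par u)" by simp
    moreover have "bsize F u = 1 \<or> x u = 0" using z2 s(1)[OF n] by auto
    ultimately show ?thesis by blast
  qed
qed

text \<open>\<open>c\<close> defines the hyperplane of the test vector. If the bound is attained,
  the test vector is an eigenvector on which all slacks vanish. These equations carry a zero from
  each vertex to its children, so the vector cannot vanish on the whole path.\<close>

lemma lambda2_bound:
  assumes l: "l > 0" and d: "d \<ge> 1" and F: "F \<subseteq> X"
    and cut: "\<forall>x. (\<Sum>y\<in>pverts T. c y * x y) = 0 --> (\<forall>u\<in>F. x u * x (par u) = 0)"
    and s: "\<forall>u\<in>X - F. bsize F u = 1 \<or> real (bsize F u) < l^2" "\<forall>u\<in>F. real (bsize F u) < l^2 + 1"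
    and path: "\<forall>x. (\<Sum>y\<in>pverts T. c y * x y) = 0 -->
      (\<Sum>j\<le>d. real (load F j) * (x (v j))\<^sup>2) / l \<le> path_form l d (\<lambda>j. x (v j))"
  shows "lambda2 T \<le> l"
    and "lambda2 T = l ==> \<exists>x. (\<Sum>y\<in>pverts T. c y * x y) = 0 \<and> (\<exists>j\<le>d. x (v j) \<noteq> 0) \<and>
      (\<Sum>j\<le>d. real (load F j) * (x (v j))\<^sup>2) / l = path_form l d (\<lambda>j. x (v j)) \<and>
      (\<forall>y\<in>pverts T. adj_sum T x y = l * x y) \<and> (\<forall>u\<in>F. x u = 0) \<and>
      (\<forall>u\<in>X - F. l * x u = real (bsize F u) * x (par u) \<and> (bsize F u = 1 \<or> x u = 0))"
proof -
  have "card (v ` {..d}) = d + 1" using card_image[OF inj] by simp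
  moreover have "card (v ` {..d}) \<le> card (pverts T)" using fin_verts verts by (intro card_mono) auto
  ultimately have "card (pverts T) \<ge> 2" using d by linarith
  from lambda2_test_vector[OF fin_verts sym_arcs this, of c]
  obtain x where x0: "\<exists>y\<in>pverts T. x y \<noteq> 0" and cx: "(\<Sum>y\<in>pverts T. c y * x y) = 0"
    and alt: "(\<forall>y\<in>pverts T. adj_sum T x y = lambda2 T * x y) \<or> adj_form T x > lambda2 T * (\<Sum>y\<in>pverts T. (x y)\<^sup>2)"
    by blast
  let ?N = "\<Sum>y\<in>pverts T. (x y)\<^sup>2"
  have N: "?N > 0" using x0 fin_verts by (auto intro: sum_pos2)
  have dec: "l * ?N - adj_form T x = (path_form l d (\<lambda>j. x (v j)) - (\<Sum>j\<le>d. real (load F j) * (x (v j))\<^sup>2) / l) +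
      (\<Sum>u\<in>X. slack l F x u)"
    by (rule form_decomposition[OF l F]) (use cut cx in blast)
  have sn: "slack l F x u \<ge> 0" if "u \<in> X" for u by (rule slack_nonneg(1)[OF l that]) (use s that in auto)
  have ss: "(\<Sum>u\<in>X. slack l F x u) \<ge> 0" using sn by (intro sum_nonneg)
  have le: "adj_form T x \<le> l * ?N" using dec path[rule_format, OF cx] ss by linarith
  have eigf: "adj_form T x = lambda2 T * ?N" if "\<forall>y\<in>pverts T. adj_sum T x y = lambda2 T * x y"
    unfolding adj_form_def using that by (simp add: sum_distrib_left power2_eq_square mult_ac)
  then have "lambda2 T * ?N \<le> adj_form T x" using alt by auto
  then have "lambda2 T * ?N \<le> l * ?N" using le by linarith
  then show "lambda2 T \<le> l" using N by simp
  assume eq: "lambda2 T = l"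
  have eig: "\<forall>y\<in>pverts T. adj_sum T x y = l * x y" using alt le eq by auto
  then have "adj_form T x = l * ?N" using eigf eq by simp
  then have z: "path_form l d (\<lambda>j. x (v j)) = (\<Sum>j\<le>d. real (load F j) * (x (v j))\<^sup>2) / l" "(\<Sum>u\<in>X. slack l F x u) = 0"
    using dec path[rule_format, OF cx] ss by linarith+
  have sz: "slack l F x u = 0" if "u \<in> X" for u using z(2) sn that finX by (simp add: sum_nonneg_eq_0_iff)
  have fz: "x u = 0" if "u \<in> F" for u
    by (rule slack_nonneg(2)[OF l _ _ _ sz that]) (use that F s in auto)
  have nf: "l * x u = real (bsize F u) * x (par u) \<and> (bsize F u = 1 \<or> x u = 0)" if "u \<in> X - F" for u
    by (rule slack_nonneg(3)[OF l _ _ _ sz]) (use that s in auto)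
  have "\<exists>j\<le>d. x (v j) \<noteq> 0"
  proof (rule ccontr)
    assume "\<not> ?thesis"
    then have vz: "x (v j) = 0" if "j \<le> d" for j using that by auto
    have "x u = 0" if "u \<in> X" for u using that
    proof (induction "rk u" arbitrary: u rule: less_induct)
      case less
      show ?case
      proof (cases "u \<in> F")
        case False
        have "x (par u) = 0"
        proof (cases "par u \<in> X")
          case True then show ?thesis using less rk_par by simp
        next
          case False
          then obtain j where "j < d" "par u = v j" using par_path[OF less.prems] by blast
          then show ?thesis using vz[of j] by simp
        qed
        then show ?thesis using nf[of u] False less.prems l by simp
      qed (rule fz)
    qed
    then show False using x0 vz unfolding verts by auto
  qed
  then show "\<exists>x. (\<Sum>y\<in>pverts T. c y * x y) = 0 \<and> (\<exists>j\<le>d. x (v j) \<noteq> 0) \<and>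
      (\<Sum>j\<le>d. real (load F j) * (x (v j))\<^sup>2) / l = path_form l d (\<lambda>j. x (v j)) \<and>
      (\<forall>y\<in>pverts T. adj_sum T x y = l * x y) \<and> (\<forall>u\<in>F. x u = 0) \<and>
      (\<forall>u\<in>X - F. l * x u = real (bsize F u) * x (par u) \<and> (bsize F u = 1 \<or> x u = 0))"
    using cx eig fz nf z(1) by (intro exI[of _ x] conjI) auto
qed

end

section \<open>A node on the path, and the shape in the case of equality\<close>

context path_decomposition
begin

lemma node_bound:
  assumes lc: "load_cert l d p S k p' S' k' (load F)" and F: "F \<subseteq> X"
    and Fn: "\<And>u. u \<in> F ==> S (p + 1) = 0 \<and> par u = v (p + 1)"
    and s: "\<And>u. u \<in> X - F ==> bsize F u = 1 \<or> real (bsize F u) < l^2" "\<And>u. u \<in> F ==> real (bsize F u) < l^2 + 1"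
  shows "lambda2 T \<le> l"
    and "lambda2 T = l ==>
      (\<exists>x. (\<forall>j\<le>d. (S (p + 1) = 0 --> j \<noteq> p + 1) --> x (v j) \<noteq> 0) \<and>
        (\<forall>u\<in>X - F. l * x u = real (bsize F u) * x (par u) \<and> (bsize F u = 1 \<or> x u = 0))) \<and>
      (\<Sum>j\<le>p. load F j) = k \<and> (\<Sum>j\<le>p'. load F (d - j)) = k' \<and>
      (k = 0 --> S 1 = l * S 0) \<and> (k' = 0 --> S' 1 = l * S' 0) \<and>
      (k > 0 --> (\<exists>i. half_tight l p S k i \<and> load F i = k \<and> (\<forall>j\<le>p. j \<noteq> i --> load F j = 0))) \<and>
      (k' > 0 --> (\<exists>i. half_tight l p' S' k' i \<and> load F (d - i) = k' \<and> (\<forall>j\<le>p'. j \<noteq> i --> load F (d - j) = 0)))"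
    and "half_strict l p S k \<or> half_strict l p' S' k' ==> lambda2 T < l"
proof -
  have hl: "half_cert l p S k" and hr: "half_cert l p' S' k'" and nd: "path_node d p S p' S'"
    and K: "(\<Sum>j\<le>p. load F j) \<le> k" "(\<Sum>j\<le>p'. load F (d - j)) \<le> k'" using lc unfolding load_cert_def by auto
  have l: "l > 0" using half_certD(1)[OF hl] .
  have Sp: "S p > 0" using half_certD(2)[OF hl, of p] by simp
  have pd: "p + 1 \<le> d" using nd unfolding path_node_def by auto
  \<comment> \<open>The hyperplane prescribes the ratio of the entries at \<open>p\<close> and
    \<open>p + 1\<close>. If the node is the vertex \<open>p + 1\<close>, it says that
    \<open>x\<close> vanishes there, which is what permits cutting the edges of
    \<open>F\<close>.\<close>
  define c where "c y = (if y = v p then S (p + 1) else if y = v (p + 1) then - S p else 0)" for y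
  have vne: "v p \<noteq> v (p + 1)" using v_eq[of p "p + 1"] pd by simp
  have csum: "(\<Sum>y\<in>pverts T. c y * x y) = S (p + 1) * x (v p) - S p * x (v (p + 1))" for x
  proof -
    have "(\<Sum>y\<in>pverts T. c y * x y) = (\<Sum>y\<in>{v p, v (p + 1)}. c y * x y)"
      by (rule sum.mono_neutral_right) (use fin_verts verts pd in \<open>auto simp: c_def\<close>)
    then show ?thesis using vne by (simp add: c_def)
  qed
  have cut: "\<forall>x. (\<Sum>y\<in>pverts T. c y * x y) = 0 --> (\<forall>u\<in>F. x u * x (par u) = 0)"
    unfolding csum
  proof (intro allI impI ballI)
    fix x u assume t: "S (p + 1) * x (v p) - S p * x (v (p + 1)) = 0" and u: "u \<in> F"
    have "x (v (p + 1)) = 0" using t Fn[OF u] Sp by simp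
    then show "x u * x (par u) = 0" using Fn[OF u] by simp
  qed
  have path: "\<forall>x. (\<Sum>y\<in>pverts T. c y * x y) = 0 -->
      (\<Sum>j\<le>d. real (load F j) * (x (v j))\<^sup>2) / l \<le> path_form l d (\<lambda>j. x (v j))"
    unfolding csum by (intro allI impI path_form_ge_load(1)[OF hl hr nd load_ends K]) simp
  have s': "\<forall>u\<in>X - F. bsize F u = 1 \<or> real (bsize F u) < l^2" "\<forall>u\<in>F. real (bsize F u) < l^2 + 1"
    using s by blast+
  have d1: "d \<ge> 1" using pd by simp
  note B = lambda2_bound[where c = c, OF l d1 F cut s' path]
  show "lambda2 T \<le> l" by (rule B(1))
  show eqcase: "(\<exists>x. (\<forall>j\<le>d. (S (p + 1) = 0 --> j \<noteq> p + 1) --> x (v j) \<noteq> 0) \<and>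
        (\<forall>u\<in>X - F. l * x u = real (bsize F u) * x (par u) \<and> (bsize F u = 1 \<or> x u = 0))) \<and>
      (\<Sum>j\<le>p. load F j) = k \<and> (\<Sum>j\<le>p'. load F (d - j)) = k' \<and>
      (k = 0 --> S 1 = l * S 0) \<and> (k' = 0 --> S' 1 = l * S' 0) \<and>
      (k > 0 --> (\<exists>i. half_tight l p S k i \<and> load F i = k \<and> (\<forall>j\<le>p. j \<noteq> i --> load F j = 0))) \<and>
      (k' > 0 --> (\<exists>i. half_tight l p' S' k' i \<and> load F (d - i) = k' \<and> (\<forall>j\<le>p'. j \<noteq> i --> load F (d - j) = 0)))"
    if "lambda2 T = l"
  proof -
    from B(2)[OF that] obtain x where x: "(\<Sum>y\<in>pverts T. c y * x y) = 0" "\<exists>j\<le>d. x (v j) \<noteq> 0"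
      "(\<Sum>j\<le>d. real (load F j) * (x (v j))\<^sup>2) / l = path_form l d (\<lambda>j. x (v j))"
      and eig: "\<And>y. y \<in> pverts T ==> adj_sum T x y = l * x y" and fz: "\<And>u. u \<in> F ==> x u = 0"
      and nf: "\<And>u. u \<in> X - F ==> l * x u = real (bsize F u) * x (par u) \<and> (bsize F u = 1 \<or> x u = 0)" by blast
    have t: "S (p + 1) * x (v p) = S p * x (v (p + 1))" using x(1) csum[of x] by simp
    \<comment> \<open>The branches at a node vertex vanish together with it, so its eigenvalue
      equation reduces to the balance of its two path neighbours.\<close>
    have bal: "x (v p) + x (v (p + 2)) = 0" if z: "S (p + 1) = 0"
    proof -
      have pd2: "p + 1 < d" using nd z unfolding path_node_def by auto
      have x0: "x (v (p + 1)) = 0" using t z Sp by simp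
      have "x u = 0" if "u \<in> children {} (v (p + 1))" for u
        using that fz[of u] nf[of u] x0 l unfolding children_def by (cases "u \<in> F") auto
      then have "(\<Sum>u\<in>children {} (v (p + 1)). x u) = 0" by simp
      moreover have "adj_sum T x (v (p + 1)) = 0" using eig[of "v (p + 1)"] x0 verts pd by simp
      ultimately show ?thesis using adj_sum_path[of "p + 1" x] pd2 by simp
    qed
    from path_form_ge_load(2)[OF hl hr nd load_ends K t x(3,2) bal] nf show ?thesis by blast
  qed
  show "lambda2 T < l" if st: "half_strict l p S k \<or> half_strict l p' S' k'"
  proof (rule ccontr)
    assume "\<not> ?thesis"
    then have "lambda2 T = l" using B(1) by simp
    note e = eqcase[OF this, THEN conjunct2]
    show False
    proof (cases "half_strict l p S k")
      case True
      then have "S 1 \<noteq> l * S 0" "\<And>i. \<not> half_tight l p S k i" unfolding half_strict_def by auto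
      then show False using e by (cases "k = 0") auto
    next
      case False
      then have "S' 1 \<noteq> l * S' 0" "\<And>i. \<not> half_tight l p' S' k' i" using st unfolding half_strict_def by auto
      then show False using e by (cases "k' = 0") auto
    qed
  qed
qed

lemma path_with_leavesI:
  assumes par: "\<And>u. u \<in> X ==> par u = v i \<or> par u = v j" and ij: "i < j" "j \<le> d"
    and k: "card {u \<in> X. par u = v i} = k" "card {u \<in> X. par u = v j} = k'"
  shows "path_with_leaves d i k j k' T"
proof -
  define L1 where "L1 = {u \<in> X. par u = v i}"
  define L2 where "L2 = {u \<in> X. par u = v j}"
  have vij: "v i \<noteq> v j" using v_eq[of i j] ij by simp
  have L: "L1 \<union> L2 = X" "L1 \<inter> L2 = {}" using par vij unfolding L1_def L2_def by auto
  have ivl: "{0..d} = {..d}" by auto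
  define G where "G = \<lparr>pverts = pverts (path_graph v d) \<union> L1,
    parcs = parcs (path_graph v d) \<union> {v i} \<times> L1 \<union> L1 \<times> {v i}\<rparr>"
  have P: "pverts (path_graph v d) = v ` {..d}"
    "parcs (path_graph v d) = {(v a, v b) | a b. a \<le> d \<and> b \<le> d \<and> (b = a + 1 \<or> a = b + 1)}"
    unfolding path_graph_def ivl by simp_all
  have finL: "finite L1" "finite L2" using finX unfolding L1_def L2_def by auto
  have g1: "attach_leaves (path_graph v d) (v i) k G"
    unfolding attach_leaves_def
    using finL k disj ij L by (intro conjI exI[of _ L1]) (auto simp: P G_def L1_def)
  have T: "T = \<lparr>pverts = pverts G \<union> L2, parcs = parcs G \<union> {v j} \<times> L2 \<union> L2 \<times> {v j}\<rparr>"
  proof (rule pair_pre_digraph.equality)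
    show "pverts T = pverts \<lparr>pverts = pverts G \<union> L2, parcs = parcs G \<union> {v j} \<times> L2 \<union> L2 \<times> {v j}\<rparr>"
      using L(1) by (auto simp: G_def P verts)
    have "{(u, par u) | u. u \<in> X} = L1 \<times> {v i} \<union> L2 \<times> {v j}" "{(par u, u) | u. u \<in> X} = {v i} \<times> L1 \<union> {v j} \<times> L2"
      using par unfolding L1_def L2_def by auto
    then show "parcs T = parcs \<lparr>pverts = pverts G \<union> L2, parcs = parcs G \<union> {v j} \<times> L2 \<union> L2 \<times> {v j}\<rparr>"
      unfolding arcs G_def P by auto
  qed simp
  have "L2 \<inter> pverts G = {}" using L disj unfolding G_def P by auto
  then have g2: "attach_leaves G (v j) k' T"
    unfolding attach_leaves_def
    using finL k ij by (intro conjI exI[of _ L2] T) (auto simp: P G_def L2_def)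
  show ?thesis unfolding path_with_leaves_def
    using g1 g2 ij inj by (intro exI[of _ v] exI[of _ G]) (simp add: ivl)
qed

lemma extremal_structure:
  assumes lc: "load_cert l d p S k p' S' k' (load {})" and kX: "card X = k + k'" and k': "k' \<ge> 1"
    and s: "\<And>u. u \<in> X ==> bsize {} u = 1 \<or> real (bsize {} u) < l^2" and eq: "lambda2 T = l"
  shows "\<exists>i j. i < j \<and> j \<le> d \<and> (k > 0 --> half_tight l p S k i) \<and> half_tight l p' S' k' (d - j) \<and>
    path_with_leaves d i k j k' T"
proof -
  let ?w = "load {}"
  have hl: "half_cert l p S k" and nd: "path_node d p S p' S'" using lc unfolding load_cert_def by auto
  have l: "l > 0" using half_certD(1)[OF hl] .
  have M: "(\<exists>x. (\<forall>j\<le>d. (S (p + 1) = 0 --> j \<noteq> p + 1) --> x (v j) \<noteq> 0) \<and>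
        (\<forall>u\<in>X - {}. l * x u = real (bsize {} u) * x (par u) \<and> (bsize {} u = 1 \<or> x u = 0))) \<and>
      (\<Sum>j\<le>p. ?w j) = k \<and> (\<Sum>j\<le>p'. ?w (d - j)) = k' \<and>
      (k = 0 --> S 1 = l * S 0) \<and> (k' = 0 --> S' 1 = l * S' 0) \<and>
      (k > 0 --> (\<exists>i. half_tight l p S k i \<and> ?w i = k \<and> (\<forall>j\<le>p. j \<noteq> i --> ?w j = 0))) \<and>
      (k' > 0 --> (\<exists>i. half_tight l p' S' k' i \<and> ?w (d - i) = k' \<and> (\<forall>j\<le>p'. j \<noteq> i --> ?w (d - j) = 0)))"
    by (rule node_bound(2)[OF lc _ _ _ _ eq]) (use s in auto)
  from M[THEN conjunct1] obtain x where x: "\<forall>j\<le>d. (S (p + 1) = 0 --> j \<noteq> p + 1) --> x (v j) \<noteq> 0"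
    "\<forall>u\<in>X - {}. l * x u = real (bsize {} u) * x (par u) \<and> (bsize {} u = 1 \<or> x u = 0)"
    by (elim exE conjE)
  have xn: "x (v j) \<noteq> 0" if "j \<le> d" "S (p + 1) = 0 --> j \<noteq> p + 1" for j using x(1) that by blast
  have nf: "l * x u = real (bsize {} u) * x (par u) \<and> (bsize {} u = 1 \<or> x u = 0)" if "u \<in> X" for u
    using x(2) that by blast
  note M2 = M[THEN conjunct2]
  note tot = M2[THEN conjunct1] M2[THEN conjunct2, THEN conjunct1]
  note M3 = M2[THEN conjunct2, THEN conjunct2, THEN conjunct2, THEN conjunct2]
  note L = M3[THEN conjunct1] and R = M3[THEN conjunct2]
  obtain i where i: "k > 0 --> half_tight l p S k i" "i \<le> p" "?w i = k" "\<And>j. j \<le> p ==> j \<noteq> i ==> ?w j = 0"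
  proof (cases "k > 0")
    case True
    then show ?thesis using L that unfolding half_tight_def by blast
  next
    case False
    then have "\<And>j. j \<le> p ==> ?w j = 0" using tot(1) by simp
    then show ?thesis using that[of 0] False by simp
  qed
  obtain i' where i': "half_tight l p' S' k' i'" "?w (d - i') = k'" "\<And>j. j \<le> p' ==> j \<noteq> i' ==> ?w (d - j) = 0"
    using R k' by auto
  have i'p: "i' \<le> p'" using i'(1) unfolding half_tight_def by simp
  have pd: "p + p' + 1 \<le> d" using nd unfolding path_node_def by auto
  define j where "j = d - i'"
  have ij: "i < j" "j \<le> d" "d - j = i'" using i(2) i'p pd unfolding j_def by auto
  have wj: "?w j = k'" using i'(2) unfolding j_def .
  have w0: "?w q = 0" if "q \<le> d" "q \<noteq> i" "q \<noteq> j" for q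
  proof -
    have "(\<Sum>q\<le>d. ?w q) = k + k'" using sum_load[of "{}"] kX by simp
    moreover have "(\<Sum>q\<le>d. ?w q) = (\<Sum>q\<in>{..d} - {i, j}. ?w q) + (\<Sum>q\<in>{i, j}. ?w q)"
      by (rule sum.subset_diff) (use ij in auto)
    moreover have "(\<Sum>q\<in>{i, j}. ?w q) = k + k'" using ij i(3) wj by simp
    ultimately have "(\<Sum>q\<in>{..d} - {i, j}. ?w q) = 0" by simp
    then show ?thesis using that by simp
  qed
  have wpos: "?w q > 0" if "u \<in> X" "par u = v q" for u q
  proof -
    have "u \<in> children {} (v q)" using that unfolding children_def by simp
    then have "bsize {} u \<le> ?w q" unfolding load_def by (intro member_le_sum) auto
    then show ?thesis using bsize_pos[OF that(1), of "{}"] by simp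
  qed
  \<comment> \<open>A node vertex is the only possible zero of \<open>x\<close> on the path, and it
    carries no branch since the whole load is concentrated at \<open>i\<close> and
    \<open>j\<close>.\<close>
  have xv: "x (v q) \<noteq> 0" if "u \<in> X" "par u = v q" "q \<le> d" for u q
  proof (rule xn[OF that(3)], intro impI notI)
    assume z: "S (p + 1) = 0" and q: "q = p + 1"
    then have "p + p' + 2 = d" using nd unfolding path_node_def by auto
    then have "q \<noteq> i" "q \<noteq> j" using q i(2) i'p unfolding j_def by auto
    then show False using w0[OF that(3)] wpos[OF that(1,2)] by simp
  qed
  \<comment> \<open>By induction the parent of a deep \<open>u\<close> hangs directly at the path.
    It has \<open>bsize\<close> at least 2, so \<open>x\<close> vanishes there, and by the slack
    equation also at the path vertex below it, which \<open>xv\<close> excludes.\<close>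
  have leaf: "par u \<notin> X" if "u \<in> X" for u using that
  proof (induction "rk u" arbitrary: u rule: less_induct)
    case less
    show ?case
    proof
      assume pX: "par u \<in> X"
      have "par (par u) \<notin> X" using less.hyps[OF rk_par[OF less.prems pX] pX] .
      then obtain q where q: "q < d" "par (par u) = v q" using par_path[OF pX] by blast
      have xq: "x (v q) \<noteq> 0" using xv[OF pX q(2)] q(1) by simp
      have "u \<in> children {} (par u)" using less.prems unfolding children_def by simp
      then have "bsize {} u \<le> (\<Sum>c\<in>children {} (par u). bsize {} c)" by (intro member_le_sum) auto
      then have "bsize {} (par u) \<noteq> 1" using bsize_rec[OF pX, of "{}"] bsize_pos[OF less.prems, of "{}"] by linarith
      then have "x (par u) = 0" using nf[OF pX] by blast
      then have "real (bsize {} (par u)) * x (v q) = 0" using nf[OF pX] q(2) by simp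
      then show False using xq bsize_pos[OF pX, of "{}"] by simp
    qed
  qed
  have s1: "bsize {} u = 1" if "u \<in> X" for u
  proof -
    have "children {} u = {}" using leaf that unfolding children_def by auto
    then show ?thesis using bsize_rec[OF that, of "{}"] by simp
  qed
  have wc: "?w q = card {u \<in> X. par u = v q}" for q
    unfolding load_def children_def using s1 by simp
  have pij: "par u = v i \<or> par u = v j" if u: "u \<in> X" for u
  proof -
    obtain q where q: "q < d" "par u = v q" using par_path[OF u leaf[OF u]] by blast
    then have "q = i \<or> q = j" using w0[of q] wpos[OF u q(2)] by auto
    then show ?thesis using q by auto
  qed
  have "path_with_leaves d i k j k' T"
    by (rule path_with_leavesI[OF pij ij(1,2)]) (use wc i(3) wj in auto)
  then show ?thesis using ij i(1) i'(1) by (intro exI[of _ i] exI[of _ j]) simp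
qed

end

lemma reverse_image: "(\<lambda>j. v (d - j)) ` {..d::nat} = v ` {..d}"
proof (intro equalityI subsetI)
  fix y assume "y \<in> v ` {..d}"
  then obtain j where "j \<le> d" "y = v j" by auto
  then have "y = v (d - (d - j))" "d - j \<le> d" by auto
  then show "y \<in> (\<lambda>j. v (d - j)) ` {..d}" by blast
qed auto

lemma reverse_path_arcs:
  fixes d :: nat
  shows "{(v (d - a), v (d - b)) | a b. a \<le> d \<and> b \<le> d \<and> (b = a + 1 \<or> a = b + 1)} =
    {(v a, v b) | a b. a \<le> d \<and> b \<le> d \<and> (b = a + 1 \<or> a = b + 1)}" (is "?A = ?B")
proof (intro equalityI subsetI)
  fix e assume "e \<in> ?A"
  then obtain a b where ab: "e = (v (d - a), v (d - b))" "a \<le> d" "b \<le> d" "b = a + 1 \<or> a = b + 1" by blast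
  then have "d - a \<le> d \<and> d - b \<le> d \<and> (d - b = d - a + 1 \<or> d - a = d - b + 1)" by auto
  then show "e \<in> ?B" unfolding ab(1) by blast
next
  fix e assume "e \<in> ?B"
  then obtain a b where ab: "e = (v a, v b)" "a \<le> d" "b \<le> d" "b = a + 1 \<or> a = b + 1" by blast
  then have "e = (v (d - (d - a)), v (d - (d - b)))" by simp
  moreover have "d - a \<le> d \<and> d - b \<le> d \<and> (d - b = d - a + 1 \<or> d - a = d - b + 1)" using ab by auto
  ultimately show "e \<in> ?A" by blast
qed

section \<open>Branches too heavy to be pushed onto the path\<close>

context path_decomposition
begin

lemma chain_mono: "chain F \<subseteq> chain {}"
  unfolding chain_def by auto

lemma chain_rtrancl_mono: "(x, y) \<in> (chain F)\<^sup>* ==> (x, y) \<in> (chain {})\<^sup>*"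
  using rtrancl_mono[OF chain_mono] by blast

lemma bsize_cut_le: "bsize F u \<le> bsize {} u"
  unfolding bsize_def using finX chain_rtrancl_mono by (intro card_mono) auto

lemma bsize_par:
  assumes "u \<in> X" "par u \<in> X"
  shows "bsize {} u < bsize {} (par u)"
proof -
  have "u \<in> children {} (par u)" using assms unfolding children_def by simp
  then have "bsize {} u \<le> (\<Sum>c\<in>children {} (par u). bsize {} c)" by (intro member_le_sum) auto
  then show ?thesis using bsize_rec[OF assms(2), of "{}"] by simp
qed

text \<open>The assumption on \<open>F\<close> says that no cut edge lies below
  \<open>u\<close>.\<close>

lemma bsize_uncut:
  assumes u: "u \<in> X" and F: "\<And>x. x \<in> F ==> par x \<in> X ==> (par x, u) \<notin> (chain {})\<^sup>*"
  shows "bsize F u = bsize {} u"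
proof -
  have "(x, u) \<in> (chain F)\<^sup>*" if "(x, u) \<in> (chain {})\<^sup>*" for x
    using that
  proof (induction rule: converse_rtrancl_induct)
    case (step x z)
    then have x: "x \<in> X" "z = par x" unfolding chain_def by auto
    have "z \<in> X" using chain_rk[OF step(2) u] by simp
    then have "x \<notin> F" using F[of x] step(2) x by auto
    then have "(x, z) \<in> chain F" using x unfolding chain_def by auto
    then show ?case using step.IH by (rule converse_rtrancl_into_rtrancl)
  qed simp
  then have "{x \<in> X. (x, u) \<in> (chain {})\<^sup>*} = {x \<in> X. (x, u) \<in> (chain F)\<^sup>*}"
    using chain_rtrancl_mono by auto
  then show ?thesis unfolding bsize_def by simp
qed

text \<open>A branch too heavy to be pushed onto the path, but only just: put the node at its root.\<close>

lemma heavy_branch_bound: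
  assumes sc: "side_conditions l d k k'" and d: "d \<ge> 4" and k: "k \<ge> 1" "k \<le> k'" and kX: "card X = k + k'"
    and below: "\<And>u. u \<in> X ==> real (bsize {} u) < l^2 + 1" and u0: "u0 \<in> X" "real (bsize {} u0) \<ge> l^2"
  shows "lambda2 T < l"
proof -
  have lk: "real k' < l^2" and h: "half_cert l (d - 2) (end_sol l (d - 1)) (k - 1)"
    using sc k unfolding side_conditions_def by auto
  \<comment> \<open>Heavy vertices are not nested: the parent of one would have size at least
    \<open>l^2 + 1\<close>.\<close>
  have root: "par u \<notin> X" if "u \<in> X" "real (bsize {} u) \<ge> l^2" for u
  proof
    assume "par u \<in> X"
    then have "bsize {} u + 1 \<le> bsize {} (par u)" using bsize_par[OF that(1)] by simp
    then have "real (bsize {} u) + 1 \<le> real (bsize {} (par u))" by linarith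
    then show False using below[OF \<open>par u \<in> X\<close>] that(2) by linarith
  qed
  have big: "bsize {} u \<ge> k' + 1" if "real (bsize {} u) \<ge> l^2" for u using that lk by linarith
  obtain q where q: "0 < q" "q < d" "par u0 = v q" using par_path[OF u0(1) root[OF u0]] by blast
  define F where "F = {c \<in> X. par c = v q}"
  have F: "F \<subseteq> X" unfolding F_def by auto
  have loadge: "bsize {} u \<le> load {} i" if "u \<in> X" "par u = v i" for u i
  proof -
    have "u \<in> children {} (v i)" using that unfolding children_def by simp
    then show ?thesis unfolding load_def by (intro member_le_sum) auto
  qed
  have s1: "bsize F u = 1 \<or> real (bsize F u) < l^2" if u: "u \<in> X - F" for u
  proof (cases "real (bsize {} u) < l^2")
    case True
    then show ?thesis using bsize_cut_le[of F u] by linarith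
  next
    case False
    then have b: "bsize {} u \<ge> k' + 1" "par u \<notin> X" using big[of u] root[of u] u by auto
    then obtain i where i: "i < d" "par u = v i" using par_path[of u] u by blast
    then have iq: "i \<noteq> q" using u unfolding F_def by auto
    \<comment> \<open>A second heavy branch at another path vertex would require
      \<open>2 * (k' + 1)\<close> branch vertices, more than the available
      \<open>k + k'\<close>.\<close>
    have "(\<Sum>j\<in>{i, q}. load {} j) \<le> (\<Sum>j\<le>d. load {} j)" using i q by (intro sum_mono2) auto
    then have "load {} i + load {} q \<le> k + k'" using sum_load[of "{}"] kX iq by simp
    then show ?thesis using loadge[of u i] loadge[OF u0(1) q(3)] i(2) b(1) big[OF u0(2)] u k by simp
  qed
  have s2: "real (bsize F u) < l^2 + 1" if "u \<in> F" for u
    using below[of u] bsize_cut_le[of F u] that F by force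
  have "bsize F u0 = bsize {} u0"
    by (rule bsize_uncut[OF u0(1)]) (use v_notin[of q] q in \<open>auto simp: F_def\<close>)
  moreover have "u0 \<in> F" using u0 q unfolding F_def by simp
  then have "bsize F u0 \<le> (\<Sum>u\<in>F. bsize F u)" using finite_subset[OF F finX] by (intro member_le_sum) auto
  \<comment> \<open>With the branch of \<open>u0\<close> cut off, at most \<open>k - 1\<close>
    remain in total, so both sides of the node may be measured against \<open>k - 1\<close>. At
    least one side is short enough to be strict.\<close>
  ultimately have ld: "(\<Sum>j\<le>d. load F j) \<le> k - 1" using sum_load[OF F] big[OF u0(2)] kX by linarith
  have K1: "(\<Sum>j\<le>q - 1. load F j) \<le> k - 1"
  proof -
    have "(\<Sum>j\<le>q - 1. load F j) \<le> (\<Sum>j\<le>d. load F j)" using q by (intro sum_mono2) auto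
    then show ?thesis using ld by linarith
  qed
  have K2: "(\<Sum>j\<le>d - q - 1. load F (d - j)) \<le> k - 1"
    using sum_split_reflect[OF q(2), of "load F"] ld by simp
  have hq: "half_cert l (n - 1) (end_sol l n) (k - 1)" if "1 \<le> n" "n < d" for n
    using end_sol_half_cert_shorten[of l "d - 1" "k - 1" n] h that by (simp add: numeral_2_eq_2)
  have hs: "half_strict l (n - 1) (end_sol l n) (k - 1)" if n: "1 \<le> n" "n \<le> d - 2" for n
  proof -
    have p: "chp l (d - 1 - n) > 0" using half_certD(2)[OF h n(2)] .
    show ?thesis by (rule half_cert_shorten(2)[OF h n(1) _ _ p]) (use n p in auto)
  qed
  have lc: "load_cert l d (q - 1) (end_sol l q) (k - 1) (d - q - 1) (end_sol l (d - q)) (k - 1) (load F)"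
    unfolding load_cert_def using hq[of q] hq[of "d - q"] vertex_node[of q d] q K1 K2 by auto
  have Fn: "end_sol l q (q - 1 + 1) = 0 \<and> par u = v (q - 1 + 1)" if "u \<in> F" for u
    using that q unfolding F_def by simp
  have "q \<le> d - 2 \<or> d - q \<le> d - 2" using d q by linarith
  then have st: "half_strict l (q - 1) (end_sol l q) (k - 1) \<or> half_strict l (d - q - 1) (end_sol l (d - q)) (k - 1)"
  proof -
    have "1 \<le> q" "1 \<le> d - q" using q by auto
    then show ?thesis using hs[of q] hs[of "d - q"] \<open>q \<le> d - 2 \<or> d - q \<le> d - 2\<close> by blast
  qed
  show ?thesis by (rule node_bound(3)[OF lc F Fn s1 s2 st])
qed

text \<open>A still heavier branch carries the node itself, as deep as possible; cutting there makes all loads light.\<close>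

lemma very_heavy_branch_bound:
  assumes sc: "side_conditions l d k k'" and d: "d \<ge> 4" and k: "k \<le> k'" and kX: "card X = k + k'"
    and u0: "u0 \<in> X" "real (bsize {} u0) \<ge> l^2 + 1"
    and deepest: "\<And>u. u \<in> X ==> rk u0 < rk u ==> real (bsize {} u) < l^2 + 1"
  shows "lambda2 T < l"
proof -
  have lk: "real k' < l^2" using sc unfolding side_conditions_def by simp
  then have b0: "bsize {} u0 \<ge> k' + 2" using u0(2) by linarith
  have "bsize {} u0 \<le> card X" unfolding bsize_def using finX by (intro card_mono) auto
  then have k2: "k \<ge> 2" using b0 kX by linarith
  have g4: "half_cert l d (end_sol l (d + 1)) (k - 2)" using sc k2 unfolding side_conditions_def by simp
  have l: "l > 0" using half_certD(1)[OF g4] .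
  \<comment> \<open>The test vector will vanish at \<open>u0\<close>, so the edges from
    \<open>u0\<close> to its parent and to its children are cut. The choice of \<open>u0\<close>
    keeps each child below \<open>l^2 + 1\<close>.\<close>
  define F where "F = insert u0 (children {} u0)"
  have F: "F \<subseteq> X" using u0 unfolding F_def children_def by auto
  have child_rk: "rk u0 < rk c" if "c \<in> children {} u0" for c
    using that rk_par[of c] u0 unfolding children_def by auto
  have cF: "children F u0 = {}" unfolding F_def children_def by auto
  have s2: "real (bsize F u) < l^2 + 1" if "u \<in> F" for u
  proof (cases "u = u0")
    case True
    then show ?thesis using bsize_rec[OF u0(1), of F] cF l by simp
  next
    case False
    then have "u \<in> children {} u0" using that unfolding F_def by simp
    then have "real (bsize {} u) < l^2 + 1" using deepest[OF _ child_rk] F that by auto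
    then show ?thesis using bsize_cut_le[of F u] by linarith
  qed
  \<comment> \<open>A vertex that was heavy before the cut and is not in \<open>F\<close> cannot lie
    below \<open>u0\<close>. After the cut it shares nothing with the branch of \<open>u0\<close>,
    so at most \<open>k + k' - (k' + 2)\<close> vertices hang there.\<close>
  have s1: "bsize F c = 1 \<or> real (bsize F c) < l^2" if c: "c \<in> X - F" for c
  proof (cases "real (bsize {} c) < l^2")
    case True
    then show ?thesis using bsize_cut_le[of F c] by linarith
  next
    case False
    have nd: "(c, u0) \<notin> (chain {})\<^sup>*"
    proof
      assume "(c, u0) \<in> (chain {})\<^sup>*"
      moreover have "c \<noteq> u0" using c unfolding F_def by auto
      ultimately obtain z where z: "(c, z) \<in> chain {}" "(z, u0) \<in> (chain {})\<^sup>*" by (auto elim: converse_rtranclE)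
      then have zp: "z = par c" unfolding chain_def by auto
      have zX: "z \<in> X" using chain_rk[OF z(2) u0(1)] by simp
      have "z \<noteq> u0" using c zp unfolding F_def children_def by auto
      then have "rk u0 < rk z" using chain_rk[OF z(2) u0(1)] by simp
      then have "real (bsize {} z) < l^2 + 1" by (rule deepest[OF zX])
      moreover have "bsize {} c + 1 \<le> bsize {} z" using bsize_par[of c] c zX zp by auto
      ultimately show False using False by linarith
    qed
    have inv: "(y, u0) \<in> (chain {})\<^sup>*" if "(x, y) \<in> (chain F)\<^sup>*" "(x, u0) \<in> (chain {})\<^sup>*" for x y
      using that
    proof (induction rule: rtrancl_induct)
      case (step y z)
      have y: "y \<notin> F" "z = par y" using step(2) unfolding chain_def by auto
      then have "y \<noteq> u0" unfolding F_def by auto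
      then obtain z' where "(y, z') \<in> chain {}" "(z', u0) \<in> (chain {})\<^sup>*"
        using step.IH[OF step.prems] by (auto elim: converse_rtranclE)
      then show ?case using y unfolding chain_def by auto
    qed
    have "{x \<in> X. (x, c) \<in> (chain F)\<^sup>*} \<inter> {x \<in> X. (x, u0) \<in> (chain {})\<^sup>*} = {}" using inv nd by auto
    then have "bsize F c + bsize {} u0 = card ({x \<in> X. (x, c) \<in> (chain F)\<^sup>*} \<union> {x \<in> X. (x, u0) \<in> (chain {})\<^sup>*})"
      unfolding bsize_def using finX by (subst card_Un_disjoint) auto
    also have "\<dots> \<le> card X" using finX by (intro card_mono) auto
    finally have "bsize F c \<le> k'" using b0 kX k by linarith
    then show ?thesis using lk by linarith
  qed
  have "bsize F c = bsize {} c" if c: "c \<in> children {} u0" for c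
  proof (rule bsize_uncut)
    show cX: "c \<in> X" using c unfolding children_def by simp
    fix x assume x: "x \<in> F" "par x \<in> X"
    show "(par x, c) \<notin> (chain {})\<^sup>*"
    proof
      assume "(par x, c) \<in> (chain {})\<^sup>*"
      then have "rk c \<le> rk (par x)" using chain_rk[OF _ cX] by blast
      moreover have "rk (par x) \<le> rk u0"
        using x rk_par[of x] u0 unfolding F_def children_def by auto
      ultimately show False using child_rk[OF c] by simp
    qed
  qed
  then have "(\<Sum>c\<in>children {} u0. bsize F c) = (\<Sum>c\<in>children {} u0. bsize {} c)" by simp
  moreover have "u0 \<notin> children {} u0" using child_rk by blast
  ultimately have "(\<Sum>u\<in>F. bsize F u) = bsize {} u0"
    unfolding F_def using bsize_rec[OF u0(1), of "{}"] bsize_rec[OF u0(1), of F] cF by (simp add: F_def)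
  then have ld: "(\<Sum>j\<le>d. load F j) \<le> k - 2" using sum_load[OF F] b0 kX by linarith
  define c where "c y = (if y = u0 then 1 else 0 :: real)" for y
  have csum: "(\<Sum>y\<in>pverts T. c y * x y) = x u0" for x
    using fin_verts verts u0 by (simp add: c_def if_distrib[where f = "\<lambda>t. t * _"] cong: if_cong)
  have cut: "\<forall>x. (\<Sum>y\<in>pverts T. c y * x y) = 0 --> (\<forall>u\<in>F. x u * x (par u) = 0)"
    unfolding csum F_def children_def by auto
  \<comment> \<open>\<open>end_sol l (d + 1)\<close> vanishes at \<open>d + 1\<close>, so this half
    form has no boundary term and is the form of the whole path.\<close>
  have pf: "half_form l d (end_sol l (d + 1)) Y = path_form l d Y" for Y
    unfolding half_form_def path_form_def by simp
  have path: "(\<Sum>j\<le>d. real (load F j) * (x (v j))\<^sup>2) / l \<le> path_form l d (\<lambda>j. x (v j))" for x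
    using half_form_ge_load(1)[OF g4 load_ends(1) ld, of "\<lambda>j. x (v j)"] unfolding pf .
  have d1: "d \<ge> 1" using d by simp
  have path': "\<forall>x. (\<Sum>y\<in>pverts T. c y * x y) = 0 -->
      (\<Sum>j\<le>d. real (load F j) * (x (v j))\<^sup>2) / l \<le> path_form l d (\<lambda>j. x (v j))" using path by blast
  have s': "\<forall>u\<in>X - F. bsize F u = 1 \<or> real (bsize F u) < l^2" "\<forall>u\<in>F. real (bsize F u) < l^2 + 1"
    using s1 s2 by blast+
  note B = lambda2_bound[where c = c, OF l d1 F cut s' path']
  show ?thesis
  proof (rule ccontr)
    assume "\<not> ?thesis"
    then have "lambda2 T = l" using B(1) by simp
    from B(2)[OF this] obtain x where x: "\<exists>j\<le>d. x (v j) \<noteq> 0"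
      "(\<Sum>j\<le>d. real (load F j) * (x (v j))\<^sup>2) / l = path_form l d (\<lambda>j. x (v j))"
      and eig: "\<And>y. y \<in> pverts T ==> adj_sum T x y = l * x y" and fz: "\<And>u. u \<in> F ==> x u = 0"
      and nf: "\<And>u. u \<in> X - F ==> l * x u = real (bsize F u) * x (par u) \<and> (bsize F u = 1 \<or> x u = 0)" by blast
    have xn: "x (v j) \<noteq> 0" if "j \<le> d" for j
      using half_form_ge_load(2)[OF g4 load_ends(1) ld, of "\<lambda>j. x (v j)"] x that unfolding pf by blast
    \<comment> \<open>For equality the eigenvector vanishes at \<open>u0\<close> and its children,
      hence at the parent of \<open>u0\<close>. The zero then climbs from parent to parent until it
      reaches the path, where the vector has no zero.\<close>
    have up: "x (par a) = 0 ==> False" if "a \<in> X" "rk a \<le> rk u0" for a using that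
    proof (induction "rk a" arbitrary: a rule: less_induct)
      case less
      show False
      proof (cases "par a \<in> X")
        case True
        have r: "rk (par a) < rk u0" using rk_par[of a] less.prems True by simp
        then have "par a \<notin> F" using child_rk unfolding F_def by force
        then have "real (bsize F (par a)) * x (par (par a)) = 0" using nf[of "par a"] True less.prems by simp
        then have "x (par (par a)) = 0" using bsize_pos[OF True, of F] by simp
        then show False using less.hyps[of "par a"] rk_par[of a] True less.prems r by simp
      next
        case False
        then obtain j where "j < d" "par a = v j" using par_path less.prems by blast
        then show False using xn[of j] less.prems by simp
      qed
    qed
    have "(\<Sum>c\<in>children {} u0. x c) = 0" using fz unfolding F_def by simp
    moreover have "adj_sum T x u0 = 0" using eig[of u0] fz[of u0] u0 verts unfolding F_def by simp
    ultimately have "x (par u0) = 0" using adj_sum_branch[OF u0(1), of x] by simp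
    then show False using up[OF u0(1)] by simp
  qed
qed

lemma path_decomposition_reverse: "path_decomposition T d (\<lambda>j. v (d - j)) X par rk"
proof
  have im2: "(\<lambda>j. v (d - j)) ` {0<..<d} = v ` {0<..<d}"
  proof (intro equalityI subsetI)
    fix y assume "y \<in> v ` {0<..<d}"
    then obtain j where "0 < j" "j < d" "y = v j" by auto
    then have "y = v (d - (d - j))" "d - j \<in> {0<..<d}" by auto
    then show "y \<in> (\<lambda>j. v (d - j)) ` {0<..<d}" by blast
  qed auto
  show "inj_on (\<lambda>j. v (d - j)) {..d}" by (auto simp: inj_on_def v_eq)
  show "finite X" "X \<inter> (\<lambda>j. v (d - j)) ` {..d} = {}" "pverts T = (\<lambda>j. v (d - j)) ` {..d} \<union> X"
    unfolding reverse_image using finX disj verts by auto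
  show "parcs T = {(v (d - a), v (d - b)) | a b. a \<le> d \<and> b \<le> d \<and> (b = a + 1 \<or> a = b + 1)} \<union>
      {(u, par u) | u. u \<in> X} \<union> {(par u, u) | u. u \<in> X}"
    unfolding reverse_path_arcs by (rule arcs)
  show "u \<in> X ==> par u \<in> X \<union> (\<lambda>j. v (d - j)) ` {0<..<d}" for u unfolding im2 by (rule par_in)
  show "u \<in> X ==> par u \<in> X ==> rk (par u) < rk u" for u by (rule rk_par)
qed

lemma cover_bound:
  assumes lc: "load_cert l d p S k p' S' k' (load {}) \<or> strict_load_cert l d (load {})"
    and kX: "card X = k + k'" and k': "k' \<ge> 1"
    and s: "\<And>u. u \<in> X ==> bsize {} u = 1 \<or> real (bsize {} u) < l^2"
  shows "lambda2 T \<le> l \<and> (lambda2 T = l --> (\<exists>i j. i < j \<and> j \<le> d \<and> (k > 0 --> half_tight l p S k i) \<and>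
    half_tight l p' S' k' (d - j) \<and> path_with_leaves d i k j k' T))"
  using lc
proof
  assume a: "load_cert l d p S k p' S' k' (load {})"
  have "lambda2 T \<le> l" by (rule node_bound(1)[OF a]) (use s in auto)
  then show ?thesis using extremal_structure[OF a kX k' s] by blast
next
  assume "strict_load_cert l d (load {})"
  then obtain q U n q' U' n' where a: "load_cert l d q U n q' U' n' (load {})"
    and st: "half_strict l q U n \<or> half_strict l q' U' n'" unfolding strict_load_cert_def by blast
  have "lambda2 T < l" by (rule node_bound(3)[OF a _ _ _ _ st]) (use s in auto)
  then show ?thesis by simp
qed

text \<open>The three cases are pushable branches, a branch of size at least \<open>l^2\<close> with
  all sizes below \<open>l^2 + 1\<close>, and a branch of size at least \<open>l^2 + 1\<close>. A
  branch vertex of size other than 1 is the parent of another one, so \<open>side\<close> supplies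
  the side conditions whenever a heavy branch occurs.\<close>

lemma upper_bound:
  assumes cov: "coverable l d k k' p S p' S'" and k: "k \<le> k'" "k' \<ge> 1" and kX: "card X = k + k'"
    and side: "\<And>u. u \<in> X ==> par u \<in> X ==> d \<ge> 4 \<and> k \<ge> 1 \<and> side_conditions l d k k'"
  shows "lambda2 T \<le> l \<and> (lambda2 T = l --> (\<exists>i j. i < j \<and> j \<le> d \<and> (k > 0 --> half_tight l p S k i) \<and>
    half_tight l p' S' k' (d - j) \<and> path_with_leaves d i k j k' T))"
proof -
  have side': "d \<ge> 4 \<and> k \<ge> 1 \<and> side_conditions l d k k'" if u: "u \<in> X" "bsize {} u \<noteq> 1" for u
  proof -
    have "children {} u \<noteq> {}" using bsize_rec[OF u(1), of "{}"] u(2) by auto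
    then obtain c where "c \<in> X" "par c = u" unfolding children_def by auto
    then show ?thesis using side[of c] u(1) by simp
  qed
  consider (small) "\<And>u. u \<in> X ==> bsize {} u = 1 \<or> real (bsize {} u) < l^2"
    | (heavy) u where "u \<in> X" "bsize {} u \<noteq> 1" "real (bsize {} u) \<ge> l^2" "\<And>u. u \<in> X ==> real (bsize {} u) < l^2 + 1"
    | (very) u where "u \<in> X" "real (bsize {} u) \<ge> l^2 + 1"
    by (metis not_less)
  then show ?thesis
  proof cases
    case small
    interpret R: path_decomposition T d "\<lambda>j. v (d - j)" X par rk by (rule path_decomposition_reverse)
    have Rl: "R.load {} = (\<lambda>j. load {} (d - j))"
      by (intro ext) (simp only: R.load_def load_def)
    have "(\<Sum>j\<le>d. load {} j) = k + k'" using sum_load[of "{}"] kX by simp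
    then obtain w where "w \<in> {load {}, \<lambda>j. load {} (d - j)}" "load_cert l d p S k p' S' k' w \<or> strict_load_cert l d w"
      using cov load_ends[of "{}"] unfolding coverable_def by blast
    then consider "load_cert l d p S k p' S' k' (load {}) \<or> strict_load_cert l d (load {})"
      | "load_cert l d p S k p' S' k' (R.load {}) \<or> strict_load_cert l d (R.load {})" unfolding Rl by blast
    then show ?thesis
    proof cases
      case 1 then show ?thesis by (rule cover_bound[OF _ kX k(2) small])
    next
      case 2 then show ?thesis by (rule R.cover_bound[OF _ kX k(2)]) (rule small)
    qed
  next
    case heavy
    note sd = side'[OF heavy(1,2)]
    have "lambda2 T < l"
      by (rule heavy_branch_bound[OF _ _ _ k(1) kX heavy(4) heavy(1) heavy(3)]) (use sd in auto)
    then show ?thesis by simp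
  next
    case very
    define U where "U = {u \<in> X. real (bsize {} u) \<ge> l^2 + 1}"
    have "finite U" "U \<noteq> {}" using very finX unfolding U_def by auto
    then have "Max (rk ` U) \<in> rk ` U" by (intro Max_in) auto
    then obtain u0 where u0: "u0 \<in> U" "rk u0 = Max (rk ` U)" by auto
    have deep: "real (bsize {} u) < l^2 + 1" if "u \<in> X" "rk u0 < rk u" for u
    proof (rule ccontr)
      assume "\<not> ?thesis"
      then have "u \<in> U" using that unfolding U_def by auto
      then have "rk u \<le> rk u0" unfolding u0(2) using \<open>finite U\<close> by simp
      then show False using that by simp
    qed
    have u0X: "u0 \<in> X" "real (bsize {} u0) \<ge> l^2 + 1" using u0 unfolding U_def by auto
    have ne: "bsize {} u0 \<noteq> 1" 
    proof
      assume "bsize {} u0 = 1"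
      then have "l^2 \<le> 0" using u0X(2) by simp
      then have l0: "l = 0" by simp
      from cov obtain w where "load_cert l d p S k p' S' k' w \<or> strict_load_cert l d w"
        unfolding coverable_def using load_ends[of "{}"] sum_load[of "{}"] kX by (metis finite.emptyI add_0_right sum.empty empty_subsetI)
      then have "l > 0" unfolding strict_load_cert_def load_cert_def half_cert_def by blast
      then show False using l0 by simp
    qed
    note sd = side'[OF u0X(1) ne]
    have "lambda2 T < l"
      by (rule very_heavy_branch_bound[OF _ _ k(1) kX u0X deep]) (use sd in auto)
    then show ?thesis by simp
  qed
qed

end

section \<open>Trees and their diameter\<close>

lemma awalk_relpow:
  assumes G: "pair_graph G" and u: "u \<in> pverts G"
  shows "(\<exists>p. pre_digraph.awalk (with_proj G) u p w \<and> length p = n) \<longleftrightarrow> (u, w) \<in> parcs G ^^ n"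
proof -
  interpret pair_graph G by (rule G)
  show ?thesis using u
  proof (induction n arbitrary: u)
    case 0
    then show ?case by (auto simp: awalk_Nil_iff)
  next
    case (Suc n)
    show ?case
    proof
      assume "\<exists>p. awalk u p w \<and> length p = Suc n"
      then obtain e p where p: "awalk u (e # p) w" "length p = n" by (metis length_Suc_conv)
      then have e: "e \<in> parcs G" "fst e = u" "awalk (snd e) p w" by (auto simp: awalk_Cons_iff)
      have "snd e \<in> pverts G" using e(1) by (rule arc_snd_in_verts)
      then have "(snd e, w) \<in> parcs G ^^ n" using Suc.IH e(3) p(2) by blast
      moreover have "(u, snd e) \<in> parcs G" using e by (metis prod.collapse)
      ultimately show "(u, w) \<in> parcs G ^^ Suc n" by (rule relpow_Suc_I2[rotated])
    next
      assume "(u, w) \<in> parcs G ^^ Suc n"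
      then obtain y where y: "(u, y) \<in> parcs G" "(y, w) \<in> parcs G ^^ n" by (rule relpow_Suc_E2)
      then have "y \<in> pverts G" using arc_snd_in_verts by fastforce
      then obtain p where "awalk y p w" "length p = n" using Suc.IH y(2) by blast
      then have "awalk u ((u, y) # p) w" "length ((u, y) # p) = Suc n" using y by (auto simp: awalk_Cons_iff)
      then show "\<exists>p. awalk u p w \<and> length p = Suc n" by blast
    qed
  qed
qed

lemma (in wf_digraph) awalk_cost_unit: "awalk_cost (\<lambda>_. 1) p = real (length p)"
  by (induction p) auto

lemma mu_unit_le_iff:
  assumes G: "pair_graph G" and u: "u \<in> pverts G"
  shows "wf_digraph.\<mu> (with_proj G) (\<lambda>_. 1) u w \<le> ereal (real n) \<longleftrightarrow> (\<exists>k\<le>n. (u, w) \<in> parcs G ^^ k)"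
proof -
  interpret pair_graph G by (rule G)
  note W = awalk_relpow[OF G u, of w]
  show ?thesis
  proof
    assume le: "\<mu> (\<lambda>_. 1) u w \<le> ereal (real n)"
    show "\<exists>k\<le>n. (u, w) \<in> parcs G ^^ k"
    proof (rule ccontr)
      assume no: "\<not> ?thesis"
      have "ereal (real (n + 1)) \<le> \<mu> (\<lambda>_. 1) u w"
        unfolding \<mu>_def
      proof (rule INF_greatest)
        fix p assume "p \<in> {p. awalk u p w}"
        then have "(u, w) \<in> parcs G ^^ length p" using W by blast
        then have "n + 1 \<le> length p" using no by (metis Suc_eq_plus1 not_less_eq_eq)
        then show "ereal (real (n + 1)) \<le> ereal (awalk_cost (\<lambda>_. 1) p)" unfolding awalk_cost_unit by simp
      qed
      then have "ereal (real (n + 1)) \<le> ereal (real n)" using le by (rule order.trans)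
      then show False by simp
    qed
  next
    assume "\<exists>k\<le>n. (u, w) \<in> parcs G ^^ k"
    then obtain k where k: "k \<le> n" "(u, w) \<in> parcs G ^^ k" by blast
    then obtain p where "awalk u p w" "length p = k" using W by blast
    then show "\<mu> (\<lambda>_. 1) u w \<le> ereal (real n)"
      unfolding \<mu>_def using k by (intro INF_lower2[of p]) (auto simp: awalk_cost_unit)
  qed
qed

lemma diameter_eq_iff:
  assumes G: "pair_graph G" and d: "d \<ge> 1"
  shows "diameter G = ereal (real d) \<longleftrightarrow>
    (\<forall>u\<in>pverts G. \<forall>w\<in>pverts G. \<exists>k\<le>d. (u, w) \<in> parcs G ^^ k) \<and>
    (\<exists>u\<in>pverts G. \<exists>w\<in>pverts G. \<forall>k<d. (u, w) \<notin> parcs G ^^ k)"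
proof -
  let ?m = "wf_digraph.\<mu> (with_proj G) (\<lambda>_. 1)"
  have sup_le: "diameter G \<le> c \<longleftrightarrow> (\<forall>u\<in>pverts G. \<forall>w\<in>pverts G. ?m u w \<le> c)" for c
    unfolding diameter_def by (simp add: SUP_le_iff)
  have le: "diameter G \<le> ereal (real n) \<longleftrightarrow>
      (\<forall>u\<in>pverts G. \<forall>w\<in>pverts G. \<exists>k\<le>n. (u, w) \<in> parcs G ^^ k)" for n
    unfolding sup_le using mu_unit_le_iff[OF G] by blast
  have lt: "k \<le> d - 1 \<longleftrightarrow> k < d" for k using d by auto
  have ge: "ereal (real d) \<le> diameter G" if uw: "u \<in> pverts G" "w \<in> pverts G" "\<forall>k<d. (u, w) \<notin> parcs G ^^ k" for u w
  proof -
    interpret pair_graph G by (rule G)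
    have "ereal (real d) \<le> ?m u w"
      unfolding \<mu>_def
    proof (rule INF_greatest)
      fix p assume "p \<in> {p. awalk u p w}"
      then have "(u, w) \<in> parcs G ^^ length p" using awalk_relpow[OF G uw(1), of w] by blast
      then have "d \<le> length p" using uw(3) by (meson not_less)
      then show "ereal (real d) \<le> ereal (awalk_cost (\<lambda>_. 1) p)" unfolding awalk_cost_unit by simp
    qed
    also have "\<dots> \<le> diameter G" using sup_le[of "diameter G"] uw by blast
    finally show ?thesis .
  qed
  show ?thesis
  proof
    assume eq: "diameter G = ereal (real d)"
    then have "\<not> diameter G \<le> ereal (real (d - 1))" using d by simp
    then have "\<exists>u\<in>pverts G. \<exists>w\<in>pverts G. \<forall>k<d. (u, w) \<notin> parcs G ^^ k"
      unfolding le[of "d - 1"] using lt by blast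
    then show "(\<forall>u\<in>pverts G. \<forall>w\<in>pverts G. \<exists>k\<le>d. (u, w) \<in> parcs G ^^ k) \<and>
      (\<exists>u\<in>pverts G. \<exists>w\<in>pverts G. \<forall>k<d. (u, w) \<notin> parcs G ^^ k)" using eq le[of d] by auto
  next
    assume h: "(\<forall>u\<in>pverts G. \<forall>w\<in>pverts G. \<exists>k\<le>d. (u, w) \<in> parcs G ^^ k) \<and>
      (\<exists>u\<in>pverts G. \<exists>w\<in>pverts G. \<forall>k<d. (u, w) \<notin> parcs G ^^ k)"
    then have "diameter G \<le> ereal (real d)" using le[of d] by blast
    moreover have "ereal (real d) \<le> diameter G" using h ge by blast
    ultimately show "diameter G = ereal (real d)" by (rule antisym)
  qed
qed

lemma pair_graphD:
  assumes "pair_graph G"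
  shows "finite (pverts G)" "parcs G \<subseteq> pverts G \<times> pverts G" "(a, b) \<in> parcs G ==> (b, a) \<in> parcs G"
    "(a, a) \<notin> parcs G"
proof -
  interpret pair_graph G by (rule assms)
  show "finite (pverts G)" by (rule pair_finite_verts)
  show "parcs G \<subseteq> pverts G \<times> pverts G" using arc_fst_in_verts arc_snd_in_verts by fastforce
  show "(a, b) \<in> parcs G ==> (b, a) \<in> parcs G" using arcs_symmetric by simp
  show "(a, a) \<notin> parcs G" using pair_no_loops by fastforce
qed

text \<open>Two neighbours of \<open>u\<close> joined by a walk avoiding \<open>u\<close> would close a cycle through \<open>u\<close>.\<close>

lemma tree_no_detour:
  assumes T: "is_tree G" and ua: "(u, a) \<in> parcs G" and ub: "(u, b) \<in> parcs G"
    and ab: "(a, b) \<in> {(x, y) \<in> parcs G. x \<noteq> u \<and> y \<noteq> u}\<^sup>*"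
  shows "a = b"
proof (rule ccontr)
  assume ne: "a \<noteq> b"
  have G: "pair_graph G" and nc: "\<And>p. pre_digraph.cycle (with_proj G) p ==> length p < 3"
    using T unfolding is_tree_def by (auto simp: not_le)
  interpret pair_graph G by (rule G)
  note D = pair_graphD[OF G]
  have bu: "b \<noteq> u" "b \<in> pverts G" using ub D by auto
  have "\<exists>p. awalk a p b \<and> u \<notin> set (pawalk_verts a p)"
    using ab
  proof (induction rule: converse_rtrancl_induct)
    case base
    have "awalk b [] b \<and> u \<notin> set (pawalk_verts b [])" using bu by (auto simp: awalk_Nil_iff)
    then show ?case by blast
  next
    case (step x y)
    then obtain p where p: "awalk y p b" "u \<notin> set (pawalk_verts y p)" by blast
    have "awalk x ((x, y) # p) b \<and> u \<notin> set (pawalk_verts x ((x, y) # p))"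
      using p step(1) by (auto simp: awalk_Cons_iff)
    then show ?case by blast
  qed
  then obtain p where p: "awalk a p b" "u \<notin> set (pawalk_verts a p)" by blast
  define q where "q = awalk_to_apath p"
  have q: "apath a q b" unfolding q_def using p(1) by (rule apath_awalk_to_apath)
  then have qw: "awalk a q b" and qd: "distinct (pawalk_verts a q)" unfolding apath_def by auto
  have "set q \<subseteq> set p" unfolding q_def using p(1) by (rule awalk_to_apath_subset)
  then have "set (pawalk_verts a q) \<subseteq> set (pawalk_verts a p)"
    using set_awalk_verts[OF qw] set_awalk_verts[OF p(1)] by auto
  then have uq: "u \<notin> set (pawalk_verts a q)" using p(2) by auto
  have "q \<noteq> []" using qw ne by (auto simp: awalk_Nil_iff)
  then have len: "length ((u, a) # q @ [(b, u)]) \<ge> 3" by (cases q) auto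
  have last: "last (pawalk_verts a q) = b" using iffD1[OF awalk_conv qw] by (elim conjE)
  have bw: "awalk b [(b, u)] u" using D(3)[OF ub] bu D(2) by (auto simp: awalk_Cons_iff awalk_Nil_iff)
  then have qb: "awalk a (q @ [(b, u)]) u" using qw last by (simp add: awalk_append_iff)
  have w: "awalk u ((u, a) # q @ [(b, u)]) u" using qb ua by (simp add: awalk_Cons_iff del: awalk_append_iff)
  have "pawalk_verts a (q @ [(b, u)]) = pawalk_verts a q @ [u]"
    using awalk_verts_append[OF qb] last by simp
  then have "distinct (tl (pawalk_verts u ((u, a) # q @ [(b, u)])))" using qd uq by simp
  then have "cycle ((u, a) # q @ [(b, u)])" unfolding cycle_def using w by blast
  then show False using nc len by fastforce
qed

section \<open>Rooting a tree at an end of a diametral path\<close>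

lemma tree_path_decomposition:
  assumes T: "T \<in> trees n d" and d: "d \<ge> 1"
  shows "\<exists>v X par rk. path_decomposition T d v X par rk \<and> card X = n - d - 1 \<and>
    (d = 3 --> (\<forall>u\<in>X. par u \<notin> X))"
proof -
  define V E where "V = pverts T" and "E = parcs T"
  have tree: "is_tree T" and cV: "card V = n" and dm: "diameter T = ereal (real d)"
    using T unfolding trees_def V_def by auto
  have G: "pair_graph T" using tree unfolding is_tree_def by simp
  note D = pair_graphD[OF G, folded V_def E_def]
  from dm[unfolded diameter_eq_iff[OF G d]]
  obtain r z where all: "\<And>u w. u \<in> V ==> w \<in> V ==> \<exists>k\<le>d. (u, w) \<in> E ^^ k"
    and rz: "r \<in> V" "z \<in> V" "\<And>k. k < d ==> (r, z) \<notin> E ^^ k" unfolding V_def E_def by blast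
  \<comment> \<open>\<open>lev\<close> is the distance from \<open>r\<close>. The absence of cycles
    leaves each other vertex exactly one neighbour that is not farther from \<open>r\<close>; it
    becomes the parent, and every edge joins a vertex to its parent.\<close>
  define lev where "lev u = (LEAST k. (r, u) \<in> E ^^ k)" for u
  have lev1: "(r, u) \<in> E ^^ lev u" "lev u \<le> d" if u: "u \<in> V" for u
  proof -
    obtain k where k: "k \<le> d" "(r, u) \<in> E ^^ k" using all[OF rz(1) u] by blast
    show "(r, u) \<in> E ^^ lev u" unfolding lev_def by (rule LeastI[of _ k]) (rule k)
    show "lev u \<le> d" unfolding lev_def using k by (meson Least_le order.trans)
  qed
  have lev2: "lev u \<le> k" if "(r, u) \<in> E ^^ k" for u k unfolding lev_def using that by (rule Least_le)
  have levz: "lev z = d" using lev1[OF rz(2)] rz(3)[of "lev z"] by (meson le_neq_implies_less)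
  have levr: "lev r = 0" using lev2[of r 0] by simp
  have lev0: "u = r" if "u \<in> V" "lev u = 0" for u using lev1(1)[OF that(1)] that(2) by simp
  have step: "lev y \<le> lev x + 1" if "(x, y) \<in> E" for x y
  proof -
    have "x \<in> V" using that D(2) by auto
    then have "(r, y) \<in> E ^^ Suc (lev x)" using lev1(1) that by (intro relpow_Suc_I)
    then show ?thesis using lev2 by fastforce
  qed
  have pred: "\<exists>y. (u, y) \<in> E \<and> lev y + 1 = lev u" if u: "u \<in> V" "u \<noteq> r" for u
  proof -
    obtain k where k: "lev u = Suc k" using lev0 u by (cases "lev u") auto
    then have "(r, u) \<in> E ^^ Suc k" using lev1(1)[OF u(1)] by simp
    then obtain y where y: "(r, y) \<in> E ^^ k" "(y, u) \<in> E" by (rule relpow_Suc_E)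
    have "lev y \<le> k" using lev2[OF y(1)] .
    moreover have "lev u \<le> lev y + 1" using step[OF y(2)] .
    ultimately show ?thesis using k y(2) D(3) by (intro exI[of _ y]) auto
  qed
  define par where "par u = (SOME y. (u, y) \<in> E \<and> lev y + 1 = lev u)" for u
  have par: "(u, par u) \<in> E" "lev (par u) + 1 = lev u" "par u \<in> V" if "u \<in> V" "u \<noteq> r" for u
  proof -
    show "(u, par u) \<in> E" "lev (par u) + 1 = lev u"
      using someI_ex[OF pred[OF that]] unfolding par_def by auto
    then show "par u \<in> V" using D(2) by auto
  qed
  \<comment> \<open>Going up from \<open>x\<close> strictly lowers the level, so the walk to the
    root never meets \<open>u\<close>.\<close>
  have desc: "(x, r) \<in> {(x, y) \<in> E. x \<noteq> u \<and> y \<noteq> u}\<^sup>*" if "x \<in> V" "lev x \<le> lev u" "x \<noteq> u" for x u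
    using that
  proof (induction "lev x" arbitrary: x rule: less_induct)
    case less
    show ?case
    proof (cases "x = r")
      case False
      note p = par[OF less.prems(1) False]
      have "par x \<noteq> u" using p less.prems by auto
      then have "(x, par x) \<in> {(x, y) \<in> E. x \<noteq> u \<and> y \<noteq> u}" using p less.prems by auto
      moreover have "(par x, r) \<in> {(x, y) \<in> E. x \<noteq> u \<and> y \<noteq> u}\<^sup>*"
        using p less.prems \<open>par x \<noteq> u\<close> by (intro less.hyps) auto
      ultimately show ?thesis by (rule converse_rtrancl_into_rtrancl)
    qed simp
  qed
  have uniq: "a = b" if ab: "(u, a) \<in> E" "(u, b) \<in> E" "lev a \<le> lev u" "lev b \<le> lev u" for u a b
  proof -
    let ?R = "{(x, y) \<in> E. x \<noteq> u \<and> y \<noteq> u}"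
    have s: "sym ?R" using D(3) unfolding sym_def by auto
    have "a \<in> V" "b \<in> V" "a \<noteq> u" "b \<noteq> u" using ab D(2,4) by auto
    then have "(a, r) \<in> ?R\<^sup>*" "(b, r) \<in> ?R\<^sup>*" using desc ab by auto
    then have "(a, b) \<in> ?R\<^sup>*" using sym_rtrancl[OF s] by (meson rtrancl_trans symD)
    then show ?thesis by (intro tree_no_detour[OF tree]) (use ab in \<open>auto simp: E_def\<close>)
  qed
  have edges: "(x \<in> V \<and> x \<noteq> r \<and> y = par x) \<or> (y \<in> V \<and> y \<noteq> r \<and> x = par y)" if xy: "(x, y) \<in> E" for x y
  proof -
    have *: "x \<noteq> r \<and> y = par x" if h: "(x, y) \<in> E" "lev y \<le> lev x" for x y
    proof -
      have xyV: "x \<in> V" "y \<in> V" "x \<noteq> y" using h D(2,4) by auto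
      have "x \<noteq> r" using h(2) levr lev0[OF xyV(2)] xyV(3) by auto
      moreover have "y = par x"
        by (rule uniq[OF h(1) par(1)[OF xyV(1) \<open>x \<noteq> r\<close>] h(2)]) (use par(2)[OF xyV(1) \<open>x \<noteq> r\<close>] in simp)
      ultimately show ?thesis by blast
    qed
    have "x \<in> V" "y \<in> V" using xy D(2) by auto
    then show ?thesis using *[OF xy] *[OF D(3)[OF xy]] by linarith
  qed
  define v where "v j = (par ^^ (d - j)) z" for j
  have iter: "(par ^^ t) z \<in> V \<and> lev ((par ^^ t) z) = d - t" if "t \<le> d" for t
    using that
  proof (induction t)
    case 0 then show ?case using rz levz by simp
  next
    case (Suc t)
    then have i: "(par ^^ t) z \<in> V" "lev ((par ^^ t) z) = d - t" by auto
    then have "(par ^^ t) z \<noteq> r" using levr Suc.prems by auto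
    then show ?case using par[OF i(1)] i(2) by auto
  qed
  have vV: "v j \<in> V" and vlev: "lev (v j) = j" if "j \<le> d" for j
    using iter[of "d - j"] that unfolding v_def by auto
  have vpar: "par (v (j + 1)) = v j" if "j + 1 \<le> d" for j
  proof -
    have "d - j = Suc (d - (j + 1))" using that by simp
    then show ?thesis unfolding v_def by simp
  qed
  have v0: "v 0 = r" using lev0[OF vV[of 0]] vlev[of 0] by simp
  have vr: "v j \<noteq> r" if "0 < j" "j \<le> d" for j using vlev[OF that(2)] levr that by auto
  have inj: "inj_on v {..d}" by (rule inj_on_inverseI[of _ lev]) (simp add: vlev)
  define X where "X = V - v ` {..d}"
  have XV: "u \<in> V" "u \<noteq> r" if "u \<in> X" for u using that v0 unfolding X_def by auto
  have finX: "finite X" using D(1) unfolding X_def by simp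
  define R where "R = {(x, par x) | x. x \<in> V \<and> x \<noteq> r}"
  have Rlev: "lev y \<le> lev x" if "(x, y) \<in> R\<^sup>*" for x y
    using that
  proof (induction rule: converse_rtrancl_induct)
    case (step x w)
    then have "lev w + 1 = lev x" using par(2) unfolding R_def by auto
    then show ?case using step by simp
  qed simp
  have Rpath: "y \<in> v ` {..d}" if "(x, y) \<in> R\<^sup>*" "x \<in> v ` {..d}" for x y
    using that
  proof (induction rule: rtrancl_induct)
    case (step y w)
    then obtain j where j: "j \<le> d" "y = v j" by auto
    have y: "w = par y" "y \<noteq> r" using step(2) unfolding R_def by auto
    then obtain i where "j = i + 1" using j v0 by (cases j) auto
    then show ?case using vpar[of i] j y by auto
  qed
  \<comment> \<open>A vertex below \<open>w\<close> reaches \<open>z\<close> only through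
    \<open>par w\<close>, so its distance from \<open>z\<close> is at least
    \<open>(lev u - lev (par w)) + (d - lev (par w))\<close>, and this is at most \<open>d\<close>.
    Applied to \<open>w = u\<close> it shows that nothing hangs at the end \<open>r\<close>; applied
    one generation higher it excludes deep branches for \<open>d = 3\<close>.\<close>
  have turn: "lev u \<le> 2 * lev (par w)" if w: "w \<in> X" and u: "u \<in> V" and uw: "(u, w) \<in> R\<^sup>*" for u w
  proof -
    \<comment> \<open>\<open>f\<close> reflects the levels below \<open>w\<close> at the level of
      \<open>par w\<close>. It changes by at most 1 along every edge, which bounds walk lengths from
      below without an argument about where a walk passes.\<close>
    define f where "f x = (if (x, w) \<in> R\<^sup>* then 2 * int (lev (par w)) - int (lev x) else int (lev x))" for x
    note wV = XV[OF w]
    have lip: "f y \<le> f x + 1 \<and> f x \<le> f y + 1" if x: "x \<in> V" "x \<noteq> r" "y = par x" for x y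
    proof -
      have l: "lev y + 1 = lev x" using par(2)[OF x(1,2)] x(3) by simp
      consider "x = w" | "x \<noteq> w" "(x, w) \<in> R\<^sup>*" | "(x, w) \<notin> R\<^sup>*" by blast
      then show ?thesis
      proof cases
        case 1
        have "(y, w) \<notin> R\<^sup>*" using Rlev[of y w] l 1 by auto
        then show ?thesis unfolding f_def using 1 x(3) l by auto
      next
        case 2
        then obtain y' where "(x, y') \<in> R" "(y', w) \<in> R\<^sup>*" by (auto elim: converse_rtranclE)
        then have "(y, w) \<in> R\<^sup>*" using x unfolding R_def by auto
        then show ?thesis unfolding f_def using 2 l by auto
      next
        case 3
        have "(x, y) \<in> R" using x unfolding R_def by auto
        then have "(y, w) \<notin> R\<^sup>*" using 3 by (meson converse_rtrancl_into_rtrancl)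
        then show ?thesis unfolding f_def using 3 l by auto
      qed
    qed
    have lipE: "f y \<le> f x + 1" if "(x, y) \<in> E" for x y using edges[OF that] lip by blast
    have walk: "f y \<le> f x + int k" if "(x, y) \<in> E ^^ k" for x y k
      using that
    proof (induction k arbitrary: y)
      case (Suc k)
      then obtain y' where "(x, y') \<in> E ^^ k" "(y', y) \<in> E" by (auto elim: relpow_Suc_E)
      then show ?case using Suc.IH lipE by fastforce
    qed simp
    have "z = v d" unfolding v_def by simp
    then have "(z, w) \<notin> R\<^sup>*" using Rpath[of z w] w unfolding X_def by auto
    then have fz: "f z = int d" unfolding f_def using levz by simp
    obtain k where "k \<le> d" "(u, z) \<in> E ^^ k" using all[OF u rz(2)] by blast
    then have "int d \<le> f u + int d" using walk[of u z k] fz by linarith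
    then show ?thesis unfolding f_def using uw by simp
  qed
  have par_in: "par u \<in> X \<union> v ` {0<..<d}" if u: "u \<in> X" for u
  proof (rule ccontr)
    assume n: "par u \<notin> X \<union> v ` {0<..<d}"
    note p = par[OF XV[OF u]]
    obtain j where j: "j \<le> d" "par u = v j" using p(3) n unfolding X_def by auto
    have "j = 0 \<or> j = d" using n j by force
    moreover have "j \<noteq> d" using p(2) j vlev[of d] lev1(2)[OF XV(1)[OF u]] by auto
    moreover have "j \<noteq> 0"
    proof
      assume "j = 0"
      then have "lev (par u) = 0" using j(2) vlev[of 0] by simp
      then show False using turn[OF u XV(1)[OF u] rtrancl_refl] p(2) by simp
    qed
    ultimately show False by blast
  qed
  have dec: "path_decomposition T d v X par lev"
  proof
    show "inj_on v {..d}" "finite X" by fact+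
    show "X \<inter> v ` {..d} = {}" unfolding X_def by auto
    show "pverts T = v ` {..d} \<union> X" unfolding X_def V_def[symmetric] using vV by auto
    show "par u \<in> X \<union> v ` {0<..<d}" if "u \<in> X" for u by (rule par_in[OF that])
    show "lev (par u) < lev u" if "u \<in> X" for u using par(2)[OF XV[OF that]] by simp
    let ?A = "{(v a, v b) | a b. a \<le> d \<and> b \<le> d \<and> (b = a + 1 \<or> a = b + 1)}"
    let ?B = "{(u, par u) | u. u \<in> X}" and ?C = "{(par u, u) | u. u \<in> X}"
    have up: "(x, par x) \<in> ?A \<union> ?B \<and> (par x, x) \<in> ?A \<union> ?C" if x: "x \<in> V" "x \<noteq> r" for x
    proof (cases "x \<in> X")
      case False
      then obtain j where j: "j \<le> d" "x = v j" using x unfolding X_def by auto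
      then obtain i where i: "j = i + 1" using x v0 by (cases j) auto
      then have "par x = v i" "i \<le> d" using vpar[of i] j by auto
      then show ?thesis using j i by blast
    qed blast
    have va: "(v a, v (a + 1)) \<in> E \<and> (v (a + 1), v a) \<in> E" if "a + 1 \<le> d" for a
      using par(1)[OF vV[OF that] vr[OF _ that]] vpar[OF that] D(3) by auto
    have "E = ?A \<union> ?B \<union> ?C"
    proof (intro equalityI subsetI)
      fix e assume "e \<in> E"
      then show "e \<in> ?A \<union> ?B \<union> ?C" using edges[of "fst e" "snd e"] up[of "fst e"] up[of "snd e"] by (cases e) auto
    next
      fix e assume "e \<in> ?A \<union> ?B \<union> ?C"
      then show "e \<in> E" using va par(1) XV D(3) by blast
    qed
    then show "parcs T = ?A \<union> ?B \<union> ?C" unfolding E_def .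
  qed
  have "card (v ` {..d}) = d + 1" using card_image[OF inj] by simp
  moreover have "card X = card V - card (v ` {..d})"
    unfolding X_def by (rule card_Diff_subset) (use vV in auto)
  ultimately have cX: "card X = n - d - 1" using cV by simp
  have d3: "par u \<notin> X" if d3: "d = 3" and u: "u \<in> X" for u
  proof
    assume w: "par u \<in> X"
    note pu = par[OF XV[OF u]] and pw = par[OF XV[OF w]]
    have "r \<notin> X" using XV(2) by blast
    moreover have "r \<notin> v ` {0<..<d}"
    proof
      assume "r \<in> v ` {0<..<d}"
      then obtain j where "r = v j" "0 < j" "j < d" by auto
      then show False using vr[of j] by simp
    qed
    ultimately have "par (par u) \<noteq> r" using par_in[OF w] by auto
    then have "lev (par (par u)) \<noteq> 0" using lev0[OF pw(3)] by blast
    moreover have "lev u \<le> 3" using lev1(2)[OF XV(1)[OF u]] d3 by simp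
    moreover have "(u, par u) \<in> R\<^sup>*" using XV[OF u] unfolding R_def by auto
    then have "lev u \<le> 2 * lev (par (par u))" by (rule turn[OF w XV(1)[OF u]])
    ultimately show False using pu(2) pw(2) by linarith
  qed
  show ?thesis using dec cX d3 by blast
qed

section \<open>Paths with branches are trees of the right diameter\<close>

lemma no_long_cycle:
  fixes h :: "'a => nat" and w :: "nat => 'a"
  assumes up: "\<And>x y. (x, y) \<in> E ==> h y \<le> h x ==> y = up x" and sym: "sym E"
    and adj: "\<And>i. i < n ==> (w i, w (Suc i)) \<in> E" and closed: "w n = w 0"
    and inj: "inj_on w {1..n}" and n: "n \<ge> 3"
  shows False
proof -
  \<comment> \<open>Both cycle neighbours of a highest vertex are no higher than it, hence both
    equal its \<open>up\<close>, although they are distinct. The indices 0 and \<open>n\<close>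
    denote the same vertex, which causes the boundary cases \<open>i = n\<close> and
    \<open>i = 1\<close>.\<close>
  have "Max ((\<lambda>i. h (w i)) ` {1..n}) \<in> (\<lambda>i. h (w i)) ` {1..n}" using n by (intro Max_in) auto
  then obtain i where i: "i \<in> {1..n}" "h (w i) = Max ((\<lambda>i. h (w i)) ` {1..n})" by auto
  have mx: "h (w j) \<le> h (w i)" if "j \<le> n" for j
  proof -
    have "h (w j') \<le> h (w i)" if "j' \<in> {1..n}" for j' unfolding i(2) using that by (intro Max_ge) auto
    from this[of n] this[of j] show ?thesis using closed n that by (cases "j = 0") simp_all
  qed
  have "(w (i - 1), w (Suc (i - 1))) \<in> E" using i(1) by (intro adj) auto
  then have "(w i, w (i - 1)) \<in> E" using i(1) sym by (auto dest: symD)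
  then have prev: "w (i - 1) = up (w i)" using mx[of "i - 1"] i(1) by (intro up) auto
  show False
  proof (cases "i = n")
    case True
    have "(w i, w 1) \<in> E" using adj[of 0] closed n True by simp
    then have "w 1 = up (w i)" using mx[of 1] n by (intro up) auto
    then have "w 1 = w (n - 1)" using prev True by simp
    then have "1 = n - 1" using inj_onD[OF inj, of 1 "n - 1"] n by simp
    then show False using n by simp
  next
    case False
    then have "(w i, w (Suc i)) \<in> E" using i(1) by (intro adj) auto
    then have "w (Suc i) = up (w i)" using mx[of "Suc i"] i(1) False by (intro up) auto
    then have e: "w (Suc i) = w (i - 1)" using prev by simp
    show False
    proof (cases "i = 1")
      case True
      then have "w 2 = w n" using e closed by (simp add: numeral_2_eq_2)
      then have "2 = n" using inj_onD[OF inj, of 2 n] n by simp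
      then show False using n by simp
    next
      case i1: False
      have "Suc i \<in> {1..n}" "i - 1 \<in> {1..n}" using i(1) False i1 by auto
      then have "Suc i = i - 1" by (rule inj_onD[OF inj e])
      then show False by simp
    qed
  qed
qed

lemma (in pair_graph) awalk_nth_arc:
  "awalk u p x ==> i < length p ==> (pawalk_verts u p ! i, pawalk_verts u p ! Suc i) \<in> parcs G"
proof (induction p arbitrary: u i)
  case (Cons e p)
  then have e: "e \<in> parcs G" "fst e = u" "awalk (snd e) p x" by (auto simp: awalk_Cons_iff)
  show ?case
  proof (cases i)
    case 0
    have "pawalk_verts (snd e) p ! 0 = snd e" by (cases p) (use e(3) in \<open>auto simp: awalk_Cons_iff\<close>)
    moreover have "(u, snd e) \<in> parcs G" using e(1,2) by (metis prod.collapse)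
    ultimately show ?thesis using 0 e(2) by simp
  next
    case (Suc j) then show ?thesis using Cons.IH[OF e(3), of j] Cons.prems by simp
  qed
qed simp

lemma (in pair_graph) length_pawalk_verts: "length (pawalk_verts u p) = Suc (length p)"
  by (induction p arbitrary: u) auto

context path_decomposition
begin

definition idx :: "'a => nat" where
  "idx y = inv_into {..d} v y"

lemma idx_v [simp]: "j \<le> d ==> idx (v j) = j"
  unfolding idx_def using inj by (simp add: inv_into_f_f)

lemma vert_cases:
  assumes "y \<in> pverts T"
  obtains "y \<in> X" | j where "j \<le> d" "y = v j"
  using assms unfolding verts by auto

definition up :: "'a => 'a" where
  "up y = (if y \<in> X then par y else v (idx y - 1))"

text \<open>Ranks of branch vertices are lifted above all path indices, so that stepping with
  \<open>up\<close> from a branch onto the path lowers the height too.\<close>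

definition height :: "'a => nat" where
  "height y = (if y \<in> X then d + 1 + rk y else idx y)"

lemma arc_cases:
  assumes "(x, y) \<in> parcs T"
  obtains j where "j < d" "x = v j" "y = v (j + 1)" | j where "j < d" "x = v (j + 1)" "y = v j"
    | "x \<in> X" "y = par x" | "y \<in> X" "x = par y"
proof -
  from assms consider a b where "x = v a" "y = v b" "a \<le> d" "b \<le> d" "b = a + 1 \<or> a = b + 1"
    | "x \<in> X" "y = par x" | "y \<in> X" "x = par y" unfolding arcs by auto
  then show ?thesis
  proof cases
    case 1
    from 1(5) show ?thesis
    proof
      assume "b = a + 1" then show ?thesis using 1 that(1)[of a] by simp
    next
      assume "a = b + 1" then show ?thesis using 1 that(2)[of b] by simp
    qed
  next
    case 2 then show ?thesis by (rule that(3))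
  next
    case 3 then show ?thesis by (rule that(4))
  qed
qed

lemma height_par: "u \<in> X ==> height (par u) < height u"
proof (cases "par u \<in> X")
  case False
  assume u: "u \<in> X"
  then obtain j where "j < d" "par u = v j" using par_path False by blast
  then show ?thesis using u False v_notin[of j] unfolding height_def by simp
qed (use rk_par in \<open>auto simp: height_def\<close>)

lemma height_v: "j \<le> d ==> height (v j) = j"
  unfolding height_def using v_notin by simp

lemma up_unique:
  assumes e: "(x, y) \<in> parcs T" and h: "height y \<le> height x"
  shows "y = up x" and "height y < height x"
proof -
  have "y = up x \<and> height y < height x"
    using e
  proof (cases rule: arc_cases)
    case (1 j) then show ?thesis using h height_v[of j] height_v[of "j + 1"] by simp
  next
    case (2 j) then show ?thesis using height_v[of j] height_v[of "j + 1"] v_notin[of "j + 1"] unfolding up_def by simp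
  next
    case 3 then show ?thesis using height_par unfolding up_def by simp
  next
    case 4 then show ?thesis using height_par[of y] h by simp
  qed
  then show "y = up x" "height y < height x" by auto
qed

lemma pair_graph: "pair_graph T"
proof unfold_locales
  fix e assume e: "e \<in> parcs T"
  show "fst e \<in> pverts T" "snd e \<in> pverts T" using arcs_verts e by auto
  show "fst e \<noteq> snd e"
  proof
    assume "fst e = snd e"
    then have "(fst e, fst e) \<in> parcs T" using e by (metis prod.collapse)
    then show False using up_unique(2)[of "fst e" "fst e"] by simp
  qed
next
  show "finite (pverts T)" by (rule fin_verts)
  show "finite (parcs T)" using arcs_verts fin_verts by (meson finite_SigmaI finite_subset)
  show "symmetric (with_proj T)" unfolding symmetric_def using sym_arcs by simp
qed

lemma reaches_root: "y \<in> pverts T ==> (y, v 0) \<in> (parcs T)\<^sup>*"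
proof (induction "height y" arbitrary: y rule: less_induct)
  case less
  show ?case
  proof (cases "y = v 0")
    case False
    have "(y, up y) \<in> parcs T \<and> height (up y) < height y"
      using less.prems
    proof (cases rule: vert_cases)
      case 1 then show ?thesis using height_par unfolding up_def arcs by auto
    next
      case (2 j)
      then have j: "0 < j" "j \<le> d" using False by (cases "j = 0"; auto)+
      then have u: "up y = v (j - 1)" using 2 v_notin[of j] unfolding up_def by simp
      have "j \<le> d \<and> j - 1 \<le> d \<and> (j - 1 = j + 1 \<or> j = j - 1 + 1)" using j by auto
      then have "(v j, v (j - 1)) \<in> parcs T" unfolding arcs by blast
      then show ?thesis using u 2 height_v[of j] height_v[of "j - 1"] j by simp
    qed
    moreover from this have "up y \<in> pverts T" using arcs_verts by auto
    ultimately show ?thesis using less.hyps[of "up y"] by (meson converse_rtrancl_into_rtrancl)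
  qed simp
qed

lemma is_tree: "is_tree T"
proof -
  interpret G: pair_graph T by (rule pair_graph)
  have conn: "Digraph_Component.connected (with_proj T)"
    unfolding connected_def strongly_connected_def
  proof (intro conjI ballI)
    show "verts (with_proj (mk_symmetric (with_proj T))) \<noteq> {}" using verts by auto
    fix u w assume "u \<in> verts (with_proj (mk_symmetric (with_proj T)))" "w \<in> verts (with_proj (mk_symmetric (with_proj T)))"
    then have uw: "u \<in> pverts T" "w \<in> pverts T" by auto
    have "(v 0, w) \<in> (parcs T)\<^sup>*" using reaches_root[OF uw(2)] sym_rtrancl[OF sym_arcs] by (auto dest: symD)
    then have "(u, w) \<in> (parcs T)\<^sup>*" using reaches_root[OF uw(1)] by (rule rtrancl_trans[rotated])
    then obtain n where "(u, w) \<in> parcs T ^^ n" by (auto simp: rtrancl_power)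
    then obtain p where "G.awalk u p w" using awalk_relpow[OF pair_graph uw(1), of w n] by blast
    then have "u \<rightarrow>\<^sup>*\<^bsub>with_proj T\<^esub> w" by (rule G.reachable_awalkI)
    then show "u \<rightarrow>\<^sup>*\<^bsub>with_proj (mk_symmetric (with_proj T))\<^esub> w"
      using G.reachable_mk_symmetric_eq[OF G.pair_sym_arcs] by simp
  qed
  have "\<not> length p \<ge> 3" if "pre_digraph.cycle (with_proj T) p" for p
  proof
    assume len: "length p \<ge> 3"
    from that obtain u where p: "G.awalk u p u" "distinct (tl (pawalk_verts u p))" "p \<noteq> []"
      unfolding G.cycle_def by auto
    define w where "w i = pawalk_verts u p ! i" for i
    have lw: "length (pawalk_verts u p) = Suc (length p)" by (rule G.length_pawalk_verts)
    have "hd (pawalk_verts u p) = u \<and> last (pawalk_verts u p) = u"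
      using iffD1[OF G.awalk_conv p(1)] by (elim conjE) (intro conjI)
    note hl = this[THEN conjunct1] this[THEN conjunct2]
    have ne: "pawalk_verts u p \<noteq> []" using lw by auto
    show False
    proof (rule no_long_cycle[of "parcs T" height up "length p" w])
      show "w (length p) = w 0" unfolding w_def
        using hl ne lw by (simp add: last_conv_nth hd_conv_nth)
      show "inj_on w {1..length p}"
      proof (rule inj_onI)
        fix i j assume ij: "i \<in> {1..length p}" "j \<in> {1..length p}" "w i = w j"
        have "tl (pawalk_verts u p) ! (q - 1) = w q" if "q \<in> {1..length p}" for q
        proof -
          have "q - 1 < length (tl (pawalk_verts u p))" "Suc (q - 1) = q" using that lw by auto
          then show ?thesis unfolding w_def by (simp add: nth_tl)
        qed
        from this[OF ij(1)] this[OF ij(2)]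
        have "tl (pawalk_verts u p) ! (i - 1) = w i" "tl (pawalk_verts u p) ! (j - 1) = w j" .
        then have "i - 1 = j - 1" using p(2) ij lw by (intro nth_eq_iff_index_eq[THEN iffD1, OF p(2)]) auto
        then show "i = j" using ij by auto
      qed
      show "(w i, w (Suc i)) \<in> parcs T" if "i < length p" for i
        unfolding w_def by (rule G.awalk_nth_arc[OF p(1) that])
    qed (use up_unique(1) sym_arcs len in auto)
  qed
  then show ?thesis unfolding is_tree_def using pair_graph conn by blast
qed

lemma path_walk: "i + t \<le> d ==> (v i, v (i + t)) \<in> parcs T ^^ t \<and> (v (i + t), v i) \<in> parcs T ^^ t"
proof (induction t)
  case (Suc t)
  have "i + t \<le> d \<and> i + t + 1 \<le> d \<and> (i + t + 1 = i + t + 1 \<or> i + t = i + t + 1 + 1)" using Suc.prems by simp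
  then have "(v (i + t), v (i + t + 1)) \<in> parcs T" unfolding arcs by blast
  then have "(v (i + t), v (i + Suc t)) \<in> parcs T" "(v (i + Suc t), v (i + t)) \<in> parcs T"
    using symD[OF sym_arcs] by auto
  note e = this
  have "(v i, v (i + t)) \<in> parcs T ^^ t" "(v (i + t), v i) \<in> parcs T ^^ t" using Suc by auto
  then show ?case using relpow_Suc_I[OF _ e(1)] relpow_Suc_I2[OF e(2)] by blast
qed simp

lemma path_walk': "i \<le> d ==> j \<le> d ==> (v i, v j) \<in> parcs T ^^ ((i - j) + (j - i))"
  using path_walk[of i "j - i"] path_walk[of j "i - j"] by (cases "i \<le> j") auto

context
  assumes leaves: "\<And>u. u \<in> X ==> par u \<notin> X"
begin

lemma leaf_par:
  assumes "u \<in> X"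
  shows "0 < idx (par u)" "idx (par u) < d" "par u = v (idx (par u))"
  using par_path[OF assms leaves[OF assms]] by (metis idx_v less_imp_le)+

lemma walk_idx:
  assumes "(v i, v j) \<in> parcs T ^^ k" "i \<le> d" "j \<le> d"
  shows "j \<le> i + k"
proof -
  \<comment> \<open>It agrees with the index on the path and changes by at most 1 along every edge,
    so it bounds the length of a walk from below.\<close>
  define f where "f y = (if y \<in> X then idx (par y) + 1 else idx y)" for y
  have fv: "f (v j) = j" if "j \<le> d" for j using that v_notin unfolding f_def by simp
  have lip: "f y \<le> f x + 1" if "(x, y) \<in> parcs T" for x y
    using that
  proof (cases rule: arc_cases)
    case 3
    then show ?thesis using leaves leaf_par(2)[of x] unfolding f_def by auto
  next
    case 4
    then show ?thesis using leaves[of y] unfolding f_def by auto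
  qed (use fv in auto)
  have "f y \<le> f x + k" if "(x, y) \<in> parcs T ^^ k" for x y k
    using that
  proof (induction k arbitrary: y)
    case (Suc k)
    then obtain z where "(x, z) \<in> parcs T ^^ k" "(z, y) \<in> parcs T" by (auto elim: relpow_Suc_E)
    then show ?case using Suc.IH lip by fastforce
  qed simp
  then show ?thesis using assms fv by metis
qed

lemma diameter: 
  assumes d: "d \<ge> 2"
  shows "diameter T = ereal (real d)"
proof -
  have near: "\<exists>a j. j \<le> d \<and> (y, v j) \<in> parcs T ^^ a \<and> (v j, y) \<in> parcs T ^^ a \<and> (a = 0 \<or> (a = 1 \<and> 0 < j \<and> j < d))"
    if "y \<in> pverts T" for y
    using that
  proof (cases rule: vert_cases)
    case 1
    have "(y, v (idx (par y))) \<in> parcs T" "(v (idx (par y)), y) \<in> parcs T"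
      using 1 leaf_par(3)[OF 1] unfolding arcs by auto
    then show ?thesis using leaf_par(1,2)[OF 1] by (intro exI[of _ 1] exI[of _ "idx (par y)"]) auto
  next
    case (2 j)
    then show ?thesis by (intro exI[of _ 0] exI[of _ j]) auto
  qed
  have "\<exists>k\<le>d. (y, z) \<in> parcs T ^^ k" if yz: "y \<in> pverts T" "z \<in> pverts T" for y z
  proof -
    obtain a i where a: "i \<le> d" "(y, v i) \<in> parcs T ^^ a" "a = 0 \<or> (a = 1 \<and> 0 < i \<and> i < d)" using near[OF yz(1)] by blast
    obtain b j where b: "j \<le> d" "(v j, z) \<in> parcs T ^^ b" "b = 0 \<or> (b = 1 \<and> 0 < j \<and> j < d)" using near[OF yz(2)] by blast
    have "(y, z) \<in> parcs T ^^ (a + ((i - j) + (j - i)) + b)"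
      unfolding relpow_add using a(2) b(2) path_walk'[OF a(1) b(1)] by (auto simp: relpow_add)
    moreover have "a + ((i - j) + (j - i)) + b \<le> d" using a b d by auto
    ultimately show ?thesis by blast
  qed
  moreover have "\<forall>k<d. (v 0, v d) \<notin> parcs T ^^ k" using walk_idx[of 0 d] by fastforce
  moreover have "v 0 \<in> pverts T" "v d \<in> pverts T" using verts by auto
  moreover have d1: "d \<ge> 1" using d by simp
  ultimately show ?thesis unfolding diameter_eq_iff[OF pair_graph d1] by blast
qed

end

lemma adj_sum_end:
  assumes d: "d \<ge> 1"
  shows "adj_sum T x (v 0) = x (v 1)"
proof -
  have "{z. (v 0, z) \<in> parcs T} = {v 1}"
  proof (intro equalityI subsetI)
    fix z assume "z \<in> {z. (v 0, z) \<in> parcs T}"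
    then have e: "(v 0, z) \<in> parcs T" by simp
    then show "z \<in> {v 1}"
    proof (cases rule: arc_cases)
      case (1 j) then show ?thesis using v_eq[of 0 j] by simp
    next
      case (2 j) then show ?thesis using v_eq[of 0 "j + 1"] by simp
    next
      case 3 then show ?thesis using v_notin[of 0] by simp
    next
      case 4
      then have "par z \<notin> X" using v_notin[of 0] by simp
      then obtain j where "0 < j" "j < d" "par z = v j" using par_path[OF 4(1)] by blast
      then show ?thesis using 4 v_eq[of 0 j] by simp
    qed
  next
    fix z assume "z \<in> {v 1}"
    then have "z = v 1" "(0::nat) \<le> d \<and> (1::nat) \<le> d \<and> ((1::nat) = 0 + 1 \<or> (0::nat) = 1 + 1)" using d by auto
    then show "z \<in> {z. (v 0, z) \<in> parcs T}" unfolding arcs by blast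
  qed
  then show ?thesis using adj_sum_eq[of "v 0" x] verts by simp
qed

text \<open>A leaf takes \<open>1 / l\<close> times the value at its neighbour, so
  \<open>inner\<close> is the eigenvalue equation with the leaves eliminated. The two ends provide
  the change of sign.\<close>

lemma lambda2_ge_path_vector:
  assumes leaves: "\<And>u. u \<in> X ==> par u \<notin> X" and d: "d \<ge> 1" and l: "l > 0"
    and ends: "y 1 = l * y 0" "y (d - 1) = l * y d"
    and inner: "\<And>j. 0 < j ==> j < d ==>
      y (j - 1) + y (j + 1) + real (card {u \<in> X. par u = v j}) * (y j / l) = l * y j"
    and sgn: "y 0 > 0" "y d < 0"
  shows "lambda2 T \<ge> l"
proof -
  define x where "x z = (if z \<in> X then y (idx (par z)) / l else y (idx z))" for z
  have xv: "x (v j) = y j" if "j \<le> d" for j using that v_notin unfolding x_def by simp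
  interpret R: path_decomposition T d "\<lambda>j. v (d - j)" X par rk by (rule path_decomposition_reverse)
  have eig: "adj_sum T x z = l * x z" if "z \<in> pverts T" for z
    using that
  proof (cases rule: vert_cases)
    case 1
    have "children {} z = {}" using leaves 1 unfolding children_def by auto
    moreover have "par z \<notin> X" using leaves 1 by simp
    ultimately show ?thesis using adj_sum_branch[OF 1, of x] 1 l by (simp add: x_def)
  next
    case (2 j)
    consider "j = 0" | "j = d" | "0 < j" "j < d" using 2 by linarith
    then show ?thesis
    proof cases
      case a: 1
      show ?thesis using adj_sum_end[OF d, of x] 2 a xv[of 0] xv[of 1] ends d by simp
    next
      case a: 2
      show ?thesis using R.adj_sum_end[OF d, of x] 2 a xv[of d] xv[of "d - 1"] ends d by simp
    next
      case a: 3
      have "x c = y j / l" if "c \<in> children {} (v j)" for c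
        using that a unfolding children_def x_def by auto
      then have "(\<Sum>c\<in>children {} (v j). x c) = real (card {u \<in> X. par u = v j}) * (y j / l)"
        by (simp add: children_def)
      then show ?thesis using adj_sum_path[OF a, of x] inner[OF a] 2 xv[of j] xv[of "j - 1"] xv[of "j + 1"] a by simp
    qed
  qed
  show ?thesis
    by (rule lambda2_ge_sign_changing_eigenvector[OF fin_verts sym_arcs eig, of "v 0" "v d"])
      (use verts xv sgn in auto)
qed

end

text \<open>Tightness at \<open>i\<close> is what makes the free solution \<open>chp\<close> on the end and the solution \<open>S\<close> beyond
  \<open>i\<close> fit together across the loaded vertex.\<close>

lemma half_eigenvector:
  assumes h: "half_cert l p S k" and t: "k > 0 ==> half_tight l p S k i" and W: "k = 0 ==> S 1 = l * S 0"
  shows "\<exists>u. (\<forall>j\<le>p. u j > 0) \<and> u p = S p \<and> u (p + 1) = S (p + 1) \<and> u 1 = l * u 0 \<and>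
    (\<forall>j. 1 \<le> j --> j \<le> p --> u (j - 1) + u (j + 1) + real (if j = i then k else 0) * (u j / l) = l * u j)"
proof -
  note D = half_certD[OF h]
  have rec: "S (j - 1) + S (j + 1) = l * S j" if "1 \<le> j" "j \<le> p" for j
    using D(3)[of "j - 1"] that by simp
  show ?thesis
  proof (cases "k = 0")
    case True
    then show ?thesis using D(2) W rec by (intro exI[of _ S]) auto
  next
    case False
    then have k: "k > 0" by simp
    from t[OF k] have i: "1 \<le> i" "i \<le> p" and ti: "real k * chp l (i + 1) * S i = l * (l * S 0 - S 1)"
      unfolding half_tight_def by auto
    define P where "P j = chp l (j + 1)" for j
    have Pp: "P j > 0" if "j \<le> p" for j using D(7)[OF that] unfolding P_def .
    have Pr: "P (j - 1) + P (j + 1) = l * P j" if "1 \<le> j" for j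
      using that unfolding P_def by (cases j) auto
    define u where "u j = (if j \<le> i then S i / P i * P j else S j)" for j
    have ui: "u j = S j" if "i \<le> j" for j using that Pp[of i] i unfolding u_def by auto
    have ul: "u j = S i / P i * P j" if "j \<le> i" for j using that unfolding u_def by simp
    have c: "S i / P i > 0" using D(2)[of i] Pp[of i] i by simp
    have "u j > 0" if "j \<le> p" for j
    proof (cases "i \<le> j")
      case True then show ?thesis using ui[of j] D(2)[OF that] by simp
    next
      case False
      have "S i / P i * P j > 0" using c Pp[OF that] by (rule mult_pos_pos)
      then show ?thesis using ul[of j] False by simp
    qed
    moreover have "u 1 = l * u 0"
      using ul[of 0] ul[of 1] i by (simp add: P_def)
    moreover have "u (j - 1) + u (j + 1) + real (if j = i then k else 0) * (u j / l) = l * u j"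
      if j: "1 \<le> j" "j \<le> p" for j
    proof -
      consider "j < i" | "j = i" | "i < j" by linarith
      then show ?thesis
      proof cases
        case 1
        have "u (j - 1) + u (j + 1) = S i / P i * (P (j - 1) + P (j + 1))"
          using ul[of "j - 1"] ul[of "j + 1"] 1 by (simp add: distrib_left)
        then show ?thesis using Pr[OF j(1)] ul[of j] 1 by simp
      next
        case 2
        have w: "P (i + 1) * S i - P i * S (i + 1) = l * S 0 - S 1"
          using chp_wronskian[of i S l] D(3) i unfolding P_def by (simp add: numeral_2_eq_2)
        have "l * (real k * P i * S i) = l * (l * (P (i + 1) * S i - P i * S (i + 1)))"
          unfolding w using ti unfolding P_def by simp
        then have kk: "real k * P i * S i = l * (P (i + 1) * S i - P i * S (i + 1))" using D(1) by simp
        have "S i / P i * P (i - 1) + S (i + 1) + real k * (S i / l) = l * S i"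
        proof -
          have pi: "P i > 0" using Pp i by simp
          have "l * P i * (S i / P i * P (i - 1) + S (i + 1) + real k * (S i / l)) =
              l * S i * P (i - 1) + l * P i * S (i + 1) + real k * P i * S i"
            using pi D(1) by (simp add: field_simps)
          also have "\<dots> = l * S i * (P (i - 1) + P (i + 1))" unfolding kk by (simp add: algebra_simps)
          also have "\<dots> = l * P i * (l * S i)" unfolding Pr[OF i(1)] by simp
          finally show ?thesis using pi D(1) by simp
        qed
        then show ?thesis using 2 ul[of "i - 1"] ui[of i] ui[of "i + 1"] by simp
      next
        case 3
        then show ?thesis using ui[of "j - 1"] ui[of j] ui[of "j + 1"] rec[OF j] by simp
      qed
    qed
    moreover have "u p = S p" "u (p + 1) = S (p + 1)" using ui i by auto
    ultimately show ?thesis by blast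
  qed
qed

text \<open>The right half is scaled by a negative factor \<open>c\<close> chosen to match the left
  half: both end vertices of the node edge get the same value from either side, or the two
  neighbours of a node vertex cancel.\<close>

lemma path_eigenvector:
  assumes hl: "half_cert l p S k" and hr: "half_cert l p' S' k'" and nd: "path_node d p S p' S'"
    and tl: "k > 0 ==> half_tight l p S k i" "k = 0 ==> S 1 = l * S 0"
    and tr: "half_tight l p' S' k' i'" and k': "k' > 0"
  shows "\<exists>y. y 0 > 0 \<and> y d < 0 \<and> y 1 = l * y 0 \<and> y (d - 1) = l * y d \<and>
    (\<forall>j. 0 < j --> j < d --> y (j - 1) + y (j + 1) +
      real ((if j = i \<and> j \<le> p then k else 0) + (if j = d - i' then k' else 0)) * (y j / l) = l * y j)"
proof -
  obtain u where u: "\<And>j. j \<le> p ==> u j > 0" "u p = S p" "u (p + 1) = S (p + 1)" "u 1 = l * u 0"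
    and ur: "\<And>j. 1 \<le> j ==> j \<le> p ==> u (j - 1) + u (j + 1) + real (if j = i then k else 0) * (u j / l) = l * u j"
    using half_eigenvector[OF hl tl] by blast
  obtain w where w: "\<And>j. j \<le> p' ==> w j > 0" "w p' = S' p'" "w (p' + 1) = S' (p' + 1)" "w 1 = l * w 0"
    and wr: "\<And>j. 1 \<le> j ==> j \<le> p' ==> w (j - 1) + w (j + 1) + real (if j = i' then k' else 0) * (w j / l) = l * w j"
    using half_eigenvector[OF hr tr] k' by blast
  have i': "1 \<le> i'" "i' \<le> p'" using tr unfolding half_tight_def by auto
  have Sp: "S p > 0" "S' p' > 0" using u(1)[of p] u(2) w(1)[of p'] w(2) by auto
  have pd: "p < d" "p' < d" "p + p' + 1 \<le> d" using path_node_neg[OF nd Sp] nd unfolding path_node_def by auto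
  obtain c where c: "c < 0" and glue: "\<And>j. p \<le> j ==> j \<le> d - p' ==> (j \<le> p + 1 --> d - p' - 1 \<le> j --> u j = c * w (d - j))"
    and mid: "p + 2 = d - p' ==> u (p + 1) = 0 \<and> w (p' + 1) = 0 \<and> u p + c * w p' = 0"
    and cover: "d - p' = p + 1 \<or> d - p' = p + 2"
  proof -
    from nd consider "p + p' + 1 = d" "S (p + 1) < 0" "S (p + 1) * S' (p' + 1) = S p * S' p'"
      | "p + p' + 2 = d" "S (p + 1) = 0" "S' (p' + 1) = 0" unfolding path_node_def by blast
    then show ?thesis
    proof cases
      case 1
      define c where "c = S (p + 1) / S' p'"
      have c0: "c < 0" unfolding c_def using 1 Sp by (simp add: divide_neg_pos)
      have a: "u (p + 1) = c * w p'" unfolding c_def u(3) w(2) using Sp by simp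
      have b: "u p = c * w (p' + 1)" unfolding c_def u(2) w(3) using Sp 1(3) by (simp add: field_simps)
      show ?thesis
      proof (rule that[OF c0])
        fix j assume j: "p \<le> j" "j \<le> d - p'"
        have "j = p \<and> d - j = p' + 1 \<or> j = p + 1 \<and> d - j = p'" using j 1(1) by linarith
        then show "j \<le> p + 1 --> d - p' - 1 \<le> j --> u j = c * w (d - j)" using a b by auto
      qed (use 1(1) in auto)
    next
      case 2
      define c where "c = - (S p / S' p')"
      have c0: "c < 0" unfolding c_def using Sp by simp
      have m: "u (p + 1) = 0 \<and> w (p' + 1) = 0 \<and> u p + c * w p' = 0"
        unfolding c_def u(2,3) w(2,3) using 2 Sp by simp
      show ?thesis
      proof (rule that[OF c0 _ m])
        fix j assume j: "p \<le> j" "j \<le> d - p'"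
        show "j \<le> p + 1 --> d - p' - 1 \<le> j --> u j = c * w (d - j)"
        proof (intro impI)
          assume "j \<le> p + 1" "d - p' - 1 \<le> j"
          then have "j = p + 1" "d - j = p' + 1" using 2(1) by linarith+
          then show "u j = c * w (d - j)" using m by simp
        qed
      qed (use 2(1) in auto)
    qed
  qed
  define y where "y j = (if j \<le> p + 1 then u j else c * w (d - j))" for j
  have yl: "y j = u j" if "j \<le> p + 1" for j using that unfolding y_def by simp
  have yr: "y j = c * w (d - j)" if j: "d - p' - 1 \<le> j" "p < j \<or> d - p' = p + 1" "j \<le> d" for j
  proof (cases "j \<le> p + 1")
    case True
    have "p \<le> j" "j \<le> d - p'" using j cover True by auto
    then show ?thesis using glue[of j] True j(1) unfolding y_def by simp
  qed (simp add: y_def)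
  have r1: "y j = c * w (d - j)" if "d - p' \<le> j" "j \<le> d" for j
    by (rule yr) (use that cover in auto)
  have ends: "y 0 > 0" "y d < 0"
  proof -
    show "y 0 > 0" using yl[of 0] u(1)[of 0] by simp
    show "y d < 0" using r1[of d] w(1)[of 0] c by (simp add: mult_neg_pos)
  qed
  have e1: "y 1 = l * y 0" using yl[of 0] yl[of 1] u(4) by simp
  have e2: "y (d - 1) = l * y d"
  proof -
    have "y (d - 1) = c * w (d - (d - 1))" using i' pd by (intro r1) auto
    moreover have "d - (d - 1) = 1" using pd by simp
    ultimately show ?thesis using r1[of d] w(4) by simp
  qed
  have inner: "y (j - 1) + y (j + 1) +
      real ((if j = i \<and> j \<le> p then k else 0) + (if j = d - i' then k' else 0)) * (y j / l) = l * y j"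
    if j: "0 < j" "j < d" for j
  proof -
    consider "j \<le> p" | "d - p' \<le> j" | "j = p + 1" "d - p' = p + 2" using cover by linarith
    then show ?thesis
    proof cases
      case 1
      have "j \<noteq> d - i'" using 1 i' pd by linarith
      then show ?thesis using ur[of j] yl[of j] yl[of "j - 1"] yl[of "j + 1"] 1 j by simp
    next
      case 2
      have q: "1 \<le> d - j" "d - j \<le> p'" using 2 j pd by auto
      have n: "\<not> (j = i \<and> j \<le> p)" "j = d - i' \<longleftrightarrow> d - j = i'" using 2 pd i' j by auto
      have idx: "d - (j - 1) = d - j + 1" "d - (j + 1) = d - j - 1" using j by auto
      have a: "y (j - 1) = c * w (d - j + 1)"
      proof (cases "d - p' \<le> j - 1")
        case True then show ?thesis using r1[of "j - 1"] j idx by simp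
      next
        case False
        then have je: "j = d - p'" using 2 by simp
        show ?thesis
        proof (cases "d - p' = p + 1")
          case True
          then show ?thesis using yr[of "j - 1"] je idx j by simp
        next
          case False
          then have "j - 1 = p + 1" "d - p' - 1 \<le> p + 1" "p + 1 \<le> d" using cover je j by auto
          then show ?thesis using yr[of "p + 1"] idx(1) by simp
        qed
      qed
      have b: "y (j + 1) = c * w (d - j - 1)" "y j = c * w (d - j)" using r1[of "j + 1"] r1[of j] 2 j idx by auto
      have "c * (w (d - j - 1) + w (d - j + 1) + real (if d - j = i' then k' else 0) * (w (d - j) / l)) = c * (l * w (d - j))"
        unfolding wr[OF q] by simp
      moreover have "(if j = i \<and> j \<le> p then k else 0) + (if j = d - i' then k' else 0) = (if d - j = i' then k' else 0)"
        by (simp only: n if_False add_0_left)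
      ultimately show ?thesis unfolding a b by (simp add: algebra_simps)
    next
      case 3
      have ji: "j \<noteq> d - i'" using 3 i' pd by auto
      have "d - (p + 2) = p'" using 3 pd by auto
      then have "y (p + 2) = c * w p'" using r1[of "p + 2"] 3 pd by simp
      then show ?thesis using 3 ji yl[of p] yl[of "p + 1"] mid by simp
    qed
  qed
  show ?thesis using ends e1 e2 inner by (intro exI[of _ y]) simp
qed

section \<open>The extremal trees\<close>

text \<open>\<open>path_with_leaves\<close> without the intermediate graph: explicit sets of leaves,
  which are convenient under renaming of vertices and reversal of the path.\<close>

definition spider :: "(nat => 'a) => nat => nat => 'a set => nat => 'a set => 'a pair_pre_digraph" where
  "spider v d i L j L' = \<lparr>pverts = v ` {..d} \<union> L \<union> L',
     parcs = {(v a, v b) | a b. a \<le> d \<and> b \<le> d \<and> (b = a + 1 \<or> a = b + 1)} \<union>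
       {v i} \<times> L \<union> L \<times> {v i} \<union> {v j} \<times> L' \<union> L' \<times> {v j}\<rparr>"

definition spider_data :: "(nat => 'a) => nat => nat => nat => 'a set => 'a set => bool" where
  "spider_data v d k k' L L' \<longleftrightarrow> inj_on v {..d} \<and> finite L \<and> finite L' \<and> card L = k \<and> card L' = k' \<and>
     L \<inter> v ` {..d} = {} \<and> L' \<inter> (v ` {..d} \<union> L) = {}"

lemma path_with_leaves_iff:
  "path_with_leaves d i k j k' T \<longleftrightarrow> i \<le> d \<and> j \<le> d \<and> (\<exists>v L L'. spider_data v d k k' L L' \<and> T = spider v d i L j L')"
proof
  have ivl: "{0..d} = {..d}" by auto
  show "i \<le> d \<and> j \<le> d \<and> (\<exists>v L L'. spider_data v d k k' L L' \<and> T = spider v d i L j L')"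
    if pl: "path_with_leaves d i k j k' T"
  proof -
    from pl obtain v G where v: "inj_on v {..d}" "i \<le> d" "j \<le> d"
      and G: "attach_leaves (path_graph v d) (v i) k G" and T: "attach_leaves G (v j) k' T"
      unfolding path_with_leaves_def ivl by blast
    from G obtain L where L: "finite L" "card L = k" "L \<inter> pverts (path_graph v d) = {}"
      "G = \<lparr>pverts = pverts (path_graph v d) \<union> L, parcs = parcs (path_graph v d) \<union> {v i} \<times> L \<union> L \<times> {v i}\<rparr>"
      unfolding attach_leaves_def by blast
    from T obtain L' where L': "finite L'" "card L' = k'" "L' \<inter> pverts G = {}"
      "T = \<lparr>pverts = pverts G \<union> L', parcs = parcs G \<union> {v j} \<times> L' \<union> L' \<times> {v j}\<rparr>"
      unfolding attach_leaves_def by blast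
    have P: "pverts (path_graph v d) = v ` {..d}"
      "parcs (path_graph v d) = {(v a, v b) | a b. a \<le> d \<and> b \<le> d \<and> (b = a + 1 \<or> a = b + 1)}"
      unfolding path_graph_def ivl by simp_all
    have "T = spider v d i L j L'" unfolding spider_def L'(4) L(4) P by simp
    moreover have "spider_data v d k k' L L'"
      unfolding spider_data_def using v(1) L(1,2) L'(1,2) L(3)[unfolded P] L'(3)[unfolded L(4) P] by simp
    ultimately show ?thesis using v(2,3) by blast
  qed
  show "path_with_leaves d i k j k' T"
    if h: "i \<le> d \<and> j \<le> d \<and> (\<exists>v L L'. spider_data v d k k' L L' \<and> T = spider v d i L j L')"
  proof -
    from h obtain v L L' where s: "spider_data v d k k' L L'" and T: "T = spider v d i L j L'" by blast
    note D = s[unfolded spider_data_def]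
    have P: "pverts (path_graph v d) = v ` {..d}"
      "parcs (path_graph v d) = {(v a, v b) | a b. a \<le> d \<and> b \<le> d \<and> (b = a + 1 \<or> a = b + 1)}"
      unfolding path_graph_def ivl by simp_all
    define G where "G = \<lparr>pverts = pverts (path_graph v d) \<union> L, parcs = parcs (path_graph v d) \<union> {v i} \<times> L \<union> L \<times> {v i}\<rparr>"
    have 1: "attach_leaves (path_graph v d) (v i) k G"
      unfolding attach_leaves_def
    proof (intro conjI exI[of _ L])
      show "v i \<in> pverts (path_graph v d)" using h unfolding P by auto
      show "L \<inter> pverts (path_graph v d) = {}" using D unfolding P by blast
    qed (use D G_def in auto)
    have 2: "attach_leaves G (v j) k' T"
      unfolding attach_leaves_def
    proof (intro conjI exI[of _ L'])
      show "v j \<in> pverts G" using h unfolding G_def P by auto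
      show "L' \<inter> pverts G = {}" using D unfolding G_def P by simp
      show "T = \<lparr>pverts = pverts G \<union> L', parcs = parcs G \<union> {v j} \<times> L' \<union> L' \<times> {v j}\<rparr>"
        unfolding T spider_def G_def P by simp
    qed (use D in auto)
    show ?thesis unfolding path_with_leaves_def ivl using 1 2 h D by blast
  qed
qed

text \<open>For an empty \<open>L\<close> the index \<open>i\<close> is unconstrained, as it must be
  for a single attached leaf; hence the conditional assumption on \<open>i\<close>.\<close>

lemma spider_decomposition:
  assumes s: "spider_data v d k k' L L'" and i: "L \<noteq> {} ==> 0 < i \<and> i < d" and j: "0 < j" "j < d"
  shows "path_decomposition (spider v d i L j L') d v (L \<union> L') (\<lambda>u. if u \<in> L then v i else v j) (\<lambda>_. 0)"
    and "u \<in> L \<union> L' ==> (if u \<in> L then v i else v j) \<notin> L \<union> L'"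
proof -
  note D = s[unfolded spider_data_def]
  have pin: "(if u \<in> L then v i else v j) \<in> v ` {0<..<d}" for u
  proof (cases "u \<in> L")
    case True
    then have "0 < i \<and> i < d" using i by blast
    then show ?thesis using True by simp
  qed (use j in simp)
  moreover have vX: "v q \<notin> L \<union> L'" if "q \<le> d" for q using D that by blast
  then have "v ` {0<..<d} \<inter> (L \<union> L') = {}" by auto
  ultimately have pX: "(if u \<in> L then v i else v j) \<notin> L \<union> L'" for u by blast
  then show "u \<in> L \<union> L' ==> (if u \<in> L then v i else v j) \<notin> L \<union> L'" by blast
  show "path_decomposition (spider v d i L j L') d v (L \<union> L') (\<lambda>u. if u \<in> L then v i else v j) (\<lambda>_. 0)"
  proof
    show "inj_on v {..d}" "finite (L \<union> L')" "(L \<union> L') \<inter> v ` {..d} = {}" using D by auto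
    show "pverts (spider v d i L j L') = v ` {..d} \<union> (L \<union> L')" unfolding spider_def by auto
    show "(if u \<in> L then v i else v j) \<in> (L \<union> L') \<union> v ` {0<..<d}" for u using pin by blast
    show "u \<in> L \<union> L' ==> (if u \<in> L then v i else v j) \<in> L \<union> L' ==> (0::nat) < 0" for u using pX by blast
    have LL: "L \<inter> L' = {}" using D by blast
    have "{(u, if u \<in> L then v i else v j) | u. u \<in> L \<union> L'} = L \<times> {v i} \<union> L' \<times> {v j}"
      "{(if u \<in> L then v i else v j, u) | u. u \<in> L \<union> L'} = {v i} \<times> L \<union> {v j} \<times> L'"
      using LL by auto
    then show "parcs (spider v d i L j L') = {(v a, v b) | a b. a \<le> d \<and> b \<le> d \<and> (b = a + 1 \<or> a = b + 1)} \<union>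
        {(u, if u \<in> L then v i else v j) | u. u \<in> L \<union> L'} \<union> {(if u \<in> L then v i else v j, u) | u. u \<in> L \<union> L'}"
      unfolding spider_def by auto
  qed
qed

text \<open>The lower bound: the halves glued by \<open>path_eigenvector\<close> give a
  sign-changing eigenvector for \<open>l\<close> on every member of the family. For
  \<open>k = 0\<close> no leaf hangs at \<open>v i\<close>, so its position has no
  influence.\<close>

lemma family_bound:
  assumes hl: "half_cert l p S k" and hr: "half_cert l p' S' k'" and nd: "path_node d p S p' S'"
    and tl: "k > 0 ==> half_tight l p S k i" "k = 0 ==> S 1 = l * S 0"
    and tr: "half_tight l p' S' k' (d - j)" and k': "k' > 0" and ij: "i < j" and d: "d \<ge> 2"
    and H: "path_with_leaves d i k j k' H" and n: "n = d + 1 + k + k'"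
  shows "H \<in> trees n d" "lambda2 H \<ge> l"
proof -
  from H obtain v L L' where jd: "j \<le> d" and s: "spider_data v d k k' L L'" and He: "H = spider v d i L j L'"
    unfolding path_with_leaves_iff by blast
  note D = s[unfolded spider_data_def]
  have pd: "p < d" using nd unfolding path_node_def by auto
  have j: "0 < j" "j < d" using ij tr unfolding half_tight_def by auto
  have ip: "1 \<le> i \<and> i \<le> p" if "L \<noteq> {}" 
  proof -
    have "k > 0" using that D by (auto simp: card_gt_0_iff)
    then show ?thesis using tl(1) unfolding half_tight_def by blast
  qed
  then have i: "0 < i \<and> i < d" if "L \<noteq> {}" using that pd by fastforce
  let ?par = "\<lambda>u. if u \<in> L then v i else v j"
  interpret P: path_decomposition H d v "L \<union> L'" ?par "\<lambda>_. 0"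
    unfolding He by (rule spider_decomposition(1)[OF s i j])
  have leaves: "?par u \<notin> L \<union> L'" if "u \<in> L \<union> L'" for u using spider_decomposition(2)[OF s i j that] .
  have LL: "L \<inter> L' = {}" using D by blast
  have "card (pverts H) = card (v ` {..d}) + card (L \<union> L')"
    unfolding P.verts using P.finX P.disj by (intro card_Un_disjoint) auto
  also have "card (v ` {..d}) = d + 1" using card_image[OF P.inj] by simp
  also have "card (L \<union> L') = k + k'" using card_Un_disjoint[of L L'] D LL by simp
  finally have cH: "card (pverts H) = n" using n by simp
  show "H \<in> trees n d" unfolding trees_def using P.is_tree cH P.diameter[OF leaves d] by simp
  have dj: "d - (d - j) = j" using j by simp
  obtain y where y: "y 0 > 0" "y d < 0" "y 1 = l * y 0" "y (d - 1) = l * y d"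
    and inner: "\<And>q. 0 < q ==> q < d ==> y (q - 1) + y (q + 1) +
      real ((if q = i \<and> q \<le> p then k else 0) + (if q = j then k' else 0)) * (y q / l) = l * y q"
    using path_eigenvector[OF hl hr nd tl tr k', unfolded dj] by blast
  show "lambda2 H \<ge> l"
  proof (rule P.lambda2_ge_path_vector[OF leaves _ half_certD(1)[OF hl] y(3,4) _ y(1,2)])
    fix q assume q: "0 < q" "q < d"
    have "{u \<in> L \<union> L'. ?par u = v q} = (if q = i then L else {}) \<union> (if q = j then L' else {})"
    proof -
      have "v i = v q \<longleftrightarrow> i = q" "v j = v q \<longleftrightarrow> j = q" using P.v_eq ij j q by auto
      then show ?thesis using LL by auto
    qed
    then have "card {u \<in> L \<union> L'. ?par u = v q} = (if q = i then k else 0) + (if q = j then k' else 0)"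
      using D ij by auto
    also have "\<dots> = (if q = i \<and> q \<le> p then k else 0) + (if q = j then k' else 0)"
      using ip D by (cases "L = {}") auto
    finally show "y (q - 1) + y (q + 1) + real (card {u \<in> L \<union> L'. ?par u = v q}) * (y q / l) = l * y q"
      using inner[OF q] by simp
  qed (use d in auto)
qed

lemma maximizer_positions_exist:
  assumes d: "d \<ge> 3" and m: "m \<ge> 1"
  shows "\<exists>i j. maximizer_positions m d i j \<and> j \<le> d"
proof -
  consider "m = 1" | "even m" | "odd m" "m \<noteq> 1" by blast
  then show ?thesis
  proof cases
    case 1
    have "d \<le> 11 \<or> (12 \<le> d \<and> d \<le> 23) \<or> d \<ge> 24" by linarith
    then show ?thesis
    proof (elim disjE)
      assume "d \<le> 11"
      then have "maximizer_positions m d 0 (d - 1)"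
        unfolding maximizer_positions_def single_positions_def using 1 d by auto
      then show ?thesis by (intro exI[of _ 0] exI[of _ "d - 1"]) auto
    next
      assume "12 \<le> d \<and> d \<le> 23"
      then have "maximizer_positions m d 0 (d - 2)"
        unfolding maximizer_positions_def single_positions_def using 1 d by auto
      then show ?thesis by (intro exI[of _ 0] exI[of _ "d - 2"]) auto
    next
      assume "d \<ge> 24"
      then have "maximizer_positions m d 0 (d - 3)"
        unfolding maximizer_positions_def single_positions_def using 1 d by auto
      then show ?thesis by (intro exI[of _ 0] exI[of _ "d - 3"]) auto
    qed
  next
    case 2
    have "d = 3 \<or> d = 4 \<or> (d \<ge> 5 \<and> even d) \<or> (d \<ge> 5 \<and> odd d)" using d by linarith
    then show ?thesis
    proof (elim disjE)
      assume "d \<ge> 5 \<and> even d"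
      moreover have "(d - 2) div 4 < d - (d - 2) div 4" using d by linarith
      ultimately have "maximizer_positions m d ((d - 2) div 4) (d - (d - 2) div 4)"
        unfolding maximizer_positions_def even_positions_def using 2 by auto
      then show ?thesis by (intro exI[of _ "(d - 2) div 4"] exI[of _ "d - (d - 2) div 4"]) auto
    next
      assume "d \<ge> 5 \<and> odd d"
      moreover have "(d - 1) div 4 < d - (d - 1) div 4" using d by linarith
      ultimately have "maximizer_positions m d ((d - 1) div 4) (d - (d - 1) div 4)"
        unfolding maximizer_positions_def even_positions_def using 2 by auto
      then show ?thesis by (intro exI[of _ "(d - 1) div 4"] exI[of _ "d - (d - 1) div 4"]) auto
    qed (use 2 in \<open>auto simp: maximizer_positions_def even_positions_def intro!: exI[of _ 1] exI[of _ "d - 1"]\<close>)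
  next
    case 3
    then have m3: "m = 3 \<or> m \<ge> 5" using m by presburger
    define i where "i = (if d \<le> 4 then 1 else if m = 3 \<and> d \<ge> 11 then (d - 4) div 2 else (d - 3) div 2)"
    have "i < d - 1" unfolding i_def using d by auto
    then have "maximizer_positions m d i (d - 1)"
      unfolding maximizer_positions_def odd_positions_def i_def using 3 m3 d by auto
    then show ?thesis by (intro exI[of _ i] exI[of _ "d - 1"]) auto
  qed
qed

lemma path_with_leaves_exists:
  fixes V :: "'a set"
  assumes V: "finite V" "card V = d + 1 + k + k'" and ij: "i \<le> d" "j \<le> d"
  shows "\<exists>H. path_with_leaves d i k j k' (H :: 'a pair_pre_digraph)"
proof -
  from V obtain g where "bij_betw g {0..<d + 1 + k + k'} V" by (metis ex_bij_betw_nat_finite)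
  then have g: "inj_on g {0..<d + 1 + k + k'}" by (rule bij_betw_imp_inj_on)
  define L L' where "L = g ` {d + 1..<d + 1 + k}" and "L' = g ` {d + 1 + k..<d + 1 + k + k'}"
  have sub: "A \<subseteq> {0..<d + 1 + k + k'} ==> inj_on g A" for A using g by (rule inj_on_subset)
  have dis: "g ` A \<inter> g ` B = {}" if "A \<subseteq> {0..<d + 1 + k + k'}" "B \<subseteq> {0..<d + 1 + k + k'}" "A \<inter> B = {}" for A B
    using inj_on_image_Int[OF g that(1,2)] that(3) by simp
  have "spider_data g d k k' L L'"
    unfolding spider_data_def
  proof (intro conjI)
    show "inj_on g {..d}" by (rule sub) auto
    show "finite L" "finite L'" unfolding L_def L'_def by auto
    show "card L = k" unfolding L_def using card_image[OF sub, of "{d + 1..<d + 1 + k}"] by auto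
    show "card L' = k'" unfolding L'_def using card_image[OF sub, of "{d + 1 + k..<d + 1 + k + k'}"] by auto
    show "L \<inter> g ` {..d} = {}" unfolding L_def by (rule dis) auto
    show "L' \<inter> (g ` {..d} \<union> L) = {}" unfolding L_def L'_def image_Un[symmetric] by (rule dis) auto
  qed
  then show ?thesis unfolding path_with_leaves_iff using ij by blast
qed

text \<open>\<open>T0\<close> provides \<open>n\<close> vertices of type \<open>'a\<close>. On them
  a member of the family can be built, which shows that the maximum over \<open>trees n d\<close> is
  \<open>l\<close> itself.\<close>

lemma lambda2_maximizer_iff:
  fixes T0 H :: "'a pair_pre_digraph"
  assumes m: "m = n - d - 1" "m \<ge> 1" and d: "d \<ge> 3" and T0: "T0 \<in> trees n d"
  shows "lambda2_maximizer n d H \<longleftrightarrow>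
    (\<exists>i j. maximizer_positions m d i j \<and> path_with_leaves d i (m div 2) j ((m + 1) div 2) H)"
proof -
  define k k' where "k = m div 2" and "k' = (m + 1) div 2"
  have kk: "k \<le> k'" "k' \<ge> 1" "k + k' = m" "k > 0 \<longleftrightarrow> m \<ge> 2" "k = 0 \<longleftrightarrow> m = 1" using m(2) unfolding k_def k'_def by auto
  have n: "n = d + 1 + k + k'" using m kk(3) by simp
  obtain l p S p' S' where c: "half_cert l p S k" "half_cert l p' S' k'" "path_node d p S p' S'"
    and cov: "coverable l d k k' p S p' S'" and W: "m = 1 --> S 1 = l * S 0"
    and side: "d \<ge> 4 \<and> m \<ge> 2 --> side_conditions l d k k'"
    and pos: "\<And>i j. i < j ==> j \<le> d ==> maximizer_positions m d i j \<longleftrightarrow>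
      (m \<ge> 2 --> half_tight l p S k i) \<and> half_tight l p' S' k' (d - j)"
    using extremal_certificate[OF d m(2)] unfolding k_def k'_def by blast
  have upper: "lambda2 T \<le> l \<and> (lambda2 T = l -->
      (\<exists>i j. maximizer_positions m d i j \<and> path_with_leaves d i k j k' T))" if T: "T \<in> trees n d" for T :: "'a pair_pre_digraph"
  proof -
    have d1: "d \<ge> 1" using d by simp
    obtain v X par rk where dec: "path_decomposition T d v X par rk" and cX: "card X = n - d - 1"
      and d3: "d = 3 --> (\<forall>u\<in>X. par u \<notin> X)" using tree_path_decomposition[OF T d1] by blast
    interpret path_decomposition T d v X par rk by (rule dec)
    have "lambda2 T \<le> l \<and> (lambda2 T = l --> (\<exists>i j. i < j \<and> j \<le> d \<and> (k > 0 --> half_tight l p S k i) \<and>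
      half_tight l p' S' k' (d - j) \<and> path_with_leaves d i k j k' T))"
    proof (rule upper_bound[OF cov kk(1,2)])
      show "card X = k + k'" using cX m kk(3) by simp
      fix u assume u: "u \<in> X" "par u \<in> X"
      have "par u \<noteq> u" using rk_par[OF u] by auto
      then have "card {u, par u} = 2" by auto
      then have "2 \<le> card X" using card_mono[OF finX, of "{u, par u}"] u by simp
      then have "m \<ge> 2" using cX m by simp
      moreover have "d \<ge> 4" using d d3 u by (cases "d = 3") auto
      ultimately show "d \<ge> 4 \<and> k \<ge> 1 \<and> side_conditions l d k k'" using side kk by auto
    qed
    then show ?thesis using pos kk(4) by blast
  qed
  have lower: "H \<in> trees n d \<and> lambda2 H \<ge> l"
    if "maximizer_positions m d i j" "path_with_leaves d i k j k' H" for i j and H :: "'a pair_pre_digraph"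
  proof -
    have ij: "i < j" using that(1) unfolding maximizer_positions_def by simp
    have jd: "j \<le> d" using that(2) unfolding path_with_leaves_iff by simp
    note t = pos[OF ij jd, THEN iffD1, OF that(1)]
    have d2: "d \<ge> 2" and k'0: "k' > 0" using d kk(2) by auto
    have "k > 0 ==> half_tight l p S k i" "k = 0 ==> S 1 = l * S 0" using t W kk by blast+
    from family_bound[OF c this t[THEN conjunct2] k'0 ij d2 that(2) n] show ?thesis by blast
  qed
  have "\<exists>H :: 'a pair_pre_digraph. H \<in> trees n d \<and> lambda2 H \<ge> l"
  proof -
    obtain i j where p: "maximizer_positions m d i j" "j \<le> d" using maximizer_positions_exist[OF d m(2)] by blast
    then have "i \<le> d" unfolding maximizer_positions_def by simp
    moreover have "card (pverts T0) = d + 1 + k + k'" using T0 n unfolding trees_def by simp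
    moreover have "finite (pverts T0)" using T0 pair_graphD(1) unfolding trees_def is_tree_def by blast
    ultimately obtain H :: "'a pair_pre_digraph" where "path_with_leaves d i k j k' H"
      using path_with_leaves_exists[of "pverts T0" d k k' i j] p(2) by blast
    then show ?thesis using lower[OF p(1)] by blast
  qed
  then obtain H0 :: "'a pair_pre_digraph" where H0: "H0 \<in> trees n d" "lambda2 H0 \<ge> l" by blast
  show ?thesis
  proof
    assume mx: "lambda2_maximizer n d H"
    then have "H \<in> trees n d" "lambda2 H0 \<le> lambda2 H" using H0(1) unfolding lambda2_maximizer_def by auto
    moreover from this have "lambda2 H = l" using upper[of H] H0(2) by auto
    ultimately show "\<exists>i j. maximizer_positions m d i j \<and> path_with_leaves d i (m div 2) j ((m + 1) div 2) H"
      using upper[of H] unfolding k_def k'_def by blast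
  next
    assume "\<exists>i j. maximizer_positions m d i j \<and> path_with_leaves d i (m div 2) j ((m + 1) div 2) H"
    then have "H \<in> trees n d \<and> lambda2 H \<ge> l" using lower unfolding k_def k'_def by blast
    then show "lambda2_maximizer n d H" unfolding lambda2_maximizer_def using upper by fastforce
  qed
qed

section \<open>Isomorphism classes of the extremal trees\<close>

definition map_graph :: "('a => 'b) => 'a pair_pre_digraph => 'b pair_pre_digraph" where
  "map_graph h G = \<lparr>pverts = h ` pverts G, parcs = (\<lambda>(a, b). (h a, h b)) ` parcs G\<rparr>"

text \<open>Arcs are pairs with the projections as tail and head, so an isomorphism is determined by
  its vertex map.\<close>

lemma isomorphic_iff:
  fixes G H :: "'a pair_pre_digraph"
  assumes wf: "pair_wf_digraph G"
  shows "isomorphic G H \<longleftrightarrow> (\<exists>h. inj_on h (pverts G) \<and> H = map_graph h G)"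
proof -
  interpret pair_wf_digraph G by (rule wf)
  have wfd: "wf_digraph (with_proj G)" by unfold_locales
  show ?thesis
  proof
    assume "isomorphic G H"
    then obtain f where f: "digraph_isomorphism f" "with_proj H = app_iso f (with_proj G)"
      unfolding digraph_iso_def by blast
    have t: "iso_tail f = fst" "iso_head f = snd"
      using f(2) by (auto simp: with_proj_def app_iso_def)
    have pv: "pverts H = iso_verts f ` pverts G" "parcs H = iso_arcs f ` parcs G"
      using f(2) by (auto simp: with_proj_def app_iso_def)
    have "iso_arcs f a = (iso_verts f (fst a), iso_verts f (snd a))" if "a \<in> parcs G" for a
      using f(1) that t unfolding digraph_isomorphism_def by (auto intro: prod_eqI)
    then have "parcs H = (\<lambda>(a, b). (iso_verts f a, iso_verts f b)) ` parcs G"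
      unfolding pv by (intro image_cong) auto
    then have "H = map_graph (iso_verts f) G" unfolding map_graph_def using pv by simp
    moreover have "inj_on (iso_verts f) (pverts G)" using f(1) unfolding digraph_isomorphism_def by simp
    ultimately show "\<exists>h. inj_on h (pverts G) \<and> H = map_graph h G" by blast
  next
    assume "\<exists>h. inj_on h (pverts G) \<and> H = map_graph h G"
    then obtain h where h: "inj_on h (pverts G)" "H = map_graph h G" by blast
    define f where "f = \<lparr>iso_verts = h, iso_arcs = (\<lambda>(a, b). (h a, h b)), iso_head = snd, iso_tail = fst\<rparr>"
    have "inj_on (\<lambda>(a, b). (h a, h b)) (parcs G)"
      using h(1) wellformed' by (auto simp: inj_on_def)
    then have "digraph_isomorphism f"
      unfolding digraph_isomorphism_def using wfd h(1) by (auto simp: f_def)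
    moreover have "with_proj H = app_iso f (with_proj G)"
      unfolding h(2) by (simp add: with_proj_def app_iso_def map_graph_def f_def)
    ultimately show "isomorphic G H" unfolding digraph_iso_def by blast
  qed
qed

lemma isomorphic_wf: "isomorphic G H ==> pair_wf_digraph G"
  unfolding digraph_iso_def pre_digraph.digraph_isomorphism_def
  by (auto simp: wf_digraph_def pair_wf_digraph_def)

lemma map_graph_spider:
  fixes v :: "nat => 'a" and h :: "'a => 'b"
  assumes "i \<le> d" "j \<le> d"
  shows "map_graph h (spider v d i L j L') = spider (h \<circ> v) d i (h ` L) j (h ` L')"
proof -
  have "(\<lambda>(a, b). (h a, h b)) ` {(v a, v b) | a b. a \<le> d \<and> b \<le> d \<and> (b = a + 1 \<or> a = b + 1)} =
      {((h \<circ> v) a, (h \<circ> v) b) | a b. a \<le> d \<and> b \<le> d \<and> (b = a + 1 \<or> a = b + 1)}" (is "?f ` ?A = ?B")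
  proof (intro equalityI subsetI)
    fix e assume "e \<in> ?B"
    then obtain a b where ab: "e = ((h \<circ> v) a, (h \<circ> v) b)" "a \<le> d \<and> b \<le> d \<and> (b = a + 1 \<or> a = b + 1)" by blast
    then have "(v a, v b) \<in> ?A" "e = ?f (v a, v b)" by auto
    then show "e \<in> ?f ` ?A" by blast
  qed auto
  moreover have "?f ` ({x} \<times> Y) = {h x} \<times> h ` Y" "?f ` (Y \<times> {x}) = h ` Y \<times> {h x}" for x Y by auto
  ultimately show ?thesis unfolding map_graph_def spider_def
    by (simp only: pair_pre_digraph.simps image_Un image_comp o_apply)
qed

lemma spider_wf:
  assumes "i \<le> d" "j \<le> d"
  shows "pair_wf_digraph (spider v d i L j L')"
  by unfold_locales (use assms in \<open>auto simp: spider_def\<close>)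

lemma spider_data_map:
  assumes s: "spider_data v d k k' L L'" and h: "inj_on h (v ` {..d} \<union> L \<union> L')"
  shows "spider_data (h \<circ> v) d k k' (h ` L) (h ` L')"
proof -
  note D = s[unfolded spider_data_def]
  have c: "inj_on h L" "inj_on h L'" "inj_on h (v ` {..d})" using h by (auto intro: inj_on_subset)
  have "h ` L \<inter> h ` (v ` {..d}) = {}" "h ` L' \<inter> h ` (v ` {..d} \<union> L) = {}"
    using inj_on_image_Int[OF h, of L "v ` {..d}"] inj_on_image_Int[OF h, of L' "v ` {..d} \<union> L"] D by auto
  then show ?thesis unfolding spider_data_def
    using D c by (auto simp: card_image comp_inj_on image_comp image_Un)
qed

lemma path_with_leaves_isomorphic:
  fixes T H :: "'a pair_pre_digraph"
  assumes T: "path_with_leaves d i k j k' T" and iso: "isomorphic H T"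
  shows "path_with_leaves d i k j k' H"
proof -
  obtain h where h: "inj_on h (pverts H)" "T = map_graph h H"
    using iso isomorphic_iff[OF isomorphic_wf[OF iso]] by blast
  interpret W: pair_wf_digraph H by (rule isomorphic_wf[OF iso])
  define g where "g = the_inv_into (pverts H) h"
  have gh: "g (h y) = y" if "y \<in> pverts H" for y unfolding g_def using h(1) that by (rule the_inv_into_f_f)
  have ig: "inj_on g (pverts T)" unfolding h(2) map_graph_def by (auto simp: inj_on_def gh)
  have He: "H = map_graph g T"
  proof (rule pair_pre_digraph.equality)
    show "pverts H = pverts (map_graph g T)" unfolding h(2) map_graph_def by (force simp: gh image_iff)
    have "(\<lambda>(a, b). (g a, g b)) ((\<lambda>(a, b). (h a, h b)) e) = e" if "e \<in> parcs H" for e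
      using that W.wellformed' by (cases e) (simp add: gh)
    then have "(\<lambda>e. (\<lambda>(a, b). (g a, g b)) ((\<lambda>(a, b). (h a, h b)) e)) ` parcs H = (\<lambda>e. e) ` parcs H"
      by (rule image_cong[OF refl])
    then show "parcs H = parcs (map_graph g T)" unfolding h(2) map_graph_def by (simp add: image_image)
  qed simp
  from T obtain v L L' where ij: "i \<le> d" "j \<le> d" and s: "spider_data v d k k' L L'" and Te: "T = spider v d i L j L'"
    unfolding path_with_leaves_iff by blast
  have "inj_on g (v ` {..d} \<union> L \<union> L')" using ig unfolding Te spider_def by simp
  then have "spider_data (g \<circ> v) d k k' (g ` L) (g ` L')" by (rule spider_data_map[OF s])
  then show ?thesis unfolding path_with_leaves_iff He Te map_graph_spider[OF ij] using ij by blast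
qed

lemma path_with_leaves_unique:
  fixes T H :: "'a pair_pre_digraph"
  assumes T: "path_with_leaves d i k j k' T" and H: "path_with_leaves d i k j k' H"
  shows "isomorphic T H"
proof -
  from T obtain v L L' where ij: "i \<le> d" "j \<le> d" and s: "spider_data v d k k' L L'" and Te: "T = spider v d i L j L'"
    unfolding path_with_leaves_iff by blast
  from H obtain w K K' where s2: "spider_data w d k k' K K'" and He: "H = spider w d i K j K'"
    unfolding path_with_leaves_iff by blast
  note D = s[unfolded spider_data_def] and D2 = s2[unfolded spider_data_def]
  obtain b where b: "bij_betw b L K" using D D2 by (metis finite_same_card_bij)
  obtain b' where b': "bij_betw b' L' K'" using D D2 by (metis finite_same_card_bij)
  define h where "h y = (if y \<in> v ` {..d} then w (inv_into {..d} v y) else if y \<in> L then b y else b' y)" for y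
  have hv: "h (v a) = w a" if "a \<le> d" for a
    using that D unfolding h_def by (simp add: inv_into_f_f)
  have hL: "h y = b y" if "y \<in> L" for y using that D unfolding h_def by auto
  have hL': "h y = b' y" if "y \<in> L'" for y using that D unfolding h_def by auto
  have im: "h ` v ` {..d} = w ` {..d}" "h ` L = K" "h ` L' = K'"
    using hv hL hL' b b' unfolding bij_betw_def by (auto simp: image_image)
  have "inj_on h (v ` {..d} \<union> L \<union> L')"
  proof -
    have i1: "inj_on h (v ` {..d})" using hv D2 D by (auto simp: inj_on_def)
    have i2: "inj_on h L" using hL b unfolding bij_betw_def by (simp add: inj_on_def)
    have i3: "inj_on h L'" using hL' b' unfolding bij_betw_def by (simp add: inj_on_def)
    have gen: "inj_on h (A \<union> B)" if "inj_on h A" "inj_on h B" "h ` A \<inter> h ` B = {}" for A B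
      using that unfolding inj_on_Un by blast
    have e1: "h ` v ` {..d} \<inter> h ` L = {}" unfolding im using D2 by blast
    have e2: "h ` (v ` {..d} \<union> L) \<inter> h ` L' = {}" unfolding image_Un im using D2 by blast
    show ?thesis by (rule gen[OF gen[OF i1 i2 e1] i3 e2])
  qed
  moreover have "H = map_graph h T"
  proof -
    have hw: "(h \<circ> v) a = w a" if "a \<le> d" for a using hv that by simp
    have "(h \<circ> v) ` {..d} = w ` {..d}" using im(1) by (simp add: image_comp)
    moreover have "{((h \<circ> v) a, (h \<circ> v) b) | a b. a \<le> d \<and> b \<le> d \<and> (b = a + 1 \<or> a = b + 1)} =
        {(w a, w b) | a b. a \<le> d \<and> b \<le> d \<and> (b = a + 1 \<or> a = b + 1)}"
      by (intro Collect_cong ex_cong1) (metis hw)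
    ultimately show ?thesis
      unfolding Te He unfolding map_graph_spider[OF ij] im unfolding spider_def using hw ij by simp
  qed
  moreover have "v ` {..d} \<union> L \<union> L' = pverts T" unfolding Te spider_def by simp
  moreover have "pair_wf_digraph T" unfolding Te using ij by (rule spider_wf)
  ultimately show ?thesis using isomorphic_iff by metis
qed

lemma path_with_leaves_reverse:
  assumes "path_with_leaves d i k j k T"
  shows "path_with_leaves d (d - j) k (d - i) k T"
proof -
  from assms obtain v L L' where ij: "i \<le> d" "j \<le> d" and s: "spider_data v d k k L L'" and Te: "T = spider v d i L j L'"
    unfolding path_with_leaves_iff by blast
  note D = s[unfolded spider_data_def]
  define w where "w a = v (d - a)" for a
  have im: "w ` {..d} = v ` {..d}" unfolding w_def by (rule reverse_image)
  have pa: "{(w a, w b) | a b. a \<le> d \<and> b \<le> d \<and> (b = a + 1 \<or> a = b + 1)} =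
      {(v a, v b) | a b. a \<le> d \<and> b \<le> d \<and> (b = a + 1 \<or> a = b + 1)}"
    unfolding w_def by (rule reverse_path_arcs)
  have "inj_on w {..d}"
  proof (rule inj_onI)
    fix a b assume ab: "a \<in> {..d}" "b \<in> {..d}" "w a = w b"
    then have "d - a = d - b" using D unfolding w_def inj_on_def by simp
    then show "a = b" using ab by auto
  qed
  then have "spider_data w d k k L' L" unfolding spider_data_def im using D by auto
  moreover have "T = spider w d (d - j) L' (d - i) L"
    unfolding Te spider_def im pa using ij by (auto simp: w_def)
  moreover have "d - j \<le> d" "d - i \<le> d" by simp_all
  ultimately show ?thesis unfolding path_with_leaves_iff by blast
qed

lemma (in path_decomposition) three_neighbours:
  assumes e: "(y, a) \<in> parcs T" "(y, b) \<in> parcs T" "(y, c) \<in> parcs T" and ne: "a \<noteq> b" "a \<noteq> c" "b \<noteq> c"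
  shows "\<exists>u\<in>X. par u = y"
proof (rule ccontr)
  assume no: "\<not> ?thesis"
  have y: "y \<in> pverts T" using e(1) arcs_verts by auto
  then show False
  proof (cases rule: vert_cases)
    case 1
    have "z = par y" if "(y, z) \<in> parcs T" for z
      using that by (cases rule: arc_cases) (use 1 no v_notin in auto)
    then show False using e ne by metis
  next
    case (2 j)
    have "z = v (j - 1) \<or> z = v (j + 1)" if "(y, z) \<in> parcs T" for z
      using that
    proof (cases rule: arc_cases)
      case (1 i)
      then have "v i = v j" "i \<le> d" using \<open>y = v j\<close> by auto
      then have "i = j" using v_eq[of i j] \<open>j \<le> d\<close> by blast
      then show ?thesis using 1(3) by blast
    next
      case (2 i)
      then have "v (i + 1) = v j" "i + 1 \<le> d" using \<open>y = v j\<close> by auto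
      then have "i + 1 = j" using v_eq[of "i + 1" j] \<open>j \<le> d\<close> by blast
      then have "j - 1 = i" by simp
      then show ?thesis using 2(3) by blast
    next
      case 3
      then show ?thesis using v_notin[OF \<open>j \<le> d\<close>] \<open>y = v j\<close> by simp
    next
      case 4
      then show ?thesis using no by blast
    qed
    then show False using e ne by metis
  qed
qed

text \<open>The two carriers of leaves are recognized intrinsically, as the vertices with three
  distinct neighbours. Hence their distance does not depend on the chosen description of the
  tree.\<close>

lemma branch_vertices:
  assumes s: "spider_data v d k k' L L'" and k: "k \<ge> 1" "k' \<ge> 1" and ij: "0 < i" "i < j" "j < d"
  defines "T \<equiv> spider v d i L j L'"
  shows "{y. \<exists>a b c. (y, a) \<in> parcs T \<and> (y, b) \<in> parcs T \<and> (y, c) \<in> parcs T \<and> a \<noteq> b \<and> a \<noteq> c \<and> b \<noteq> c} = {v i, v j}"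
    and "(v i, v j) \<in> parcs T ^^ (j - i)" "(v j, v i) \<in> parcs T ^^ (j - i)"
    and "(v i, v j) \<in> parcs T ^^ t ==> j - i \<le> t"
proof -
  note D = s[unfolded spider_data_def]
  have i0: "0 < i \<and> i < d" and j0: "0 < j" using ij by auto
  interpret P: path_decomposition T d v "L \<union> L'" "\<lambda>u. if u \<in> L then v i else v j" "\<lambda>_. 0"
    unfolding T_def by (rule spider_decomposition(1)[OF s i0 j0 ij(3)])
  have leaves: "(if u \<in> L then v i else v j) \<notin> L \<union> L'" if "u \<in> L \<union> L'" for u
    by (rule spider_decomposition(2)[OF s i0 j0 ij(3) that])
  have nb: "\<exists>a b c. (v q, a) \<in> parcs T \<and> (v q, b) \<in> parcs T \<and> (v q, c) \<in> parcs T \<and> a \<noteq> b \<and> a \<noteq> c \<and> b \<noteq> c"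
    if q: "0 < q" "q < d" and c: "c \<in> L \<union> L'" "(v q, c) \<in> parcs T" for q c
  proof -
    have "(v q, v (q - 1)) \<in> parcs T" "(v q, v (q + 1)) \<in> parcs T"
      using P.path_walk[of "q - 1" 1] P.path_walk[of q 1] q by auto
    moreover have "v (q - 1) \<noteq> v (q + 1)" using P.v_eq[of "q - 1" "q + 1"] q by auto
    moreover have "v (q - 1) \<notin> L \<union> L'" "v (q + 1) \<notin> L \<union> L'" using q by (intro P.v_notin; simp)+
    then have "v (q - 1) \<noteq> c" "v (q + 1) \<noteq> c" using c by blast+
    ultimately show ?thesis using c by blast
  qed
  show "{y. \<exists>a b c. (y, a) \<in> parcs T \<and> (y, b) \<in> parcs T \<and> (y, c) \<in> parcs T \<and> a \<noteq> b \<and> a \<noteq> c \<and> b \<noteq> c} = {v i, v j}"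
    (is "?N = _")
  proof (intro equalityI subsetI)
    fix y assume "y \<in> ?N"
    then obtain u where "u \<in> L \<union> L'" "(if u \<in> L then v i else v j) = y" using P.three_neighbours by blast
    then show "y \<in> {v i, v j}" by (auto split: if_splits)
  next
    fix y assume y: "y \<in> {v i, v j}"
    obtain a where a: "a \<in> L" using D k by (metis card.empty ex_in_conv not_one_le_zero)
    obtain b where b: "b \<in> L'" using D k by (metis card.empty ex_in_conv not_one_le_zero)
    have "(v i, a) \<in> parcs T" "(v j, b) \<in> parcs T" using a b unfolding T_def spider_def by auto
    then show "y \<in> ?N" using nb[of i a] nb[of j b] a b ij y by auto
  qed
  show "(v i, v j) \<in> parcs T ^^ (j - i)" "(v j, v i) \<in> parcs T ^^ (j - i)"
    using P.path_walk[of i "j - i"] ij by auto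
  show "j - i \<le> t" if "(v i, v j) \<in> parcs T ^^ t"
    using P.walk_idx[OF leaves that] ij by simp
qed

lemma path_with_leaves_distance:
  assumes T: "path_with_leaves d i k j k' T" "path_with_leaves d i2 k j2 k' T"
    and k: "k \<ge> 1" "k' \<ge> 1" and ij: "0 < i" "i < j" "j < d" and ij2: "0 < i2" "i2 < j2" "j2 < d"
  shows "j - i = j2 - i2"
proof -
  obtain v L L' where a: "spider_data v d k k' L L'" "T = spider v d i L j L'"
    using T(1) unfolding path_with_leaves_iff by blast
  obtain w K K' where b: "spider_data w d k k' K K'" "T = spider w d i2 K j2 K'"
    using T(2) unfolding path_with_leaves_iff by blast
  note A = branch_vertices[OF a(1) k ij, folded a(2)]
  note B = branch_vertices[OF b(1) k ij2, folded b(2)]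
  have "{v i, v j} = {w i2, w j2}" using A(1) B(1) by simp
  then have "(v i = w i2 \<and> v j = w j2) \<or> (v i = w j2 \<and> v j = w i2)" by (auto simp: doubleton_eq_iff)
  then have "j2 - i2 \<le> j - i" "j - i \<le> j2 - i2" using A(2-4) B(2-4) by metis+
  then show ?thesis by simp
qed

theorem theorem1p5:
  fixes T :: "'a pair_pre_digraph" and n d m :: nat
  assumes "m = n - d - 1" and "m \<ge> 1" and "d \<ge> 3"
    and "lambda2_maximizer n d T"
  shows "(\<exists>i j. maximizer_positions m d i j \<and>
            path_with_leaves d i (m div 2) j ((m + 1) div 2) T) \<and>
         (\<forall>i j (H :: 'a pair_pre_digraph). maximizer_positions m d i j \<longrightarrow>
            path_with_leaves d i (m div 2) j ((m + 1) div 2) H \<longrightarrow> lambda2_maximizer n d H) \<and>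
         (even m \<and> d \<ge> 5 \<and> even d \<and> (d - 2) div 4 \<noteq> (d - 2 + 3) div 4 \<longrightarrow>
            (\<exists>T1 T2 T3 :: 'a pair_pre_digraph.
               (\<forall>H. lambda2_maximizer n d H \<longleftrightarrow>
                  isomorphic H T1 \<or> isomorphic H T2 \<or> isomorphic H T3) \<and>
               \<not> isomorphic T1 T2 \<and> \<not> isomorphic T1 T3 \<and> \<not> isomorphic T2 T3))"
proof (intro conjI)
  have T: "T \<in> trees n d" using assms(4) unfolding lambda2_maximizer_def by simp
  note mx = lambda2_maximizer_iff[OF assms(1-3) T]
  show "\<exists>i j. maximizer_positions m d i j \<and> path_with_leaves d i (m div 2) j ((m + 1) div 2) T"
    using assms(4) unfolding mx .
  show "\<forall>i j (H :: 'a pair_pre_digraph). maximizer_positions m d i j \<longrightarrow>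
      path_with_leaves d i (m div 2) j ((m + 1) div 2) H \<longrightarrow> lambda2_maximizer n d H"
    unfolding mx by blast
  show "even m \<and> d \<ge> 5 \<and> even d \<and> (d - 2) div 4 \<noteq> (d - 2 + 3) div 4 \<longrightarrow>
            (\<exists>T1 T2 T3 :: 'a pair_pre_digraph.
               (\<forall>H. lambda2_maximizer n d H \<longleftrightarrow>
                  isomorphic H T1 \<or> isomorphic H T2 \<or> isomorphic H T3) \<and>
               \<not> isomorphic T1 T2 \<and> \<not> isomorphic T1 T3 \<and> \<not> isomorphic T2 T3)"
  proof
    assume h: "even m \<and> d \<ge> 5 \<and> even d \<and> (d - 2) div 4 \<noteq> (d - 2 + 3) div 4"
    define k where "k = m div 2"
    define a where "a = (d - 2) div 4"
    have k: "(m + 1) div 2 = k" "m div 2 = k" "k \<ge> 1" "m = k + k" using h assms(2) unfolding k_def by auto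
    \<comment> \<open>For even \<open>d\<close> the floor and the ceiling of
      \<open>(d - 2) / 4\<close> differ exactly when 4 divides \<open>d\<close>.\<close>
    have a: "(d - 2 + 3) div 4 = a + 1" "d = 4 * a + 4" "a \<ge> 1" using h unfolding a_def by presburger+
    let ?P = "\<lambda>i j H. path_with_leaves d i k j k (H :: 'a pair_pre_digraph)"
    have pos: "maximizer_positions m d i j \<longleftrightarrow> (i = a \<or> i = a + 1) \<and> (j = d - a \<or> j = d - (a + 1))" for i j
      unfolding maximizer_positions_def even_positions_def a_def[symmetric] a(1) using h a(2,3) by auto
    have "card (pverts T) = d + 1 + k + k" "finite (pverts T)"
    proof -
      show "card (pverts T) = d + 1 + k + k" using T assms(1,2) k(4) unfolding trees_def by simp
      show "finite (pverts T)" using T pair_graphD(1) unfolding trees_def is_tree_def by blast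
    qed
    then have ex: "\<exists>H. ?P i j H" if "i \<le> d" "j \<le> d" for i j
      using path_with_leaves_exists[of "pverts T" d k k i j] that by blast
    obtain T1 where T1: "?P a (d - a) T1" using ex[of a "d - a"] a by auto
    obtain T2 where T2: "?P a (d - (a + 1)) T2" using ex[of a "d - (a + 1)"] a by auto
    obtain T3 where T3: "?P (a + 1) (d - (a + 1)) T3" using ex[of "a + 1" "d - (a + 1)"] a by auto
    have mxk: "lambda2_maximizer n d H \<longleftrightarrow> (\<exists>i j. maximizer_positions m d i j \<and> ?P i j H)" for H
      unfolding mx k(1,2) ..
    \<comment> \<open>Of the four admissible pairs, \<open>(a + 1, d - a)\<close> is the mirror
      image of \<open>(a, d - (a + 1))\<close>. The three remaining trees have their carriers at
      distances \<open>d - 2 * a\<close>, \<open>d - 2 * a - 1\<close> and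
      \<open>d - 2 * a - 2\<close>, which tells them apart.\<close>
    have rev: "?P a (d - (a + 1)) H" if "?P (a + 1) (d - a) H" for H
      using path_with_leaves_reverse[OF that] a by simp
    have "lambda2_maximizer n d H \<longleftrightarrow> isomorphic H T1 \<or> isomorphic H T2 \<or> isomorphic H T3" for H
    proof
      assume "lambda2_maximizer n d H"
      then obtain i j where ij: "(i = a \<or> i = a + 1) \<and> (j = d - a \<or> j = d - (a + 1))" "?P i j H"
        unfolding mxk pos by blast
      then consider "?P a (d - a) H" | "?P a (d - (a + 1)) H" | "?P (a + 1) (d - a) H" | "?P (a + 1) (d - (a + 1)) H" by blast
      then show "isomorphic H T1 \<or> isomorphic H T2 \<or> isomorphic H T3"
        using path_with_leaves_unique[OF _ T1] path_with_leaves_unique[OF _ T2] path_with_leaves_unique[OF _ T3] rev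
        by cases blast+
    next
      assume "isomorphic H T1 \<or> isomorphic H T2 \<or> isomorphic H T3"
      then have "?P a (d - a) H \<or> ?P a (d - (a + 1)) H \<or> ?P (a + 1) (d - (a + 1)) H"
        using path_with_leaves_isomorphic T1 T2 T3 by blast
      then show "lambda2_maximizer n d H" unfolding mxk pos by blast
    qed
    moreover have "\<not> isomorphic T1 T2"
    proof
      assume "isomorphic T1 T2"
      then have "?P a (d - (a + 1)) T1" using path_with_leaves_isomorphic T2 by blast
      from path_with_leaves_distance[OF T1 this k(3,3)] show False using a by simp
    qed
    moreover have "\<not> isomorphic T1 T3"
    proof
      assume "isomorphic T1 T3"
      then have "?P (a + 1) (d - (a + 1)) T1" using path_with_leaves_isomorphic T3 by blast
      from path_with_leaves_distance[OF T1 this k(3,3)] show False using a by simp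
    qed
    moreover have "\<not> isomorphic T2 T3"
    proof
      assume "isomorphic T2 T3"
      then have "?P (a + 1) (d - (a + 1)) T2" using path_with_leaves_isomorphic T3 by blast
      from path_with_leaves_distance[OF T2 this k(3,3)] show False using a by simp
    qed
    ultimately show "\<exists>T1 T2 T3 :: 'a pair_pre_digraph.
               (\<forall>H. lambda2_maximizer n d H \<longleftrightarrow>
                  isomorphic H T1 \<or> isomorphic H T2 \<or> isomorphic H T3) \<and>
               \<not> isomorphic T1 T2 \<and> \<not> isomorphic T1 T3 \<and> \<not> isomorphic T2 T3" by blast
  qed
qed

end
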